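(* Let $k$ be an algebraically closed field of characteristic $0$ and $L/K$ a finite Galois extension of fields finitely generated over $k$ with Galois group $G$. Put $X=\operatorname{Spec}L$, $Y=\operatorname{Spec}K$, and let $M$ be a simple $\mathcal D_X$-module (of finite dimension over $L$). Put $L_1=L^{G_M}$, $Z=\operatorname{Spec}L_1$, and consider the factorization $X\xrightarrow{p}Z\xrightarrow{q}Y$, $\pi=q\circ p$, corresponding to the field extensions $L/L_1/K$. Let $\mathcal A$ be the set of (isomorphism classes of) simple $\mathcal D_Z$-modules $N_Z$ with $[p^!(N_Z):M]\neq0$, and $\mathcal B$ the set of (isomorphism classes of) simple $\mathcal D_Y$-modules $N_Y$ with $[\pi^!(N_Y):M]\ne0$. (1) If $N_Z\in\mathcal A$, then $q_+(N_Z)$ is simple. (2) The map $N_Z\mapsto q_+(N_Z)$ defines a bijection $\mathcal A\to\mathcal B$. (3) If $N_Z\in\mathcal A$ and $N_Y=q_+(N_Z)$, then $N_Z$ is the unique simple component of $q^!(N_Y)$ that belongs to $\mathcal A$. (4) If $q_+(N_Z)=N_Y$ with $N_Z\in\mathcal A$, then $[p^!(N_Z):M]=[\pi^!(N_Y):M]$.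
   Context: $\mathcal D_X=\mathcal D_L$ etc. are the rings of $k$-linear differential operators of the fields; all modules are finite-dimensional over the field. For a finite extension $E'/E$ with map $f:\operatorname{Spec}E'\to\operatorname{Spec}E$: $f^!(N)=E'\otimes_EN$ as a module over $\mathcal D_{E'}=E'\otimes_E\mathcal D_E$, and $f_+(M)$ is $M$ restricted to the subring $\mathcal D_E\subset\mathcal D_{E'}$. These functors preserve semisimplicity; $[S:S_1]$ denotes the multiplicity of a simple module $S_1$ in $S$. For $g\in G$ the twist $M_g$ is $M$ as a set with action $P\cdot m=(g^{-1}Pg)m$, and $G_M=\{g\in G\mid M_g\cong M\}$ is the inertia group. *)

theory Defs
  imports "HOL-Algebra.Algebra" "HOL-Algebra.Algebraic_Closure"
begin

section \<open>Rings of differential operators\<close>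

text \<open>Operators on a field \<open>E\<close> are represented by functions that are extensional on \<open>carrier E\<close>, so
  that equal operators are equal functions. The base field is a subset \<open>k\<close> of \<open>carrier E\<close>.\<close>

definition linear_ops :: "'l set \<Rightarrow> ('l, 'b) ring_scheme \<Rightarrow> ('l \<Rightarrow> 'l) set" where
  "linear_ops k E =
     {P \<in> carrier E \<rightarrow>\<^sub>E carrier E.
        (\<forall>x\<in>carrier E. \<forall>y\<in>carrier E. P (x \<oplus>\<^bsub>E\<^esub> y) = P x \<oplus>\<^bsub>E\<^esub> P y) \<and>
        (\<forall>c\<in>k. \<forall>x\<in>carrier E. P (c \<otimes>\<^bsub>E\<^esub> x) = c \<otimes>\<^bsub>E\<^esub> P x)}"

definition mult_op :: "('l, 'b) ring_scheme \<Rightarrow> 'l \<Rightarrow> 'l \<Rightarrow> 'l" where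
  "mult_op E a = (\<lambda>x\<in>carrier E. a \<otimes>\<^bsub>E\<^esub> x)"

definition commutator_op :: "('l, 'b) ring_scheme \<Rightarrow> ('l \<Rightarrow> 'l) \<Rightarrow> 'l \<Rightarrow> 'l \<Rightarrow> 'l" where
  "commutator_op E P a = (\<lambda>x\<in>carrier E. P (a \<otimes>\<^bsub>E\<^esub> x) \<ominus>\<^bsub>E\<^esub> a \<otimes>\<^bsub>E\<^esub> P x)"

text \<open>Grothendieck's definition, with the order shifted by one: \<open>order_less E n P\<close> says that \<open>P\<close>
  has order at most \<open>n - 1\<close>, where only \<open>0\<close> has order at most \<open>-1\<close>.\<close>

primrec order_less :: "('l, 'b) ring_scheme \<Rightarrow> nat \<Rightarrow> ('l \<Rightarrow> 'l) \<Rightarrow> bool" where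
  "order_less E 0 P \<longleftrightarrow> P = (\<lambda>x\<in>carrier E. \<zero>\<^bsub>E\<^esub>)"
| "order_less E (Suc n) P \<longleftrightarrow> (\<forall>a\<in>carrier E. order_less E n (commutator_op E P a))"

definition diff_ring :: "'l set \<Rightarrow> ('l, 'b) ring_scheme \<Rightarrow> ('l \<Rightarrow> 'l) ring" where
  "diff_ring k E =
     \<lparr>carrier = {P \<in> linear_ops k E. \<exists>n. order_less E n P},
      monoid.mult = (\<lambda>P Q. compose (carrier E) P Q),
      monoid.one = (\<lambda>x\<in>carrier E. x),
      ring.zero = (\<lambda>x\<in>carrier E. \<zero>\<^bsub>E\<^esub>),
      ring.add = (\<lambda>P Q. \<lambda>x\<in>carrier E. P x \<oplus>\<^bsub>E\<^esub> Q x)\<rparr>"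

text \<open>For a finite separable extension \<open>F/E\<close>, every differential operator of \<open>E\<close> is the restriction
  of exactly one differential operator of \<open>F\<close>. This is the embedding of \<open>diff_ring k E\<close> as a
  subring of \<open>diff_ring k F\<close>.\<close>

definition ext_op :: "'l set \<Rightarrow> ('l, 'b) ring_scheme \<Rightarrow> ('l, 'b) ring_scheme \<Rightarrow> ('l \<Rightarrow> 'l) \<Rightarrow> ('l \<Rightarrow> 'l)" where
  "ext_op k E F P = (THE Q. Q \<in> carrier (diff_ring k F) \<and> (\<forall>x\<in>carrier E. Q x = P x))"


section \<open>Left modules over a noncommutative ring\<close>

text \<open>The library locale \<open>module\<close> requires a commutative ring of scalars. Its record type and its
  notion of \<open>submodule\<close> are reused; the fields \<open>mult\<close> and \<open>one\<close> of the record play no role.\<close>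

locale left_module = R?: ring R + M?: abelian_group M
  for R :: "('r, 'x) ring_scheme" (structure) and M :: "('r, 'm, 'y) module_scheme" (structure) +
  assumes smult_closed:
      "\<lbrakk>a \<in> carrier R; x \<in> carrier M\<rbrakk> \<Longrightarrow> a \<odot>\<^bsub>M\<^esub> x \<in> carrier M"
    and smult_l_distr:
      "\<lbrakk>a \<in> carrier R; b \<in> carrier R; x \<in> carrier M\<rbrakk>
        \<Longrightarrow> (a \<oplus>\<^bsub>R\<^esub> b) \<odot>\<^bsub>M\<^esub> x = a \<odot>\<^bsub>M\<^esub> x \<oplus>\<^bsub>M\<^esub> b \<odot>\<^bsub>M\<^esub> x"
    and smult_r_distr:
      "\<lbrakk>a \<in> carrier R; x \<in> carrier M; y \<in> carrier M\<rbrakk>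
        \<Longrightarrow> a \<odot>\<^bsub>M\<^esub> (x \<oplus>\<^bsub>M\<^esub> y) = a \<odot>\<^bsub>M\<^esub> x \<oplus>\<^bsub>M\<^esub> a \<odot>\<^bsub>M\<^esub> y"
    and smult_assoc:
      "\<lbrakk>a \<in> carrier R; b \<in> carrier R; x \<in> carrier M\<rbrakk>
        \<Longrightarrow> (a \<otimes>\<^bsub>R\<^esub> b) \<odot>\<^bsub>M\<^esub> x = a \<odot>\<^bsub>M\<^esub> (b \<odot>\<^bsub>M\<^esub> x)"
    and smult_one:
      "x \<in> carrier M \<Longrightarrow> \<one>\<^bsub>R\<^esub> \<odot>\<^bsub>M\<^esub> x = x"

definition module_isos ::
    "('r, 'x) ring_scheme \<Rightarrow> ('r, 'm, 'y) module_scheme \<Rightarrow> ('r, 'n, 'z) module_scheme \<Rightarrow> ('m \<Rightarrow> 'n) set"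
  where
  "module_isos R M N =
     {f \<in> iso (add_monoid M) (add_monoid N).
        \<forall>a\<in>carrier R. \<forall>x\<in>carrier M. f (a \<odot>\<^bsub>M\<^esub> x) = a \<odot>\<^bsub>N\<^esub> f x}"

definition module_isomorphic ::
    "('r, 'x) ring_scheme \<Rightarrow> ('r, 'm, 'y) module_scheme \<Rightarrow> ('r, 'n, 'z) module_scheme \<Rightarrow> bool"
  where
  "module_isomorphic R M N \<longleftrightarrow> left_module R M \<and> left_module R N \<and> module_isos R M N \<noteq> {}"

definition module_iso_rel ::
    "('r, 'x) ring_scheme \<Rightarrow> (('r, 'm) module \<times> ('r, 'm) module) set" where
  "module_iso_rel R = {(M, N). module_isomorphic R M N}"

definition simple_left_module ::
    "('r, 'x) ring_scheme \<Rightarrow> ('r, 'm, 'y) module_scheme \<Rightarrow> bool" where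
  "simple_left_module R M \<longleftrightarrow>
     left_module R M \<and> carrier M \<noteq> {\<zero>\<^bsub>M\<^esub>} \<and>
     (\<forall>H. submodule H R M \<longrightarrow> H = {\<zero>\<^bsub>M\<^esub>} \<or> H = carrier M)"

definition simple_decomposition ::
    "('r, 'x) ring_scheme \<Rightarrow> ('r, 'm, 'y) module_scheme \<Rightarrow> nat \<Rightarrow> (nat \<Rightarrow> 'm set) \<Rightarrow> bool" where
  "simple_decomposition R S n H \<longleftrightarrow>
     (\<forall>i<n. submodule (H i) R S \<and> simple_left_module R (S\<lparr>carrier := H i\<rparr>)) \<and>
     (\<forall>x\<in>carrier S. \<exists>!h. h \<in> (\<Pi>\<^sub>E i\<in>{..<n}. H i) \<and> x = (\<Oplus>\<^bsub>S\<^esub>i\<in>{..<n}. h i))"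

text \<open>The number of summands isomorphic to \<open>S1\<close> in a decomposition of the semisimple module \<open>S\<close> of
  finite length into simple submodules; it does not depend on the decomposition.\<close>

definition multiplicity_in ::
    "('r, 'x) ring_scheme \<Rightarrow> ('r, 'm, 'y) module_scheme \<Rightarrow> ('r, 'n, 'z) module_scheme \<Rightarrow> nat" where
  "multiplicity_in R S S1 =
     (THE c. \<exists>n H. simple_decomposition R S n H \<and>
        c = card {i. i < n \<and> module_isomorphic R (S\<lparr>carrier := H i\<rparr>) S1})"


section \<open>Modules over rings of differential operators\<close>

definition finite_dim_over :: "('l, 'b) ring_scheme \<Rightarrow> ('l \<Rightarrow> 'l, 'm, 'y) module_scheme \<Rightarrow> bool" where
  "finite_dim_over E M \<longleftrightarrow>
     (\<exists>B. finite B \<and> B \<subseteq> carrier M \<and>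
        (\<forall>m\<in>carrier M. \<exists>c\<in>B \<rightarrow> carrier E. m = (\<Oplus>\<^bsub>M\<^esub>b\<in>B. mult_op E (c b) \<odot>\<^bsub>M\<^esub> b)))"

definition simple_dmodule :: "'l set \<Rightarrow> ('l, 'b) ring_scheme \<Rightarrow> ('l \<Rightarrow> 'l, 'm, 'y) module_scheme \<Rightarrow> bool" where
  "simple_dmodule k E M \<longleftrightarrow> simple_left_module (diff_ring k E) M \<and> finite_dim_over E M"

definition direct_image ::
    "'l set \<Rightarrow> ('l, 'b) ring_scheme \<Rightarrow> ('l, 'b) ring_scheme \<Rightarrow> ('l \<Rightarrow> 'l, 'm) module \<Rightarrow> ('l \<Rightarrow> 'l, 'm) module" where
  "direct_image k E F M = M\<lparr>smult := (\<lambda>P m. ext_op k E F P \<odot>\<^bsub>M\<^esub> m)\<rparr>"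


subsection \<open>The inverse image\<close>

definition tensor_relations ::
    "('l, 'b) ring_scheme \<Rightarrow> ('l, 'b) ring_scheme \<Rightarrow> ('l \<Rightarrow> 'l, 'm) module \<Rightarrow> (('l \<times> 'm) \<Rightarrow>\<^sub>0 int) set" where
  "tensor_relations E F N =
     {frag_of (a \<oplus>\<^bsub>F\<^esub> b, x) - frag_of (a, x) - frag_of (b, x) | a b x.
        a \<in> carrier F \<and> b \<in> carrier F \<and> x \<in> carrier N} \<union>
     {frag_of (a, x \<oplus>\<^bsub>N\<^esub> y) - frag_of (a, x) - frag_of (a, y) | a x y.
        a \<in> carrier F \<and> x \<in> carrier N \<and> y \<in> carrier N} \<union>
     {frag_of (a \<otimes>\<^bsub>F\<^esub> e, x) - frag_of (a, mult_op E e \<odot>\<^bsub>N\<^esub> x) | a e x.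
        a \<in> carrier F \<and> e \<in> carrier E \<and> x \<in> carrier N}"

definition tensor_kernel ::
    "('l, 'b) ring_scheme \<Rightarrow> ('l, 'b) ring_scheme \<Rightarrow> ('l \<Rightarrow> 'l, 'm) module \<Rightarrow> (('l \<times> 'm) \<Rightarrow>\<^sub>0 int) set" where
  "tensor_kernel E F N =
     generate (free_Abelian_group (carrier F \<times> carrier N)) (tensor_relations E F N)"

text \<open>The abelian group \<open>F \<otimes>\<^sub>E N\<close>, written multiplicatively as all quotient groups of the library.\<close>

definition tensor_group ::
    "('l, 'b) ring_scheme \<Rightarrow> ('l, 'b) ring_scheme \<Rightarrow> ('l \<Rightarrow> 'l, 'm) module \<Rightarrow> (('l \<times> 'm) \<Rightarrow>\<^sub>0 int) set monoid" where
  "tensor_group E F N = free_Abelian_group (carrier F \<times> carrier N) Mod tensor_kernel E F N"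

definition pure_tensor ::
    "('l, 'b) ring_scheme \<Rightarrow> ('l, 'b) ring_scheme \<Rightarrow> ('l \<Rightarrow> 'l, 'm) module \<Rightarrow> 'l \<Rightarrow> 'm \<Rightarrow> (('l \<times> 'm) \<Rightarrow>\<^sub>0 int) set" where
  "pure_tensor E F N a x =
     tensor_kernel E F N #>\<^bsub>free_Abelian_group (carrier F \<times> carrier N)\<^esub> frag_of (a, x)"

text \<open>The action of \<open>P\<close> on \<open>F \<otimes>\<^sub>E N\<close> that comes from the identification of \<open>diff_ring k F\<close> with
  \<open>F \<otimes>\<^sub>E diff_ring k E\<close>, hence of \<open>F \<otimes>\<^sub>E N\<close> with the tensor product of \<open>diff_ring k F\<close> and \<open>N\<close> over
  \<open>diff_ring k E\<close>: if the operator \<open>P \<circ> a\<close> is written as a sum of \<open>b\<^sub>i \<circ> Q\<^sub>i\<close> with \<open>b\<^sub>i\<close> in \<open>F\<close> and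
  \<open>Q\<^sub>i\<close> in \<open>diff_ring k E\<close>, then \<open>P\<close> maps \<open>a \<otimes> x\<close> to the sum of the \<open>b\<^sub>i \<otimes> Q\<^sub>i x\<close>. In particular, a
  derivation acts by the Leibniz rule.\<close>

definition tensor_action ::
    "'l set \<Rightarrow> ('l, 'b) ring_scheme \<Rightarrow> ('l, 'b) ring_scheme \<Rightarrow> ('l \<Rightarrow> 'l, 'm) module \<Rightarrow> ('l \<Rightarrow> 'l) \<Rightarrow>
     (('l \<times> 'm) \<Rightarrow>\<^sub>0 int) set \<Rightarrow> (('l \<times> 'm) \<Rightarrow>\<^sub>0 int) set" where
  "tensor_action k E F N P =
     (THE \<phi>. \<phi> \<in> hom (tensor_group E F N) (tensor_group E F N) \<and>
        \<phi> \<in> extensional (carrier (tensor_group E F N)) \<and>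
        (\<forall>a\<in>carrier F. \<forall>x\<in>carrier N. \<forall>(n::nat) b Q.
           b \<in> {..<n} \<rightarrow> carrier F \<longrightarrow> Q \<in> {..<n} \<rightarrow> carrier (diff_ring k E) \<longrightarrow>
           P \<otimes>\<^bsub>diff_ring k F\<^esub> mult_op F a =
             (\<Oplus>\<^bsub>diff_ring k F\<^esub>i\<in>{..<n}. mult_op F (b i) \<otimes>\<^bsub>diff_ring k F\<^esub> ext_op k E F (Q i)) \<longrightarrow>
           \<phi> (pure_tensor E F N a x) =
             (\<Otimes>\<^bsub>tensor_group E F N\<^esub>i\<in>{..<n}. pure_tensor E F N (b i) (Q i \<odot>\<^bsub>N\<^esub> x))))"

definition inverse_image ::
    "'l set \<Rightarrow> ('l, 'b) ring_scheme \<Rightarrow> ('l, 'b) ring_scheme \<Rightarrow> ('l \<Rightarrow> 'l, 'm) module \<Rightarrow>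
     ('l \<Rightarrow> 'l, (('l \<times> 'm) \<Rightarrow>\<^sub>0 int) set) module" where
  "inverse_image k E F N =
     \<lparr>carrier = carrier (tensor_group E F N),
      monoid.mult = undefined,
      monoid.one = undefined,
      ring.zero = \<one>\<^bsub>tensor_group E F N\<^esub>,
      ring.add = (\<lambda>s t. s \<otimes>\<^bsub>tensor_group E F N\<^esub> t),
      smult = tensor_action k E F N\<rparr>"


section \<open>Galois extensions and inertia groups\<close>

definition galois_group :: "('l, 'b) ring_scheme \<Rightarrow> 'l set \<Rightarrow> ('l \<Rightarrow> 'l) set" where
  "galois_group L K = {g \<in> Bij (carrier L). g \<in> ring_iso L L \<and> (\<forall>x\<in>K. g x = x)}"

definition fixed_field :: "('l, 'b) ring_scheme \<Rightarrow> ('l \<Rightarrow> 'l) set \<Rightarrow> 'l set" where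
  "fixed_field L H = {x \<in> carrier L. \<forall>g\<in>H. g x = x}"

definition finite_galois :: "('l, 'b) ring_scheme \<Rightarrow> 'l set \<Rightarrow> bool" where
  "finite_galois L K \<longleftrightarrow>
     field L \<and> subfield K L \<and> ring.finite_dimension L K (carrier L) \<and>
     fixed_field L (galois_group L K) = K"

definition fin_gen_field :: "('l, 'b) ring_scheme \<Rightarrow> 'l set \<Rightarrow> bool" where
  "fin_gen_field E k \<longleftrightarrow> (\<exists>S. finite S \<and> S \<subseteq> carrier E \<and> generate_field E (k \<union> S) = carrier E)"

text \<open>\<open>P\<close> acts on the twist of \<open>M\<close> by \<open>g\<close> as the operator \<open>g\<inverse> \<circ> P \<circ> g\<close> acts on \<open>M\<close>.\<close>

definition twist ::
    "('l, 'b) ring_scheme \<Rightarrow> ('l \<Rightarrow> 'l) \<Rightarrow> ('l \<Rightarrow> 'l, 'm) module \<Rightarrow> ('l \<Rightarrow> 'l, 'm) module" where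
  "twist L g M =
     M\<lparr>smult := (\<lambda>P m. compose (carrier L) (inv\<^bsub>BijGroup (carrier L)\<^esub> g) (compose (carrier L) P g) \<odot>\<^bsub>M\<^esub> m)\<rparr>"

definition inertia_group ::
    "'l set \<Rightarrow> ('l, 'b) ring_scheme \<Rightarrow> 'l set \<Rightarrow> ('l \<Rightarrow> 'l, 'm) module \<Rightarrow> ('l \<Rightarrow> 'l) set" where
  "inertia_group k L K M =
     {g \<in> galois_group L K. module_isomorphic (diff_ring k L) (twist L g M) M}"

text \<open>For a field extension \<open>F/E\<close>, the simple modules \<open>N\<close> over \<open>diff_ring k E\<close> whose inverse image
  contains the simple module \<open>M\<close> over \<open>diff_ring k F\<close>. Only modules with underlying type \<open>'m\<close> can be
  collected; for \<open>'m = nat \<Rightarrow> 'l\<close>, say, every finite-dimensional module is isomorphic to one of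
  those.\<close>

definition simple_below ::
    "'l set \<Rightarrow> ('l, 'b) ring_scheme \<Rightarrow> ('l, 'b) ring_scheme \<Rightarrow> ('l \<Rightarrow> 'l, 'n) module \<Rightarrow>
     ('l \<Rightarrow> 'l, 'm) module set" where
  "simple_below k E F M =
     {N. simple_dmodule k E N \<and> multiplicity_in (diff_ring k F) (inverse_image k E F N) M \<noteq> 0}"

end

theory Submission
  imports Defs
begin

text \<open>Let \<open>L/E\<close> be a Galois extension with group \<open>H\<close>. The module \<open>L \<otimes>\<^sub>E V\<close> is the direct sum of the twists of
  the \<open>D\<^sub>L\<close>-module \<open>V\<close> by the elements of \<open>H\<close>, so every \<open>D\<^sub>E\<close>-linear map from \<open>V\<close> to a \<open>D\<^sub>L\<close>-module \<open>W\<close> is a sum of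
  \<open>D\<^sub>L\<close>-linear maps from the twists of \<open>V\<close> to \<open>W\<close>. If \<open>V = W = M\<close> is simple and \<open>E = K\<close>, only the twists by
  elements of the inertia group contribute, and these maps commute with the elements of \<open>L1\<close>. Hence
  every \<open>D\<^sub>K\<close>-linear endomorphism of \<open>M\<close> is \<open>L1\<close>-linear. By semisimplicity of the inverse image and
  adjunction, a simple module below \<open>M\<close> is both a submodule and a quotient of \<open>M\<close>. Composing a
  \<open>D\<^sub>K\<close>-linear map between two such modules over \<open>D\<^sub>Z\<close> with a surjection from \<open>M\<close> and an embedding into \<open>M\<close>
  gives an endomorphism of \<open>M\<close>, so the map is \<open>D\<^sub>Z\<close>-linear; and the \<open>D\<^sub>K\<close>-submodules of \<open>M\<close> that are quotients of \<open>M\<close>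
  are stable under \<open>L1\<close>. All four claims follow from this and adjunction.\<close>

section \<open>Semisimple modules and multiplicities\<close>

text \<open>Operators have arbitrary order and are defined by iterated commutators, so the
  identification of D_F with F \<otimes>_E D_E is reached without coordinates or derivations. The
  Galois group supplies elements x_i, y_i of \<open>L\<close> with \<Sum> x_i g(y_i) equal to 1 for
  g = 1 and to 0 otherwise, that is, the idempotent of the diagonal in L \<otimes>_E L. Averaging
  with it extends operators, and together with the trace form it stands in for a basis. The obstacle
  is the field in the middle: the inertia group need not be normal, so L1/K need not be Galois. What
  q requires is therefore proved over \<open>L\<close> and brought down by the normalised trace,
  which is where characteristic 0 enters; semisimplicity of q^! N in particular comes from \<pi>^! N
  by way of p^!. Multiplicities are measured by the largest r such that r homomorphisms to the
  simple module are jointly onto. This depends on Hom groups only, so multiplicities in two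
  different modules are compared through their maps to \<open>M\<close>. Members of A and B may have
  another element type than \<open>M\<close>, so a structure found inside \<open>M\<close> is
  carried back to a given carrier.\<close>

abbreviation add_hom :: "('a, 'x) ring_scheme \<Rightarrow> ('b, 'y) ring_scheme \<Rightarrow> ('a \<Rightarrow> 'b) set" where
  "add_hom V W \<equiv> hom (add_monoid V) (add_monoid W)"

lemma add_homI:
  assumes "\<And>x. x \<in> carrier V \<Longrightarrow> f x \<in> carrier W"
    and "\<And>x y. x \<in> carrier V \<Longrightarrow> y \<in> carrier V \<Longrightarrow> f (x \<oplus>\<^bsub>V\<^esub> y) = f x \<oplus>\<^bsub>W\<^esub> f y"
  shows "f \<in> add_hom V W"
  using assms by (auto simp: hom_def)

lemma add_hom_closed: "f \<in> add_hom V W \<Longrightarrow> x \<in> carrier V \<Longrightarrow> f x \<in> carrier W"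
  by (auto simp: hom_def)

lemma add_hom_add:
  "f \<in> add_hom V W \<Longrightarrow> x \<in> carrier V \<Longrightarrow> y \<in> carrier V \<Longrightarrow> f (x \<oplus>\<^bsub>V\<^esub> y) = f x \<oplus>\<^bsub>W\<^esub> f y"
  by (auto simp: hom_def)

context
  fixes V :: "('a, 'x) ring_scheme" and W :: "('b, 'y) ring_scheme"
  assumes V: "abelian_group V" and W: "abelian_group W"
begin

interpretation V: abelian_group V by (rule V)
interpretation W: abelian_group W by (rule W)

lemma add_hom_zero: "f \<in> add_hom V W \<Longrightarrow> f \<zero>\<^bsub>V\<^esub> = \<zero>\<^bsub>W\<^esub>"
  using hom_one[of f "add_monoid V" "add_monoid W"] V.a_group W.a_group by simp

lemma add_hom_minus: "f \<in> add_hom V W \<Longrightarrow> x \<in> carrier V \<Longrightarrow> f (\<ominus>\<^bsub>V\<^esub> x) = \<ominus>\<^bsub>W\<^esub> f x"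
  by (metis V.a_inv_closed V.r_neg W.add.inv_equality W.a_comm add_hom_add add_hom_closed add_hom_zero)

lemma add_hom_diff:
  "f \<in> add_hom V W \<Longrightarrow> x \<in> carrier V \<Longrightarrow> y \<in> carrier V \<Longrightarrow> f (x \<ominus>\<^bsub>V\<^esub> y) = f x \<ominus>\<^bsub>W\<^esub> f y"
  by (simp add: a_minus_def add_hom_add add_hom_minus)

lemma add_hom_finsum:
  "f \<in> add_hom V W \<Longrightarrow> finite I \<Longrightarrow> g \<in> I \<rightarrow> carrier V \<Longrightarrow> f (finsum V g I) = (\<Oplus>\<^bsub>W\<^esub>i\<in>I. f (g i))"
proof -
  assume f: "f \<in> add_hom V W" and "finite I" "g \<in> I \<rightarrow> carrier V"
  from this(2,3) show ?thesis
  proof (induction I rule: finite_induct)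
    case empty
    then show ?case by (simp add: add_hom_zero[OF f])
  next
    case (insert i I)
    then have "finsum V g I \<in> carrier V" "g i \<in> carrier V" by auto
    with insert show ?case
      by (subst V.finsum_insert, simp, simp, force, force, subst W.finsum_insert)
        (auto simp: add_hom_add[OF f] intro: add_hom_closed[OF f])
  qed
qed

lemma add_hom_sum:
  assumes "finite I" "\<And>i. i \<in> I \<Longrightarrow> f i \<in> add_hom V W"
  shows "(\<lambda>x. \<Oplus>\<^bsub>W\<^esub>i\<in>I. f i x) \<in> add_hom V W"
proof (rule add_homI)
  show "(\<Oplus>\<^bsub>W\<^esub>i\<in>I. f i x) \<in> carrier W" if "x \<in> carrier V" for x
    by (rule W.finsum_closed) (use add_hom_closed[OF assms(2) that] in auto)
  show "(\<Oplus>\<^bsub>W\<^esub>i\<in>I. f i (x \<oplus>\<^bsub>V\<^esub> y)) = (\<Oplus>\<^bsub>W\<^esub>i\<in>I. f i x) \<oplus>\<^bsub>W\<^esub> (\<Oplus>\<^bsub>W\<^esub>i\<in>I. f i y)"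
    if xy: "x \<in> carrier V" "y \<in> carrier V" for x y
  proof -
    have c: "f i x \<in> carrier W" "f i y \<in> carrier W" if "i \<in> I" for i
      using add_hom_closed[OF assms(2)[OF that]] xy by auto
    have "(\<Oplus>\<^bsub>W\<^esub>i\<in>I. f i (x \<oplus>\<^bsub>V\<^esub> y)) = (\<Oplus>\<^bsub>W\<^esub>i\<in>I. f i x \<oplus>\<^bsub>W\<^esub> f i y)"
      using c add_hom_add[OF assms(2) xy] by (intro W.finsum_cong') auto
    then show ?thesis using c by (simp add: W.finsum_addf Pi_iff)
  qed
qed

lemma add_hom_uminus: "f \<in> add_hom V W \<Longrightarrow> g \<in> add_hom V W \<Longrightarrow> (\<lambda>x. f x \<ominus>\<^bsub>W\<^esub> g x) \<in> add_hom V W"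
  by (intro add_homI)
    (auto simp: add_hom_add a_minus_def W.minus_add W.a_ac add_hom_closed)

end

lemma (in abelian_group) minus_eq_zero_iff:
  "x \<in> carrier G \<Longrightarrow> y \<in> carrier G \<Longrightarrow> x \<ominus> y = \<zero> \<longleftrightarrow> x = y"
  by (metis a_minus_def add.inv_closed add.inv_inv minus_equality r_neg)

lemma set_addD:
  assumes "x \<in> H <+>\<^bsub>G\<^esub> K" obtains h k where "h \<in> H" "k \<in> K" "x = h \<oplus>\<^bsub>G\<^esub> k"
  using assms by (auto simp: set_add_def set_mult_def)

lemma set_addI: "h \<in> H \<Longrightarrow> k \<in> K \<Longrightarrow> h \<oplus>\<^bsub>G\<^esub> k \<in> H <+>\<^bsub>G\<^esub> K"
  by (auto simp: set_add_def set_mult_def)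

lemma (in abelian_group) set_add_zero:
  assumes "H \<subseteq> carrier G"
  shows "H <+>\<^bsub>G\<^esub> {\<zero>} = H" "{\<zero>} <+>\<^bsub>G\<^esub> H = H"
proof -
  have "h \<oplus> \<zero> = h \<and> \<zero> \<oplus> h = h" if "h \<in> H" for h using that assms by auto
  then show "H <+>\<^bsub>G\<^esub> {\<zero>} = H" "{\<zero>} <+>\<^bsub>G\<^esub> H = H"
    by (auto simp: set_add_def set_mult_def)
qed

lemma add_hom_set_add:
  assumes "f \<in> add_hom V W" "H \<subseteq> carrier V" "K \<subseteq> carrier V"
  shows "f ` (H <+>\<^bsub>V\<^esub> K) = f ` H <+>\<^bsub>W\<^esub> f ` K"
proof -
  have "f (h \<oplus>\<^bsub>V\<^esub> k) = f h \<oplus>\<^bsub>W\<^esub> f k" if "h \<in> H" "k \<in> K" for h k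
    using that assms by (meson add_hom_add subsetD)
  then show ?thesis by (force simp: set_add_def set_mult_def)
qed

lemma add_hom_comp: "f \<in> add_hom U V \<Longrightarrow> g \<in> add_hom V W \<Longrightarrow> (\<lambda>x. g (f x)) \<in> add_hom U W"
  by (rule add_homI) (simp_all add: add_hom_closed add_hom_add)

context left_module
begin

lemma smult_l_null: "x \<in> carrier M \<Longrightarrow> \<zero>\<^bsub>R\<^esub> \<odot>\<^bsub>M\<^esub> x = \<zero>\<^bsub>M\<^esub>"
  by (metis M.add.r_cancel_one' R.zero_closed R.r_zero smult_closed smult_l_distr)

lemma smult_add_hom: "a \<in> carrier R \<Longrightarrow> (\<lambda>x. a \<odot>\<^bsub>M\<^esub> x) \<in> add_hom M M"
  by (intro add_homI smult_closed smult_r_distr)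

lemma smult_r_null: "a \<in> carrier R \<Longrightarrow> a \<odot>\<^bsub>M\<^esub> \<zero>\<^bsub>M\<^esub> = \<zero>\<^bsub>M\<^esub>"
  using add_hom_zero[OF M.abelian_group_axioms M.abelian_group_axioms smult_add_hom] .

lemma smult_l_add_hom: "x \<in> carrier M \<Longrightarrow> (\<lambda>a. a \<odot>\<^bsub>M\<^esub> x) \<in> add_hom R M"
  by (intro add_homI smult_closed smult_l_distr)

lemmas smult_finsum =
  add_hom_finsum[OF M.abelian_group_axioms M.abelian_group_axioms smult_add_hom]

lemmas smult_l_finsum =
  add_hom_finsum[OF R.abelian_group_axioms M.abelian_group_axioms smult_l_add_hom]

lemmas smult_diff =
  add_hom_diff[OF M.abelian_group_axioms M.abelian_group_axioms smult_add_hom]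

text \<open>Negatives come for free because the scalar \<ominus>\<one> acts as negation; hence only
  zero, sums and scalar multiples have to be checked.\<close>

lemma submoduleI:
  assumes "H \<subseteq> carrier M" "\<zero>\<^bsub>M\<^esub> \<in> H" "\<And>x y. x \<in> H \<Longrightarrow> y \<in> H \<Longrightarrow> x \<oplus>\<^bsub>M\<^esub> y \<in> H"
    "\<And>a x. a \<in> carrier R \<Longrightarrow> x \<in> H \<Longrightarrow> a \<odot>\<^bsub>M\<^esub> x \<in> H"
  shows "submodule H R M"
proof -
  have "\<ominus>\<^bsub>M\<^esub> x \<in> H" if "x \<in> H" for x
  proof -
    have x: "x \<in> carrier M" using that assms(1) by auto
    have "(\<ominus>\<^bsub>R\<^esub> \<one>\<^bsub>R\<^esub>) \<odot>\<^bsub>M\<^esub> x \<oplus>\<^bsub>M\<^esub> x = \<zero>\<^bsub>M\<^esub>"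
      by (metis R.add.inv_closed R.l_neg R.one_closed smult_l_distr smult_l_null smult_one x)
    then have "\<ominus>\<^bsub>M\<^esub> x = (\<ominus>\<^bsub>R\<^esub> \<one>\<^bsub>R\<^esub>) \<odot>\<^bsub>M\<^esub> x"
      by (simp add: M.minus_equality smult_closed x)
    then show ?thesis using assms(4) that by simp
  qed
  then show ?thesis
    using assms by (intro submodule.intro subgroup.intro submodule_axioms.intro) (auto simp: a_inv_def)
qed

lemma submoduleD:
  assumes "submodule H R M"
  shows "H \<subseteq> carrier M" "\<zero>\<^bsub>M\<^esub> \<in> H"
    "x \<in> H \<Longrightarrow> y \<in> H \<Longrightarrow> x \<oplus>\<^bsub>M\<^esub> y \<in> H" "x \<in> H \<Longrightarrow> \<ominus>\<^bsub>M\<^esub> x \<in> H"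
    "x \<in> H \<Longrightarrow> y \<in> H \<Longrightarrow> x \<ominus>\<^bsub>M\<^esub> y \<in> H"
    "a \<in> carrier R \<Longrightarrow> x \<in> H \<Longrightarrow> a \<odot>\<^bsub>M\<^esub> x \<in> H"
proof -
  interpret H: submodule H R M by fact
  show "H \<subseteq> carrier M" "\<zero>\<^bsub>M\<^esub> \<in> H" "x \<in> H \<Longrightarrow> y \<in> H \<Longrightarrow> x \<oplus>\<^bsub>M\<^esub> y \<in> H"
    "a \<in> carrier R \<Longrightarrow> x \<in> H \<Longrightarrow> a \<odot>\<^bsub>M\<^esub> x \<in> H" "x \<in> H \<Longrightarrow> \<ominus>\<^bsub>M\<^esub> x \<in> H"
    "x \<in> H \<Longrightarrow> y \<in> H \<Longrightarrow> x \<ominus>\<^bsub>M\<^esub> y \<in> H"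
    using H.subset H.one_closed H.m_closed H.m_inv_closed
    by (auto simp: a_inv_def a_minus_def)
qed

lemma submodule_finsum:
  assumes H: "submodule H R M" and "finite I" "\<And>i. i \<in> I \<Longrightarrow> f i \<in> H"
  shows "finsum M f I \<in> H"
  using assms(2,3)
proof (induction I rule: finite_induct)
  case (insert i I)
  then show ?case
    using submoduleD(1)[OF H]
    by (subst M.finsum_insert) (auto intro: submoduleD[OF H] simp: subset_iff)
qed (simp add: submoduleD[OF H])

lemma submodule_carrier: "submodule (carrier M) R M"
  by (rule submoduleI) (auto simp: smult_closed)

lemma submodule_zero: "submodule {\<zero>\<^bsub>M\<^esub>} R M"
  by (rule submoduleI) (auto simp: smult_r_null)

lemma submodule_Int: "submodule H R M \<Longrightarrow> submodule H' R M \<Longrightarrow> submodule (H \<inter> H') R M"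
  by (rule submoduleI) (auto simp: submoduleD dest: submoduleD(1))

lemma submodule_add:
  assumes H: "submodule H R M" and H': "submodule H' R M"
  shows "submodule (H <+>\<^bsub>M\<^esub> H') R M"
proof (rule submoduleI)
  have sub: "x \<in> carrier M" if "x \<in> H \<or> x \<in> H'" for x
    using that submoduleD(1)[OF H] submoduleD(1)[OF H'] by auto
  show "H <+>\<^bsub>M\<^esub> H' \<subseteq> carrier M" using sub by (auto elim!: set_addD)
  show "\<zero>\<^bsub>M\<^esub> \<in> H <+>\<^bsub>M\<^esub> H'"
    using set_addI[OF submoduleD(2)[OF H] submoduleD(2)[OF H'], of M] by simp
  show "x \<oplus>\<^bsub>M\<^esub> y \<in> H <+>\<^bsub>M\<^esub> H'" if xy: "x \<in> H <+>\<^bsub>M\<^esub> H'" "y \<in> H <+>\<^bsub>M\<^esub> H'" for x y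
  proof -
    obtain h k h' k' where *: "h \<in> H" "k \<in> H'" "x = h \<oplus>\<^bsub>M\<^esub> k" "h' \<in> H" "k' \<in> H'" "y = h' \<oplus>\<^bsub>M\<^esub> k'"
      using xy by (elim set_addD) blast
    then have "x \<oplus>\<^bsub>M\<^esub> y = (h \<oplus>\<^bsub>M\<^esub> h') \<oplus>\<^bsub>M\<^esub> (k \<oplus>\<^bsub>M\<^esub> k')" using sub by (simp add: M.a_ac)
    then show ?thesis using * submoduleD(3)[OF H] submoduleD(3)[OF H'] by (auto intro: set_addI)
  qed
  show "a \<odot>\<^bsub>M\<^esub> x \<in> H <+>\<^bsub>M\<^esub> H'" if ax: "a \<in> carrier R" "x \<in> H <+>\<^bsub>M\<^esub> H'" for a x
  proof -
    obtain h k where *: "h \<in> H" "k \<in> H'" "x = h \<oplus>\<^bsub>M\<^esub> k" using ax by (elim set_addD)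
    then have "a \<odot>\<^bsub>M\<^esub> x = a \<odot>\<^bsub>M\<^esub> h \<oplus>\<^bsub>M\<^esub> a \<odot>\<^bsub>M\<^esub> k" using sub that by (simp add: smult_r_distr)
    then show ?thesis using * that submoduleD(6)[OF H] submoduleD(6)[OF H'] by (auto intro: set_addI)
  qed
qed

lemma submodule_left_module:
  assumes H: "submodule H R M"
  shows "left_module R (M\<lparr>carrier := H\<rparr>)"
proof -
  interpret H: submodule H R M by fact
  interpret MH: abelian_group "M\<lparr>carrier := H\<rparr>"
  proof (rule abelian_groupI)
    fix x assume "x \<in> carrier (M\<lparr>carrier := H\<rparr>)"
    then show "\<exists>y\<in>carrier (M\<lparr>carrier := H\<rparr>). y \<oplus>\<^bsub>M\<lparr>carrier := H\<rparr>\<^esub> x = \<zero>\<^bsub>M\<lparr>carrier := H\<rparr>\<^esub>"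
      using submoduleD(1)[OF H] submoduleD(4)[OF H, of x]
      by (intro bexI[of _ "\<ominus>\<^bsub>M\<^esub> x"]) (simp_all add: M.l_neg subset_iff)
  qed (use submoduleD[OF H] in \<open>auto simp: M.a_ac subset_iff\<close>)
  show ?thesis
    by unfold_locales
      (use submoduleD[OF H] in \<open>auto simp: smult_l_distr smult_r_distr smult_assoc smult_one subset_iff\<close>)
qed

lemma submodule_carrier_update_iff:
  assumes S: "submodule S R M"
  shows "submodule H R (M\<lparr>carrier := S\<rparr>) \<longleftrightarrow> submodule H R M \<and> H \<subseteq> S"
proof -
  interpret S: left_module R "M\<lparr>carrier := S\<rparr>" by (rule submodule_left_module[OF S])
  show ?thesis
  proof safe
    assume H: "submodule H R (M\<lparr>carrier := S\<rparr>)"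
    show "submodule H R M"
      by (rule submoduleI) (use S.submoduleD[OF H] submoduleD[OF S] in auto)
    show "x \<in> S" if "x \<in> H" for x using S.submoduleD(1)[OF H] that by auto
  next
    assume H: "submodule H R M" "H \<subseteq> S"
    show "submodule H R (M\<lparr>carrier := S\<rparr>)"
      by (rule S.submoduleI) (use submoduleD[OF H(1)] H(2) in auto)
  qed
qed

end

definition mod_hom ::
    "('r, 'x) ring_scheme \<Rightarrow> ('r, 'm, 'y) module_scheme \<Rightarrow> ('r, 'n, 'z) module_scheme \<Rightarrow> ('m \<Rightarrow> 'n) set"
  where "mod_hom R V W = {f \<in> add_hom V W. \<forall>a\<in>carrier R. \<forall>x\<in>carrier V. f (a \<odot>\<^bsub>V\<^esub> x) = a \<odot>\<^bsub>W\<^esub> f x}"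

lemma mod_homI:
  assumes "\<And>x. x \<in> carrier V \<Longrightarrow> f x \<in> carrier W"
    and "\<And>x y. x \<in> carrier V \<Longrightarrow> y \<in> carrier V \<Longrightarrow> f (x \<oplus>\<^bsub>V\<^esub> y) = f x \<oplus>\<^bsub>W\<^esub> f y"
    and "\<And>a x. a \<in> carrier R \<Longrightarrow> x \<in> carrier V \<Longrightarrow> f (a \<odot>\<^bsub>V\<^esub> x) = a \<odot>\<^bsub>W\<^esub> f x"
  shows "f \<in> mod_hom R V W"
  using assms by (auto simp: mod_hom_def hom_def)

lemma mod_homD:
  assumes "f \<in> mod_hom R V W"
  shows "f \<in> add_hom V W" "x \<in> carrier V \<Longrightarrow> f x \<in> carrier W"
    "x \<in> carrier V \<Longrightarrow> y \<in> carrier V \<Longrightarrow> f (x \<oplus>\<^bsub>V\<^esub> y) = f x \<oplus>\<^bsub>W\<^esub> f y"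
    "a \<in> carrier R \<Longrightarrow> x \<in> carrier V \<Longrightarrow> f (a \<odot>\<^bsub>V\<^esub> x) = a \<odot>\<^bsub>W\<^esub> f x"
  using assms by (auto simp: mod_hom_def hom_def)

lemma mod_hom_comp: "f \<in> mod_hom R U V \<Longrightarrow> g \<in> mod_hom R V W \<Longrightarrow> (\<lambda>x. g (f x)) \<in> mod_hom R U W"
  by (rule mod_homI) (auto simp: mod_homD)

lemma left_module_abelian_group: "left_module R V \<Longrightarrow> abelian_group V"
  by (simp add: left_module_def)

lemma mod_hom_zero:
  "left_module R V \<Longrightarrow> left_module R W \<Longrightarrow> f \<in> mod_hom R V W \<Longrightarrow> f \<zero>\<^bsub>V\<^esub> = \<zero>\<^bsub>W\<^esub>"
  by (meson add_hom_zero left_module_abelian_group mod_homD(1))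

lemma mod_hom_diff:
  "left_module R V \<Longrightarrow> left_module R W \<Longrightarrow> f \<in> mod_hom R V W \<Longrightarrow> x \<in> carrier V \<Longrightarrow> y \<in> carrier V \<Longrightarrow>
    f (x \<ominus>\<^bsub>V\<^esub> y) = f x \<ominus>\<^bsub>W\<^esub> f y"
  by (meson add_hom_diff left_module_abelian_group mod_homD(1))

text \<open>Simplicity of \<open>S\<close> is expressed inside the ambient module, which avoids a
  change of the carrier in the record; \<open>simple_sub_iff\<close> gives the translation.\<close>

definition simple_sub :: "('r, 'x) ring_scheme \<Rightarrow> ('r, 'm, 'y) module_scheme \<Rightarrow> 'm set \<Rightarrow> bool" where
  "simple_sub R V S \<longleftrightarrow> submodule S R V \<and> S \<noteq> {\<zero>\<^bsub>V\<^esub>} \<and>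
     (\<forall>H. submodule H R V \<and> H \<subseteq> S \<longrightarrow> H = {\<zero>\<^bsub>V\<^esub>} \<or> H = S)"

lemma (in left_module) simple_sub_iff:
  "simple_sub R M S \<longleftrightarrow> submodule S R M \<and> simple_left_module R (M\<lparr>carrier := S\<rparr>)"
  unfolding simple_sub_def simple_left_module_def
  using submodule_left_module submodule_carrier_update_iff by auto

lemma (in left_module) simple_sub_carrier: "simple_sub R M (carrier M) \<longleftrightarrow> simple_left_module R M"
  unfolding simple_sub_def simple_left_module_def
  using submodule_carrier submoduleD(1) left_module_axioms by metis

inductive fss :: "('r, 'x) ring_scheme \<Rightarrow> ('r, 'm, 'y) module_scheme \<Rightarrow> 'm set \<Rightarrow> bool"
  for R V where
  zero: "fss R V {\<zero>\<^bsub>V\<^esub>}"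
| add: "fss R V W \<Longrightarrow> simple_sub R V S \<Longrightarrow> fss R V (W <+>\<^bsub>V\<^esub> S)"

context
  fixes R :: "('r, 'x) ring_scheme" and V :: "('r, 'm, 'y) module_scheme"
    and W :: "('r, 'n, 'z) module_scheme"
  assumes V: "left_module R V" and W: "left_module R W"
begin

interpretation V: left_module R V by (rule V)
interpretation W: left_module R W by (rule W)

lemma submodule_preimage:
  assumes f: "f \<in> mod_hom R V W" and H: "submodule H R W"
  shows "submodule {x \<in> carrier V. f x \<in> H} R V"
  using W.submoduleD[OF H] f
  by (intro V.submoduleI) (auto simp: mod_homD mod_hom_zero[OF V W f] V.smult_closed)

lemma submodule_image:
  assumes f: "f \<in> mod_hom R V W" and H: "submodule H R V"
  shows "submodule (f ` H) R W"
proof (rule W.submoduleI)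
  note H' = V.submoduleD[OF H]
  show "f ` H \<subseteq> carrier W" using H'(1) mod_homD(2)[OF f] by auto
  show "\<zero>\<^bsub>W\<^esub> \<in> f ` H" using mod_hom_zero[OF V W f] H'(2) by force
  show "x \<oplus>\<^bsub>W\<^esub> y \<in> f ` H" if xy: "x \<in> f ` H" "y \<in> f ` H" for x y
  proof -
    obtain u v where "u \<in> H" "v \<in> H" "x = f u" "y = f v" using xy by blast
    then show ?thesis using H' mod_homD(3)[OF f, of u v] by (metis image_eqI subsetD)
  qed
  show "a \<odot>\<^bsub>W\<^esub> x \<in> f ` H" if ax: "a \<in> carrier R" "x \<in> f ` H" for a x
  proof -
    obtain u where "u \<in> H" "x = f u" using ax by auto
    then show ?thesis using H' mod_homD(4)[OF f, of a u] ax(1) by (metis image_eqI subsetD)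
  qed
qed

lemma inj_on_mod_hom:
  assumes f: "f \<in> mod_hom R V W" and H: "submodule H R V" and "\<And>x. x \<in> H \<Longrightarrow> f x = \<zero>\<^bsub>W\<^esub> \<Longrightarrow> x = \<zero>\<^bsub>V\<^esub>"
  shows "inj_on f H"
proof (rule inj_onI)
  fix x y assume *: "x \<in> H" "y \<in> H" "f x = f y"
  note H' = V.submoduleD[OF H]
  have xy: "x \<in> carrier V" "y \<in> carrier V" using * H' by auto
  then have "f (x \<ominus>\<^bsub>V\<^esub> y) = \<zero>\<^bsub>W\<^esub>" using mod_hom_diff[OF V W f] * mod_homD(2)[OF f] by (simp add: W.M.minus_eq_zero_iff)
  then have "x \<ominus>\<^bsub>V\<^esub> y = \<zero>\<^bsub>V\<^esub>" using assms(3) H'(5) * by blast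
  then show "x = y" using xy by (simp add: V.M.minus_eq_zero_iff)
qed

text \<open>Schur's lemma. The kernel of \<open>f\<close> and the preimage of a submodule of the
  image both cut out submodules of \<open>S\<close>, and each of these is zero or
  \<open>S\<close>.\<close>

lemma simple_sub_mod_hom:
  assumes f: "f \<in> mod_hom R V W" and S: "simple_sub R V S"
  shows "f ` S = {\<zero>\<^bsub>W\<^esub>} \<or> inj_on f S \<and> simple_sub R W (f ` S)"
proof -
  have SV: "submodule S R V" using S by (simp add: simple_sub_def)
  note S' = V.submoduleD[OF SV]
  let ?K = "S \<inter> {x \<in> carrier V. f x \<in> {\<zero>\<^bsub>W\<^esub>}}"
  have "submodule ?K R V"
    by (intro V.submodule_Int SV submodule_preimage[OF f] W.submodule_zero)
  then have "?K = {\<zero>\<^bsub>V\<^esub>} \<or> ?K = S" using S unfolding simple_sub_def by blast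
  then show ?thesis
  proof
    assume K: "?K = S"
    have "f x = \<zero>\<^bsub>W\<^esub>" if "x \<in> S" for x using that K by blast
    then have "f ` S \<subseteq> {\<zero>\<^bsub>W\<^esub>}" by blast
    then have "f ` S = {\<zero>\<^bsub>W\<^esub>}" using S'(2) by (metis image_is_empty empty_iff subset_singletonD)
    then show ?thesis ..
  next
    assume K: "?K = {\<zero>\<^bsub>V\<^esub>}"
    have inj: "inj_on f S"
      by (rule inj_on_mod_hom[OF f SV]) (use K S'(1) in blast)
    have "H = {\<zero>\<^bsub>W\<^esub>} \<or> H = f ` S" if H: "submodule H R W" "H \<subseteq> f ` S" for H
    proof -
      let ?H = "S \<inter> {x \<in> carrier V. f x \<in> H}"
      have "submodule ?H R V" by (intro V.submodule_Int SV submodule_preimage[OF f] H)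
      then have "?H = {\<zero>\<^bsub>V\<^esub>} \<or> ?H = S" using S unfolding simple_sub_def by blast
      then have "f ` ?H = {f \<zero>\<^bsub>V\<^esub>} \<or> f ` ?H = f ` S" by (elim disjE) simp_all
      moreover have "f ` ?H = H" using H S'(1) by blast
      ultimately show ?thesis using mod_hom_zero[OF V W f] by simp
    qed
    moreover have "f ` S \<noteq> {\<zero>\<^bsub>W\<^esub>}"
    proof
      assume "f ` S = {\<zero>\<^bsub>W\<^esub>}"
      have "x \<in> ?K" if "x \<in> S" for x
        using S'(1) that imageI[OF that, of f] by (simp add: \<open>f ` S = {\<zero>\<^bsub>W\<^esub>}\<close> subset_iff)
      then have "S = {\<zero>\<^bsub>V\<^esub>}" using K S'(2) by blast
      then show False using S by (simp add: simple_sub_def)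
    qed
    ultimately have "simple_sub R W (f ` S)"
      using submodule_image[OF f SV] unfolding simple_sub_def by blast
    then show ?thesis using inj by blast
  qed
qed

text \<open>A simple summand maps either to zero, and is then absorbed, or to a simple submodule by
  Schur's lemma.\<close>

lemma fss_image:
  assumes f: "f \<in> mod_hom R V W" and "fss R V H"
  shows "submodule H R V \<and> fss R W (f ` H)"
  using assms(2)
proof induction
  case zero
  then show ?case using mod_hom_zero[OF V W f] by (auto simp: V.submodule_zero fss.zero)
next
  case (add H S)
  have S: "submodule S R V" using add by (simp add: simple_sub_def)
  have sub: "H \<subseteq> carrier V" "S \<subseteq> carrier V" using add S V.submoduleD(1) by auto
  have "f ` (H <+>\<^bsub>V\<^esub> S) = f ` H <+>\<^bsub>W\<^esub> f ` S"
    by (rule add_hom_set_add[OF mod_homD(1)[OF f] sub])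
  moreover have "f ` H <+>\<^bsub>W\<^esub> {\<zero>\<^bsub>W\<^esub>} = f ` H"
    using sub mod_homD(2)[OF f] by (intro W.M.set_add_zero) auto
  ultimately show ?case
    using simple_sub_mod_hom[OF f add(2)] add fss.add V.submodule_add S by metis
qed

end

lemma (in left_module) fss_submodule: "fss R M H \<Longrightarrow> submodule H R M"
  by (induction rule: fss.induct) (auto simp: submodule_zero submodule_add simple_sub_def)

lemma (in left_module) fss_simple_sub: "simple_sub R M S \<Longrightarrow> fss R M S"
proof -
  assume S: "simple_sub R M S"
  then have "S \<subseteq> carrier M" using submoduleD(1) by (auto simp: simple_sub_def)
  then have "{\<zero>\<^bsub>M\<^esub>} <+>\<^bsub>M\<^esub> S = S" by (rule M.set_add_zero)
  then show ?thesis using fss.add[OF fss.zero S] by simp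
qed

lemma (in left_module) fss_add: "fss R M H' \<Longrightarrow> fss R M H \<Longrightarrow> fss R M (H <+>\<^bsub>M\<^esub> H')"
proof (induction rule: fss.induct)
  case zero
  then have "H \<subseteq> carrier M" using submoduleD(1) fss_submodule by blast
  then have "H <+>\<^bsub>M\<^esub> {\<zero>\<^bsub>M\<^esub>} = H" by (rule M.set_add_zero)
  then show ?case using zero by simp
next
  case (add W S)
  have "H \<subseteq> carrier M" "W \<subseteq> carrier M" "S \<subseteq> carrier M"
    using submoduleD(1) fss_submodule add by (auto simp: simple_sub_def)
  then have "H <+>\<^bsub>M\<^esub> (W <+>\<^bsub>M\<^esub> S) = (H <+>\<^bsub>M\<^esub> W) <+>\<^bsub>M\<^esub> S"
    unfolding set_add_def using M.add.set_mult_assoc by auto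
  then show ?case using add fss.add by metis
qed

lemma (in abelian_group) add_diff_cancel:
  assumes "x \<in> carrier G" "y \<in> carrier G"
  shows "(x \<oplus> y) \<ominus> y = x" "(x \<oplus> y) \<ominus> x = y" "(x \<ominus> y) \<oplus> y = x"
proof -
  show "(x \<oplus> y) \<ominus> y = x" "(x \<ominus> y) \<oplus> y = x"
    using assms by (simp_all add: a_minus_def a_assoc r_neg l_neg)
  then show "(x \<oplus> y) \<ominus> x = y" using assms by (simp add: a_minus_def a_comm[of x] a_assoc r_neg)
qed

section \<open>Complements, retractions and direct decompositions\<close>

context left_module
begin

lemma set_add_subset:
  assumes C: "submodule C R M" and "A \<subseteq> C" "B \<subseteq> C"
  shows "A <+>\<^bsub>M\<^esub> B \<subseteq> C"
proof
  fix x assume "x \<in> A <+>\<^bsub>M\<^esub> B"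
  then obtain a b where "a \<in> A" "b \<in> B" "x = a \<oplus>\<^bsub>M\<^esub> b" by (elim set_addD)
  then show "x \<in> C" using assms submoduleD(3)[OF C, of a b] by blast
qed

text \<open>The complement \<open>C\<close> grows along the construction of \<open>W\<close>: a new
  simple summand is either contained in \<open>W0 + C\<close> already or meets it in zero, and in
  the second case it is added to \<open>C\<close>. Taking \<open>W\<close> to be the whole module
  yields a complement of \<open>W0\<close>.\<close>

lemma fss_complement:
  assumes "fss R M W" and W0: "submodule W0 R M"
  shows "\<exists>C. submodule C R M \<and> W0 \<inter> C = {\<zero>\<^bsub>M\<^esub>} \<and> W \<subseteq> W0 <+>\<^bsub>M\<^esub> C"
  using assms(1)
proof induction
  case zero
  have "{\<zero>\<^bsub>M\<^esub>} \<subseteq> W0 <+>\<^bsub>M\<^esub> {\<zero>\<^bsub>M\<^esub>}" "W0 \<inter> {\<zero>\<^bsub>M\<^esub>} = {\<zero>\<^bsub>M\<^esub>}"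
    using submoduleD(1,2)[OF W0] by (auto simp: M.set_add_zero)
  then show ?case using submodule_zero by blast
next
  case (add W S)
  then obtain C where C: "submodule C R M" "W0 \<inter> C = {\<zero>\<^bsub>M\<^esub>}" "W \<subseteq> W0 <+>\<^bsub>M\<^esub> C" by blast
  have S: "submodule S R M" using add(2) by (simp add: simple_sub_def)
  note WC = submodule_add[OF W0 C(1)]
  note sub = submoduleD(1)[OF W0] submoduleD(1)[OF C(1)] submoduleD(1)[OF S]
  have "S \<inter> (W0 <+>\<^bsub>M\<^esub> C) = {\<zero>\<^bsub>M\<^esub>} \<or> S \<inter> (W0 <+>\<^bsub>M\<^esub> C) = S"
    using add(2) submodule_Int[OF S WC] unfolding simple_sub_def by blast
  then show ?case
  proof
    assume "S \<inter> (W0 <+>\<^bsub>M\<^esub> C) = S"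
    then have "S \<subseteq> W0 <+>\<^bsub>M\<^esub> C" by blast
    then have "W <+>\<^bsub>M\<^esub> S \<subseteq> W0 <+>\<^bsub>M\<^esub> C"
      by (rule set_add_subset[OF WC C(3)])
    then show ?thesis using C by blast
  next
    assume SWC: "S \<inter> (W0 <+>\<^bsub>M\<^esub> C) = {\<zero>\<^bsub>M\<^esub>}"
    \<comment> \<open>If \<open>x = c + s\<close> lies in \<open>W0\<close>, then
      \<open>s = x - c\<close> lies in both \<open>S\<close> and \<open>W0 + C\<close>, hence
      vanishes, and \<open>x = c\<close> lies in \<open>W0 \<inter> C\<close>.\<close>
    have "x = \<zero>\<^bsub>M\<^esub>" if x: "x \<in> W0" "x \<in> C <+>\<^bsub>M\<^esub> S" for x
    proof -
      obtain c s where cs: "c \<in> C" "s \<in> S" "x = c \<oplus>\<^bsub>M\<^esub> s" using x(2) by (elim set_addD)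
      have car: "c \<in> carrier M" "s \<in> carrier M" "x \<in> carrier M" using cs x sub by auto
      then have "s = x \<oplus>\<^bsub>M\<^esub> \<ominus>\<^bsub>M\<^esub> c"
        using cs(3) M.add_diff_cancel(2)[of c s] by (simp add: a_minus_def)
      then have "s \<in> W0 <+>\<^bsub>M\<^esub> C" using set_addI[OF x(1) submoduleD(4)[OF C(1) cs(1)]] by simp
      then have "s = \<zero>\<^bsub>M\<^esub>" using SWC cs(2) by blast
      then have "x = c" using cs(3) car by simp
      then show ?thesis using x(1) cs(1) C(2) by blast
    qed
    then have "W0 \<inter> (C <+>\<^bsub>M\<^esub> S) = {\<zero>\<^bsub>M\<^esub>}"
      using submoduleD(2)[OF W0] submoduleD(2)[OF submodule_add[OF C(1) S]] by blast
    moreover have "W <+>\<^bsub>M\<^esub> S \<subseteq> (W0 <+>\<^bsub>M\<^esub> C) <+>\<^bsub>M\<^esub> S"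
      using C(3) by (auto elim!: set_addD intro!: set_addI)
    moreover have "(W0 <+>\<^bsub>M\<^esub> C) <+>\<^bsub>M\<^esub> S = W0 <+>\<^bsub>M\<^esub> (C <+>\<^bsub>M\<^esub> S)"
      unfolding set_add_def using M.add.set_mult_assoc sub by simp
    ultimately show ?thesis using submodule_add[OF C(1) S] by metis
  qed
qed

lemma direct_unique:
  assumes "submodule W R M" "submodule C R M" "W \<inter> C = {\<zero>\<^bsub>M\<^esub>}"
    "w \<in> W" "c \<in> C" "w' \<in> W" "c' \<in> C" "w \<oplus>\<^bsub>M\<^esub> c = w' \<oplus>\<^bsub>M\<^esub> c'"
  shows "w = w' \<and> c = c'"
proof -
  have car: "w \<in> carrier M" "c \<in> carrier M" "w' \<in> carrier M" "c' \<in> carrier M"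
    using assms submoduleD(1) by blast+
  have "w' \<oplus>\<^bsub>M\<^esub> ((w \<ominus>\<^bsub>M\<^esub> w') \<oplus>\<^bsub>M\<^esub> c) = ((w \<ominus>\<^bsub>M\<^esub> w') \<oplus>\<^bsub>M\<^esub> w') \<oplus>\<^bsub>M\<^esub> c"
    using car by (simp add: M.a_ac)
  then have "w' \<oplus>\<^bsub>M\<^esub> ((w \<ominus>\<^bsub>M\<^esub> w') \<oplus>\<^bsub>M\<^esub> c) = w' \<oplus>\<^bsub>M\<^esub> c'"
    using car assms(8) by (simp add: M.add_diff_cancel)
  then have "c' = (w \<ominus>\<^bsub>M\<^esub> w') \<oplus>\<^bsub>M\<^esub> c" using car by simp
  then have "w \<ominus>\<^bsub>M\<^esub> w' = c' \<ominus>\<^bsub>M\<^esub> c" using car by (simp add: M.add_diff_cancel)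
  moreover have "w \<ominus>\<^bsub>M\<^esub> w' \<in> W" "c' \<ominus>\<^bsub>M\<^esub> c \<in> C" using assms submoduleD(5) by blast+
  ultimately have "w \<ominus>\<^bsub>M\<^esub> w' = \<zero>\<^bsub>M\<^esub>" "c' \<ominus>\<^bsub>M\<^esub> c = \<zero>\<^bsub>M\<^esub>" using assms(3) by auto
  then show ?thesis using car by (simp add: M.minus_eq_zero_iff)
qed

text \<open>The value is described through the uniqueness of the decomposition; linearity holds
  because sums and multiples of decompositions are again decompositions.\<close>

lemma direct_projection:
  assumes W: "submodule W R M" and C: "submodule C R M" and WC: "W \<inter> C = {\<zero>\<^bsub>M\<^esub>}"
    and car: "carrier M \<subseteq> W <+>\<^bsub>M\<^esub> C"
  obtains p where "p \<in> mod_hom R M M" "\<And>x. x \<in> carrier M \<Longrightarrow> p x \<in> W" "\<And>x. x \<in> W \<Longrightarrow> p x = x"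
    "\<And>x. x \<in> C \<Longrightarrow> p x = \<zero>\<^bsub>M\<^esub>"
proof -
  note sub = subsetD[OF submoduleD(1)[OF W]] subsetD[OF submoduleD(1)[OF C]]
  define p where "p x = (THE w. w \<in> W \<and> (\<exists>c\<in>C. x = w \<oplus>\<^bsub>M\<^esub> c))" for x
  have p: "p (w \<oplus>\<^bsub>M\<^esub> c) = w" if "w \<in> W" "c \<in> C" for w c
    unfolding p_def using that direct_unique[OF W C WC] by (intro the_equality) blast+
  show thesis
  proof (rule that[of p])
    show "p \<in> mod_hom R M M"
    proof (rule mod_homI)
      fix x y a assume x: "x \<in> carrier M"
      then obtain w c where wc: "w \<in> W" "c \<in> C" "x = w \<oplus>\<^bsub>M\<^esub> c" using car by (blast elim!: set_addD)
      show "p x \<in> carrier M" using p[OF wc(1,2)] wc sub by simp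
      show "p (x \<oplus>\<^bsub>M\<^esub> y) = p x \<oplus>\<^bsub>M\<^esub> p y" if y: "y \<in> carrier M"
      proof -
        obtain w' c' where wc': "w' \<in> W" "c' \<in> C" "y = w' \<oplus>\<^bsub>M\<^esub> c'" using car y by (blast elim!: set_addD)
        have "x \<oplus>\<^bsub>M\<^esub> y = (w \<oplus>\<^bsub>M\<^esub> w') \<oplus>\<^bsub>M\<^esub> (c \<oplus>\<^bsub>M\<^esub> c')" using wc wc' sub by (simp add: M.a_ac)
        then show ?thesis using p wc wc' submoduleD(3)[OF W] submoduleD(3)[OF C] by simp
      qed
      show "p (a \<odot>\<^bsub>M\<^esub> x) = a \<odot>\<^bsub>M\<^esub> p x" if a: "a \<in> carrier R"
        using wc sub p submoduleD(6)[OF W a] submoduleD(6)[OF C a] a by (simp add: smult_r_distr)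
    qed
    show "p x \<in> W" if "x \<in> carrier M" for x
      using that p car by (metis set_addD subsetD)
    show "p x = x" if "x \<in> W" for x
      using p[OF that submoduleD(2)[OF C]] that sub by simp
    show "p x = \<zero>\<^bsub>M\<^esub>" if "x \<in> C" for x
      using p[OF submoduleD(2)[OF W] that] that sub by simp
  qed
qed

lemma fss_retraction:
  assumes "fss R M (carrier M)" "submodule W R M"
  obtains p where "p \<in> mod_hom R M M" "\<And>x. x \<in> carrier M \<Longrightarrow> p x \<in> W" "\<And>x. x \<in> W \<Longrightarrow> p x = x"
  using fss_complement[OF assms] direct_projection[OF assms(2)] by metis

text \<open>Stated as well-foundedness so that it gives both minimal submodules and the induction in
  \<open>dcc_fss\<close>. It will be supplied by finite dimension.\<close>

definition dcc :: bool where
  "dcc \<longleftrightarrow> wf {(H', H). submodule H' R M \<and> submodule H R M \<and> H' \<subset> H}"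

lemma dcc_simple_sub:
  assumes dcc "submodule W R M" "W \<noteq> {\<zero>\<^bsub>M\<^esub>}"
  obtains S where "simple_sub R M S" "S \<subseteq> W"
proof -
  let ?Q = "{H. submodule H R M \<and> H \<noteq> {\<zero>\<^bsub>M\<^esub>} \<and> H \<subseteq> W}"
  have "W \<in> ?Q" using assms by simp
  then obtain S where S: "S \<in> ?Q"
    and min: "\<And>H. (H, S) \<in> {(H', H). submodule H' R M \<and> submodule H R M \<and> H' \<subset> H} \<Longrightarrow> H \<notin> ?Q"
    using wfE_min[OF assms(1)[unfolded dcc_def], of W ?Q] by blast
  have "simple_sub R M S" unfolding simple_sub_def using S min by blast
  then show ?thesis using that S by blast
qed

text \<open>Converse of \<open>fss_retraction\<close>. A retraction \<open>p\<close> of the module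
  onto a simple \<open>S \<subseteq> W\<close> splits \<open>W\<close> into \<open>S\<close> and the
  kernel of \<open>p\<close> in \<open>W\<close>; the second part is strictly smaller, so that
  induction applies.\<close>

lemma dcc_fss:
  assumes "dcc" and retr: "\<And>W. submodule W R M \<Longrightarrow>
      \<exists>p \<in> mod_hom R M M. (\<forall>x\<in>carrier M. p x \<in> W) \<and> (\<forall>x\<in>W. p x = x)"
  shows "fss R M (carrier M)"
proof -
  have "submodule W R M \<longrightarrow> fss R M W" for W
    using assms(1)[unfolded dcc_def]
  proof (induction W rule: wf_induct_rule)
    case (less W)
    show ?case
    proof
      assume W: "submodule W R M"
      show "fss R M W"
      proof (cases "W = {\<zero>\<^bsub>M\<^esub>}")
        case True
        then show ?thesis by (simp add: fss.zero)
      next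
        case False
        obtain S where S: "simple_sub R M S" "S \<subseteq> W" using dcc_simple_sub[OF assms(1) W False] by blast
        have SM: "submodule S R M" using S by (simp add: simple_sub_def)
        obtain p where p: "p \<in> mod_hom R M M" "\<forall>x\<in>carrier M. p x \<in> S" "\<forall>x\<in>S. p x = x"
          using retr[OF SM] by blast
        let ?C = "W \<inter> {x \<in> carrier M. p x \<in> {\<zero>\<^bsub>M\<^esub>}}"
        have C: "submodule ?C R M"
          using submodule_preimage[OF left_module_axioms left_module_axioms p(1) submodule_zero] submodule_Int W by blast
        \<comment> \<open>A nonzero element of \<open>S\<close> is fixed by \<open>p\<close>, so it
          lies outside the kernel; this makes \<open>?C\<close> a proper submodule of
          \<open>W\<close>.\<close>
        obtain s where "s \<in> S" "s \<noteq> \<zero>\<^bsub>M\<^esub>" using S(1) submoduleD(2)[OF SM] unfolding simple_sub_def by blast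
        then have "s \<in> W - ?C" using S(2) p(3) by auto
        then have "?C \<noteq> W" by blast
        then have "fss R M ?C" using less[of ?C] C W by blast
        moreover have "W = ?C <+>\<^bsub>M\<^esub> S"
        proof
          show "?C <+>\<^bsub>M\<^esub> S \<subseteq> W" by (rule set_add_subset[OF W _ S(2)]) blast
          show "W \<subseteq> ?C <+>\<^bsub>M\<^esub> S"
          proof
            fix x assume x: "x \<in> W"
            have car: "x \<in> carrier M" "p x \<in> carrier M" using x submoduleD(1)[OF W] mod_homD(2)[OF p(1)] by auto
            have "p (x \<ominus>\<^bsub>M\<^esub> p x) = \<zero>\<^bsub>M\<^esub>"
              using mod_hom_diff[OF left_module_axioms left_module_axioms p(1) car] p(2,3) car
              by (simp add: M.minus_eq_zero_iff)
            moreover have "x \<ominus>\<^bsub>M\<^esub> p x \<in> W" using submoduleD(5)[OF W x] p(2) car S(2) by blast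
            ultimately have "x \<ominus>\<^bsub>M\<^esub> p x \<in> ?C" using car by simp
            moreover have "x = (x \<ominus>\<^bsub>M\<^esub> p x) \<oplus>\<^bsub>M\<^esub> p x" using car by (simp add: a_minus_def M.a_assoc M.l_neg)
            ultimately show "x \<in> ?C <+>\<^bsub>M\<^esub> S" using set_addI p(2) car by metis
          qed
        qed
        ultimately show ?thesis using fss.add S(1) by metis
      qed
    qed
  qed
  then show ?thesis using submodule_carrier by blast
qed

text \<open>Summands are kept only when they meet the sum of the earlier ones in zero; simplicity
  leaves no case in between. The clause that all sums of admissible families lie in \<open>W\<close>
  serves the induction: it allows the uniqueness of a decomposition along \<open>W\<close> and
  \<open>S\<close> to be applied to an arbitrary family.\<close>

lemma fss_decomposition:
  assumes "fss R M W"
  shows "\<exists>(n::nat) H. (\<forall>i<n. simple_sub R M (H i)) \<and>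
    (\<forall>h \<in> (\<Pi>\<^sub>E i\<in>{..<n}. H i). (\<Oplus>\<^bsub>M\<^esub>i\<in>{..<n}. h i) \<in> W) \<and>
    (\<forall>x\<in>W. \<exists>!h. h \<in> (\<Pi>\<^sub>E i\<in>{..<n}. H i) \<and> x = (\<Oplus>\<^bsub>M\<^esub>i\<in>{..<n}. h i))"
  using assms
proof induction
  case zero
  show ?case by (rule exI[of _ 0]) auto
next
  case (add W S)
  have W: "submodule W R M" and S: "submodule S R M" using add fss_submodule by (auto simp: simple_sub_def)
  note sub = subsetD[OF submoduleD(1)[OF W]] subsetD[OF submoduleD(1)[OF S]]
  from add obtain n :: nat and H where H: "\<forall>i<n. simple_sub R M (H i)"
    and HW: "\<forall>h \<in> (\<Pi>\<^sub>E i\<in>{..<n}. H i). (\<Oplus>\<^bsub>M\<^esub>i\<in>{..<n}. h i) \<in> W"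
    and ex1: "\<forall>x\<in>W. \<exists>!h. h \<in> (\<Pi>\<^sub>E i\<in>{..<n}. H i) \<and> x = (\<Oplus>\<^bsub>M\<^esub>i\<in>{..<n}. h i)" by blast
  have "S \<inter> W = {\<zero>\<^bsub>M\<^esub>} \<or> S \<inter> W = S"
    using add(2) submodule_Int[OF S W] unfolding simple_sub_def by blast
  then show ?case
  proof
    assume "S \<inter> W = S"
    then have "W <+>\<^bsub>M\<^esub> S \<subseteq> W" by (intro set_add_subset[OF W]) auto
    moreover have "W \<subseteq> W <+>\<^bsub>M\<^esub> S"
    proof
      fix x assume "x \<in> W"
      then show "x \<in> W <+>\<^bsub>M\<^esub> S" using set_addI[of x W "\<zero>\<^bsub>M\<^esub>" S M] submoduleD(2)[OF S] sub by simp
    qed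
    ultimately show ?thesis using H HW ex1 by (metis subset_antisym)
  next
    assume WS: "S \<inter> W = {\<zero>\<^bsub>M\<^esub>}"
    \<comment> \<open>The new summand receives the index \<open>n\<close>, so families on
      \<open>{..<Suc n}\<close> split into a family on \<open>{..<n}\<close> and a last entry in
      \<open>S\<close>.\<close>
    define H' where "H' = H(n := S)"
    have carH: "h i \<in> carrier M" if "h \<in> (\<Pi>\<^sub>E i\<in>{..<n}. H i)" "i < n" for h i
    proof -
      have "h i \<in> H i" using that by auto
      moreover have "H i \<subseteq> carrier M" using H that(2) submoduleD(1) by (simp add: simple_sub_def)
      ultimately show ?thesis by blast
    qed
    have PiE_Suc: "restrict h {..<n} \<in> (\<Pi>\<^sub>E i\<in>{..<n}. H i) \<and> h n \<in> S" if "h \<in> (\<Pi>\<^sub>E i\<in>{..<Suc n}. H' i)" for h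
    proof -
      have "h i \<in> H' i" if "i < Suc n" for i using that \<open>h \<in> (\<Pi>\<^sub>E i\<in>{..<Suc n}. H' i)\<close> by auto
      then have "h i \<in> H i" if "i < n" for i using that by (metis H'_def fun_upd_other less_Suc_eq less_irrefl)
      moreover have "h n \<in> S" using \<open>\<And>i. i < Suc n \<Longrightarrow> h i \<in> H' i\<close>[of n] by (simp add: H'_def)
      ultimately show ?thesis by auto
    qed
    have fs: "(\<Oplus>\<^bsub>M\<^esub>i\<in>{..<Suc n}. h i) = (\<Oplus>\<^bsub>M\<^esub>i\<in>{..<n}. restrict h {..<n} i) \<oplus>\<^bsub>M\<^esub> h n"
      if h: "h \<in> (\<Pi>\<^sub>E i\<in>{..<Suc n}. H' i)" for h
    proof -
      have c: "h i \<in> carrier M" if "i < n" for i using carH[OF conjunct1[OF PiE_Suc[OF h]] that] that by simp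
      have "(\<Oplus>\<^bsub>M\<^esub>i\<in>{..<Suc n}. h i) = h n \<oplus>\<^bsub>M\<^esub> (\<Oplus>\<^bsub>M\<^esub>i\<in>{..<n}. h i)"
        unfolding lessThan_Suc using c sub(2)[OF conjunct2[OF PiE_Suc[OF h]]]
        by (subst M.finsum_insert) auto
      moreover have "(\<Oplus>\<^bsub>M\<^esub>i\<in>{..<n}. h i) = (\<Oplus>\<^bsub>M\<^esub>i\<in>{..<n}. restrict h {..<n} i)"
        by (rule M.finsum_cong') (use c in auto)
      ultimately show ?thesis using c sub(2)[OF conjunct2[OF PiE_Suc[OF h]]]
        by (simp add: M.a_comm M.finsum_closed Pi_iff)
    qed
    have ex1': "\<exists>!h. h \<in> (\<Pi>\<^sub>E i\<in>{..<Suc n}. H' i) \<and> x = (\<Oplus>\<^bsub>M\<^esub>i\<in>{..<Suc n}. h i)" if "x \<in> W <+>\<^bsub>M\<^esub> S" for x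
    proof -
      obtain w s where ws: "w \<in> W" "s \<in> S" "x = w \<oplus>\<^bsub>M\<^esub> s" using \<open>x \<in> W <+>\<^bsub>M\<^esub> S\<close> by (elim set_addD)
      obtain h where h: "h \<in> (\<Pi>\<^sub>E i\<in>{..<n}. H i)" "w = (\<Oplus>\<^bsub>M\<^esub>i\<in>{..<n}. h i)" using ex1 ws by blast
      show ?thesis
      proof (rule ex1I[of _ "h(n := s)"])
        have 1: "h(n := s) \<in> (\<Pi>\<^sub>E i\<in>{..<Suc n}. H' i)"
          using h(1) ws(2) by (auto simp: PiE_iff H'_def extensional_def less_Suc_eq)
        have 2: "restrict (h(n := s)) {..<n} = h" using h(1) by (auto simp: fun_eq_iff PiE_iff extensional_def)
        show "h(n := s) \<in> (\<Pi>\<^sub>E i\<in>{..<Suc n}. H' i) \<and> x = (\<Oplus>\<^bsub>M\<^esub>i\<in>{..<Suc n}. (h(n := s)) i)"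
          using 1 fs[OF 1] 2 ws(3) h(2) by simp
      next
        fix h' assume h': "h' \<in> (\<Pi>\<^sub>E i\<in>{..<Suc n}. H' i) \<and> x = (\<Oplus>\<^bsub>M\<^esub>i\<in>{..<Suc n}. h' i)"
        note r = PiE_Suc[OF conjunct1[OF h']]
        have "w \<oplus>\<^bsub>M\<^esub> s = (\<Oplus>\<^bsub>M\<^esub>i\<in>{..<n}. restrict h' {..<n} i) \<oplus>\<^bsub>M\<^esub> h' n"
          using h' fs ws(3) by simp
        then have "w = (\<Oplus>\<^bsub>M\<^esub>i\<in>{..<n}. restrict h' {..<n} i) \<and> s = h' n"
          using direct_unique[OF W S _ ws(1,2)] WS HW r by blast
        then have eq: "restrict h' {..<n} = h" "h' n = s" using ex1 ws(1) h r by blast+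
        show "h' = h(n := s)"
        proof
          fix i
          show "h' i = (h(n := s)) i"
            using eq fun_cong[OF eq(1), of i] h' h(1)
            by (cases "i < n"; cases "i = n") (auto simp: PiE_iff extensional_def)
        qed
      qed
    qed
    have 1: "\<forall>x\<in>W <+>\<^bsub>M\<^esub> S. \<exists>!h. h \<in> (\<Pi>\<^sub>E i\<in>{..<Suc n}. H' i) \<and> x = (\<Oplus>\<^bsub>M\<^esub>i\<in>{..<Suc n}. h i)"
      by (intro ballI ex1')
    have 2: "\<forall>i<Suc n. simple_sub R M (H' i)" using H add(2) by (simp add: H'_def less_Suc_eq)
    have 3: "\<forall>h\<in>(\<Pi>\<^sub>E i\<in>{..<Suc n}. H' i). (\<Oplus>\<^bsub>M\<^esub>i\<in>{..<Suc n}. h i) \<in> W <+>\<^bsub>M\<^esub> S"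
    proof
      fix h assume h: "h \<in> (\<Pi>\<^sub>E i\<in>{..<Suc n}. H' i)"
      show "(\<Oplus>\<^bsub>M\<^esub>i\<in>{..<Suc n}. h i) \<in> W <+>\<^bsub>M\<^esub> S"
        unfolding fs[OF h] using PiE_Suc[OF h] HW by (intro set_addI) blast+
    qed
    show ?thesis by (rule exI, rule exI, rule conjI[OF 2 conjI[OF 3 1]])
  qed
qed

lemma fss_simple_decomposition:
  assumes "fss R M (carrier M)"
  obtains n H where "simple_decomposition R M n H"
  using fss_decomposition[OF assms] simple_sub_iff unfolding simple_decomposition_def by metis

text \<open>These are the coordinates in the unique expansion. Uniqueness gives linearity, since
  sums and multiples of expansions are again expansions.\<close>

lemma simple_decomposition_projections:
  assumes dec: "simple_decomposition R M n H"
  obtains p where "\<And>i. i < n \<Longrightarrow> p i \<in> mod_hom R M (M\<lparr>carrier := H i\<rparr>)"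
    "\<And>x. x \<in> carrier M \<Longrightarrow> x = (\<Oplus>\<^bsub>M\<^esub>i\<in>{..<n}. p i x)"
    "\<And>h i. h \<in> (\<Pi> i\<in>{..<n}. H i) \<Longrightarrow> i < n \<Longrightarrow> p i (\<Oplus>\<^bsub>M\<^esub>i\<in>{..<n}. h i) = h i"
proof -
  have H: "submodule (H i) R M" if "i < n" for i using dec that by (simp add: simple_decomposition_def)
  have carH: "h i \<in> carrier M" if "h \<in> (\<Pi> i\<in>{..<n}. H i)" "i < n" for h i
    using submoduleD(1)[OF H] that by auto
  define d where "d x = (THE h. h \<in> (\<Pi>\<^sub>E i\<in>{..<n}. H i) \<and> x = (\<Oplus>\<^bsub>M\<^esub>i\<in>{..<n}. h i))" for x
  have d: "d x \<in> (\<Pi>\<^sub>E i\<in>{..<n}. H i) \<and> x = (\<Oplus>\<^bsub>M\<^esub>i\<in>{..<n}. d x i)" if "x \<in> carrier M" for x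
  proof -
    have "\<exists>!h. h \<in> (\<Pi>\<^sub>E i\<in>{..<n}. H i) \<and> x = (\<Oplus>\<^bsub>M\<^esub>i\<in>{..<n}. h i)"
      using dec that by (simp add: simple_decomposition_def)
    from theI'[OF this] show ?thesis by (simp add: d_def)
  qed
  have d_eq: "d (\<Oplus>\<^bsub>M\<^esub>i\<in>{..<n}. h i) i = h i" if h: "h \<in> (\<Pi> i\<in>{..<n}. H i)" "i < n" for h i
  proof -
    let ?h = "restrict h {..<n}"
    have c: "(\<Oplus>\<^bsub>M\<^esub>i\<in>{..<n}. h i) \<in> carrier M" using carH[OF h(1)] by (intro M.finsum_closed) auto
    have 1: "?h \<in> (\<Pi>\<^sub>E i\<in>{..<n}. H i)" using h by auto
    have 2: "(\<Oplus>\<^bsub>M\<^esub>i\<in>{..<n}. h i) = (\<Oplus>\<^bsub>M\<^esub>i\<in>{..<n}. ?h i)"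
      using carH[OF h(1)] by (intro M.finsum_cong') auto
    have "\<exists>!h'. h' \<in> (\<Pi>\<^sub>E i\<in>{..<n}. H i) \<and> (\<Oplus>\<^bsub>M\<^esub>i\<in>{..<n}. h i) = (\<Oplus>\<^bsub>M\<^esub>i\<in>{..<n}. h' i)"
      using dec c by (simp add: simple_decomposition_def)
    then have "d (\<Oplus>\<^bsub>M\<^esub>i\<in>{..<n}. h i) = ?h"
      unfolding d_def by (rule the1_equality) (use 1 2 in simp)
    then show ?thesis using h(2) by simp
  qed
  show thesis
  proof (rule that[of "\<lambda>i x. d x i"])
    fix i assume i: "i < n"
    show "(\<lambda>x. d x i) \<in> mod_hom R M (M\<lparr>carrier := H i\<rparr>)"
    proof (rule mod_homI)
      fix x y a assume x: "x \<in> carrier M"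
      have dx: "d x \<in> (\<Pi> i\<in>{..<n}. H i)" using d[OF x] by (auto simp: PiE_iff)
      show "d x i \<in> carrier (M\<lparr>carrier := H i\<rparr>)" using dx i by auto
      show "d (x \<oplus>\<^bsub>M\<^esub> y) i = d x i \<oplus>\<^bsub>M\<lparr>carrier := H i\<rparr>\<^esub> d y i" if y: "y \<in> carrier M"
      proof -
        have dy: "d y \<in> (\<Pi> i\<in>{..<n}. H i)" using d[OF y] by (auto simp: PiE_iff)
        have "x \<oplus>\<^bsub>M\<^esub> y = (\<Oplus>\<^bsub>M\<^esub>i\<in>{..<n}. d x i) \<oplus>\<^bsub>M\<^esub> (\<Oplus>\<^bsub>M\<^esub>i\<in>{..<n}. d y i)"
          using d[OF x] d[OF y] by simp
        also have "\<dots> = (\<Oplus>\<^bsub>M\<^esub>i\<in>{..<n}. d x i \<oplus>\<^bsub>M\<^esub> d y i)"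
          using carH[OF dx] carH[OF dy] by (intro M.finsum_addf[symmetric]) auto
        finally show ?thesis
          using d_eq[of "\<lambda>i. d x i \<oplus>\<^bsub>M\<^esub> d y i" i] dx dy i submoduleD(3)[OF H] by (simp add: Pi_iff)
      qed
      show "d (a \<odot>\<^bsub>M\<^esub> x) i = a \<odot>\<^bsub>M\<lparr>carrier := H i\<rparr>\<^esub> d x i" if a: "a \<in> carrier R"
      proof -
        have "a \<odot>\<^bsub>M\<^esub> x = a \<odot>\<^bsub>M\<^esub> (\<Oplus>\<^bsub>M\<^esub>i\<in>{..<n}. d x i)" using d[OF x] by simp
        also have "\<dots> = (\<Oplus>\<^bsub>M\<^esub>i\<in>{..<n}. a \<odot>\<^bsub>M\<^esub> d x i)"
          using carH[OF dx] a by (intro smult_finsum) auto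
        finally show ?thesis
          using d_eq[of "\<lambda>i. a \<odot>\<^bsub>M\<^esub> d x i" i] dx i a submoduleD(6)[OF H a] by (simp add: Pi_iff)
      qed
    qed
  qed (use d d_eq in auto)
qed

end

section \<open>Isomorphisms, Schur's lemma and multiplicities\<close>

lemma module_isomorphic_iff:
  "module_isomorphic R V W \<longleftrightarrow> left_module R V \<and> left_module R W \<and>
    (\<exists>f\<in>mod_hom R V W. bij_betw f (carrier V) (carrier W))"
  by (auto simp: module_isomorphic_def module_isos_def mod_hom_def iso_def)

lemma mod_hom_inv_into:
  assumes V: "left_module R V" and f: "f \<in> mod_hom R V W" and bij: "bij_betw f (carrier V) (carrier W)"
  shows "inv_into (carrier V) f \<in> mod_hom R W V"
proof -
  interpret V: left_module R V by fact
  let ?g = "inv_into (carrier V) f"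
  have g: "?g x \<in> carrier V" "f (?g x) = x" if "x \<in> carrier W" for x
    using bij that by (auto simp: bij_betw_def intro: inv_into_into f_inv_into_f)
  have gf: "?g (f x) = x" if "x \<in> carrier V" for x
    using bij that by (simp add: bij_betw_inv_into_left)
  show ?thesis
  proof (rule mod_homI)
    show "?g x \<in> carrier V" if "x \<in> carrier W" for x using g that by simp
    show "?g (x \<oplus>\<^bsub>W\<^esub> y) = ?g x \<oplus>\<^bsub>V\<^esub> ?g y" if xy: "x \<in> carrier W" "y \<in> carrier W" for x y
    proof -
      have "f (?g x \<oplus>\<^bsub>V\<^esub> ?g y) = x \<oplus>\<^bsub>W\<^esub> y" using g xy by (simp add: mod_homD(3)[OF f])
      then show ?thesis using gf[of "?g x \<oplus>\<^bsub>V\<^esub> ?g y"] g xy by simp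
    qed
    show "?g (a \<odot>\<^bsub>W\<^esub> x) = a \<odot>\<^bsub>V\<^esub> ?g x" if ax: "a \<in> carrier R" "x \<in> carrier W" for a x
    proof -
      have "f (a \<odot>\<^bsub>V\<^esub> ?g x) = a \<odot>\<^bsub>W\<^esub> x" using g ax by (simp add: mod_homD(4)[OF f])
      then show ?thesis using gf[of "a \<odot>\<^bsub>V\<^esub> ?g x"] g ax by (simp add: V.smult_closed)
    qed
  qed
qed

lemma module_isomorphic_refl: "left_module R V \<Longrightarrow> module_isomorphic R V V"
  unfolding module_isomorphic_iff by (auto intro!: bexI[of _ "\<lambda>x. x"] mod_homI simp: bij_betw_def)

lemma module_isomorphic_sym: "module_isomorphic R V W \<Longrightarrow> module_isomorphic R W V"
  unfolding module_isomorphic_iff using mod_hom_inv_into bij_betw_inv_into by blast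

lemma module_isomorphic_trans:
  assumes "module_isomorphic R U V" "module_isomorphic R V W"
  shows "module_isomorphic R U W"
proof -
  obtain f g where f: "f \<in> mod_hom R U V" "bij_betw f (carrier U) (carrier V)"
    and g: "g \<in> mod_hom R V W" "bij_betw g (carrier V) (carrier W)"
    using assms unfolding module_isomorphic_iff by blast
  have "bij_betw (\<lambda>x. g (f x)) (carrier U) (carrier W)"
    using bij_betw_trans[OF f(2) g(2)] by (simp add: comp_def)
  then show ?thesis using assms mod_hom_comp[OF f(1) g(1)] unfolding module_isomorphic_iff by blast
qed

lemma simple_left_moduleD: "simple_left_module R V \<Longrightarrow> left_module R V"
  by (simp add: simple_left_module_def)

lemma simple_module_nonzero:
  assumes "simple_left_module R V" obtains x where "x \<in> carrier V" "x \<noteq> \<zero>\<^bsub>V\<^esub>"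
proof -
  interpret V: left_module R V using assms by (rule simple_left_moduleD)
  show thesis using assms that V.M.zero_closed unfolding simple_left_module_def by blast
qed

lemma inj_on_simple:
  assumes V: "simple_left_module R V" and W: "left_module R W" and f: "f \<in> mod_hom R V W"
    and x: "x \<in> carrier V" "f x \<noteq> \<zero>\<^bsub>W\<^esub>"
  shows "inj_on f (carrier V)"
proof -
  interpret V: left_module R V using V by (rule simple_left_moduleD)
  have "f ` carrier V \<noteq> {\<zero>\<^bsub>W\<^esub>}" using x by blast
  then show ?thesis
    using simple_sub_mod_hom[OF V.left_module_axioms W f] V V.simple_sub_carrier by blast
qed

text \<open>The map is restricted to a submodule \<open>H\<close> because the elimination argument
  for multiplicities looks at a single simple summand.\<close>

lemma surj_simple:
  assumes V: "left_module R V" and W: "simple_left_module R W" and f: "f \<in> mod_hom R V W"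
    and H: "submodule H R V" and x: "x \<in> H" "f x \<noteq> \<zero>\<^bsub>W\<^esub>"
  shows "f ` H = carrier W"
proof -
  have "submodule (f ` H) R W" using submodule_image[OF V simple_left_moduleD[OF W] f H] .
  moreover have "f ` H \<noteq> {\<zero>\<^bsub>W\<^esub>}" using x by blast
  ultimately show ?thesis using W unfolding simple_left_module_def by blast
qed

lemma simple_hom_iso:
  assumes V: "simple_left_module R V" and W: "simple_left_module R W" and f: "f \<in> mod_hom R V W"
    and x: "x \<in> carrier V" "f x \<noteq> \<zero>\<^bsub>W\<^esub>"
  shows "module_isomorphic R V W"
proof -
  interpret V: left_module R V using V by (rule simple_left_moduleD)
  show ?thesis unfolding module_isomorphic_iff bij_betw_def
    using inj_on_simple[OF V simple_left_moduleD[OF W] f x] f simple_left_moduleD[OF W]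
      surj_simple[OF V.left_module_axioms W f V.submodule_carrier x] V.left_module_axioms by blast
qed

lemma simple_left_module_iso:
  assumes "module_isomorphic R V W" "simple_left_module R V"
  shows "simple_left_module R W"
proof -
  obtain f where f: "f \<in> mod_hom R V W" "bij_betw f (carrier V) (carrier W)"
    and V: "left_module R V" and W: "left_module R W" using assms(1) unfolding module_isomorphic_iff by blast
  interpret V: left_module R V by fact
  interpret W: left_module R W by fact
  obtain x where x: "x \<in> carrier V" "x \<noteq> \<zero>\<^bsub>V\<^esub>" using simple_module_nonzero[OF assms(2)] .
  then have "f x \<noteq> \<zero>\<^bsub>W\<^esub>"
    using mod_hom_zero[OF V W f(1)] f(2) V.M.zero_closed unfolding bij_betw_def inj_on_def by metis
  then have "f ` carrier V \<noteq> {\<zero>\<^bsub>W\<^esub>}" using x(1) by blast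
  then have "simple_sub R W (f ` carrier V)"
    using simple_sub_mod_hom[OF V W f(1)] assms(2) V.simple_sub_carrier by blast
  then show ?thesis using f(2) W.simple_sub_carrier by (simp add: bij_betw_def)
qed

lemma mod_hom_sub:
  assumes V: "left_module R V" and W: "left_module R W" and f: "f \<in> mod_hom R V W" and g: "g \<in> mod_hom R V W"
  shows "(\<lambda>x. f x \<ominus>\<^bsub>W\<^esub> g x) \<in> mod_hom R V W"
proof -
  interpret W: left_module R W by fact
  have "(\<lambda>x. f x \<ominus>\<^bsub>W\<^esub> g x) \<in> add_hom V W"
    using add_hom_uminus[OF left_module_abelian_group[OF V] left_module_abelian_group[OF W]] f g by (simp add: mod_homD)
  moreover have "f (a \<odot>\<^bsub>V\<^esub> x) \<ominus>\<^bsub>W\<^esub> g (a \<odot>\<^bsub>V\<^esub> x) = a \<odot>\<^bsub>W\<^esub> (f x \<ominus>\<^bsub>W\<^esub> g x)"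
    if "a \<in> carrier R" "x \<in> carrier V" for a x
    using that mod_homD(2,4)[OF f] mod_homD(2,4)[OF g] W.smult_diff by simp
  ultimately show ?thesis by (simp add: mod_hom_def)
qed

text \<open>Gaussian elimination: a summand on which some \<open>f j\<close> is bijective is used to eliminate \<open>f j\<close>.\<close>

lemma joint_surj_card_le:
  fixes n :: nat
  assumes V: "left_module R V" and S1: "simple_left_module R S1"
    and H: "\<And>i. i < n \<Longrightarrow> simple_sub R V (H i)"
    and J: "finite J" "\<And>j. j \<in> J \<Longrightarrow> f j \<in> mod_hom R V S1"
    and surj: "\<And>s. (\<And>j. j \<in> J \<Longrightarrow> s j \<in> carrier S1) \<Longrightarrow>
        \<exists>h. (\<forall>i<n. h i \<in> H i) \<and> (\<forall>j\<in>J. f j (\<Oplus>\<^bsub>V\<^esub>i\<in>{..<n}. h i) = s j)"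
  shows "card J \<le> card {i. i < n \<and> module_isomorphic R (V\<lparr>carrier := H i\<rparr>) S1}"
  using H J surj
proof (induction n arbitrary: J f)
  interpret V: left_module R V by fact
  interpret S1: left_module R S1 using S1 by (rule simple_left_moduleD)
  note S1m = S1.left_module_axioms
  {
    case 0
    have "J = {}"
    proof (rule ccontr)
      assume "J \<noteq> {}"
      then obtain j where j: "j \<in> J" by blast
      obtain s where s: "s \<in> carrier S1" "s \<noteq> \<zero>\<^bsub>S1\<^esub>" using simple_module_nonzero[OF S1] .
      have "f j \<zero>\<^bsub>V\<^esub> = s" using "0.prems"(4)[of "\<lambda>_. s"] s(1) j by simp
      then show False using s(2) mod_hom_zero[OF V S1m "0.prems"(3)[OF j]] by simp
    qed
    then show ?case by simp
  next
    case (Suc n)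
    let ?T = "H n"
    have T: "simple_sub R V ?T" using Suc.prems(1) by simp
    then have TV: "submodule ?T R V" by (simp add: simple_sub_def)
    have Hsub: "h i \<in> carrier V" if "\<forall>i<Suc n. h i \<in> H i" "i < Suc n" for h i
      using that Suc.prems(1) V.submoduleD(1)[of "H i"] unfolding simple_sub_def by blast
    have split: "(\<Oplus>\<^bsub>V\<^esub>i\<in>{..<Suc n}. h i) = h n \<oplus>\<^bsub>V\<^esub> (\<Oplus>\<^bsub>V\<^esub>i\<in>{..<n}. h i)"
      "h n \<in> carrier V" "(\<Oplus>\<^bsub>V\<^esub>i\<in>{..<n}. h i) \<in> carrier V"
      if h: "\<forall>i<Suc n. h i \<in> H i" for h
    proof -
      show 1: "h n \<in> carrier V" using Hsub[OF h] by simp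
      have 2: "h \<in> {..<n} \<rightarrow> carrier V" using Hsub[OF h] by simp
      then show "(\<Oplus>\<^bsub>V\<^esub>i\<in>{..<n}. h i) \<in> carrier V" by (rule V.M.finsum_closed)
      show "(\<Oplus>\<^bsub>V\<^esub>i\<in>{..<Suc n}. h i) = h n \<oplus>\<^bsub>V\<^esub> (\<Oplus>\<^bsub>V\<^esub>i\<in>{..<n}. h i)"
        unfolding lessThan_Suc using 1 2 by (subst V.M.finsum_insert) auto
    qed
    let ?I = "\<lambda>n. {i. i < n \<and> module_isomorphic R (V\<lparr>carrier := H i\<rparr>) S1}"
    have mono: "card (?I n) \<le> card (?I (Suc n))" by (intro card_mono) auto
    show ?case
    \<comment> \<open>Either every map kills the last summand, which can then be dropped, or some
      \<open>f j0\<close> is bijective on it and serves as a pivot.\<close>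
    proof (cases "\<forall>j\<in>J. \<forall>x\<in>?T. f j x = \<zero>\<^bsub>S1\<^esub>")
      case True
      have "card J \<le> card (?I n)"
      proof (rule Suc.IH)
        fix s assume "\<And>j. j \<in> J \<Longrightarrow> s j \<in> carrier S1"
        then obtain h where h: "\<forall>i<Suc n. h i \<in> H i" "\<forall>j\<in>J. f j (\<Oplus>\<^bsub>V\<^esub>i\<in>{..<Suc n}. h i) = s j"
          using Suc.prems(4)[of s] by blast
        have "f j (\<Oplus>\<^bsub>V\<^esub>i\<in>{..<n}. h i) = s j" if j: "j \<in> J" for j
        proof -
          have "s j = f j (h n) \<oplus>\<^bsub>S1\<^esub> f j (\<Oplus>\<^bsub>V\<^esub>i\<in>{..<n}. h i)"
            using mod_homD(3)[OF Suc.prems(3)[OF j] split(2,3)[OF h(1)]] h(2) j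
            by (simp flip: split(1)[OF h(1)])
          then show ?thesis
            using True j h(1) mod_homD(2)[OF Suc.prems(3)[OF j] split(3)[OF h(1)]] by simp
        qed
        then show "\<exists>h. (\<forall>i<n. h i \<in> H i) \<and> (\<forall>j\<in>J. f j (\<Oplus>\<^bsub>V\<^esub>i\<in>{..<n}. h i) = s j)"
          using h(1) by (intro exI[of _ h]) simp
      qed (use Suc.prems in auto)
      then show ?thesis using mono by simp
    next
      case False
      then obtain j0 x0 where j0: "j0 \<in> J" and x0: "x0 \<in> ?T" "f j0 x0 \<noteq> \<zero>\<^bsub>S1\<^esub>" by blast
      note f0 = Suc.prems(3)[OF j0]
      have "f j0 ` ?T \<noteq> {\<zero>\<^bsub>S1\<^esub>}" using x0 by blast
      then have inj: "inj_on (f j0) ?T" using simple_sub_mod_hom[OF V S1m f0 T] by blast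
      have im: "f j0 ` ?T = carrier S1" by (rule surj_simple[OF V S1 f0 TV x0])
      have f0T: "f j0 \<in> mod_hom R (V\<lparr>carrier := ?T\<rparr>) S1"
        using f0 V.submoduleD(1)[OF TV] by (intro mod_homI) (auto simp: mod_homD subset_iff)
      have bij: "bij_betw (f j0) (carrier (V\<lparr>carrier := ?T\<rparr>)) (carrier S1)"
        using inj im by (simp add: bij_betw_def)
      note VT = V.submodule_left_module[OF TV]
      have iso: "module_isomorphic R (V\<lparr>carrier := ?T\<rparr>) S1"
        unfolding module_isomorphic_iff using VT S1m f0T bij by blast
      define q where "q = inv_into ?T (f j0)"
      have "q \<in> mod_hom R S1 (V\<lparr>carrier := ?T\<rparr>)"
        using mod_hom_inv_into[OF VT f0T bij] by (simp add: q_def)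
      then have q: "q \<in> mod_hom R S1 V"
        using V.submoduleD(1)[OF TV] by (auto simp: mod_hom_def hom_def)
      have qf: "q (f j0 x) = x" if "x \<in> ?T" for x using inj that by (simp add: q_def)
      \<comment> \<open>Subtracting the composite of \<open>f j0\<close>, \<open>q\<close> and
        \<open>f j\<close>, where \<open>q\<close> inverts \<open>f j0\<close> on the last summand,
        makes every \<open>f' j\<close> vanish on that summand.\<close>
      define f' where "f' j x = f j x \<ominus>\<^bsub>S1\<^esub> f j (q (f j0 x))" for j x
      have f': "f' j \<in> mod_hom R V S1" if "j \<in> J" for j
        unfolding f'_def using mod_hom_comp[OF mod_hom_comp[OF f0 q]] Suc.prems(3)[OF that]
        by (intro mod_hom_sub[OF V S1m]) auto
      have "card (J - {j0}) \<le> card (?I n)"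
      proof (rule Suc.IH)
        fix s assume s: "\<And>j. j \<in> J - {j0} \<Longrightarrow> s j \<in> carrier S1"
        \<comment> \<open>Prescribing the value zero at \<open>j0\<close> makes the correction term
          vanish at the chosen vector, so that \<open>f' j\<close> and \<open>f j\<close> have the
          same value there.\<close>
        have "(s(j0 := \<zero>\<^bsub>S1\<^esub>)) j \<in> carrier S1" if "j \<in> J" for j using s that by auto
        then obtain h where h: "\<forall>i<Suc n. h i \<in> H i"
          "\<forall>j\<in>J. f j (\<Oplus>\<^bsub>V\<^esub>i\<in>{..<Suc n}. h i) = (s(j0 := \<zero>\<^bsub>S1\<^esub>)) j"
          using Suc.prems(4)[of "s(j0 := \<zero>\<^bsub>S1\<^esub>)"] by blast
        have "f' j (\<Oplus>\<^bsub>V\<^esub>i\<in>{..<n}. h i) = s j" if j: "j \<in> J - {j0}" for j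
        proof -
          let ?v = "\<Oplus>\<^bsub>V\<^esub>i\<in>{..<Suc n}. h i"
          have jJ: "j \<in> J" "j \<noteq> j0" using j by auto
          have fc: "f j \<zero>\<^bsub>V\<^esub> = \<zero>\<^bsub>S1\<^esub>" "q \<zero>\<^bsub>S1\<^esub> = \<zero>\<^bsub>V\<^esub>"
            using mod_hom_zero[OF V S1m] mod_hom_zero[OF S1m V q] Suc.prems(3) jJ by auto
          have "f' j ?v = s j"
            unfolding f'_def using h(2) j0 jJ fc s[OF j] by (simp add: a_minus_def)
          moreover have "f' j (h n) = \<zero>\<^bsub>S1\<^esub>"
            using qf[of "h n"] h(1) split(2)[OF h(1)] mod_homD(2)[OF Suc.prems(3)[OF jJ(1)]]
            by (simp add: f'_def S1.M.minus_eq_zero_iff)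
          moreover have "f' j ?v = f' j (h n) \<oplus>\<^bsub>S1\<^esub> f' j (\<Oplus>\<^bsub>V\<^esub>i\<in>{..<n}. h i)"
            using split[OF h(1)] mod_homD(3)[OF f'[OF jJ(1)]] by simp
          ultimately show ?thesis using mod_homD(2)[OF f'[OF jJ(1)] split(3)[OF h(1)]] by simp
        qed
        then show "\<exists>h. (\<forall>i<n. h i \<in> H i) \<and> (\<forall>j\<in>J - {j0}. f' j (\<Oplus>\<^bsub>V\<^esub>i\<in>{..<n}. h i) = s j)"
          using h(1) by (intro exI[of _ h]) simp
      qed (use Suc.prems f' in auto)
      moreover have "?I (Suc n) = insert n (?I n)" using iso by (auto simp: less_Suc_eq)
      ultimately show ?thesis using Suc.prems(2) j0 by (simp add: card_Diff_singleton)
    qed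
  }
qed

text \<open>A homomorphism onto the \<open>r\<close>-th power of \<open>S\<close>, without forming
  the power. The largest such \<open>r\<close> is the multiplicity of \<open>S\<close>, a
  description that mentions no decomposition.\<close>

definition joint_surj ::
    "('r, 'x) ring_scheme \<Rightarrow> ('r, 'm, 'y) module_scheme \<Rightarrow> ('r, 'n, 'z) module_scheme \<Rightarrow> nat \<Rightarrow> (nat \<Rightarrow> 'm \<Rightarrow> 'n) \<Rightarrow> bool"
  where "joint_surj R V S r f \<longleftrightarrow> (\<forall>j<r. f j \<in> mod_hom R V S) \<and>
    (\<forall>s. (\<forall>j<r. s j \<in> carrier S) \<longrightarrow> (\<exists>v\<in>carrier V. \<forall>j<r. f j v = s j))"

text \<open>The upper bound is the elimination above. For the lower bound, the projections to the
  summands isomorphic to \<open>S1\<close>, followed by isomorphisms, are jointly onto.\<close>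

lemma joint_surj_decomposition:
  assumes V: "left_module R V" and S1: "simple_left_module R S1" and dec: "simple_decomposition R V n H"
  shows "(\<exists>f. joint_surj R V S1 r f) \<longleftrightarrow> r \<le> card {i. i < n \<and> module_isomorphic R (V\<lparr>carrier := H i\<rparr>) S1}"
    (is "_ \<longleftrightarrow> r \<le> card ?I")
proof -
  interpret V: left_module R V by fact
  interpret S1: left_module R S1 using S1 by (rule simple_left_moduleD)
  note S1m = S1.left_module_axioms
  obtain p where p: "\<And>i. i < n \<Longrightarrow> p i \<in> mod_hom R V (V\<lparr>carrier := H i\<rparr>)"
    and psum: "\<And>x. x \<in> carrier V \<Longrightarrow> x = (\<Oplus>\<^bsub>V\<^esub>i\<in>{..<n}. p i x)"
    and ph: "\<And>h i. h \<in> (\<Pi> i\<in>{..<n}. H i) \<Longrightarrow> i < n \<Longrightarrow> p i (\<Oplus>\<^bsub>V\<^esub>i\<in>{..<n}. h i) = h i"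
    using V.simple_decomposition_projections[OF dec] by metis
  have H: "submodule (H i) R V" "simple_sub R V (H i)" if "i < n" for i
    using dec that V.simple_sub_iff by (auto simp: simple_decomposition_def)
  show ?thesis
  proof
    assume "\<exists>f. joint_surj R V S1 r f"
    then obtain f where f: "joint_surj R V S1 r f" by blast
    have "card {..<r} \<le> card ?I"
    proof (rule joint_surj_card_le[OF V S1])
      fix s assume "\<And>j. j \<in> {..<r} \<Longrightarrow> s j \<in> carrier S1"
      then have "\<forall>j<r. s j \<in> carrier S1" by simp
      then obtain v where v: "v \<in> carrier V" "\<forall>j<r. f j v = s j" using f unfolding joint_surj_def by blast
      have "\<forall>i<n. p i v \<in> H i" using mod_homD(2)[OF p v(1)] by auto
      then show "\<exists>h. (\<forall>i<n. h i \<in> H i) \<and> (\<forall>j\<in>{..<r}. f j (\<Oplus>\<^bsub>V\<^esub>i\<in>{..<n}. h i) = s j)"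
        using v psum[OF v(1)] by (intro exI[of _ "\<lambda>i. p i v"]) simp
    qed (use H f in \<open>auto simp: joint_surj_def\<close>)
    then show "r \<le> card ?I" by simp
  next
    assume r: "r \<le> card ?I"
    have "finite ?I" by simp
    from ex_bij_betw_nat_finite[OF this] obtain b where b: "bij_betw b {..<card ?I} ?I"
      unfolding atLeast0LessThan by blast
    have bI: "b j < n" "module_isomorphic R (V\<lparr>carrier := H (b j)\<rparr>) S1" if "j < r" for j
      using b r that by (auto simp: bij_betw_def)
    have binj: "j = j'" if "b j = b j'" "j < r" "j' < r" for j j'
      using b r that unfolding bij_betw_def inj_on_def by simp
    have "\<forall>j. \<exists>g. j < r \<longrightarrow> g \<in> mod_hom R (V\<lparr>carrier := H (b j)\<rparr>) S1 \<and> bij_betw g (H (b j)) (carrier S1)"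
      using bI(2) unfolding module_isomorphic_iff by auto
    then obtain g where g: "\<And>j. j < r \<Longrightarrow> g j \<in> mod_hom R (V\<lparr>carrier := H (b j)\<rparr>) S1"
      "\<And>j. j < r \<Longrightarrow> bij_betw (g j) (H (b j)) (carrier S1)" by metis
    have "joint_surj R V S1 r (\<lambda>j x. g j (p (b j) x))"
      unfolding joint_surj_def
    proof safe
      show "(\<lambda>x. g j (p (b j) x)) \<in> mod_hom R V S1" if "j < r" for j
        using mod_hom_comp[OF p[OF bI(1)[OF that]] g(1)[OF that]] .
    next
      fix s assume s: "\<forall>j<r. s j \<in> carrier S1"
      \<comment> \<open>A preimage of \<open>s\<close>: the summand numbered \<open>b j\<close>
        carries the element that \<open>g j\<close> sends to \<open>s j\<close>, all other summands
        carry zero. The description recovers \<open>j\<close> from \<open>b j\<close>, which is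
        possible as \<open>b\<close> is injective below \<open>r\<close>.\<close>
      define h where "h i = (if \<exists>j<r. b j = i then
          (let j = (THE j. j < r \<and> b j = i) in inv_into (H i) (g j) (s j)) else \<zero>\<^bsub>V\<^esub>)" for i
      have hb: "h (b j) = inv_into (H (b j)) (g j) (s j)" if "j < r" for j
      proof -
        have "(THE j'. j' < r \<and> b j' = b j) = j" using that binj by blast
        then show ?thesis using that by (auto simp: h_def Let_def)
      qed
      have gh: "h (b j) \<in> H (b j)" "g j (h (b j)) = s j" if "j < r" for j
        using g(2)[OF that] s that unfolding hb[OF that] bij_betw_def
        by (auto intro: inv_into_into f_inv_into_f)
      have hH: "h i \<in> H i" if "i < n" for i
      proof (cases "\<exists>j<r. b j = i")
        case True
        then show ?thesis using gh(1) by blast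
      next
        case False
        then show ?thesis using V.submoduleD(2)[OF H(1)[OF that]] unfolding h_def if_not_P[OF False] by simp
      qed
      then have hPi: "h \<in> (\<Pi> i\<in>{..<n}. H i)" by auto
      show "\<exists>v\<in>carrier V. \<forall>j<r. g j (p (b j) v) = s j"
      proof (intro bexI allI impI)
        show "(\<Oplus>\<^bsub>V\<^esub>i\<in>{..<n}. h i) \<in> carrier V"
          using hH V.submoduleD(1)[OF H(1)] by (intro V.M.finsum_closed) blast
        show "g j (p (b j) (\<Oplus>\<^bsub>V\<^esub>i\<in>{..<n}. h i)) = s j" if "j < r" for j
          using ph[OF hPi bI(1)[OF that]] gh(2)[OF that] by simp
      qed
    qed
    then show "\<exists>f. joint_surj R V S1 r f" by blast
  qed
qed

text \<open>\<open>multiplicity_in\<close> is a definite description, so independence of the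
  decomposition has to be shown. The existence of a jointly surjective family does not refer to a
  decomposition, and a natural number is determined by its lower bounds.\<close>

lemma le_multiplicity_in_iff:
  assumes V: "left_module R V" and S1: "simple_left_module R S1" and fss: "fss R V (carrier V)"
  shows "r \<le> multiplicity_in R V S1 \<longleftrightarrow> (\<exists>f. joint_surj R V S1 r f)"
proof -
  interpret V: left_module R V by fact
  obtain n H where dec: "simple_decomposition R V n H" using V.fss_simple_decomposition[OF fss] .
  let ?c = "\<lambda>n H. card {i. i < n \<and> module_isomorphic R (V\<lparr>carrier := H i\<rparr>) S1}"
  have "multiplicity_in R V S1 = ?c n H"
    unfolding multiplicity_in_def
  proof (rule the_equality)
    show "\<exists>n' H'. simple_decomposition R V n' H' \<and> ?c n H = ?c n' H'" using dec by blast
  next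
    fix c assume "\<exists>n' H'. simple_decomposition R V n' H' \<and> c = ?c n' H'"
    then obtain n' H' where dec': "simple_decomposition R V n' H'" and c: "c = ?c n' H'" by blast
    have "r \<le> c \<longleftrightarrow> r \<le> ?c n H" for r
      unfolding c joint_surj_decomposition[OF V S1 dec, symmetric]
        joint_surj_decomposition[OF V S1 dec', symmetric] ..
    then show "c = ?c n H" by (meson order_antisym order_refl)
  qed
  then show ?thesis using joint_surj_decomposition[OF V S1 dec] by simp
qed

text \<open>The case \<open>r = 1\<close>, where joint surjectivity is surjectivity: a nonzero map
  to a simple module is onto.\<close>

lemma multiplicity_nonzero_iff:
  assumes V: "left_module R V" and S1: "simple_left_module R S1" and fss: "fss R V (carrier V)"
  shows "multiplicity_in R V S1 \<noteq> 0 \<longleftrightarrow> (\<exists>f\<in>mod_hom R V S1. \<exists>x\<in>carrier V. f x \<noteq> \<zero>\<^bsub>S1\<^esub>)"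
proof -
  interpret V: left_module R V by fact
  have "multiplicity_in R V S1 \<noteq> 0 \<longleftrightarrow> (\<exists>f. joint_surj R V S1 1 f)"
    using le_multiplicity_in_iff[OF assms, of 1] by (simp add: Suc_le_eq)
  also have "\<dots> \<longleftrightarrow> (\<exists>f\<in>mod_hom R V S1. \<exists>x\<in>carrier V. f x \<noteq> \<zero>\<^bsub>S1\<^esub>)"
  proof safe
    fix f assume f: "joint_surj R V S1 1 f"
    obtain s where s: "s \<in> carrier S1" "s \<noteq> \<zero>\<^bsub>S1\<^esub>" using simple_module_nonzero[OF S1] .
    have f0: "f 0 \<in> mod_hom R V S1" using f by (simp add: joint_surj_def)
    have "\<exists>v\<in>carrier V. \<forall>j<1. f j v = s"
      using f s(1) unfolding joint_surj_def by (elim conjE allE[of _ "\<lambda>_. s"]) simp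
    then obtain v where "v \<in> carrier V" "f 0 v = s" by auto
    then show "\<exists>f\<in>mod_hom R V S1. \<exists>x\<in>carrier V. f x \<noteq> \<zero>\<^bsub>S1\<^esub>"
      using f0 s(2) by blast
  next
    fix f x assume f: "f \<in> mod_hom R V S1" "x \<in> carrier V" "f x \<noteq> \<zero>\<^bsub>S1\<^esub>"
    have im: "f ` carrier V = carrier S1" by (rule surj_simple[OF V S1 f(1) V.submodule_carrier f(2,3)])
    have "joint_surj R V S1 1 (\<lambda>_. f)"
      unfolding joint_surj_def
    proof safe
      fix s :: "nat \<Rightarrow> _" assume "\<forall>j<1. s j \<in> carrier S1"
      then have "s 0 \<in> f ` carrier V" using im by simp
      then show "\<exists>v\<in>carrier V. \<forall>j<1. f v = s j" by auto
    qed (use f in auto)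
    then show "\<exists>f. joint_surj R V S1 1 f" by blast
  qed
  finally show ?thesis .
qed

text \<open>Composition with the surjection \<open>t\<close> turns jointly surjective families on
  \<open>W\<close> into such families on \<open>V\<close>, and by the factorization every family on
  \<open>V\<close> arises in this way.\<close>

lemma multiplicity_eqI:
  assumes V: "left_module R V" "fss R V (carrier V)" and W: "left_module R W" "fss R W (carrier W)"
    and S1: "simple_left_module R S1"
    and t: "t \<in> mod_hom R V W" "t ` carrier V = carrier W"
    and factor: "\<And>f. f \<in> mod_hom R V S1 \<Longrightarrow> \<exists>g\<in>mod_hom R W S1. \<forall>x\<in>carrier V. f x = g (t x)"
  shows "multiplicity_in R V S1 = multiplicity_in R W S1"
proof -
  have "(\<exists>f. joint_surj R V S1 r f) \<longleftrightarrow> (\<exists>g. joint_surj R W S1 r g)" for r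
  proof
    assume "\<exists>f. joint_surj R V S1 r f"
    then obtain f where f: "joint_surj R V S1 r f" by blast
    then have "\<forall>j. \<exists>g. j < r \<longrightarrow> g \<in> mod_hom R W S1 \<and> (\<forall>x\<in>carrier V. f j x = g (t x))"
      using factor unfolding joint_surj_def by blast
    then obtain g where g: "\<And>j. j < r \<Longrightarrow> g j \<in> mod_hom R W S1"
      "\<And>j x. j < r \<Longrightarrow> x \<in> carrier V \<Longrightarrow> f j x = g j (t x)" by metis
    have "joint_surj R W S1 r g" unfolding joint_surj_def
    proof safe
      fix s assume "\<forall>j<r. s j \<in> carrier S1"
      then obtain v where "v \<in> carrier V" "\<forall>j<r. f j v = s j" using f unfolding joint_surj_def by blast
      then show "\<exists>v\<in>carrier W. \<forall>j<r. g j v = s j"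
        using g(2) mod_homD(2)[OF t(1)] by (intro bexI[of _ "t v"]) auto
    qed (use g in auto)
    then show "\<exists>g. joint_surj R W S1 r g" by blast
  next
    assume "\<exists>g. joint_surj R W S1 r g"
    then obtain g where g: "joint_surj R W S1 r g" by blast
    have "joint_surj R V S1 r (\<lambda>j x. g j (t x))" unfolding joint_surj_def
    proof safe
      fix s assume "\<forall>j<r. s j \<in> carrier S1"
      then obtain w where w: "w \<in> carrier W" "\<forall>j<r. g j w = s j" using g unfolding joint_surj_def by blast
      then obtain v where "v \<in> carrier V" "w = t v" using t(2) by blast
      then show "\<exists>v\<in>carrier V. \<forall>j<r. g j (t v) = s j" using w(2) by blast
    qed (use g mod_hom_comp[OF t(1)] in \<open>auto simp: joint_surj_def\<close>)
    then show "\<exists>f. joint_surj R V S1 r f" by blast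
  qed
  then have "r \<le> multiplicity_in R V S1 \<longleftrightarrow> r \<le> multiplicity_in R W S1" for r
    using le_multiplicity_in_iff[OF V(1) S1 V(2)] le_multiplicity_in_iff[OF W(1) S1 W(2)] by simp
  then show ?thesis by (meson order_antisym order_refl)
qed

section \<open>Iterated commutators\<close>

text \<open>The operators need not be extensional, the commutators are only taken with the scalars in
  \<open>C\<close>, and the values may lie in a larger ring than the arguments in \<open>S\<close>.\<close>

primrec ord_less :: "('l, 'b) ring_scheme \<Rightarrow> 'l set \<Rightarrow> 'l set \<Rightarrow> nat \<Rightarrow> ('l \<Rightarrow> 'l) \<Rightarrow> bool" where
  "ord_less L C S 0 P \<longleftrightarrow> (\<forall>x\<in>S. P x = \<zero>\<^bsub>L\<^esub>)"
| "ord_less L C S (Suc n) P \<longleftrightarrow> (\<forall>a\<in>C. ord_less L C S n (\<lambda>x. P (a \<otimes>\<^bsub>L\<^esub> x) \<ominus>\<^bsub>L\<^esub> a \<otimes>\<^bsub>L\<^esub> P x))"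

lemma (in abelian_monoid) finsum_swap:
  assumes "finite A" "finite B" "\<And>a b. a \<in> A \<Longrightarrow> b \<in> B \<Longrightarrow> f a b \<in> carrier G"
  shows "(\<Oplus>a\<in>A. \<Oplus>b\<in>B. f a b) = (\<Oplus>b\<in>B. \<Oplus>a\<in>A. f a b)"
  using assms(1,3)
proof (induction A rule: finite_induct)
  case empty
  then show ?case by simp
next
  case (insert a A)
  have c: "f a \<in> B \<rightarrow> carrier G" "(\<lambda>b. \<Oplus>a\<in>A. f a b) \<in> B \<rightarrow> carrier G"
    using insert.prems by (auto intro!: finsum_closed)
  have "(\<Oplus>a\<in>insert a A. \<Oplus>b\<in>B. f a b) = (\<Oplus>b\<in>B. f a b) \<oplus> (\<Oplus>a\<in>A. \<Oplus>b\<in>B. f a b)"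
    using insert.hyps insert.prems by (intro finsum_insert) (auto intro!: finsum_closed)
  also have "(\<Oplus>a\<in>A. \<Oplus>b\<in>B. f a b) = (\<Oplus>b\<in>B. \<Oplus>a\<in>A. f a b)"
    using insert by auto
  also have "(\<Oplus>b\<in>B. f a b) \<oplus> (\<Oplus>b\<in>B. \<Oplus>a\<in>A. f a b) = (\<Oplus>b\<in>B. f a b \<oplus> (\<Oplus>a\<in>A. f a b))"
    using c by (rule finsum_addf[symmetric])
  also have "\<dots> = (\<Oplus>b\<in>B. \<Oplus>a\<in>insert a A. f a b)"
    using insert.hyps insert.prems c by (intro finsum_cong' refl) (auto intro!: finsum_closed simp: finsum_insert Pi_iff)
  finally show ?case .
qed

context cring
begin

text \<open>For an extension L/E the instances that occur are \<open>C = S = L\<close>,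
  \<open>C = E\<close> with \<open>S = L\<close>, and \<open>C = S = E\<close>.\<close>

definition scalars :: "'a set \<Rightarrow> 'a set \<Rightarrow> bool" where
  "scalars C S \<longleftrightarrow> C \<subseteq> carrier R \<and> S \<subseteq> carrier R \<and> (\<forall>c\<in>C. \<forall>x\<in>S. c \<otimes> x \<in> S)"

lemma scalarsD: "scalars C S \<Longrightarrow> c \<in> C \<Longrightarrow> x \<in> S \<Longrightarrow> c \<otimes> x \<in> S"
  "scalars C S \<Longrightarrow> c \<in> C \<Longrightarrow> c \<in> carrier R" "scalars C S \<Longrightarrow> x \<in> S \<Longrightarrow> x \<in> carrier R"
  by (auto simp: scalars_def)

text \<open>Operators are plain functions, so equality is only available on \<open>S\<close>;
  multiplication by \<open>C\<close> keeps the arguments in the commutators inside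
  \<open>S\<close>.\<close>

lemma ord_less_cong:
  assumes "scalars C S" "\<And>x. x \<in> S \<Longrightarrow> P x = Q x"
  shows "ord_less R C S n P \<longleftrightarrow> ord_less R C S n Q"
  using assms(2)
proof (induction n arbitrary: P Q)
  case (Suc n)
  have "ord_less R C S n (\<lambda>x. P (a \<otimes> x) \<ominus> a \<otimes> P x) \<longleftrightarrow> ord_less R C S n (\<lambda>x. Q (a \<otimes> x) \<ominus> a \<otimes> Q x)"
    if "a \<in> C" for a
    using Suc.prems that scalarsD(1)[OF assms(1)] by (intro Suc.IH) simp
  then show ?case by simp
qed simp

lemma ord_less_congD:
  "ord_less R C S n P \<Longrightarrow> scalars C S \<Longrightarrow> (\<And>x. x \<in> S \<Longrightarrow> Q x = P x) \<Longrightarrow> ord_less R C S n Q"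
  using ord_less_cong by metis

lemma ord_less_mono:
  assumes "C' \<subseteq> C" "S' \<subseteq> S"
  shows "ord_less R C S n P \<Longrightarrow> ord_less R C' S' n P"
  using assms by (induction n arbitrary: P) auto

lemma comm_closed:
  assumes "scalars C S" "P \<in> S \<rightarrow> carrier R" "a \<in> C"
  shows "(\<lambda>x. P (a \<otimes> x) \<ominus> a \<otimes> P x) \<in> S \<rightarrow> carrier R"
  using assms scalarsD[OF assms(1)] by (auto simp: Pi_iff)

lemma ord_less_Suc:
  assumes "scalars C S"
  shows "P \<in> S \<rightarrow> carrier R \<Longrightarrow> ord_less R C S n P \<Longrightarrow> ord_less R C S (Suc n) P"
proof (induction n arbitrary: P)
  case 0
  then show ?case using scalarsD[OF assms] by (auto simp: minus_eq)
next
  case (Suc n)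
  have "ord_less R C S (Suc n) (\<lambda>x. P (a \<otimes> x) \<ominus> a \<otimes> P x)" if "a \<in> C" for a
    using that Suc.prems(2) by (intro Suc.IH[OF comm_closed[OF assms Suc.prems(1)]]) simp_all
  then show ?case by (subst ord_less.simps(2)) blast
qed

lemma ord_less_le:
  assumes "scalars C S" "P \<in> S \<rightarrow> carrier R" "ord_less R C S n P" "n \<le> m"
  shows "ord_less R C S m P"
  using assms(4,3) by (induction m rule: dec_induct) (auto intro: ord_less_Suc[OF assms(1,2)] simp del: ord_less.simps)

lemma ord_less_add:
  assumes "scalars C S"
  shows "P \<in> S \<rightarrow> carrier R \<Longrightarrow> Q \<in> S \<rightarrow> carrier R \<Longrightarrow> ord_less R C S n P \<Longrightarrow> ord_less R C S n Q \<Longrightarrow>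
    ord_less R C S n (\<lambda>x. P x \<oplus> Q x)"
proof (induction n arbitrary: P Q)
  case (Suc n)
  show ?case unfolding ord_less.simps
  proof
    fix a assume a: "a \<in> C"
    have "ord_less R C S n (\<lambda>x. (P (a \<otimes> x) \<ominus> a \<otimes> P x) \<oplus> (Q (a \<otimes> x) \<ominus> a \<otimes> Q x))"
      using Suc.prems a by (intro Suc.IH comm_closed[OF assms]) simp_all
    then show "ord_less R C S n (\<lambda>x. P (a \<otimes> x) \<oplus> Q (a \<otimes> x) \<ominus> a \<otimes> (P x \<oplus> Q x))"
    proof (rule ord_less_congD[OF _ assms])
      fix x assume x: "x \<in> S"
      have "P (a \<otimes> x) \<in> carrier R" "Q (a \<otimes> x) \<in> carrier R" "P x \<in> carrier R" "Q x \<in> carrier R" "a \<in> carrier R"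
        using Suc.prems(1,2) x a scalarsD[OF assms] by auto
      then show "P (a \<otimes> x) \<oplus> Q (a \<otimes> x) \<ominus> a \<otimes> (P x \<oplus> Q x) = P (a \<otimes> x) \<ominus> a \<otimes> P x \<oplus> (Q (a \<otimes> x) \<ominus> a \<otimes> Q x)"
        by algebra
    qed
  qed
qed simp

lemma ord_less_smult:
  assumes "scalars C S" "l \<in> carrier R"
  shows "P \<in> S \<rightarrow> carrier R \<Longrightarrow> ord_less R C S n P \<Longrightarrow> ord_less R C S n (\<lambda>x. l \<otimes> P x)"
proof (induction n arbitrary: P)
  case 0
  then show ?case using assms by simp
next
  case (Suc n)
  show ?case unfolding ord_less.simps
  proof
    fix a assume a: "a \<in> C"
    have "ord_less R C S n (\<lambda>x. l \<otimes> (P (a \<otimes> x) \<ominus> a \<otimes> P x))"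
      using Suc.prems a by (intro Suc.IH comm_closed[OF assms(1)]) simp_all
    then show "ord_less R C S n (\<lambda>x. l \<otimes> P (a \<otimes> x) \<ominus> a \<otimes> (l \<otimes> P x))"
    proof (rule ord_less_congD[OF _ assms(1)])
      fix x assume x: "x \<in> S"
      have "P (a \<otimes> x) \<in> carrier R" "P x \<in> carrier R" "a \<in> carrier R"
        using Suc.prems(1) x a scalarsD[OF assms(1)] by auto
      then show "l \<otimes> P (a \<otimes> x) \<ominus> a \<otimes> (l \<otimes> P x) = l \<otimes> (P (a \<otimes> x) \<ominus> a \<otimes> P x)"
        using assms(2) by algebra
    qed
  qed
qed

lemma ord_less_diff:
  assumes "scalars C S" "P \<in> S \<rightarrow> carrier R" "Q \<in> S \<rightarrow> carrier R" "ord_less R C S n P" "ord_less R C S n Q"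
  shows "ord_less R C S n (\<lambda>x. P x \<ominus> Q x)"
proof (rule ord_less_congD[OF _ assms(1)])
  show "ord_less R C S n (\<lambda>x. P x \<oplus> (\<ominus> \<one>) \<otimes> Q x)"
    using assms by (intro ord_less_add ord_less_smult) auto
  show "P x \<ominus> Q x = P x \<oplus> (\<ominus> \<one>) \<otimes> Q x" if "x \<in> S" for x
  proof -
    have "P x \<in> carrier R" "Q x \<in> carrier R" using assms that by auto
    then show ?thesis by algebra
  qed
qed

text \<open>Multiplication by \<open>y\<close> commutes with the scalars, so the commutator with
  \<open>a\<close> of \<open>P\<close> after \<open>y\<close> is the commutator of \<open>P\<close>
  with \<open>a\<close>, taken after \<open>y\<close>.\<close>

lemma ord_less_mult_arg:
  assumes "scalars C S" "y \<in> carrier R" "\<And>x. x \<in> S \<Longrightarrow> y \<otimes> x \<in> S"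
  shows "ord_less R C S n P \<Longrightarrow> ord_less R C S n (\<lambda>x. P (y \<otimes> x))"
proof (induction n arbitrary: P)
  case 0
  then show ?case using assms by simp
next
  case (Suc n)
  show ?case unfolding ord_less.simps
  proof
    fix a assume a: "a \<in> C"
    have "ord_less R C S n (\<lambda>x. P (a \<otimes> (y \<otimes> x)) \<ominus> a \<otimes> P (y \<otimes> x))"
      using Suc.prems a by (intro Suc.IH[of "\<lambda>x. P (a \<otimes> x) \<ominus> a \<otimes> P x"]) simp
    then show "ord_less R C S n (\<lambda>x. P (y \<otimes> (a \<otimes> x)) \<ominus> a \<otimes> P (y \<otimes> x))"
    proof (rule ord_less_congD[OF _ assms(1)])
      fix x assume x: "x \<in> S"
      have "y \<otimes> (a \<otimes> x) = a \<otimes> (y \<otimes> x)"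
        using a x assms(2) scalarsD[OF assms(1)] by (simp add: m_lcomm)
      then show "P (y \<otimes> (a \<otimes> x)) \<ominus> a \<otimes> P (y \<otimes> x) = P (a \<otimes> (y \<otimes> x)) \<ominus> a \<otimes> P (y \<otimes> x)" by simp
    qed
  qed
qed

lemma ord_less_zero: "scalars C S \<Longrightarrow> ord_less R C S n (\<lambda>x. \<zero>)"
  using ord_less_le[of C S "\<lambda>x. \<zero>" 0 n] by simp

lemma ord_less_finsum:
  assumes "scalars C S" "finite I"
  shows "(\<And>i. i \<in> I \<Longrightarrow> P i \<in> S \<rightarrow> carrier R) \<Longrightarrow> (\<And>i. i \<in> I \<Longrightarrow> ord_less R C S n (P i)) \<Longrightarrow>
    ord_less R C S n (\<lambda>x. \<Oplus>i\<in>I. P i x)"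
  using assms(2)
proof (induction I rule: finite_induct)
  case empty
  then show ?case by (simp add: ord_less_zero[OF assms(1)])
next
  case (insert i I)
  have c: "P i x \<in> carrier R" "(\<lambda>i. P i x) \<in> I \<rightarrow> carrier R" if "x \<in> S" for x
    using insert.prems(1) that by auto
  have "ord_less R C S n (\<lambda>x. P i x \<oplus> (\<Oplus>i\<in>I. P i x))"
    using insert c by (intro ord_less_add[OF assms(1)]) (auto intro!: finsum_closed)
  then show ?case
    by (rule ord_less_congD[OF _ assms(1)]) (use c insert.hyps in \<open>simp add: finsum_insert\<close>)
qed

text \<open>Induction on \<open>n + m\<close> with [PQ, a] = P[Q, a] + [P, a]Q. In the shifted count
  the sharp bound for positive \<open>n\<close> and \<open>m\<close> is \<open>n + m - 1\<close>;
  the weaker one is enough, since the ring of operators only asks for the existence of a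
  bound.\<close>

lemma ord_less_comp:
  assumes E: "subring E R" and P: "P \<in> E \<rightarrow> E" and add: "\<And>x y. x \<in> E \<Longrightarrow> y \<in> E \<Longrightarrow> P (x \<oplus> y) = P x \<oplus> P y"
    and Q: "Q \<in> E \<rightarrow> E"
  shows "ord_less R E E n P \<Longrightarrow> ord_less R E E m Q \<Longrightarrow> ord_less R E E (n + m) (\<lambda>x. P (Q x))"
  using P add Q
proof (induction "n + m" arbitrary: n m P Q)
  case 0
  then show ?case using subringE(2)[OF E] by simp
next
  case (Suc r)
  note E' = subringE[OF E]
  have sc: "scalars E E" using E' by (auto simp: scalars_def)
  have P: "P x \<in> E" and Q: "Q x \<in> E" if "x \<in> E" for x using Suc.prems that by auto
  have car: "x \<in> carrier R" if "x \<in> E" for x using E'(1) that by auto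
  have P0: "P \<zero> = \<zero>"
    using Suc.prems(4)[of \<zero> \<zero>] E'(2) car P by (metis add.l_cancel_one' l_zero zero_closed)
  have minus: "x \<ominus> y \<in> E" if "x \<in> E" "y \<in> E" for x y using E' that by (simp add: minus_eq)
  have comE: "(\<lambda>x. T (a \<otimes> x) \<ominus> a \<otimes> T x) \<in> E \<rightarrow> E" if "T \<in> E \<rightarrow> E" "a \<in> E" for T a
  proof
    fix x assume x: "x \<in> E"
    have "T x \<in> E" "T (a \<otimes> x) \<in> E" using that x E'(6) by (auto intro: funcset_mem)
    then show "T (a \<otimes> x) \<ominus> a \<otimes> T x \<in> E" using minus E'(6) that(2) by simp
  qed
  show ?case
  \<comment> \<open>If one factor vanishes on \<open>E\<close>, so does the composite, because
    \<open>P \<zero> = \<zero>\<close>.\<close>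
  proof (cases "n = 0 \<or> m = 0")
    case True
    then have "ord_less R E E 0 (\<lambda>x. P (Q x))"
      using Suc.prems P0 Q by auto
    then show ?thesis
      by (rule ord_less_le[OF sc, rotated]) (use P Q car in auto)
  next
    case False
    then obtain n' m' where nm: "n = Suc n'" "m = Suc m'" by (metis not0_implies_Suc)
    have "ord_less R E E r (\<lambda>x. P (Q (a \<otimes> x)) \<ominus> a \<otimes> P (Q x))" if a: "a \<in> E" for a
    proof -
      let ?Pa = "\<lambda>x. P (a \<otimes> x) \<ominus> a \<otimes> P x" and ?Qa = "\<lambda>x. Q (a \<otimes> x) \<ominus> a \<otimes> Q x"
      have 1: "ord_less R E E (n + m') (\<lambda>x. P (?Qa x))"
        using Suc.prems Suc.hyps(2) nm a comE by (intro Suc.hyps(1)) simp_all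
      have "?Pa (x \<oplus> y) = ?Pa x \<oplus> ?Pa y" if "x \<in> E" "y \<in> E" for x y
      proof -
        have "P (a \<otimes> (x \<oplus> y)) = P (a \<otimes> x) \<oplus> P (a \<otimes> y)"
          using that a E' Suc.prems(4)[of "a \<otimes> x" "a \<otimes> y"] by (simp add: r_distr car)
        moreover have "P x \<in> carrier R" "P y \<in> carrier R" "P (a \<otimes> x) \<in> carrier R" "P (a \<otimes> y) \<in> carrier R" "a \<in> carrier R"
          using that a E' P car by auto
        ultimately show ?thesis using that Suc.prems(4) by simp algebra
      qed
      then have 2: "ord_less R E E (n' + m) (\<lambda>x. ?Pa (Q x))"
        using Suc.prems Suc.hyps(2) nm a comE by (intro Suc.hyps(1)) simp_all
      have "ord_less R E E r (\<lambda>x. P (?Qa x) \<oplus> ?Pa (Q x))"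
      proof (rule ord_less_add[OF sc])
        show "(\<lambda>x. P (?Qa x)) \<in> E \<rightarrow> carrier R"
          using P car funcset_mem[OF comE[OF Suc.prems(5) a]] by simp
        show "(\<lambda>x. ?Pa (Q x)) \<in> E \<rightarrow> carrier R"
          using Q car funcset_mem[OF comE[OF Suc.prems(3) a]] by simp
        show "ord_less R E E r (\<lambda>x. P (?Qa x))" using 1 nm Suc.hyps(2) by simp
        show "ord_less R E E r (\<lambda>x. ?Pa (Q x))" using 2 nm Suc.hyps(2) by (simp del: ord_less.simps)
      qed
      then show ?thesis
      proof (rule ord_less_congD[OF _ sc])
        fix x assume x: "x \<in> E"
        have q: "?Qa x \<in> E" "a \<otimes> Q x \<in> E" using comE[of Q a] Suc.prems a x E' Q by auto
        then have "P (?Qa x \<oplus> a \<otimes> Q x) = P (?Qa x) \<oplus> P (a \<otimes> Q x)" by (rule Suc.prems(4))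
        moreover have "?Qa x \<oplus> a \<otimes> Q x = Q (a \<otimes> x)"
          using car Q x a E' by (intro add_diff_cancel) auto
        moreover have "P (?Qa x) \<in> carrier R" "P (a \<otimes> Q x) \<in> carrier R" "a \<otimes> P (Q x) \<in> carrier R"
          using q P car a x Q E' by auto
        ultimately show "P (Q (a \<otimes> x)) \<ominus> a \<otimes> P (Q x) = P (?Qa x) \<oplus> ?Pa (Q x)"
          by (simp add: minus_eq a_assoc)
      qed
    qed
    then have "ord_less R E E (Suc r) (\<lambda>x. P (Q x))" by simp
    then show ?thesis using Suc.hyps(2) by simp
  qed
qed

end

section \<open>The ring of differential operators of a subring\<close>

text \<open>Inverses are defined through the carrier, so negation, unlike sum and product, is not
  literally unchanged when the carrier shrinks.\<close>

lemma (in ring) subring_minus: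
  assumes E: "subring E R" and "x \<in> E" "y \<in> E"
  shows "x \<ominus>\<^bsub>R\<lparr>carrier := E\<rparr>\<^esub> y = x \<ominus> y"
proof -
  interpret E: ring "R\<lparr>carrier := E\<rparr>" by (rule subring_is_ring[OF E])
  have y: "\<ominus> y \<in> E" "y \<in> carrier R" using subringE[OF E] assms by auto
  have "\<ominus>\<^bsub>R\<lparr>carrier := E\<rparr>\<^esub> y = \<ominus> y"
    by (rule E.minus_equality) (use y assms l_neg in simp_all)
  then show ?thesis by (simp add: a_minus_def)
qed

context cring
begin

text \<open>The link between the given notion of order and \<open>ord_less\<close>. Extensionality
  turns vanishing on \<open>E\<close> into equality with the zero function at the bottom of the
  recursion.\<close>

lemma order_less_iff:
  assumes E: "subring E R"
  shows "P \<in> E \<rightarrow>\<^sub>E E \<Longrightarrow> order_less (R\<lparr>carrier := E\<rparr>) n P \<longleftrightarrow> ord_less R E E n P"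
proof (induction n arbitrary: P)
  case 0
  have "(P = (\<lambda>x\<in>E. \<zero>)) = (\<forall>x\<in>E. P x = \<zero>)"
  proof
    assume "\<forall>x\<in>E. P x = \<zero>"
    then show "P = (\<lambda>x\<in>E. \<zero>)" using 0 by (intro extensionalityI[of _ E]) (auto simp: PiE_iff)
  qed auto
  then show ?case by simp
next
  case (Suc n)
  note E' = subringE[OF E]
  have sc: "scalars E E" using E' by (auto simp: scalars_def)
  have "order_less (R\<lparr>carrier := E\<rparr>) n (commutator_op (R\<lparr>carrier := E\<rparr>) P a) \<longleftrightarrow>
      ord_less R E E n (\<lambda>x. P (a \<otimes> x) \<ominus> a \<otimes> P x)" if a: "a \<in> E" for a
  proof -
    have com: "commutator_op (R\<lparr>carrier := E\<rparr>) P a x = P (a \<otimes> x) \<ominus> a \<otimes> P x"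
      "P (a \<otimes> x) \<ominus> a \<otimes> P x \<in> E" if "x \<in> E" for x
    proof -
      have "P x \<in> E" "P (a \<otimes> x) \<in> E" using a that E' PiE_mem[OF Suc.prems] by auto
      then have "P (a \<otimes> x) \<in> E" "a \<otimes> P x \<in> E" using a E' by auto
      then show "commutator_op (R\<lparr>carrier := E\<rparr>) P a x = P (a \<otimes> x) \<ominus> a \<otimes> P x" "P (a \<otimes> x) \<ominus> a \<otimes> P x \<in> E"
        using that E' by (simp_all add: commutator_op_def subring_minus[OF E]) (simp add: minus_eq)
    qed
    have "commutator_op (R\<lparr>carrier := E\<rparr>) P a \<in> E \<rightarrow>\<^sub>E E"
    proof (rule PiE_I)
      show "commutator_op (R\<lparr>carrier := E\<rparr>) P a x \<in> E" if "x \<in> E" for x using com[OF that] by simp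
    qed (simp add: commutator_op_def)
    from Suc.IH[OF this] show ?thesis using ord_less_cong[OF sc com(1)] by simp
  qed
  then show ?case by simp
qed

lemma diff_ring_iff:
  assumes E: "subring E R"
  shows "P \<in> carrier (diff_ring k (R\<lparr>carrier := E\<rparr>)) \<longleftrightarrow> P \<in> E \<rightarrow>\<^sub>E E \<and>
    (\<forall>x\<in>E. \<forall>y\<in>E. P (x \<oplus> y) = P x \<oplus> P y) \<and> (\<forall>c\<in>k. \<forall>x\<in>E. P (c \<otimes> x) = c \<otimes> P x) \<and>
    (\<exists>n. ord_less R E E n P)"
  using order_less_iff[OF E, of P] by (auto simp: diff_ring_def linear_ops_def)

lemma diff_ringD:
  assumes "subring E R" "P \<in> carrier (diff_ring k (R\<lparr>carrier := E\<rparr>))"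
  shows "P \<in> extensional E" "x \<in> E \<Longrightarrow> P x \<in> E" "x \<in> E \<Longrightarrow> y \<in> E \<Longrightarrow> P (x \<oplus> y) = P x \<oplus> P y"
    "c \<in> k \<Longrightarrow> x \<in> E \<Longrightarrow> P (c \<otimes> x) = c \<otimes> P x" "\<exists>n. ord_less R E E n P"
  using assms(2) unfolding diff_ring_iff[OF assms(1)] by (auto simp: PiE_iff)

lemma diff_ringI:
  assumes E: "subring E R" and k: "k \<subseteq> E"
    and P: "\<And>x. x \<in> E \<Longrightarrow> P x \<in> E" "\<And>x y. x \<in> E \<Longrightarrow> y \<in> E \<Longrightarrow> P (x \<oplus> y) = P x \<oplus> P y"
      "\<And>c x. c \<in> k \<Longrightarrow> x \<in> E \<Longrightarrow> P (c \<otimes> x) = c \<otimes> P x" "ord_less R E E n P"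
  shows "restrict P E \<in> carrier (diff_ring k (R\<lparr>carrier := E\<rparr>))"
proof -
  note E' = subringE[OF E]
  have sc: "scalars E E" using E' by (auto simp: scalars_def)
  have "ord_less R E E n (restrict P E)" by (rule ord_less_congD[OF P(4) sc]) simp
  then show ?thesis unfolding diff_ring_iff[OF E] using P(1-3) E' k by (auto simp: subset_iff)
qed

lemma diff_ring_ops:
  shows "x \<in> E \<Longrightarrow> (P \<otimes>\<^bsub>diff_ring k (R\<lparr>carrier := E\<rparr>)\<^esub> Q) x = P (Q x)"
    "x \<in> E \<Longrightarrow> (P \<oplus>\<^bsub>diff_ring k (R\<lparr>carrier := E\<rparr>)\<^esub> Q) x = P x \<oplus> Q x"
    "x \<in> E \<Longrightarrow> \<one>\<^bsub>diff_ring k (R\<lparr>carrier := E\<rparr>)\<^esub> x = x"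
    "x \<in> E \<Longrightarrow> \<zero>\<^bsub>diff_ring k (R\<lparr>carrier := E\<rparr>)\<^esub> x = \<zero>"
  by (simp_all add: diff_ring_def compose_def)

lemma diff_ring_eqI:
  assumes "subring E R" "P \<in> carrier (diff_ring k (R\<lparr>carrier := E\<rparr>))"
    "Q \<in> carrier (diff_ring k (R\<lparr>carrier := E\<rparr>))" "\<And>x. x \<in> E \<Longrightarrow> P x = Q x"
  shows "P = Q"
  using diff_ringD(1)[OF assms(1,2)] diff_ringD(1)[OF assms(1,3)] assms(4) by (rule extensionalityI)

lemma mult_op_diff_ring:
  assumes E: "subring E R" and k: "k \<subseteq> E" and e: "e \<in> E"
  shows "mult_op (R\<lparr>carrier := E\<rparr>) e \<in> carrier (diff_ring k (R\<lparr>carrier := E\<rparr>))"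
proof -
  note E' = subringE[OF E]
  have car: "x \<in> carrier R" if "x \<in> E" for x using E'(1) that by auto
  have "restrict (\<lambda>x. e \<otimes> x) E \<in> carrier (diff_ring k (R\<lparr>carrier := E\<rparr>))"
  \<comment> \<open>The bound 1 expresses order at most 0: a multiplication commutes with all
    multiplications.\<close>
  proof (rule diff_ringI[OF E k, of _ 1])
    show "ord_less R E E 1 (\<lambda>x. e \<otimes> x)"
      using e car by (auto simp: m_lcomm minus_eq r_neg)
    show "e \<otimes> (c \<otimes> x) = c \<otimes> (e \<otimes> x)" if "c \<in> k" "x \<in> E" for c x
      using e car that k by (auto simp: m_lcomm)
  qed (use e E' car r_distr in auto)
  then show ?thesis by (simp add: mult_op_def)
qed

lemma ring_diff_ring:
  assumes E: "subring E R" and k: "k \<subseteq> E"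
  shows "ring (diff_ring k (R\<lparr>carrier := E\<rparr>))" (is "ring ?D")
proof -
  note E' = subringE[OF E]
  note [simp] = diff_ring_ops[where E = E and k = k]
  note D = diff_ringD[OF E, of _ k]
  note eqI = diff_ring_eqI[OF E, of _ k]
  have sc: "scalars E E" using E' by (auto simp: scalars_def)
  have car: "x \<in> carrier R" if "x \<in> E" for x using E'(1) that by auto
  have kE: "c \<in> E" if "c \<in> k" for c using k that by auto
  have ops: "P \<otimes>\<^bsub>?D\<^esub> Q = restrict (\<lambda>x. P (Q x)) E" "P \<oplus>\<^bsub>?D\<^esub> Q = restrict (\<lambda>x. P x \<oplus> Q x) E"
    "\<one>\<^bsub>?D\<^esub> = restrict (\<lambda>x. x) E" "\<zero>\<^bsub>?D\<^esub> = restrict (\<lambda>x. \<zero>) E" for P Q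
    by (simp_all add: diff_ring_def compose_def)
  have mult: "P \<otimes>\<^bsub>?D\<^esub> Q \<in> carrier ?D" if PQ: "P \<in> carrier ?D" "Q \<in> carrier ?D" for P Q
  proof -
    obtain n m where nm: "ord_less R E E n P" "ord_less R E E m Q" using D(5) PQ by metis
    show ?thesis unfolding ops
    proof (rule diff_ringI[OF E k, of _ "n + m"])
      show "ord_less R E E (n + m) (\<lambda>x. P (Q x))"
        by (rule ord_less_comp[OF E _ _ _ nm]) (use D(2,3) PQ in auto)
    qed (use D(2-4)[OF PQ(1)] D(2-4)[OF PQ(2)] in simp_all)
  qed
  have add: "P \<oplus>\<^bsub>?D\<^esub> Q \<in> carrier ?D" if PQ: "P \<in> carrier ?D" "Q \<in> carrier ?D" for P Q
  proof -
    obtain n m where nm: "ord_less R E E n P" "ord_less R E E m Q" using D(5) PQ by metis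
    have PQ': "P \<in> E \<rightarrow> carrier R" "Q \<in> E \<rightarrow> carrier R" using D(2) PQ car by auto
    show ?thesis unfolding ops
    \<comment> \<open>For the sum, \<open>n + m\<close> is merely a common upper bound of the two
      orders.\<close>
    proof (rule diff_ringI[OF E k, of _ "n + m"])
      show "ord_less R E E (n + m) (\<lambda>x. P x \<oplus> Q x)"
        by (rule ord_less_add[OF sc PQ' ord_less_le[OF sc PQ'(1) nm(1)] ord_less_le[OF sc PQ'(2) nm(2)]])
          simp_all
      show "P (x \<oplus> y) \<oplus> Q (x \<oplus> y) = P x \<oplus> Q x \<oplus> (P y \<oplus> Q y)" if "x \<in> E" "y \<in> E" for x y
        using that D(2,3)[OF PQ(1)] D(2,3)[OF PQ(2)] car by (simp add: a_ac)
      show "P (c \<otimes> x) \<oplus> Q (c \<otimes> x) = c \<otimes> (P x \<oplus> Q x)" if "c \<in> k" "x \<in> E" for c x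
        using that D(2,4)[OF PQ(1)] D(2,4)[OF PQ(2)] car kE by (simp add: r_distr)
    qed (use D(2)[OF PQ(1)] D(2)[OF PQ(2)] E' in simp_all)
  qed
  have one: "\<one>\<^bsub>?D\<^esub> \<in> carrier ?D"
    unfolding ops by (rule diff_ringI[OF E k, of _ 1]) (use car in \<open>auto simp: minus_eq r_neg\<close>)
  have zero: "\<zero>\<^bsub>?D\<^esub> \<in> carrier ?D"
    unfolding ops by (rule diff_ringI[OF E k, of _ 0]) (use car kE E' in auto)
  have neg: "\<exists>Q\<in>carrier ?D. Q \<oplus>\<^bsub>?D\<^esub> P = \<zero>\<^bsub>?D\<^esub>" if P: "P \<in> carrier ?D" for P
  proof -
    obtain n where n: "ord_less R E E n P" using D(5) P by metis
    have "restrict (\<lambda>x. (\<ominus> \<one>) \<otimes> P x) E \<in> carrier ?D"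
    proof (rule diff_ringI[OF E k, of _ n])
      show "ord_less R E E n (\<lambda>x. (\<ominus> \<one>) \<otimes> P x)"
        by (rule ord_less_smult[OF sc]) (use n D(2)[OF P] car in auto)
    qed (use D(2-4)[OF P] car kE E' in \<open>auto simp: r_distr m_lcomm\<close>)
    moreover have "restrict (\<lambda>x. (\<ominus> \<one>) \<otimes> P x) E \<oplus>\<^bsub>?D\<^esub> P = \<zero>\<^bsub>?D\<^esub>"
      unfolding ops using D(2)[OF P] car by (intro restrict_ext) (simp add: l_minus l_neg)
    ultimately show ?thesis by blast
  qed
  have "abelian_group ?D"
  proof (rule abelian_groupI)
    fix P Q T assume PQT: "P \<in> carrier ?D" "Q \<in> carrier ?D" "T \<in> carrier ?D"
    show "P \<oplus>\<^bsub>?D\<^esub> Q \<oplus>\<^bsub>?D\<^esub> T = P \<oplus>\<^bsub>?D\<^esub> (Q \<oplus>\<^bsub>?D\<^esub> T)"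
      by (rule eqI) (use PQT add D(2) car a_assoc in simp_all)
  next
    fix P Q assume PQT: "P \<in> carrier ?D" "Q \<in> carrier ?D"
    show "P \<oplus>\<^bsub>?D\<^esub> Q = Q \<oplus>\<^bsub>?D\<^esub> P"
      by (rule eqI) (use PQT add D(2) car a_comm in simp_all)
  next
    fix P assume P: "P \<in> carrier ?D"
    show "\<zero>\<^bsub>?D\<^esub> \<oplus>\<^bsub>?D\<^esub> P = P"
      by (rule eqI) (use P add zero D(2) car in simp_all)
  qed (use add zero neg in auto)
  moreover have "monoid ?D"
  proof (rule monoidI)
    fix P Q T assume PQT: "P \<in> carrier ?D" "Q \<in> carrier ?D" "T \<in> carrier ?D"
    show "P \<otimes>\<^bsub>?D\<^esub> Q \<otimes>\<^bsub>?D\<^esub> T = P \<otimes>\<^bsub>?D\<^esub> (Q \<otimes>\<^bsub>?D\<^esub> T)"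
      by (rule eqI) (use PQT mult D(2) in simp_all)
  next
    fix P assume P: "P \<in> carrier ?D"
    show "\<one>\<^bsub>?D\<^esub> \<otimes>\<^bsub>?D\<^esub> P = P" "P \<otimes>\<^bsub>?D\<^esub> \<one>\<^bsub>?D\<^esub> = P"
      by (rule eqI; use P mult one D(2) in simp)+
  qed (use mult one in auto)
  ultimately show ?thesis
  proof (rule ringI)
    fix P Q T assume PQT: "P \<in> carrier ?D" "Q \<in> carrier ?D" "T \<in> carrier ?D"
    show "(P \<oplus>\<^bsub>?D\<^esub> Q) \<otimes>\<^bsub>?D\<^esub> T = P \<otimes>\<^bsub>?D\<^esub> T \<oplus>\<^bsub>?D\<^esub> Q \<otimes>\<^bsub>?D\<^esub> T"
      "T \<otimes>\<^bsub>?D\<^esub> (P \<oplus>\<^bsub>?D\<^esub> Q) = T \<otimes>\<^bsub>?D\<^esub> P \<oplus>\<^bsub>?D\<^esub> T \<otimes>\<^bsub>?D\<^esub> Q"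
      by (rule eqI; use PQT add mult D(2,3) in simp)+
  qed
qed

end

section \<open>Dual families of a finite Galois extension\<close>

context field
begin

lemma galois_groupD:
  assumes "g \<in> galois_group R K"
  shows "x \<in> carrier R \<Longrightarrow> g x \<in> carrier R"
    "x \<in> carrier R \<Longrightarrow> y \<in> carrier R \<Longrightarrow> g (x \<oplus> y) = g x \<oplus> g y"
    "x \<in> carrier R \<Longrightarrow> y \<in> carrier R \<Longrightarrow> g (x \<otimes> y) = g x \<otimes> g y"
    "g \<one> = \<one>" "x \<in> K \<Longrightarrow> g x = x" "g \<in> extensional (carrier R)" "bij_betw g (carrier R) (carrier R)"
    "g \<in> add_hom R R" "g \<zero> = \<zero>"
proof -
  have g: "g \<in> ring_hom R R" using assms by (simp add: galois_group_def ring_iso_def)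
  show 1: "x \<in> carrier R \<Longrightarrow> g x \<in> carrier R"
    "x \<in> carrier R \<Longrightarrow> y \<in> carrier R \<Longrightarrow> g (x \<oplus> y) = g x \<oplus> g y" for x y
    using g by (simp_all add: ring_hom_closed ring_hom_add)
  show "x \<in> carrier R \<Longrightarrow> y \<in> carrier R \<Longrightarrow> g (x \<otimes> y) = g x \<otimes> g y"
    "g \<one> = \<one>" using g by (simp_all add: ring_hom_mult ring_hom_one)
  show "x \<in> K \<Longrightarrow> g x = x" "g \<in> extensional (carrier R)" "bij_betw g (carrier R) (carrier R)"
    using assms by (simp_all add: galois_group_def Bij_def)
  show "g \<in> add_hom R R" by (rule add_homI) (use 1 in auto)
  then show "g \<zero> = \<zero>" using add_hom_zero[OF abelian_group_axioms abelian_group_axioms] by simp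
qed

lemma galois_groupI:
  assumes "\<And>x. x \<in> carrier R \<Longrightarrow> g x \<in> carrier R"
    "\<And>x y. x \<in> carrier R \<Longrightarrow> y \<in> carrier R \<Longrightarrow> g (x \<oplus> y) = g x \<oplus> g y"
    "\<And>x y. x \<in> carrier R \<Longrightarrow> y \<in> carrier R \<Longrightarrow> g (x \<otimes> y) = g x \<otimes> g y"
    "g \<one> = \<one>" "\<And>x. x \<in> K \<Longrightarrow> g x = x" "g \<in> extensional (carrier R)" "bij_betw g (carrier R) (carrier R)"
  shows "g \<in> galois_group R K"
  using assms by (auto simp: galois_group_def Bij_def ring_iso_def intro!: ring_hom_memI)

abbreviation ginv :: "('a \<Rightarrow> 'a) \<Rightarrow> 'a \<Rightarrow> 'a" where
  "ginv g \<equiv> inv\<^bsub>BijGroup (carrier R)\<^esub> g"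

lemma galois_id:
  assumes "K \<subseteq> carrier R" shows "(\<lambda>x\<in>carrier R. x) \<in> galois_group R K"
  using id_Bij[of "carrier R"] assms by (intro galois_groupI) (auto simp: Bij_def)

lemma galois_compose:
  assumes K: "K \<subseteq> carrier R" and g: "g \<in> galois_group R K" and h: "h \<in> galois_group R K"
  shows "compose (carrier R) g h \<in> galois_group R K"
proof (rule galois_groupI)
  show "bij_betw (compose (carrier R) g h) (carrier R) (carrier R)"
    by (rule bij_betw_compose[OF galois_groupD(7)[OF h] galois_groupD(7)[OF g]])
  show "compose (carrier R) g h \<one> = \<one>"
    using galois_groupD(4)[OF g] galois_groupD(4)[OF h] by (simp add: compose_eq)
  show "compose (carrier R) g h x = x" if "x \<in> K" for x
    using that K galois_groupD(5)[OF g] galois_groupD(5)[OF h] by (auto simp: compose_eq)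
qed (simp_all add: compose_eq galois_groupD(1-3)[OF g] galois_groupD(1-3)[OF h])

lemma galois_inv:
  assumes K: "K \<subseteq> carrier R" and g: "g \<in> galois_group R K"
  shows "inv\<^bsub>BijGroup (carrier R)\<^esub> g \<in> galois_group R K"
    "x \<in> carrier R \<Longrightarrow> (inv\<^bsub>BijGroup (carrier R)\<^esub> g) (g x) = x"
    "x \<in> carrier R \<Longrightarrow> g ((inv\<^bsub>BijGroup (carrier R)\<^esub> g) x) = x"
proof -
  let ?h = "inv\<^bsub>BijGroup (carrier R)\<^esub> g"
  have "g \<in> Bij (carrier R)" using g by (simp add: galois_group_def)
  then have h: "?h = (\<lambda>x\<in>carrier R. inv_into (carrier R) g x)" by (rule inv_BijGroup)
  note bij = galois_groupD(7)[OF g]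
  have bh: "bij_betw ?h (carrier R) (carrier R)"
    unfolding h using bij_betw_inv_into[OF bij] bij_betw_cong[of "carrier R"] by (simp cong: bij_betw_cong)
  show hg: "?h (g x) = x" if "x \<in> carrier R" for x
    using that bij galois_groupD(1)[OF g] by (simp add: h bij_betw_inv_into_left)
  show gh: "g (?h x) = x" if "x \<in> carrier R" for x
    using that bij by (simp add: h bij_betw_inv_into_right)
  have hc: "?h x \<in> carrier R" if "x \<in> carrier R" for x using bij_betw_apply[OF bh that] .
  show "?h \<in> galois_group R K"
  proof (rule galois_groupI)
    show "?h (x \<oplus> y) = ?h x \<oplus> ?h y" if "x \<in> carrier R" "y \<in> carrier R" for x y
      using hg[of "?h x \<oplus> ?h y"] that by (simp add: galois_groupD(2)[OF g] gh hc)
    show "?h (x \<otimes> y) = ?h x \<otimes> ?h y" if "x \<in> carrier R" "y \<in> carrier R" for x y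
      using hg[of "?h x \<otimes> ?h y"] that by (simp add: galois_groupD(3)[OF g] gh hc)
    show "?h \<one> = \<one>" using hg[of \<one>] galois_groupD(4)[OF g] by simp
    show "?h x = x" if "x \<in> K" for x using hg[of x] galois_groupD(5)[OF g that] that K by auto
  qed (use hc bh in \<open>auto simp: h\<close>)
qed

text \<open>View the family as the tensor \<Sum> x_i \<otimes> y_i, with the evaluations x \<otimes>
  y \<mapsto> x h(y). Each \<open>g\<close> in \<open>S\<close> moves some \<open>t\<close>;
  multiplying the tensor by d(1 \<otimes> t - g(t) \<otimes> 1) multiplies the evaluation at
  \<open>h\<close> by d(h(t) - g(t)). This kills the evaluation at \<open>g\<close>, keeps earlier
  zeros and, for the right \<open>d\<close>, the value 1 at the identity.\<close>

lemma separating_family: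
  assumes "finite S" "S \<subseteq> galois_group R K" "(\<lambda>x\<in>carrier R. x) \<notin> S" and K: "K \<subseteq> carrier R"
  shows "\<exists>(m::nat) x y. (\<forall>i<m. x i \<in> carrier R \<and> y i \<in> carrier R) \<and> (\<Oplus>i\<in>{..<m}. x i \<otimes> y i) = \<one> \<and>
    (\<forall>g\<in>S. (\<Oplus>i\<in>{..<m}. x i \<otimes> g (y i)) = \<zero>)"
  using assms(1-3)
proof (induction S rule: finite_induct)
  case empty
  then show ?case by (intro exI[of _ 1] exI[of _ "\<lambda>_. \<one>"]) (simp add: lessThan_Suc)
next
  case (insert g S)
  let ?id = "\<lambda>x\<in>carrier R. x"
  obtain m :: nat and x y where x: "i < m \<Longrightarrow> x i \<in> carrier R" and y: "i < m \<Longrightarrow> y i \<in> carrier R"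
    and xy: "(\<Oplus>i\<in>{..<m}. x i \<otimes> y i) = \<one>" "\<forall>g\<in>S. (\<Oplus>i\<in>{..<m}. x i \<otimes> g (y i)) = \<zero>" for i
    using insert.IH insert.prems by blast
  have g: "g \<in> galois_group R K" "g \<noteq> ?id" using insert.prems by auto
  have "\<exists>t\<in>carrier R. g t \<noteq> t"
  proof (rule ccontr)
    assume *: "\<not> ?thesis"
    have "g = ?id" by (rule extensionalityI[OF galois_groupD(6)[OF g(1)]]) (use * in auto)
    then show False using g(2) by simp
  qed
  then obtain t where t: "t \<in> carrier R" "g t \<noteq> t" by blast
  have gt: "g t \<in> carrier R" using galois_groupD(1)[OF g(1) t(1)] .
  \<comment> \<open>\<open>d\<close> normalises to 1 the factor d(t - g(t)) by which the evaluation
    at the identity changes.\<close>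
  define d where "d = inv (t \<ominus> g t)"
  have "t \<ominus> g t \<noteq> \<zero>" using t gt by (simp add: minus_eq_zero_iff)
  then have d: "d \<in> carrier R" "d \<otimes> (t \<ominus> g t) = \<one>"
    using t gt field_Units by (simp_all add: d_def)
  \<comment> \<open>The multiplier has two terms, so the family doubles: indices below
    \<open>m\<close> belong to d \<otimes> t, the others to - d g(t) \<otimes> 1.\<close>
  define x' where "x' i = (if i < m then d \<otimes> x i else \<ominus> (d \<otimes> g t) \<otimes> x (i - m))" for i
  define y' where "y' i = (if i < m then t \<otimes> y i else y (i - m))" for i
  have x': "x' i \<in> carrier R" and y': "y' i \<in> carrier R" if "i < m + m" for i
    using that x y d(1) t(1) gt by (auto simp: x'_def y'_def)
  have sum: "(\<Oplus>i\<in>{..<m + m}. x' i \<otimes> h (y' i)) = d \<otimes> (h t \<ominus> g t) \<otimes> (\<Oplus>i\<in>{..<m}. x i \<otimes> h (y i))"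
    if h: "h \<in> galois_group R K" for h
  proof -
    note hD = galois_groupD[OF h]
    let ?s = "\<Oplus>i\<in>{..<m}. x i \<otimes> h (y i)"
    have c: "x i \<in> carrier R" "h (y i) \<in> carrier R" if "i < m" for i using x y hD(1) that by auto
    have s: "?s \<in> carrier R" using c by (intro finsum_closed) auto
    have "i \<in> (\<lambda>i. m + i) ` {..<m}" if "\<not> i < m" "i < m + m" for i
      using that by (intro image_eqI[of _ _ "i - m"]) auto
    then have "{..<m + m} = {..<m} \<union> (\<lambda>i. m + i) ` {..<m}" by auto
    then have "(\<Oplus>i\<in>{..<m + m}. x' i \<otimes> h (y' i)) =
        (\<Oplus>i\<in>{..<m}. x' i \<otimes> h (y' i)) \<oplus> (\<Oplus>i\<in>(\<lambda>i. m + i) ` {..<m}. x' i \<otimes> h (y' i))"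
      using x' y' hD(1) by (simp, intro finsum_Un_disjoint) auto
    also have "(\<Oplus>i\<in>{..<m}. x' i \<otimes> h (y' i)) = (\<Oplus>i\<in>{..<m}. (d \<otimes> h t) \<otimes> (x i \<otimes> h (y i)))"
      using c x y d(1) t(1) hD(1,3) by (intro finsum_cong') (auto simp: x'_def y'_def m_ac)
    also have "\<dots> = (d \<otimes> h t) \<otimes> ?s"
      using c d(1) hD(1)[OF t(1)] by (intro finsum_rdistr[symmetric]) auto
    also have "(\<Oplus>i\<in>(\<lambda>i. m + i) ` {..<m}. x' i \<otimes> h (y' i)) = (\<Oplus>i\<in>{..<m}. x' (m + i) \<otimes> h (y' (m + i)))"
      using x' y' hD(1) by (intro finsum_reindex) (auto simp: inj_on_def)
    also have "\<dots> = (\<Oplus>i\<in>{..<m}. \<ominus> (d \<otimes> g t) \<otimes> (x i \<otimes> h (y i)))"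
      using c d(1) gt by (intro finsum_cong') (auto simp: x'_def y'_def m_assoc)
    also have "\<dots> = \<ominus> (d \<otimes> g t) \<otimes> ?s" using c d(1) gt by (intro finsum_rdistr[symmetric]) auto
    also have "(d \<otimes> h t) \<otimes> ?s \<oplus> \<ominus> (d \<otimes> g t) \<otimes> ?s = d \<otimes> (h t \<ominus> g t) \<otimes> ?s"
      using s d(1) hD(1)[OF t(1)] gt by (simp add: minus_eq l_distr r_distr r_minus l_minus)
    finally show ?thesis .
  qed
  have "(\<Oplus>i\<in>{..<m + m}. x' i \<otimes> y' i) = (\<Oplus>i\<in>{..<m + m}. x' i \<otimes> ?id (y' i))"
    using x' y' by (intro finsum_cong') auto
  also have "\<dots> = (\<Oplus>i\<in>{..<m}. x i \<otimes> ?id (y i))"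
    unfolding sum[OF galois_id[OF K]] using t gt d x y by (simp add: Pi_iff)
  also have "\<dots> = \<one>" unfolding xy(1)[symmetric] using x y by (intro finsum_cong') auto
  finally have 1: "(\<Oplus>i\<in>{..<m + m}. x' i \<otimes> y' i) = \<one>" .
  have 2: "(\<Oplus>i\<in>{..<m + m}. x' i \<otimes> h (y' i)) = \<zero>" if h: "h \<in> insert g S" for h
  proof (cases "h = g")
    case True
    have "(\<Oplus>i\<in>{..<m}. x i \<otimes> g (y i)) \<in> carrier R"
      using x y galois_groupD(1)[OF g(1)] by (intro finsum_closed) auto
    then show ?thesis unfolding True sum[OF g(1)] using gt d(1) by (simp add: minus_eq r_neg)
  next
    case False
    then have h: "h \<in> galois_group R K" "(\<Oplus>i\<in>{..<m}. x i \<otimes> h (y i)) = \<zero>" using that insert.prems xy(2) by auto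
    show ?thesis unfolding sum[OF h(1)] h(2) using galois_groupD(1)[OF h(1) t(1)] gt d(1) by simp
  qed
  show ?case
    by (intro exI[of _ "m + m"] exI[of _ x'] exI[of _ y'] conjI 1) (use x' y' 2 in simp_all)
qed

end

text \<open>Galois theory enters only through a finite group and its fixed field. The locale is used
  for \<open>K\<close> as well as for \<open>L1\<close>.\<close>

locale galois_sub = field L for L (structure) +
  fixes k E :: "'a set"
  assumes subfield: "subfield E L" and k_sub: "k \<subseteq> E"
    and finite_G: "finite (galois_group L E)" and fixed: "fixed_field L (galois_group L E) = E"
begin

abbreviation "G \<equiv> galois_group L E"

lemma E_sub: "E \<subseteq> carrier L" and subring_E: "subring E L"
  using subfieldE(1,3)[OF subfield] by auto

lemma E_car: "e \<in> E \<Longrightarrow> e \<in> carrier L" using E_sub by auto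

lemma k_car: "c \<in> k \<Longrightarrow> c \<in> carrier L" using E_sub k_sub by auto

text \<open>The trace of \<open>L\<close> over \<open>E\<close>. Its values lie in \<open>E\<close>
  because translation by a group element permutes the summands.\<close>

definition tr :: "'a \<Rightarrow> 'a" where "tr z = (\<Oplus>g\<in>G. g z)"

lemma tr_car: "z \<in> carrier L \<Longrightarrow> tr z \<in> carrier L"
  unfolding tr_def using galois_groupD(1) by (intro finsum_closed) auto

lemma galois_sum_reindex:
  assumes h: "h \<in> G" and f: "\<And>g. g \<in> G \<Longrightarrow> f g \<in> carrier M" and M: "abelian_group M"
  shows "(\<Oplus>\<^bsub>M\<^esub>g\<in>G. f (compose (carrier L) h g)) = (\<Oplus>\<^bsub>M\<^esub>g\<in>G. f g)"
proof -
  interpret M: abelian_group M by fact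
  let ?c = "compose (carrier L) h"
  let ?h' = "ginv h"
  note h' = galois_inv[OF E_sub h]
  have cc: "?c g \<in> G" if "g \<in> G" for g using galois_compose[OF E_sub h that] .
  have inj: "inj_on ?c G"
  proof (rule inj_onI)
    fix g g' assume g: "g \<in> G" "g' \<in> G" "?c g = ?c g'"
    show "g = g'"
    proof (rule extensionalityI[OF galois_groupD(6)[OF g(1)] galois_groupD(6)[OF g(2)]])
      fix x assume x: "x \<in> carrier L"
      have "h (g x) = h (g' x)" using g(3) x by (metis compose_eq)
      then have "?h' (h (g x)) = ?h' (h (g' x))" by simp
      then show "g x = g' x" using h'(2) galois_groupD(1)[OF g(1) x] galois_groupD(1)[OF g(2) x] by simp
    qed
  qed
  have "g \<in> ?c ` G" if g: "g \<in> G" for g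
  proof
    show "compose (carrier L) ?h' g \<in> G" using galois_compose[OF E_sub h'(1) g] .
    show "g = ?c (compose (carrier L) ?h' g)"
    proof (rule extensionalityI[OF galois_groupD(6)[OF g]])
      show "?c (compose (carrier L) ?h' g) \<in> extensional (carrier L)" by simp
      show "g x = ?c (compose (carrier L) ?h' g) x" if "x \<in> carrier L" for x
        using that galois_groupD(1)[OF g that] h'(3) by (simp add: compose_eq)
    qed
  qed
  then have im: "?c ` G = G" using cc by auto
  show ?thesis using M.finsum_reindex[OF _ inj, of f] f unfolding im by auto
qed

lemma galois_tr:
  assumes h: "h \<in> G" and z: "z \<in> carrier L"
  shows "h (tr z) = tr z"
proof -
  have "h (tr z) = (\<Oplus>g\<in>G. h (g z))"
    unfolding tr_def
    using galois_groupD(1) z finite_G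
    by (intro add_hom_finsum[OF abelian_group_axioms abelian_group_axioms galois_groupD(8)[OF h]]) auto
  also have "\<dots> = (\<Oplus>g\<in>G. compose (carrier L) h g z)" using z by (simp add: compose_eq)
  also have "\<dots> = tr z"
    unfolding tr_def using galois_groupD(1) z by (intro galois_sum_reindex[OF h] abelian_group_axioms) auto
  finally show ?thesis .
qed

lemma tr_closed: "z \<in> carrier L \<Longrightarrow> tr z \<in> E"
  using galois_tr tr_car fixed unfolding fixed_field_def by blast

lemma tr_add_hom: "tr \<in> add_hom L L"
  unfolding tr_def using galois_groupD(8) finite_G
  by (intro add_hom_sum[OF abelian_group_axioms abelian_group_axioms]) auto

lemma tr_smult:
  assumes "e \<in> E" "z \<in> carrier L" shows "tr (e \<otimes> z) = e \<otimes> tr z"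
proof -
  have "g (e \<otimes> z) = e \<otimes> g z" if "g \<in> G" for g
    using assms E_car galois_groupD(3)[OF that] galois_groupD(5)[OF that] by simp
  then have "tr (e \<otimes> z) = (\<Oplus>g\<in>G. e \<otimes> g z)"
    unfolding tr_def using assms E_car galois_groupD(1) by (intro finsum_cong') auto
  also have "\<dots> = e \<otimes> tr z"
    unfolding tr_def using assms E_car galois_groupD(1) finite_G by (intro finsum_rdistr[symmetric]) auto
  finally show ?thesis .
qed

end

text \<open>The families are dual with respect to the trace form, and \<Sum> x_i \<otimes> y_i is
  the idempotent of the diagonal in L \<otimes>_E L. They replace a basis and its dual basis; linear
  independence is not demanded, so their length \<open>m\<close> may exceed the degree.\<close>

locale galois_dual = galois_sub +
  fixes m :: nat and x y :: "nat \<Rightarrow> 'a"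
  assumes x_car: "i < m \<Longrightarrow> x i \<in> carrier L" and y_car: "i < m \<Longrightarrow> y i \<in> carrier L"
    and dual: "g \<in> G \<Longrightarrow> (\<Oplus>i\<in>{..<m}. x i \<otimes> g (y i)) = (if g = (\<lambda>x\<in>carrier L. x) then \<one> else \<zero>)"
begin

lemma sum_xy: "(\<Oplus>i\<in>{..<m}. x i \<otimes> y i) = \<one>"
proof -
  have "(\<Oplus>i\<in>{..<m}. x i \<otimes> y i) = (\<Oplus>i\<in>{..<m}. x i \<otimes> (\<lambda>x\<in>carrier L. x) (y i))"
    using x_car y_car by (intro finsum_cong') auto
  then show ?thesis using dual[OF galois_id[OF E_sub]] by simp
qed

lemma sum_delta:
  assumes "\<And>g. g \<in> G \<Longrightarrow> f g \<in> carrier L"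
  shows "(\<Oplus>g\<in>G. (if g = (\<lambda>x\<in>carrier L. x) then \<one> else \<zero>) \<otimes> f g) = f (\<lambda>x\<in>carrier L. x)"
proof -
  let ?id = "\<lambda>x\<in>carrier L. x"
  have id: "?id \<in> G" by (rule galois_id[OF E_sub])
  have "(\<Oplus>g\<in>G. (if g = ?id then \<one> else \<zero>) \<otimes> f g) = (\<Oplus>g\<in>G. if ?id = g then f g else \<zero>)"
    using assms by (intro finsum_cong') auto
  also have "\<dots> = f ?id" using id finite_G assms by (intro add.finprod_singleton) auto
  finally show ?thesis .
qed

text \<open>Exchanging the sums over \<open>i\<close> and over the group leaves \<Sum>_g (\<Sum>_i
  x_i g(y_i)) g(z), and duality retains only the identity.\<close>

lemma expand_x:
  assumes z: "z \<in> carrier L" shows "(\<Oplus>i\<in>{..<m}. x i \<otimes> tr (y i \<otimes> z)) = z"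
proof -
  have c: "x i \<in> carrier L" "g (y i) \<in> carrier L" "g z \<in> carrier L" if "i < m" "g \<in> G" for i g
    using that x_car y_car galois_groupD(1)[OF that(2)] z by auto
  have gz: "g z \<in> carrier L" if "g \<in> G" for g using galois_groupD(1)[OF that z] .
  have "(\<Oplus>i\<in>{..<m}. x i \<otimes> tr (y i \<otimes> z)) = (\<Oplus>i\<in>{..<m}. \<Oplus>g\<in>G. x i \<otimes> g (y i) \<otimes> g z)"
  proof (intro finsum_cong' refl)
    fix i assume i: "i \<in> {..<m}"
    have "tr (y i \<otimes> z) = (\<Oplus>g\<in>G. g (y i) \<otimes> g z)"
      unfolding tr_def using i y_car z c galois_groupD(3) by (intro finsum_cong') auto
    then have "x i \<otimes> tr (y i \<otimes> z) = (\<Oplus>g\<in>G. x i \<otimes> (g (y i) \<otimes> g z))"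
      using i c x_car finite_G by (simp, intro finsum_rdistr) auto
    also have "\<dots> = (\<Oplus>g\<in>G. x i \<otimes> g (y i) \<otimes> g z)"
      using i c by (intro finsum_cong') (auto simp: m_assoc)
    finally show "x i \<otimes> tr (y i \<otimes> z) = (\<Oplus>g\<in>G. x i \<otimes> g (y i) \<otimes> g z)" .
  qed (use c in \<open>auto intro!: finsum_closed\<close>)
  also have "\<dots> = (\<Oplus>g\<in>G. \<Oplus>i\<in>{..<m}. x i \<otimes> g (y i) \<otimes> g z)"
    using c finite_G by (intro finsum_swap) auto
  also have "\<dots> = (\<Oplus>g\<in>G. (if g = (\<lambda>x\<in>carrier L. x) then \<one> else \<zero>) \<otimes> g z)"
  proof (intro finsum_cong' refl)
    fix g assume g: "g \<in> G"
    have "(\<Oplus>i\<in>{..<m}. x i \<otimes> g (y i) \<otimes> g z) = (\<Oplus>i\<in>{..<m}. x i \<otimes> g (y i)) \<otimes> g z"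
      using c gz g by (intro finsum_ldistr[symmetric]) auto
    then show "(\<Oplus>i\<in>{..<m}. x i \<otimes> g (y i) \<otimes> g z) = (if g = (\<lambda>x\<in>carrier L. x) then \<one> else \<zero>) \<otimes> g z"
      using dual[OF g] by simp
  qed (use gz in auto)
  also have "\<dots> = z" using sum_delta[of "\<lambda>g. g z"] gz z by simp
  finally show ?thesis .
qed

text \<open>Apply \<open>g\<close> to the duality relation of the group element g^-1 h.\<close>

lemma dual_pair:
  assumes g: "g \<in> G" and h: "h \<in> G"
  shows "(\<Oplus>i\<in>{..<m}. g (x i) \<otimes> h (y i)) = (if g = h then \<one> else \<zero>)"
proof -
  let ?c = "compose (carrier L) (ginv g) h" and ?id = "\<lambda>x\<in>carrier L. x"
  note gi = galois_inv[OF E_sub g] and gD = galois_groupD[OF g] and hD = galois_groupD[OF h]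
  have c: "?c \<in> G" by (rule galois_compose[OF E_sub gi(1) h])
  note cD = galois_groupD[OF c]
  have gc: "g (?c z) = h z" if "z \<in> carrier L" for z
    using gi(3)[OF hD(1)[OF that]] that by (simp add: compose_eq)
  have "?c = ?id \<longleftrightarrow> g = h"
  proof
    assume c_id: "?c = ?id"
    have "g z = h z" if z: "z \<in> carrier L" for z using gc[OF z] z unfolding c_id by simp
    then show "g = h" using extensionalityI[OF gD(6) hD(6)] by blast
  next
    assume "g = h"
    then have "?c z = ?id z" if "z \<in> carrier L" for z using gi(2)[OF that] that by (simp add: compose_eq)
    then show "?c = ?id" using extensionalityI[OF cD(6) restrict_extensional] by blast
  qed
  then have "(if g = h then \<one> else \<zero>) = g (\<Oplus>i\<in>{..<m}. x i \<otimes> ?c (y i))"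
    unfolding dual[OF c] using gD(4,9) hD(4) by simp
  also have "\<dots> = (\<Oplus>i\<in>{..<m}. g (x i \<otimes> ?c (y i)))"
    using x_car y_car cD(1)
    by (intro add_hom_finsum[OF abelian_group_axioms abelian_group_axioms gD(8)]) auto
  also have "\<dots> = (\<Oplus>i\<in>{..<m}. g (x i) \<otimes> h (y i))"
    using x_car y_car gD(1,3) hD(1) cD(1) gc by (intro finsum_cong') auto
  finally show ?thesis ..
qed

text \<open>Duality is symmetric in the two families, so every statement proved for
  \<open>x\<close>, \<open>y\<close> also holds for \<open>y\<close>, \<open>x\<close>; this gives
  the second expansion \<open>expand_y\<close>.\<close>

lemma dual_swap:
  assumes g: "g \<in> G"
  shows "(\<Oplus>i\<in>{..<m}. y i \<otimes> g (x i)) = (if g = (\<lambda>x\<in>carrier L. x) then \<one> else \<zero>)"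
proof -
  have "(\<Oplus>i\<in>{..<m}. y i \<otimes> g (x i)) = (\<Oplus>i\<in>{..<m}. g (x i) \<otimes> (\<lambda>x\<in>carrier L. x) (y i))"
    using x_car y_car galois_groupD(1)[OF g] by (intro finsum_cong') (auto simp: m_comm)
  then show ?thesis using dual_pair[OF g galois_id[OF E_sub]] by simp
qed

lemma swapped: "galois_dual L k E m y x"
  using galois_sub_axioms x_car y_car dual_swap by (simp add: galois_dual_def galois_dual_axioms_def)

lemmas expand_y = galois_dual.expand_x[OF swapped]

end

section \<open>Extension of differential operators\<close>

lemma (in abelian_group) finsum_diff:
  assumes "f \<in> I \<rightarrow> carrier G" "g \<in> I \<rightarrow> carrier G"
  shows "(\<Oplus>i\<in>I. f i \<ominus> g i) = (\<Oplus>i\<in>I. f i) \<ominus> (\<Oplus>i\<in>I. g i)"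
proof -
  have c: "(\<lambda>i. f i \<ominus> g i) \<in> I \<rightarrow> carrier G" "(\<Oplus>i\<in>I. f i \<ominus> g i) \<in> carrier G" "(\<Oplus>i\<in>I. g i) \<in> carrier G"
    using assms by (auto intro!: finsum_closed)
  have "(\<Oplus>i\<in>I. f i) = (\<Oplus>i\<in>I. (f i \<ominus> g i) \<oplus> g i)"
    using assms by (intro finsum_cong') (auto simp: add_diff_cancel Pi_iff)
  also have "\<dots> = (\<Oplus>i\<in>I. f i \<ominus> g i) \<oplus> (\<Oplus>i\<in>I. g i)" by (rule finsum_addf[OF c(1) assms(2)])
  finally show ?thesis using c by (simp add: add_diff_cancel)
qed

context cring
begin

abbreviation com :: "('a \<Rightarrow> 'a) \<Rightarrow> 'a \<Rightarrow> 'a \<Rightarrow> 'a" where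
  "com P a \<equiv> (\<lambda>z. P (a \<otimes> z) \<ominus> a \<otimes> P z)"

lemma mult_add_hom: "a \<in> carrier R \<Longrightarrow> (\<lambda>z. a \<otimes> z) \<in> add_hom R R"
  by (intro add_homI) (auto simp: r_distr)

lemmas add_hom_com_closed = add_hom_uminus[OF abelian_group_axioms abelian_group_axioms]

lemma com_add_hom: "T \<in> add_hom R R \<Longrightarrow> a \<in> carrier R \<Longrightarrow> com T a \<in> add_hom R R"
  using add_hom_comp[OF mult_add_hom, of a T R] add_hom_comp[OF _ mult_add_hom, of T R a]
  by (intro add_hom_com_closed) auto

end

context galois_dual
begin

lemma scalars_LL: "scalars (carrier L) (carrier L)"
  and scalars_EL: "scalars E (carrier L)" and scalars_EE: "scalars E E"
  using subringE[OF subring_E] by (auto simp: scalars_def)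

text \<open>Action of \<Sum> x_i \<otimes> y_i on additive endomorphisms of \<open>L\<close>, the
  second factor acting before \<open>T\<close> and the first after it. For an
  \<open>E\<close>-linear \<open>T\<close> the result is \<open>L\<close>-linear. In general it
  trades commutators with \<open>E\<close> for commutators with \<open>L\<close>, one at a time, and
  therefore has to be iterated.\<close>

definition eps :: "('a \<Rightarrow> 'a) \<Rightarrow> 'a \<Rightarrow> 'a" where
  "eps T z = (\<Oplus>i\<in>{..<m}. x i \<otimes> T (y i \<otimes> z))"

lemma eps_cong: "(\<And>z. z \<in> carrier L \<Longrightarrow> T z = T' z) \<Longrightarrow> (\<And>z. z \<in> carrier L \<Longrightarrow> T' z \<in> carrier L) \<Longrightarrow>
    z \<in> carrier L \<Longrightarrow> eps T z = eps T' z"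
  unfolding eps_def using x_car y_car by (intro finsum_cong') auto

lemma eps_add_hom: "T \<in> add_hom L L \<Longrightarrow> eps T \<in> add_hom L L"
  unfolding eps_def
proof (rule add_hom_sum[OF abelian_group_axioms abelian_group_axioms])
  fix i assume "T \<in> add_hom L L" "i \<in> {..<m}"
  then show "(\<lambda>z. x i \<otimes> T (y i \<otimes> z)) \<in> add_hom L L"
    using x_car y_car mult_add_hom by (intro add_hom_comp[OF add_hom_comp[OF mult_add_hom]]) auto
qed simp

lemma eps_pow_add_hom: "T \<in> add_hom L L \<Longrightarrow> (eps ^^ n) T \<in> add_hom L L"
  by (induction n) (auto intro: eps_add_hom)

text \<open>Multiplication by \<open>a\<close> commutes with the multiplications by
  \<open>x i\<close> and \<open>y i\<close>, so taking the commutator with \<open>a\<close> and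
  averaging can be exchanged.\<close>

lemma com_eps:
  assumes T: "T \<in> add_hom L L" and az: "a \<in> carrier L" "z \<in> carrier L"
  shows "com (eps T) a z = eps (com T a) z"
proof -
  have Tc: "T w \<in> carrier L" if "w \<in> carrier L" for w using add_hom_closed[OF T that] .
  have c: "x i \<in> carrier L" "y i \<in> carrier L" "T (y i \<otimes> z) \<in> carrier L" "T (a \<otimes> (y i \<otimes> z)) \<in> carrier L"
    "y i \<otimes> (a \<otimes> z) = a \<otimes> (y i \<otimes> z)" if "i < m" for i
    using that x_car y_car az Tc by (auto simp: m_lcomm)
  have "eps (com T a) z = (\<Oplus>i\<in>{..<m}. x i \<otimes> T (a \<otimes> (y i \<otimes> z)) \<ominus> a \<otimes> (x i \<otimes> T (y i \<otimes> z)))"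
    unfolding eps_def
  proof (intro finsum_cong' refl)
    fix i assume "i \<in> {..<m}"
    then have "x i \<in> carrier L" "T (y i \<otimes> z) \<in> carrier L" "T (a \<otimes> (y i \<otimes> z)) \<in> carrier L" using c by auto
    then show "x i \<otimes> (T (a \<otimes> (y i \<otimes> z)) \<ominus> a \<otimes> T (y i \<otimes> z)) =
        x i \<otimes> T (a \<otimes> (y i \<otimes> z)) \<ominus> a \<otimes> (x i \<otimes> T (y i \<otimes> z))" using az by algebra
  qed (use c az in auto)
  also have "\<dots> = (\<Oplus>i\<in>{..<m}. x i \<otimes> T (a \<otimes> (y i \<otimes> z))) \<ominus> (\<Oplus>i\<in>{..<m}. a \<otimes> (x i \<otimes> T (y i \<otimes> z)))"
    using c az by (intro finsum_diff) auto
  also have "(\<Oplus>i\<in>{..<m}. x i \<otimes> T (a \<otimes> (y i \<otimes> z))) = eps T (a \<otimes> z)"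
    unfolding eps_def using c by (intro finsum_cong') auto
  also have "(\<Oplus>i\<in>{..<m}. a \<otimes> (x i \<otimes> T (y i \<otimes> z))) = a \<otimes> eps T z"
    unfolding eps_def using c az by (intro finsum_rdistr[symmetric]) auto
  finally show ?thesis by simp
qed

lemma com_eps_pow:
  assumes T: "T \<in> add_hom L L" and a: "a \<in> carrier L"
  shows "z \<in> carrier L \<Longrightarrow> com ((eps ^^ n) T) a z = (eps ^^ n) (com T a) z"
proof (induction n arbitrary: z)
  case (Suc n)
  have "com ((eps ^^ Suc n) T) a z = eps (com ((eps ^^ n) T) a) z"
    using com_eps[OF eps_pow_add_hom[OF T, of n] a Suc.prems] by simp
  also have "\<dots> = eps ((eps ^^ n) (com T a)) z"
    using Suc add_hom_closed[OF eps_pow_add_hom[OF com_add_hom[OF T a]]] by (intro eps_cong) auto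
  finally show ?case by simp
qed simp

text \<open>The element \<open>a \<otimes> 1 - 1 \<otimes> a\<close> multiplied by the idempotent of the diagonal in \<open>L \<otimes>\<^sub>E L\<close>
  vanishes, so that the commutator with \<open>a\<close> is a combination of commutators with elements of \<open>E\<close>.\<close>

lemma ord_less_com_eps:
  assumes T: "T \<in> add_hom L L" and ord: "ord_less L E (carrier L) (Suc n) T" and a: "a \<in> carrier L"
  shows "ord_less L E (carrier L) n (com (eps T) a)"
proof -
  \<comment> \<open>One matrix serves both expansions y_i a = \<Sum>_j y_j c_ij and a x_j = \<Sum>_i
    x_i c_ij, because its entries are values of the symmetric trace form. Comparing the two gives
    [eps T, a](z) = \<Sum>_ij x_i [T, c_ij](y_j z).\<close>
  define c where "c i j = tr (x j \<otimes> (y i \<otimes> a))" for i j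
  have cE: "c i j \<in> E" and cL: "c i j \<in> carrier L" if "i < m" "j < m" for i j
    using that x_car y_car a tr_closed E_car by (auto simp: c_def)
  have Tc: "T w \<in> carrier L" if "w \<in> carrier L" for w using add_hom_closed[OF T that] .
  have eq: "com (eps T) a z = (\<Oplus>i\<in>{..<m}. \<Oplus>j\<in>{..<m}. x i \<otimes> com T (c i j) (y j \<otimes> z))"
    if z: "z \<in> carrier L" for z
  proof -
    have car: "x i \<in> carrier L" "T (y j \<otimes> z) \<in> carrier L" "T (c i j \<otimes> (y j \<otimes> z)) \<in> carrier L"
      "c i j \<in> carrier L" "y j \<in> carrier L" if "i < m" "j < m" for i j
      using that x_car y_car cL Tc z by auto
    have T1: "T (y i \<otimes> (a \<otimes> z)) = (\<Oplus>j\<in>{..<m}. T (c i j \<otimes> (y j \<otimes> z)))" if i: "i < m" for i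
    proof -
      have "y i \<otimes> (a \<otimes> z) = (y i \<otimes> a) \<otimes> z" using i y_car a z by (simp add: m_assoc)
      also have "y i \<otimes> a = (\<Oplus>j\<in>{..<m}. y j \<otimes> c i j)"
        using expand_y[of "y i \<otimes> a"] i y_car a by (simp add: c_def)
      also have "\<dots> \<otimes> z = (\<Oplus>j\<in>{..<m}. y j \<otimes> c i j \<otimes> z)"
        using car i z by (intro finsum_ldistr) auto
      also have "\<dots> = (\<Oplus>j\<in>{..<m}. c i j \<otimes> (y j \<otimes> z))"
        using car i z by (intro finsum_cong') (auto simp: m_ac)
      finally have *: "y i \<otimes> (a \<otimes> z) = (\<Oplus>j\<in>{..<m}. c i j \<otimes> (y j \<otimes> z))" .
      show ?thesis unfolding *
        using car i z by (intro add_hom_finsum[OF abelian_group_axioms abelian_group_axioms T]) auto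
    qed
    have ax: "a \<otimes> x j = (\<Oplus>i\<in>{..<m}. x i \<otimes> c i j)" if j: "j < m" for j
    proof -
      have "(\<Oplus>i\<in>{..<m}. x i \<otimes> c i j) = (\<Oplus>i\<in>{..<m}. x i \<otimes> tr (y i \<otimes> (a \<otimes> x j)))"
        using car(1) cL j x_car y_car a tr_car by (intro finsum_cong') (auto simp: c_def m_ac)
      then show ?thesis using expand_x[of "a \<otimes> x j"] j x_car a by simp
    qed
    have 1: "eps T (a \<otimes> z) = (\<Oplus>i\<in>{..<m}. \<Oplus>j\<in>{..<m}. x i \<otimes> T (c i j \<otimes> (y j \<otimes> z)))"
      unfolding eps_def
    proof (intro finsum_cong' refl)
      fix i assume i: "i \<in> {..<m}"
      show "x i \<otimes> T (y i \<otimes> (a \<otimes> z)) = (\<Oplus>j\<in>{..<m}. x i \<otimes> T (c i j \<otimes> (y j \<otimes> z)))"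
        using i car T1 by (simp, intro finsum_rdistr) auto
    qed (use car in \<open>auto intro!: finsum_closed\<close>)
    have "a \<otimes> eps T z = (\<Oplus>j\<in>{..<m}. a \<otimes> (x j \<otimes> T (y j \<otimes> z)))"
      unfolding eps_def using car a by (intro finsum_rdistr) auto
    also have "\<dots> = (\<Oplus>j\<in>{..<m}. \<Oplus>i\<in>{..<m}. x i \<otimes> (c i j \<otimes> T (y j \<otimes> z)))"
    proof (intro finsum_cong' refl)
      fix j assume j: "j \<in> {..<m}"
      have "a \<otimes> (x j \<otimes> T (y j \<otimes> z)) = (\<Oplus>i\<in>{..<m}. x i \<otimes> c i j) \<otimes> T (y j \<otimes> z)"
        using j car a ax by (simp add: m_assoc[symmetric])
      also have "\<dots> = (\<Oplus>i\<in>{..<m}. x i \<otimes> c i j \<otimes> T (y j \<otimes> z))"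
        using j car by (intro finsum_ldistr) auto
      also have "\<dots> = (\<Oplus>i\<in>{..<m}. x i \<otimes> (c i j \<otimes> T (y j \<otimes> z)))"
        using j car by (intro finsum_cong') (auto simp: m_assoc)
      finally show "a \<otimes> (x j \<otimes> T (y j \<otimes> z)) = \<dots>" .
    qed (use car in \<open>auto intro!: finsum_closed\<close>)
    also have "\<dots> = (\<Oplus>i\<in>{..<m}. \<Oplus>j\<in>{..<m}. x i \<otimes> (c i j \<otimes> T (y j \<otimes> z)))"
      using car by (intro finsum_swap) auto
    finally have "com (eps T) a z = (\<Oplus>i\<in>{..<m}. \<Oplus>j\<in>{..<m}. x i \<otimes> T (c i j \<otimes> (y j \<otimes> z))) \<ominus>
        (\<Oplus>i\<in>{..<m}. \<Oplus>j\<in>{..<m}. x i \<otimes> (c i j \<otimes> T (y j \<otimes> z)))" using 1 by simp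
    also have "\<dots> = (\<Oplus>i\<in>{..<m}. (\<Oplus>j\<in>{..<m}. x i \<otimes> T (c i j \<otimes> (y j \<otimes> z))) \<ominus>
        (\<Oplus>j\<in>{..<m}. x i \<otimes> (c i j \<otimes> T (y j \<otimes> z))))"
      using car by (intro finsum_diff[symmetric]) (auto intro!: finsum_closed)
    also have "\<dots> = (\<Oplus>i\<in>{..<m}. \<Oplus>j\<in>{..<m}. x i \<otimes> com T (c i j) (y j \<otimes> z))"
    proof (intro finsum_cong' refl)
      fix i assume i: "i \<in> {..<m}"
      have "(\<Oplus>j\<in>{..<m}. x i \<otimes> com T (c i j) (y j \<otimes> z)) =
          (\<Oplus>j\<in>{..<m}. x i \<otimes> T (c i j \<otimes> (y j \<otimes> z)) \<ominus> x i \<otimes> (c i j \<otimes> T (y j \<otimes> z)))"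
      proof (intro finsum_cong' refl)
        fix j assume "j \<in> {..<m}"
        then have "x i \<in> carrier L" "T (y j \<otimes> z) \<in> carrier L" "T (c i j \<otimes> (y j \<otimes> z)) \<in> carrier L"
          "c i j \<in> carrier L" using car i by auto
        then show "x i \<otimes> com T (c i j) (y j \<otimes> z) = x i \<otimes> T (c i j \<otimes> (y j \<otimes> z)) \<ominus> x i \<otimes> (c i j \<otimes> T (y j \<otimes> z))"
          by algebra
      qed (use car i in auto)
      also have "\<dots> = (\<Oplus>j\<in>{..<m}. x i \<otimes> T (c i j \<otimes> (y j \<otimes> z))) \<ominus> (\<Oplus>j\<in>{..<m}. x i \<otimes> (c i j \<otimes> T (y j \<otimes> z)))"
        using car i by (intro finsum_diff) auto
      finally show "(\<Oplus>j\<in>{..<m}. x i \<otimes> T (c i j \<otimes> (y j \<otimes> z))) \<ominus> (\<Oplus>j\<in>{..<m}. x i \<otimes> (c i j \<otimes> T (y j \<otimes> z))) =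
          (\<Oplus>j\<in>{..<m}. x i \<otimes> com T (c i j) (y j \<otimes> z))" by simp
    qed (use car in \<open>auto intro!: finsum_closed\<close>)
    finally show ?thesis .
  qed
  have comc: "com T (c i j) w \<in> carrier L" if "i < m" "j < m" "w \<in> carrier L" for i j w
    using cL Tc that by auto
  have ord1: "ord_less L E (carrier L) n (\<lambda>z. x i \<otimes> com T (c i j) (y j \<otimes> z))" if ij: "i < m" "j < m" for i j
  proof (rule ord_less_smult[OF scalars_EL x_car[OF ij(1)]])
    have "ord_less L E (carrier L) n (com T (c i j))" using ord cE[OF ij] by simp
    then show "ord_less L E (carrier L) n (\<lambda>z. com T (c i j) (y j \<otimes> z))"
      by (rule ord_less_mult_arg[OF scalars_EL y_car[OF ij(2)], rotated]) (use y_car[OF ij(2)] in simp)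
  qed (use comc y_car ij in auto)
  have "ord_less L E (carrier L) n (\<lambda>z. \<Oplus>i\<in>{..<m}. \<Oplus>j\<in>{..<m}. x i \<otimes> com T (c i j) (y j \<otimes> z))"
  proof (intro ord_less_finsum[OF scalars_EL] finite_lessThan)
    fix i assume i: "i \<in> {..<m}"
    show "(\<lambda>z. \<Oplus>j\<in>{..<m}. x i \<otimes> com T (c i j) (y j \<otimes> z)) \<in> carrier L \<rightarrow> carrier L"
      using comc y_car x_car i by (auto intro!: finsum_closed)
    fix j assume j: "j \<in> {..<m}"
    show "(\<lambda>z. x i \<otimes> com T (c i j) (y j \<otimes> z)) \<in> carrier L \<rightarrow> carrier L"
      using comc y_car x_car i j by auto
    show "ord_less L E (carrier L) n (\<lambda>z. x i \<otimes> com T (c i j) (y j \<otimes> z))" using ord1 i j by simp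
  qed
  then show ?thesis by (rule ord_less_congD[OF _ scalars_EL]) (rule eq)
qed

text \<open>Each application of \<open>eps\<close> pays for replacing one commutator with
  \<open>E\<close> by one with \<open>L\<close>; the bound \<open>n\<close> counts commutators, so
  \<open>n\<close> applications are taken.\<close>

lemma ord_less_eps_pow:
  "T \<in> add_hom L L \<Longrightarrow> ord_less L E (carrier L) n T \<Longrightarrow> ord_less L (carrier L) (carrier L) n ((eps ^^ n) T)"
proof (induction n arbitrary: T)
  case (Suc n)
  have "ord_less L (carrier L) (carrier L) n (com ((eps ^^ Suc n) T) a)" if a: "a \<in> carrier L" for a
  proof -
    \<comment> \<open>The innermost application is spent on the commutator with \<open>a\<close>;
      the remaining \<open>n\<close> can be exchanged with it.\<close>
    have "ord_less L (carrier L) (carrier L) n ((eps ^^ n) (com (eps T) a))"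
      using ord_less_com_eps[OF Suc.prems a] com_add_hom[OF eps_add_hom[OF Suc.prems(1)] a] by (intro Suc.IH)
    then show ?thesis
    proof (rule ord_less_congD[OF _ scalars_LL])
      show "com ((eps ^^ Suc n) T) a z = (eps ^^ n) (com (eps T) a) z" if "z \<in> carrier L" for z
        using com_eps_pow[OF eps_add_hom[OF Suc.prems(1)] a that, of n] by (simp add: funpow_swap1)
    qed
  qed
  then show ?case by (subst ord_less.simps(2)) blast
qed simp

text \<open>Composition with the trace makes \<open>P\<close> an operator on \<open>L\<close>, and
  averaging restores \<open>P\<close> up to lower order. After the first average the defect is
  \<Sum> x_i [P, tr(y_i z)], of lower order; each further average keeps this because \<Sum> x_i y_i
  = 1. The factor \<open>z\<close> serves the induction; the result is applied with
  \<open>z = \<one>\<close>.\<close>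

lemma ord_less_eps_pow_tr:
  assumes P: "\<And>e. e \<in> E \<Longrightarrow> P e \<in> carrier L" and ord: "ord_less L E E (Suc N) P"
    and T: "(\<lambda>z. P (tr z)) \<in> add_hom L L"
  shows "z \<in> carrier L \<Longrightarrow>
    ord_less L E E N (\<lambda>e. (eps ^^ Suc n) (\<lambda>z. P (tr z)) (z \<otimes> e) \<ominus> z \<otimes> P e)"
proof (induction n arbitrary: z)
  case 0
  let ?t = "\<lambda>i. tr (y i \<otimes> z)"
  have tE: "?t i \<in> E" and tL: "?t i \<in> carrier L" if "i < m" for i
    using that y_car 0 tr_closed E_car by auto
  have te: "?t i \<otimes> e \<in> E" if "i < m" "e \<in> E" for i e using tE that subringE(6)[OF subring_E] by simp
  have comc: "com P (?t i) e \<in> carrier L" if "i < m" "e \<in> E" for i e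
    using P te tL that by simp
  have "ord_less L E E N (\<lambda>e. \<Oplus>i\<in>{..<m}. x i \<otimes> com P (?t i) e)"
  proof (intro ord_less_finsum[OF scalars_EE] ord_less_smult[OF scalars_EE] finite_lessThan)
    fix i assume "i \<in> {..<m}"
    then show "ord_less L E E N (com P (?t i))" using ord tE by simp
  qed (use x_car comc in auto)
  then show ?case
  proof (rule ord_less_congD[OF _ scalars_EE])
    fix e assume e: "e \<in> E"
    have te': "tr (y i \<otimes> (z \<otimes> e)) = ?t i \<otimes> e" if "i < m" for i
    proof -
      have "y i \<otimes> (z \<otimes> e) = e \<otimes> (y i \<otimes> z)" using that y_car 0 e E_car by (simp add: m_ac)
      then show ?thesis using tr_smult[OF e, of "y i \<otimes> z"] that y_car 0 e E_car tL by (simp add: m_comm)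
    qed
    have Pc: "P (?t i \<otimes> e) \<in> carrier L" "P e \<in> carrier L" if "i < m" for i using P te e that by auto
    have "z \<otimes> P e = (\<Oplus>i\<in>{..<m}. x i \<otimes> ?t i) \<otimes> P e" using expand_x[OF 0] by simp
    also have "\<dots> = (\<Oplus>i\<in>{..<m}. x i \<otimes> ?t i \<otimes> P e)"
      using x_car tL P[OF e] by (intro finsum_ldistr) auto
    finally have z: "z \<otimes> P e = (\<Oplus>i\<in>{..<m}. x i \<otimes> ?t i \<otimes> P e)" .
    have "eps (\<lambda>z. P (tr z)) (z \<otimes> e) = (\<Oplus>i\<in>{..<m}. x i \<otimes> P (?t i \<otimes> e))"
      unfolding eps_def using x_car Pc te' by (intro finsum_cong') auto
    then have "(eps ^^ Suc 0) (\<lambda>z. P (tr z)) (z \<otimes> e) \<ominus> z \<otimes> P e =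
        (\<Oplus>i\<in>{..<m}. x i \<otimes> P (?t i \<otimes> e)) \<ominus> (\<Oplus>i\<in>{..<m}. x i \<otimes> ?t i \<otimes> P e)" using z by simp
    also have "\<dots> = (\<Oplus>i\<in>{..<m}. x i \<otimes> P (?t i \<otimes> e) \<ominus> x i \<otimes> ?t i \<otimes> P e)"
      using x_car Pc tL P[OF e] by (intro finsum_diff[symmetric]) auto
    also have "\<dots> = (\<Oplus>i\<in>{..<m}. x i \<otimes> com P (?t i) e)"
    proof (intro finsum_cong' refl)
      fix i assume "i \<in> {..<m}"
      then have "x i \<in> carrier L" "P (?t i \<otimes> e) \<in> carrier L" "P e \<in> carrier L" "?t i \<in> carrier L"
        using x_car Pc tL by auto
      then show "x i \<otimes> P (?t i \<otimes> e) \<ominus> x i \<otimes> ?t i \<otimes> P e = x i \<otimes> com P (?t i) e" by algebra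
    qed (use x_car comc e in auto)
    finally show "(eps ^^ Suc 0) (\<lambda>z. P (tr z)) (z \<otimes> e) \<ominus> z \<otimes> P e = \<dots>" .
  qed
next
  case (Suc n)
  let ?U = "(eps ^^ Suc n) (\<lambda>z. P (tr z))"
  have Uc: "?U w \<in> carrier L" if "w \<in> carrier L" for w
    using add_hom_closed[OF eps_pow_add_hom[OF T] that] .
  have c: "x i \<in> carrier L" "y i \<otimes> z \<in> carrier L" if "i < m" for i using that x_car y_car Suc.prems by auto
  have dc: "?U ((y i \<otimes> z) \<otimes> e) \<ominus> (y i \<otimes> z) \<otimes> P e \<in> carrier L" if "i < m" "e \<in> E" for i e
    using that Uc[of "(y i \<otimes> z) \<otimes> e"] c P E_car by simp
  have "ord_less L E E N (\<lambda>e. \<Oplus>i\<in>{..<m}. x i \<otimes> (?U ((y i \<otimes> z) \<otimes> e) \<ominus> (y i \<otimes> z) \<otimes> P e))"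
    using c dc Suc.IH by (intro ord_less_finsum[OF scalars_EE] ord_less_smult[OF scalars_EE] finite_lessThan) auto
  then show ?case
  proof (rule ord_less_congD[OF _ scalars_EE])
    fix e assume e: "e \<in> E"
    have Ue: "?U ((y i \<otimes> z) \<otimes> e) \<in> carrier L" if "i < m" for i
      using that c e E_car by (intro Uc) auto
    have "z \<otimes> P e = (\<Oplus>i\<in>{..<m}. x i \<otimes> y i) \<otimes> (z \<otimes> P e)" using sum_xy Suc.prems P[OF e] by simp
    also have "\<dots> = (\<Oplus>i\<in>{..<m}. x i \<otimes> y i \<otimes> (z \<otimes> P e))"
      using x_car y_car Suc.prems P[OF e] by (intro finsum_ldistr) auto
    also have "\<dots> = (\<Oplus>i\<in>{..<m}. x i \<otimes> ((y i \<otimes> z) \<otimes> P e))"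
      using x_car y_car Suc.prems P[OF e] by (intro finsum_cong') (auto simp: m_assoc)
    finally have z: "z \<otimes> P e = (\<Oplus>i\<in>{..<m}. x i \<otimes> ((y i \<otimes> z) \<otimes> P e))" .
    have "eps ?U (z \<otimes> e) = (\<Oplus>i\<in>{..<m}. x i \<otimes> ?U ((y i \<otimes> z) \<otimes> e))"
      unfolding eps_def[of ?U "z \<otimes> e"] using x_car y_car Suc.prems e E_car Ue by (intro finsum_cong') (auto simp: m_assoc)
    then have "(eps ^^ Suc (Suc n)) (\<lambda>z. P (tr z)) (z \<otimes> e) \<ominus> z \<otimes> P e =
        (\<Oplus>i\<in>{..<m}. x i \<otimes> ?U ((y i \<otimes> z) \<otimes> e)) \<ominus> (\<Oplus>i\<in>{..<m}. x i \<otimes> ((y i \<otimes> z) \<otimes> P e))" using z by simp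
    also have "\<dots> = (\<Oplus>i\<in>{..<m}. x i \<otimes> ?U ((y i \<otimes> z) \<otimes> e) \<ominus> x i \<otimes> ((y i \<otimes> z) \<otimes> P e))"
      using c Ue P[OF e] by (intro finsum_diff[symmetric]) auto
    also have "\<dots> = (\<Oplus>i\<in>{..<m}. x i \<otimes> (?U ((y i \<otimes> z) \<otimes> e) \<ominus> (y i \<otimes> z) \<otimes> P e))"
    proof (intro finsum_cong' refl)
      fix i assume i: "i \<in> {..<m}"
      have "x i \<in> carrier L" "?U ((y i \<otimes> z) \<otimes> e) \<in> carrier L" "(y i \<otimes> z) \<otimes> P e \<in> carrier L"
        using c Ue P[OF e] i by auto
      then show "x i \<otimes> ?U ((y i \<otimes> z) \<otimes> e) \<ominus> x i \<otimes> ((y i \<otimes> z) \<otimes> P e) =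
          x i \<otimes> (?U ((y i \<otimes> z) \<otimes> e) \<ominus> (y i \<otimes> z) \<otimes> P e)" by (simp add: minus_eq r_distr r_minus)
    qed (use c dc e in auto)
    finally show "(eps ^^ Suc (Suc n)) (\<lambda>z. P (tr z)) (z \<otimes> e) \<ominus> z \<otimes> P e = \<dots>" .
  qed
qed

text \<open>Induction on the order. With \<open>N + 1\<close> averages the composite of
  \<open>P\<close> with the trace becomes a differential operator of \<open>L\<close> whose
  restriction to \<open>E\<close> differs from \<open>P\<close> by an operator of lower order; this
  difference is extended by induction and subtracted. The difference takes values in
  \<open>L\<close>, so \<open>P\<close> is allowed to do so as well.\<close>

lemma extend_operator:
  assumes P: "\<And>e. e \<in> E \<Longrightarrow> P e \<in> carrier L" "\<And>e f. e \<in> E \<Longrightarrow> f \<in> E \<Longrightarrow> P (e \<oplus> f) = P e \<oplus> P f"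
    "ord_less L E E n P"
  shows "\<exists>Q\<in>add_hom L L. ord_less L (carrier L) (carrier L) n Q \<and> (\<forall>e\<in>E. Q e = P e)"
  using P
proof (induction n arbitrary: P)
  case 0
  then show ?case by (intro bexI[of _ "\<lambda>z. \<zero>"] add_homI) auto
next
  case (Suc N)
  note P = Suc.prems
  let ?T = "\<lambda>z. P (tr z)"
  have T: "?T \<in> add_hom L L"
    using P(1,2) tr_closed add_hom_add[OF tr_add_hom] by (intro add_homI) auto
  \<comment> \<open>The trace is \<open>E\<close>-linear, so commutators with \<open>E\<close> pass
    through it, and the bound for \<open>P\<close> on \<open>E\<close> becomes one for the composite
    on \<open>L\<close>.\<close>
  have ordT: "ord_less L E (carrier L) n (\<lambda>z. P' (tr z))" if "ord_less L E E n P'" for n P'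
    using that
  proof (induction n arbitrary: P')
    case 0
    then show ?case using tr_closed by simp
  next
    case (Suc n)
    have h: "ord_less L E (carrier L) n (\<lambda>z. com P' a (tr z))" if "a \<in> E" for a
      using Suc.IH[of "com P' a"] Suc.prems that by simp
    have "ord_less L E (carrier L) n (\<lambda>z. P' (tr (a \<otimes> z)) \<ominus> a \<otimes> P' (tr z))" if a: "a \<in> E" for a
      by (rule ord_less_congD[OF h[OF a] scalars_EL]) (simp add: tr_smult[OF a])
    then show ?case by simp
  qed
  \<comment> \<open>One average for each of the \<open>Suc N\<close> commutators in the bound for
    \<open>P\<close>.\<close>
  let ?Q0 = "(eps ^^ Suc N) ?T"
  note Q0 = eps_pow_add_hom[OF T, of "Suc N"]
  have Q0o: "ord_less L (carrier L) (carrier L) (Suc N) ?Q0"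
    by (rule ord_less_eps_pow[OF T ordT[OF P(3)]])
  have Q0c: "?Q0 z \<in> carrier L" if "z \<in> carrier L" for z using add_hom_closed[OF Q0 that] .
  define P1 where "P1 e = ?Q0 e \<ominus> P e" for e
  have "ord_less L E E N (\<lambda>e. ?Q0 (\<one> \<otimes> e) \<ominus> \<one> \<otimes> P e)"
    by (rule ord_less_eps_pow_tr[OF P(1,3) T one_closed])
  then have "ord_less L E E N P1"
    by (rule ord_less_congD[OF _ scalars_EE]) (use P(1) E_car in \<open>simp add: P1_def\<close>)
  moreover have "P1 e \<in> carrier L" if "e \<in> E" for e using P(1)[OF that] Q0c E_car[OF that] by (simp add: P1_def)
  moreover have "P1 (e \<oplus> f) = P1 e \<oplus> P1 f" if "e \<in> E" "f \<in> E" for e f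
  proof -
    have "P e \<in> carrier L" "P f \<in> carrier L" "?Q0 e \<in> carrier L" "?Q0 f \<in> carrier L"
      using that P(1) Q0c E_car by auto
    moreover have "?Q0 (e \<oplus> f) = ?Q0 e \<oplus> ?Q0 f" using add_hom_add[OF Q0] that E_car by blast
    ultimately show ?thesis unfolding P1_def P(2)[OF that] by (simp only: minus_eq a_ac minus_add a_closed a_inv_closed)
  qed
  ultimately obtain Q1 where Q1: "Q1 \<in> add_hom L L" "ord_less L (carrier L) (carrier L) N Q1" "\<forall>e\<in>E. Q1 e = P1 e" using Suc.IH[of P1] by blast
  have Q1c: "Q1 z \<in> carrier L" if "z \<in> carrier L" for z using add_hom_closed[OF Q1(1) that] .
  have funs: "?Q0 \<in> carrier L \<rightarrow> carrier L" "Q1 \<in> carrier L \<rightarrow> carrier L" using Q0c Q1c by auto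
  show ?case
  proof (intro bexI conjI ballI)
    show "(\<lambda>z. ?Q0 z \<ominus> Q1 z) \<in> add_hom L L" by (rule add_hom_com_closed[OF Q0 Q1(1)])
    show "ord_less L (carrier L) (carrier L) (Suc N) (\<lambda>z. ?Q0 z \<ominus> Q1 z)"
      by (rule ord_less_diff[OF scalars_LL funs Q0o ord_less_Suc[OF scalars_LL funs(2) Q1(2)]])
    show "?Q0 e \<ominus> Q1 e = P e" if e: "e \<in> E" for e
    proof -
      have "?Q0 e \<in> carrier L" "P e \<in> carrier L" using e Q0c E_car P(1) by auto
      moreover have "Q1 e = ?Q0 e \<ominus> P e" using Q1(3) e by (simp add: P1_def)
      ultimately show ?thesis by (simp only: minus_eq minus_add minus_minus a_closed a_inv_closed r_neg1 r_neg2)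
    qed
  qed
qed

text \<open>A finite separable extension has no relative differential operators besides
  multiplications. By induction [Q, y_i] is multiplication by some c_i, and \<Sum> x_i [Q, y_i] =
  eps Q - Q. As \<open>Q\<close> is \<open>E\<close>-linear, \<open>eps Q\<close> is multiplication
  by its value at 1, so \<open>Q\<close> is multiplication by that value minus \<Sum> x_i
  c_i.\<close>

lemma linear_operator_mult:
  "Q \<in> add_hom L L \<Longrightarrow> (\<And>e z. e \<in> E \<Longrightarrow> z \<in> carrier L \<Longrightarrow> Q (e \<otimes> z) = e \<otimes> Q z) \<Longrightarrow>
    ord_less L (carrier L) (carrier L) n Q \<Longrightarrow> \<exists>c\<in>carrier L. \<forall>z\<in>carrier L. Q z = c \<otimes> z"
proof (induction n arbitrary: Q)
  case 0
  then show ?case by (intro bexI[of _ \<zero>]) auto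
next
  case (Suc n)
  note Q = Suc.prems(1)
  have Qc: "Q w \<in> carrier L" if "w \<in> carrier L" for w using add_hom_closed[OF Q that] .
  have "\<exists>c\<in>carrier L. \<forall>z\<in>carrier L. com Q (y i) z = c \<otimes> z" if i: "i < m" for i
  proof (rule Suc.IH)
    have yi: "y i \<in> carrier L" using y_car i .
    show "com Q (y i) \<in> add_hom L L" by (rule com_add_hom[OF Q yi])
    show "ord_less L (carrier L) (carrier L) n (com Q (y i))" using Suc.prems(3) yi by simp
    show "com Q (y i) (e \<otimes> z) = e \<otimes> com Q (y i) z" if "e \<in> E" "z \<in> carrier L" for e z
    proof -
      have c: "e \<in> carrier L" "Q z \<in> carrier L" "Q (y i \<otimes> z) \<in> carrier L" using that yi E_car Qc by auto
      have "y i \<otimes> (e \<otimes> z) = e \<otimes> (y i \<otimes> z)" using c(1) that yi by (simp add: m_lcomm)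
      then have "com Q (y i) (e \<otimes> z) = e \<otimes> Q (y i \<otimes> z) \<ominus> y i \<otimes> (e \<otimes> Q z)"
        using Suc.prems(2) that yi by simp
      also have "\<dots> = e \<otimes> com Q (y i) z" using c yi by algebra
      finally show ?thesis .
    qed
  qed
  then have "\<forall>i. \<exists>c. i < m \<longrightarrow> c \<in> carrier L \<and> (\<forall>z\<in>carrier L. com Q (y i) z = c \<otimes> z)" by blast
  then obtain c where c: "\<And>i. i < m \<Longrightarrow> c i \<in> carrier L"
    "\<And>i z. i < m \<Longrightarrow> z \<in> carrier L \<Longrightarrow> com Q (y i) z = c i \<otimes> z" by metis
  \<comment> \<open>Expand y_i z in the \<open>y j\<close> with coefficients in \<open>E\<close>,
    which \<open>Q\<close> lets through; summation over \<open>i\<close> then moves \<open>z\<close>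
    out of \<open>Q\<close>.\<close>
  have eps1: "eps Q z = z \<otimes> eps Q \<one>" if z: "z \<in> carrier L" for z
  proof -
    have car: "x i \<in> carrier L" "tr (x j \<otimes> (y i \<otimes> z)) \<in> carrier L" "Q (y j) \<in> carrier L" "y j \<in> carrier L"
      "tr (y i \<otimes> (x j \<otimes> z)) \<in> carrier L"
      if "i < m" "j < m" for i j using that x_car y_car z tr_car Qc by auto
    have "eps Q z = (\<Oplus>i\<in>{..<m}. \<Oplus>j\<in>{..<m}. x i \<otimes> tr (y i \<otimes> (x j \<otimes> z)) \<otimes> Q (y j))"
      unfolding eps_def
    proof (intro finsum_cong' refl)
      fix i assume i: "i \<in> {..<m}"
      have yz: "y i \<otimes> z \<in> carrier L" using i y_car z by simp
      have "Q (y i \<otimes> z) = Q (\<Oplus>j\<in>{..<m}. y j \<otimes> tr (x j \<otimes> (y i \<otimes> z)))" using expand_y[OF yz] by simp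
      also have "\<dots> = (\<Oplus>j\<in>{..<m}. Q (y j \<otimes> tr (x j \<otimes> (y i \<otimes> z))))"
        using car i by (intro add_hom_finsum[OF abelian_group_axioms abelian_group_axioms Q]) auto
      also have "\<dots> = (\<Oplus>j\<in>{..<m}. tr (y i \<otimes> (x j \<otimes> z)) \<otimes> Q (y j))"
      proof (intro finsum_cong' refl)
        fix j assume j: "j \<in> {..<m}"
        have e: "x j \<otimes> (y i \<otimes> z) = y i \<otimes> (x j \<otimes> z)" using i j x_car y_car z by (simp add: m_lcomm)
        have "Q (tr (x j \<otimes> (y i \<otimes> z)) \<otimes> y j) = tr (x j \<otimes> (y i \<otimes> z)) \<otimes> Q (y j)"
          using Suc.prems(2)[OF tr_closed y_car] j x_car yz by simp
        then show "Q (y j \<otimes> tr (x j \<otimes> (y i \<otimes> z))) = tr (y i \<otimes> (x j \<otimes> z)) \<otimes> Q (y j)"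
          using i j car e by (simp add: m_comm)
      qed (use car i in auto)
      finally have Qy: "Q (y i \<otimes> z) = \<dots>" .
      have "x i \<otimes> Q (y i \<otimes> z) = (\<Oplus>j\<in>{..<m}. x i \<otimes> (tr (y i \<otimes> (x j \<otimes> z)) \<otimes> Q (y j)))"
        unfolding Qy using car i by (intro finsum_rdistr) auto
      also have "\<dots> = (\<Oplus>j\<in>{..<m}. x i \<otimes> tr (y i \<otimes> (x j \<otimes> z)) \<otimes> Q (y j))"
        using car i by (intro finsum_cong') (auto simp: m_assoc)
      finally show "x i \<otimes> Q (y i \<otimes> z) = \<dots>" .
    qed (use car in \<open>auto intro!: finsum_closed\<close>)
    also have "\<dots> = (\<Oplus>j\<in>{..<m}. \<Oplus>i\<in>{..<m}. x i \<otimes> tr (y i \<otimes> (x j \<otimes> z)) \<otimes> Q (y j))"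
      using car by (intro finsum_swap) auto
    also have "\<dots> = (\<Oplus>j\<in>{..<m}. z \<otimes> (x j \<otimes> Q (y j \<otimes> \<one>)))"
    proof (intro finsum_cong' refl)
      fix j assume j: "j \<in> {..<m}"
      have "(\<Oplus>i\<in>{..<m}. x i \<otimes> tr (y i \<otimes> (x j \<otimes> z)) \<otimes> Q (y j)) = (\<Oplus>i\<in>{..<m}. x i \<otimes> tr (y i \<otimes> (x j \<otimes> z))) \<otimes> Q (y j)"
        using car j by (intro finsum_ldistr[symmetric]) auto
      also have "\<dots> = x j \<otimes> z \<otimes> Q (y j)" using expand_x[of "x j \<otimes> z"] j x_car z by simp
      finally show "(\<Oplus>i\<in>{..<m}. x i \<otimes> tr (y i \<otimes> (x j \<otimes> z)) \<otimes> Q (y j)) = z \<otimes> (x j \<otimes> Q (y j \<otimes> \<one>))"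
        using j car z by (simp add: m_ac)
    qed (use car z Qc in auto)
    also have "\<dots> = z \<otimes> eps Q \<one>"
      unfolding eps_def using car z Qc by (intro finsum_rdistr[symmetric]) auto
    finally show ?thesis .
  qed
  have e1: "eps Q \<one> \<in> carrier L" using add_hom_closed[OF eps_add_hom[OF Q]] by simp
  define s where "s = (\<Oplus>i\<in>{..<m}. x i \<otimes> c i)"
  have s: "s \<in> carrier L" unfolding s_def using x_car c by (intro finsum_closed) auto
  show ?case
  proof (intro bexI ballI)
    show "eps Q \<one> \<ominus> s \<in> carrier L" using e1 s by simp
    fix z assume z: "z \<in> carrier L"
    have car: "x i \<in> carrier L" "y i \<in> carrier L" "Q (y i \<otimes> z) \<in> carrier L" "Q z \<in> carrier L" "c i \<in> carrier L"
      if "i < m" for i using that x_car y_car Qc z c by auto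
    have "s \<otimes> z = (\<Oplus>i\<in>{..<m}. x i \<otimes> c i \<otimes> z)"
      unfolding s_def using car z by (intro finsum_ldistr) auto
    also have "\<dots> = (\<Oplus>i\<in>{..<m}. x i \<otimes> Q (y i \<otimes> z) \<ominus> x i \<otimes> y i \<otimes> Q z)"
    proof (intro finsum_cong' refl)
      fix i assume i: "i \<in> {..<m}"
      have "x i \<otimes> c i \<otimes> z = x i \<otimes> com Q (y i) z" using c(2)[of i z] car i z by (simp add: m_assoc)
      also have "\<dots> = x i \<otimes> Q (y i \<otimes> z) \<ominus> x i \<otimes> y i \<otimes> Q z"
        using car[of i] i by (simp add: minus_eq r_distr r_minus m_assoc)
      finally show "x i \<otimes> c i \<otimes> z = \<dots>" .
    qed (use car in auto)
    also have "\<dots> = eps Q z \<ominus> (\<Oplus>i\<in>{..<m}. x i \<otimes> y i \<otimes> Q z)"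
      unfolding eps_def using car by (intro finsum_diff) auto
    also have "(\<Oplus>i\<in>{..<m}. x i \<otimes> y i \<otimes> Q z) = (\<Oplus>i\<in>{..<m}. x i \<otimes> y i) \<otimes> Q z"
      using car Qc z by (intro finsum_ldistr[symmetric]) auto
    finally have "s \<otimes> z = z \<otimes> eps Q \<one> \<ominus> Q z" using sum_xy Qc[OF z] eps1[OF z] by simp
    then have "Q z = z \<otimes> eps Q \<one> \<ominus> s \<otimes> z"
      using Qc[OF z] z e1 by (simp add: minus_eq minus_add r_neg1 r_neg2)
    then show "Q z = (eps Q \<one> \<ominus> s) \<otimes> z" using z e1 s by algebra
  qed
qed

text \<open>This is the uniqueness of extensions. The commutators of \<open>Q\<close> with elements
  of \<open>E\<close> vanish on \<open>E\<close> as well and have smaller order, hence are zero by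
  induction. So \<open>Q\<close> is \<open>E\<close>-linear, therefore a multiplication, and its
  factor is \<open>Q \<one> = \<zero>\<close>.\<close>

lemma operator_eq_zero:
  "Q \<in> add_hom L L \<Longrightarrow> (\<And>e. e \<in> E \<Longrightarrow> Q e = \<zero>) \<Longrightarrow> ord_less L (carrier L) (carrier L) n Q \<Longrightarrow>
    z \<in> carrier L \<Longrightarrow> Q z = \<zero>"
proof (induction n arbitrary: Q z)
  case (Suc n)
  note Q = Suc.prems(1)
  note E' = subringE[OF subring_E]
  have "com Q e w = \<zero>" if e: "e \<in> E" and w: "w \<in> carrier L" for e w
  proof (rule Suc.IH[OF com_add_hom[OF Q E_car[OF e]] _ _ w])
    show "ord_less L (carrier L) (carrier L) n (com Q e)" using Suc.prems(3) E_car[OF e] by simp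
    show "com Q e f = \<zero>" if "f \<in> E" for f
      using Suc.prems(2) e E'(6) that E_car by (simp add: minus_eq)
  qed
  then have lin: "Q (e \<otimes> w) = e \<otimes> Q w" if "e \<in> E" "w \<in> carrier L" for e w
    using that add_hom_closed[OF Q] E_car by (simp add: minus_eq_zero_iff)
  obtain c where c: "c \<in> carrier L" "\<forall>z\<in>carrier L. Q z = c \<otimes> z"
    using linear_operator_mult[OF Q lin Suc.prems(3)] by blast
  have "c = \<zero>" using c Suc.prems(2)[OF E'(3)] by simp
  then show ?case using c(2) Suc.prems(4) by simp
qed simp

end

lemma carrier_update_self: "R\<lparr>carrier := carrier R\<rparr> = R"
  by simp

text \<open>The \<open>x i\<close> and the functionals \<open>\<phi> i\<close> replace a basis of \<open>F\<close> over \<open>E\<close>; the unique extension of operators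
  stands for the identification of the differential operators of \<open>F\<close> with \<open>F \<otimes>\<^sub>E D\<^sub>E\<close>.\<close>

locale etale_pair = cring L for L (structure) +
  fixes k E F :: "'a set" and m :: nat and x :: "nat \<Rightarrow> 'a" and \<phi> :: "nat \<Rightarrow> 'a \<Rightarrow> 'a"
  assumes subring_E: "subring E L" and subring_F: "subring F L" and E_F: "E \<subseteq> F" and k_E: "k \<subseteq> E"
    and x_F: "i < m \<Longrightarrow> x i \<in> F"
    and \<phi>_E: "i < m \<Longrightarrow> z \<in> F \<Longrightarrow> \<phi> i z \<in> E"
    and \<phi>_add: "i < m \<Longrightarrow> z \<in> F \<Longrightarrow> w \<in> F \<Longrightarrow> \<phi> i (z \<oplus> w) = \<phi> i z \<oplus> \<phi> i w"
    and \<phi>_smult: "i < m \<Longrightarrow> e \<in> E \<Longrightarrow> z \<in> F \<Longrightarrow> \<phi> i (e \<otimes> z) = e \<otimes> \<phi> i z"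
    and expand: "z \<in> F \<Longrightarrow> (\<Oplus>i\<in>{..<m}. x i \<otimes> \<phi> i z) = z"
    and ext_ex1: "P \<in> carrier (diff_ring k (L\<lparr>carrier := E\<rparr>)) \<Longrightarrow>
      \<exists>!Q. Q \<in> carrier (diff_ring k (L\<lparr>carrier := F\<rparr>)) \<and> (\<forall>e\<in>E. Q e = P e)"

section \<open>Conjugation by Galois automorphisms and the unique extension of operators\<close>

context field
begin

abbreviation conj_op :: "('a \<Rightarrow> 'a) \<Rightarrow> ('a \<Rightarrow> 'a) \<Rightarrow> 'a \<Rightarrow> 'a" where
  "conj_op g P \<equiv> compose (carrier R) (inv\<^bsub>BijGroup (carrier R)\<^esub> g) (compose (carrier R) P g)"

lemmas DL_D = diff_ringD[OF carrier_is_subring, unfolded carrier_update_self]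
lemmas DL_I = diff_ringI[OF carrier_is_subring, unfolded carrier_update_self]
lemmas DL_eqI = diff_ring_eqI[OF carrier_is_subring, unfolded carrier_update_self]
lemmas DL_ops = diff_ring_ops[where E = "carrier R", unfolded carrier_update_self]
lemmas DL_mult_op = mult_op_diff_ring[OF carrier_is_subring, unfolded carrier_update_self]

lemma DL_add_hom: "P \<in> carrier (diff_ring k R) \<Longrightarrow> P \<in> add_hom R R"
  by (rule add_homI) (simp_all add: DL_D)

end

context galois_sub
begin

lemma k_carrier: "k \<subseteq> carrier L" using k_car by auto

lemma conj_apply:
  assumes g: "g \<in> G" and P: "P \<in> carrier (diff_ring k L)" and z: "z \<in> carrier L"
  shows "conj_op g P z = ginv g (P (g z))" "g (conj_op g P z) = P (g z)"
proof -
  show *: "conj_op g P z = ginv g (P (g z))"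
    using z by (simp add: compose_eq)
  show "g (conj_op g P z) = P (g z)"
    unfolding * using galois_inv(3)[OF E_sub g] DL_D(2)[OF P] galois_groupD(1)[OF g z] by simp
qed

text \<open>The commutator of the conjugate with \<open>a\<close> is the conjugate of the commutator
  with \<open>g a\<close>, so the order is preserved. Linearity over \<open>k\<close> holds since
  \<open>g\<close> fixes \<open>E\<close> and thus \<open>k\<close>.\<close>

lemma conj_closed:
  assumes g: "g \<in> G" and P: "P \<in> carrier (diff_ring k L)"
  shows "conj_op g P \<in> carrier (diff_ring k L)"
proof -
  let ?h = "ginv g"
  note h = galois_inv[OF E_sub g]
  note gD = galois_groupD[OF g] and hD = galois_groupD[OF h(1)] and PD = DL_D[OF P]
  have sc: "scalars (carrier L) (carrier L)" by (simp add: scalars_def)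
  have ord: "ord_less L (carrier L) (carrier L) n (\<lambda>z. ?h (T (g z)))"
    if "ord_less L (carrier L) (carrier L) n T" "\<And>z. z \<in> carrier L \<Longrightarrow> T z \<in> carrier L" for n T
    using that
  proof (induction n arbitrary: T)
    case 0
    then show ?case using gD(1) hD(9) by simp
  next
    case (Suc n)
    have "ord_less L (carrier L) (carrier L) n (\<lambda>z. ?h (T (g (a \<otimes> z))) \<ominus> a \<otimes> ?h (T (g z)))"
      if a: "a \<in> carrier L" for a
    proof -
      have "ord_less L (carrier L) (carrier L) n (\<lambda>z. ?h (T (g a \<otimes> g z) \<ominus> g a \<otimes> T (g z)))"
        using Suc.prems gD(1)[OF a] by (intro Suc.IH[of "com T (g a)"]) auto
      then show ?thesis
      proof (rule ord_less_congD[OF _ sc])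
        fix z assume z: "z \<in> carrier L"
        have c: "g a \<in> carrier L" "g z \<in> carrier L" "T (g a \<otimes> g z) \<in> carrier L" "T (g z) \<in> carrier L"
          using a z gD(1) Suc.prems(2) by auto
        have "?h (T (g a \<otimes> g z) \<ominus> g a \<otimes> T (g z)) = ?h (T (g a \<otimes> g z)) \<ominus> ?h (g a) \<otimes> ?h (T (g z))"
          using c add_hom_diff[OF abelian_group_axioms abelian_group_axioms hD(8)] hD(3) by simp
        then show "?h (T (g (a \<otimes> z))) \<ominus> a \<otimes> ?h (T (g z)) = ?h (T (g a \<otimes> g z) \<ominus> g a \<otimes> T (g z))"
          using gD(3)[OF a z] h(2)[OF a] by simp
      qed
    qed
    then show ?case by (subst ord_less.simps(2)) blast
  qed
  obtain n where n: "ord_less L (carrier L) (carrier L) n P" using PD(5) by blast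
  have "restrict (\<lambda>z. ?h (P (g z))) (carrier L) \<in> carrier (diff_ring k L)"
  proof (rule DL_I[OF k_carrier])
    show "ord_less L (carrier L) (carrier L) n (\<lambda>z. ?h (P (g z)))" by (rule ord[OF n PD(2)])
    show "?h (P (g (c \<otimes> z))) = c \<otimes> ?h (P (g z))" if "c \<in> k" "z \<in> carrier L" for c z
    proof -
      have c: "c \<in> E" "c \<in> carrier L" using that k_sub k_car by auto
      show ?thesis using c that gD(1)[OF that(2)] gD(3,5) hD(3,5) PD(2,4) by simp
    qed
  qed (use gD(1,2) hD(1,2) PD(2,3) in auto)
  moreover have "restrict (\<lambda>z. ?h (P (g z))) (carrier L) = conj_op g P"
    by (auto simp: compose_def fun_eq_iff)
  ultimately show ?thesis by simp
qed

text \<open>Conjugation by \<open>g\<close> is a ring endomorphism of the operators, and the module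
  axioms pull back along it.\<close>

lemma left_module_twist:
  assumes g: "g \<in> G" and M: "left_module (diff_ring k L) M"
  shows "left_module (diff_ring k L) (twist L g M)"
proof -
  interpret M: left_module "diff_ring k L" M by fact
  note h = galois_inv[OF E_sub g]
  note gD = galois_groupD[OF g] and hD = galois_groupD[OF h(1)]
  note cc = conj_closed[OF g]
  have tw: "carrier (twist L g M) = carrier M" "\<zero>\<^bsub>twist L g M\<^esub> = \<zero>\<^bsub>M\<^esub>"
    "x \<oplus>\<^bsub>twist L g M\<^esub> y = x \<oplus>\<^bsub>M\<^esub> y" "P \<odot>\<^bsub>twist L g M\<^esub> x = conj_op g P \<odot>\<^bsub>M\<^esub> x" for x y P
    by (simp_all add: twist_def)
  have ag: "abelian_group (twist L g M)"
  proof (rule abelian_groupI)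
    show "\<exists>y\<in>carrier (twist L g M). y \<oplus>\<^bsub>twist L g M\<^esub> x = \<zero>\<^bsub>twist L g M\<^esub>" if "x \<in> carrier (twist L g M)" for x
      using that M.M.l_neg unfolding tw by (intro bexI[of _ "\<ominus>\<^bsub>M\<^esub> x"]) simp_all
  qed (simp_all add: tw M.M.a_ac)
  have add: "conj_op g (P \<oplus>\<^bsub>diff_ring k L\<^esub> Q) = conj_op g P \<oplus>\<^bsub>diff_ring k L\<^esub> conj_op g Q"
    if "P \<in> carrier (diff_ring k L)" "Q \<in> carrier (diff_ring k L)" for P Q
  proof (rule DL_eqI[OF cc[OF M.R.a_closed[OF that]] M.R.a_closed[OF cc[OF that(1)] cc[OF that(2)]]])
    fix z assume z: "z \<in> carrier L"
    show "conj_op g (P \<oplus>\<^bsub>diff_ring k L\<^esub> Q) z = (conj_op g P \<oplus>\<^bsub>diff_ring k L\<^esub> conj_op g Q) z"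
      using z conj_apply(1)[OF g that(1) z] conj_apply(1)[OF g that(2) z]
        conj_apply(1)[OF g M.R.a_closed[OF that] z] gD(1)[OF z] DL_D(2)[OF that(1)] DL_D(2)[OF that(2)]
      by (simp only: DL_ops hD(2))
  qed
  have mult: "conj_op g (P \<otimes>\<^bsub>diff_ring k L\<^esub> Q) = conj_op g P \<otimes>\<^bsub>diff_ring k L\<^esub> conj_op g Q"
    if "P \<in> carrier (diff_ring k L)" "Q \<in> carrier (diff_ring k L)" for P Q
  proof (rule DL_eqI[OF cc[OF M.R.m_closed[OF that]] M.R.m_closed[OF cc[OF that(1)] cc[OF that(2)]]])
    fix z assume z: "z \<in> carrier L"
    show "conj_op g (P \<otimes>\<^bsub>diff_ring k L\<^esub> Q) z = (conj_op g P \<otimes>\<^bsub>diff_ring k L\<^esub> conj_op g Q) z"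
      using z conj_apply(1)[OF g that(1) DL_D(2)[OF cc[OF that(2)] z]] conj_apply(2)[OF g that(2) z]
        conj_apply(1)[OF g M.R.m_closed[OF that] z] gD(1)[OF z]
      by (simp only: DL_ops)
  qed
  have one: "conj_op g \<one>\<^bsub>diff_ring k L\<^esub> = \<one>\<^bsub>diff_ring k L\<^esub>"
  proof (rule DL_eqI[OF cc[OF M.R.one_closed] M.R.one_closed])
    fix z assume z: "z \<in> carrier L"
    show "conj_op g \<one>\<^bsub>diff_ring k L\<^esub> z = \<one>\<^bsub>diff_ring k L\<^esub> z"
      using z conj_apply(1)[OF g M.R.one_closed z] gD(1)[OF z] h(2)[OF z] by (simp only: DL_ops)
  qed
  show ?thesis
  proof (intro left_module.intro M.R.ring_axioms ag left_module_axioms.intro)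
  qed (simp_all add: tw cc M.smult_closed M.smult_l_distr M.smult_r_distr M.smult_assoc M.smult_one add mult one
      del: compose_eq)
qed

end

context galois_dual
begin

text \<open>Existence comes from \<open>extend_operator\<close>, which knows nothing of
  \<open>k\<close>. Since an operator that vanishes on \<open>E\<close> is zero, commutators with
  elements of \<open>k\<close> vanish, which is linearity over \<open>k\<close>, and so does the
  difference of two extensions.\<close>

lemma ext_ex1:
  assumes P: "P \<in> carrier (diff_ring k (L\<lparr>carrier := E\<rparr>))"
  shows "\<exists>!Q. Q \<in> carrier (diff_ring k L) \<and> (\<forall>e\<in>E. Q e = P e)"
proof -
  note PD = diff_ringD[OF subring_E P]
  obtain n where n: "ord_less L E E n P" using PD(5) by blast
  obtain Q where Q: "Q \<in> add_hom L L" "ord_less L (carrier L) (carrier L) n Q" "\<forall>e\<in>E. Q e = P e"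
    using extend_operator[of P n] PD(2,3) E_car n by blast
  \<comment> \<open>On \<open>E\<close> the commutator of \<open>Q\<close> with \<open>c\<close> is
    that of \<open>P\<close>, which is zero by linearity over \<open>k\<close>; hence it is zero on
    \<open>L\<close>.\<close>
  have Qk: "Q (c \<otimes> z) = c \<otimes> Q z" if c: "c \<in> k" and z: "z \<in> carrier L" for c z
  proof -
    have cE: "c \<in> E" using c k_sub by blast
    note cL = E_car[OF cE]
    have Qc: "Q w \<in> carrier L" if "w \<in> carrier L" for w using add_hom_closed[OF Q(1) that] .
    have "ord_less L (carrier L) (carrier L) (Suc n) Q" using Qc by (intro ord_less_Suc[OF scalars_LL _ Q(2)]) auto
    then have "ord_less L (carrier L) (carrier L) n (com Q c)" using cL by simp
    moreover have "com Q c e = \<zero>" if e: "e \<in> E" for e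
      using Q(3) PD(4)[OF c e] e cE subringE(6)[OF subring_E] E_car PD(2)[OF e] cL by (simp add: minus_eq_zero_iff)
    ultimately have "com Q c z = \<zero>" using operator_eq_zero[OF com_add_hom[OF Q(1) cL] _ _ z] by blast
    then show ?thesis using Qc z cL by (simp add: minus_eq_zero_iff)
  qed
  have Q': "restrict Q (carrier L) \<in> carrier (diff_ring k L)"
    using Qk add_hom_closed[OF Q(1)] add_hom_add[OF Q(1)] by (intro DL_I[OF k_carrier _ _ _ Q(2)]) auto
  show ?thesis
  proof (rule ex1I[of _ "restrict Q (carrier L)"])
    show "restrict Q (carrier L) \<in> carrier (diff_ring k L) \<and> (\<forall>e\<in>E. restrict Q (carrier L) e = P e)"
      using Q' Q(3) E_car by simp
  next
    fix T assume T: "T \<in> carrier (diff_ring k L) \<and> (\<forall>e\<in>E. T e = P e)"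
    obtain n' where n': "ord_less L (carrier L) (carrier L) n' T" using DL_D(5) T by blast
    have Tc: "T z \<in> carrier L" and Qc: "Q z \<in> carrier L" if "z \<in> carrier L" for z
      using T DL_D(2) add_hom_closed[OF Q(1)] that by auto
    then have funs: "T \<in> carrier L \<rightarrow> carrier L" "Q \<in> carrier L \<rightarrow> carrier L" by auto
    have "ord_less L (carrier L) (carrier L) (n' + n) (\<lambda>z. T z \<ominus> Q z)"
      by (rule ord_less_diff[OF scalars_LL funs ord_less_le[OF scalars_LL funs(1) n']
            ord_less_le[OF scalars_LL funs(2) Q(2)]]) simp_all
    moreover have "(\<lambda>z. T z \<ominus> Q z) \<in> add_hom L L"
      by (rule add_hom_com_closed[OF DL_add_hom Q(1)]) (use T in blast)
    moreover have "T e \<ominus> Q e = \<zero>" if "e \<in> E" for e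
      using T Q(3) that E_car[OF PD(2)[OF that]] by (simp add: minus_eq_zero_iff)
    ultimately have "T z \<ominus> Q z = \<zero>" if "z \<in> carrier L" for z
      using operator_eq_zero[of "\<lambda>z. T z \<ominus> Q z"] that by blast
    then have "T z = Q z" if "z \<in> carrier L" for z using that Tc Qc by (simp add: minus_eq_zero_iff)
    then show "T = restrict Q (carrier L)" using T Q' by (intro DL_eqI) auto
  qed
qed

lemma etale_pair_top: "etale_pair L k E (carrier L) m x (\<lambda>i z. tr (y i \<otimes> z))"
proof (intro etale_pair.intro cring_axioms etale_pair_axioms.intro)
  show "tr (y i \<otimes> (z \<oplus> w)) = tr (y i \<otimes> z) \<oplus> tr (y i \<otimes> w)"
    if "i < m" "z \<in> carrier L" "w \<in> carrier L" for i z w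
    using that y_car add_hom_add[OF tr_add_hom] by (simp add: r_distr)
  show "tr (y i \<otimes> (e \<otimes> z)) = e \<otimes> tr (y i \<otimes> z)" if "i < m" "e \<in> E" "z \<in> carrier L" for i e z
    using that y_car tr_smult[of e "y i \<otimes> z"] E_car by (simp add: m_lcomm)
  show "\<exists>!Q. Q \<in> carrier (diff_ring k (L\<lparr>carrier := carrier L\<rparr>)) \<and> (\<forall>e\<in>E. Q e = P e)"
    if "P \<in> carrier (diff_ring k (L\<lparr>carrier := E\<rparr>))" for P
    using ext_ex1[OF that] by simp
qed (use subring_E carrier_is_subring E_sub k_sub x_car y_car tr_closed expand_x in auto)

text \<open>A conjugate of the extension still extends \<open>P\<close>, because \<open>g\<close> is
  the identity on \<open>E\<close>; uniqueness identifies the two.\<close>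

lemma ext_galois_commute:
  assumes P: "P \<in> carrier (diff_ring k (L\<lparr>carrier := E\<rparr>))"
    and Q: "Q \<in> carrier (diff_ring k L)" "\<And>e. e \<in> E \<Longrightarrow> Q e = P e" and g: "g \<in> G"
  shows "conj_op g Q = Q" "z \<in> carrier L \<Longrightarrow> g (Q z) = Q (g z)"
proof -
  have "conj_op g Q e = P e" if e: "e \<in> E" for e
    using conj_apply(1)[OF g Q(1) E_car[OF e]] galois_groupD(5)[OF g e] Q(2)[OF e]
      galois_groupD(5)[OF galois_inv(1)[OF E_sub g]] diff_ringD(2)[OF subring_E P e] by simp
  then show *: "conj_op g Q = Q" using ext_ex1[OF P] conj_closed[OF g Q(1)] Q by blast
  show "z \<in> carrier L \<Longrightarrow> g (Q z) = Q (g z)" using conj_apply(2)[OF g Q(1), of z] unfolding * .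
qed

lemma ext_tr_commute:
  assumes P: "P \<in> carrier (diff_ring k (L\<lparr>carrier := E\<rparr>))"
    and Q: "Q \<in> carrier (diff_ring k L)" "\<And>e. e \<in> E \<Longrightarrow> Q e = P e" and z: "z \<in> carrier L"
  shows "P (tr z) = tr (Q z)"
proof -
  have "P (tr z) = Q (tr z)" using Q(2)[OF tr_closed[OF z]] by simp
  also have "\<dots> = (\<Oplus>g\<in>G. Q (g z))"
    unfolding tr_def using galois_groupD(1) z finite_G
    by (intro add_hom_finsum[OF abelian_group_axioms abelian_group_axioms DL_add_hom[OF Q(1)]]) auto
  also have "\<dots> = tr (Q z)"
    unfolding tr_def using ext_galois_commute(2)[OF P Q _ z] galois_groupD(1) z DL_D(2)[OF Q(1)]
    by (intro finsum_cong') auto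
  finally show ?thesis .
qed

end

lemma (in galois_sub) galois_dual_exists: "\<exists>m x y. galois_dual L k E m x y"
proof -
  let ?id = "\<lambda>x\<in>carrier L. x"
  obtain m :: nat and x y where *: "\<forall>i<m. x i \<in> carrier L \<and> y i \<in> carrier L" "(\<Oplus>i\<in>{..<m}. x i \<otimes> y i) = \<one>"
    "\<forall>g\<in>G - {?id}. (\<Oplus>i\<in>{..<m}. x i \<otimes> g (y i)) = \<zero>"
    using separating_family[of "G - {?id}" E] finite_G E_sub by auto
  have "(\<Oplus>i\<in>{..<m}. x i \<otimes> ?id (y i)) = (\<Oplus>i\<in>{..<m}. x i \<otimes> y i)" using *(1) by (intro finsum_cong') auto
  then have "galois_dual L k E m x y"
    using * by (intro galois_dual.intro galois_sub_axioms galois_dual_axioms.intro) auto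
  then show ?thesis by blast
qed

text \<open>The inverse of the order of the Galois group lies in \<open>k\<close>, so that multiplication by it
  commutes with all differential operators.\<close>

locale galois_avg = galois_dual +
  assumes k_subfield: "subfield k L"
    and char_0: "\<And>n::nat. n > 0 \<Longrightarrow> add_pow L n \<one> \<noteq> \<zero>"
begin

definition order_inv :: 'a where "order_inv = inv (add_pow L (card G) \<one>)"

text \<open>The trace, normalised so that elements of \<open>E\<close> are fixed: an
  \<open>E\<close>-linear retraction of \<open>L\<close> onto \<open>E\<close>.\<close>

definition avg :: "'a \<Rightarrow> 'a" where "avg z = order_inv \<otimes> tr z"

lemma card_G: "card G > 0"
  using finite_G galois_id[OF E_sub] by (auto simp: card_gt_0_iff)

lemma order_inv: "order_inv \<in> k" "order_inv \<in> E" "order_inv \<in> carrier L"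
  "order_inv \<otimes> add_pow L (card G) \<one> = \<one>"
proof -
  note k' = subringE[OF subfieldE(1)[OF k_subfield]]
  \<comment> \<open>\<open>k\<close> is a subfield, so it contains the multiples of 1 and the
    inverses of the nonzero ones.\<close>
  have "add_pow L n \<one> \<in> k" for n :: nat
    by (induction n) (use k' in \<open>auto simp: add.nat_pow_Suc\<close>)
  then have *: "add_pow L (card G) \<one> \<in> k - {\<zero>}" using char_0[OF card_G] by simp
  then show 1: "order_inv \<in> k" unfolding order_inv_def using subfield_m_inv(1)[OF k_subfield *] by simp
  show "order_inv \<in> E" "order_inv \<in> carrier L" using 1 k_sub k_car by auto
  show "order_inv \<otimes> add_pow L (card G) \<one> = \<one>"
    unfolding order_inv_def by (rule subfield_m_inv(3)[OF k_subfield *])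
qed

lemma avg_closed: "z \<in> carrier L \<Longrightarrow> avg z \<in> E"
  unfolding avg_def using subringE(6)[OF subring_E] order_inv tr_closed by simp

lemma avg_add: "z \<in> carrier L \<Longrightarrow> w \<in> carrier L \<Longrightarrow> avg (z \<oplus> w) = avg z \<oplus> avg w"
  unfolding avg_def using order_inv tr_car add_hom_add[OF tr_add_hom] by (simp add: r_distr)

lemma avg_smult: "e \<in> E \<Longrightarrow> z \<in> carrier L \<Longrightarrow> avg (e \<otimes> z) = e \<otimes> avg z"
  unfolding avg_def using order_inv tr_car tr_smult E_car by (simp add: m_lcomm)

lemma avg_one: "avg \<one> = \<one>"
proof -
  have "tr \<one> = (\<Oplus>g\<in>G. \<one>)"
    unfolding tr_def using galois_groupD(4) by (intro finsum_cong') auto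
  also have "\<dots> = add_pow L (card G) \<one>" by (rule add.finprod_const) simp
  finally show ?thesis unfolding avg_def using order_inv by simp
qed

lemma avg_commute:
  assumes P: "P \<in> carrier (diff_ring k (L\<lparr>carrier := E\<rparr>))"
    and Q: "Q \<in> carrier (diff_ring k L)" "\<And>e. e \<in> E \<Longrightarrow> Q e = P e" and z: "z \<in> carrier L"
  shows "P (avg z) = avg (Q z)"
  unfolding avg_def
  using diff_ringD(4)[OF subring_E P order_inv(1) tr_closed[OF z]] ext_tr_commute[OF P Q z] by simp

end

text \<open>F/E need not be Galois, so its data come from \<open>L\<close>. The normalised trace of
  L/F moves the \<open>x i\<close> into \<open>F\<close>, and the functionals are restricted. An
  operator of \<open>E\<close> is first extended to \<open>L\<close>; the extension commutes with
  the group of L/F, hence preserves its fixed field \<open>F\<close>, and is restricted to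
  it.\<close>

lemma etale_pair_galois:
  assumes "galois_sub L k E" and "galois_avg L k F m' x' y'" and E_F: "E \<subseteq> F"
  shows "\<exists>m x \<phi>. etale_pair L k E F m x \<phi>"
proof -
  interpret E: galois_sub L k E by fact
  interpret F: galois_avg L k F m' x' y' by fact
  obtain m x y where "galois_dual L k E m x y" using E.galois_dual_exists by blast
  then interpret E: galois_dual L k E m x y .
  have GFE: "g \<in> E.G" if "g \<in> F.G" for g using that E_F by (auto simp: galois_group_def)
  have ext: "\<exists>!Q. Q \<in> carrier (diff_ring k (L\<lparr>carrier := F\<rparr>)) \<and> (\<forall>e\<in>E. Q e = P e)"
    if P: "P \<in> carrier (diff_ring k (L\<lparr>carrier := E\<rparr>))" for P
  proof -
    obtain Q where Q: "Q \<in> carrier (diff_ring k L)" "\<And>e. e \<in> E \<Longrightarrow> Q e = P e" using E.ext_ex1[OF P] by blast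
    note QD = E.DL_D[OF Q(1)]
    obtain n where n: "ord_less L (carrier L) (carrier L) n Q" using QD(5) by blast
    have QF: "Q z \<in> F" if z: "z \<in> F" for z
    proof -
      have "g (Q z) = Q z" if g: "g \<in> F.G" for g
        using E.ext_galois_commute(2)[OF P Q GFE[OF g] F.E_car[OF z]] E.galois_groupD(5)[OF g z] by simp
      then have "Q z \<in> fixed_field L F.G" using QD(2)[OF F.E_car[OF z]] by (simp add: fixed_field_def)
      then show ?thesis by (simp add: F.fixed)
    qed
    have R: "restrict Q F \<in> carrier (diff_ring k (L\<lparr>carrier := F\<rparr>))"
    proof (rule E.diff_ringI[OF F.subring_E F.k_sub QF])
      show "ord_less L F F n Q" by (rule E.ord_less_mono[OF F.E_sub F.E_sub n])
    qed (use QD(3,4) F.E_car in auto)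
    show ?thesis
    proof (rule ex1I[of _ "restrict Q F"])
      show "restrict Q F \<in> carrier (diff_ring k (L\<lparr>carrier := F\<rparr>)) \<and> (\<forall>e\<in>E. restrict Q F e = P e)"
        using R Q(2) E_F by auto
    next
      fix T assume T: "T \<in> carrier (diff_ring k (L\<lparr>carrier := F\<rparr>)) \<and> (\<forall>e\<in>E. T e = P e)"
      \<comment> \<open>Two extensions to \<open>F\<close> are compared through their extensions to
        \<open>L\<close>, which agree by uniqueness for L/E.\<close>
      obtain T' where T': "T' \<in> carrier (diff_ring k L)" "\<And>e. e \<in> F \<Longrightarrow> T' e = T e"
        using F.ext_ex1[OF conjunct1[OF T]] by blast
      have "T' e = P e" if "e \<in> E" for e using T' T that E_F by auto
      then have "T' = Q" using E.ext_ex1[OF P] Q T' by blast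
      then have "T e = restrict Q F e" if "e \<in> F" for e using T'(2) that by simp
      then show "T = restrict Q F" using E.diff_ring_eqI[OF F.subring_E conjunct1[OF T] R] by blast
    qed
  qed
  have "etale_pair L k E F m (\<lambda>i. F.avg (x i)) (\<lambda>i z. E.tr (y i \<otimes>\<^bsub>L\<^esub> z))"
  proof (intro etale_pair.intro E.cring_axioms etale_pair_axioms.intro)
    show "E.tr (y i \<otimes>\<^bsub>L\<^esub> (z \<oplus>\<^bsub>L\<^esub> w)) = E.tr (y i \<otimes>\<^bsub>L\<^esub> z) \<oplus>\<^bsub>L\<^esub> E.tr (y i \<otimes>\<^bsub>L\<^esub> w)"
      if "i < m" "z \<in> F" "w \<in> F" for i z w
      using that E.y_car add_hom_add[OF E.tr_add_hom] F.E_car by (simp add: E.r_distr)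
    show "E.tr (y i \<otimes>\<^bsub>L\<^esub> (e \<otimes>\<^bsub>L\<^esub> z)) = e \<otimes>\<^bsub>L\<^esub> E.tr (y i \<otimes>\<^bsub>L\<^esub> z)" if "i < m" "e \<in> E" "z \<in> F" for i e z
      using that E.y_car E.tr_smult[of e "y i \<otimes>\<^bsub>L\<^esub> z"] E.E_car F.E_car by (simp add: E.m_lcomm)
    show "(\<Oplus>\<^bsub>L\<^esub>i\<in>{..<m}. F.avg (x i) \<otimes>\<^bsub>L\<^esub> E.tr (y i \<otimes>\<^bsub>L\<^esub> z)) = z" if z: "z \<in> F" for z
    proof -
      have c: "x i \<in> carrier L" "E.tr (y i \<otimes>\<^bsub>L\<^esub> z) \<in> F" "E.tr (y i \<otimes>\<^bsub>L\<^esub> z) \<in> carrier L" if "i < m" for i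
        using that E.x_car E.y_car E.tr_closed E.tr_car E_F F.E_car z by auto
      have A: "F.avg \<in> add_hom L L" using F.avg_closed F.E_car F.avg_add by (intro add_homI) auto
      \<comment> \<open>Apply the retraction onto \<open>F\<close> to the expansion of
        \<open>z\<close> over \<open>L\<close>; the coefficients lie in
        \<open>E \<subseteq> F\<close> and pass through.\<close>
      have "z = F.avg z" using F.avg_smult[OF z E.one_closed] F.avg_one F.E_car[OF z] by simp
      also have "\<dots> = F.avg (\<Oplus>\<^bsub>L\<^esub>i\<in>{..<m}. x i \<otimes>\<^bsub>L\<^esub> E.tr (y i \<otimes>\<^bsub>L\<^esub> z))"
        using E.expand_x[OF F.E_car[OF z]] by simp
      also have "\<dots> = (\<Oplus>\<^bsub>L\<^esub>i\<in>{..<m}. F.avg (x i \<otimes>\<^bsub>L\<^esub> E.tr (y i \<otimes>\<^bsub>L\<^esub> z)))"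
        using c by (intro add_hom_finsum[OF E.abelian_group_axioms E.abelian_group_axioms A]) auto
      also have "\<dots> = (\<Oplus>\<^bsub>L\<^esub>i\<in>{..<m}. F.avg (x i) \<otimes>\<^bsub>L\<^esub> E.tr (y i \<otimes>\<^bsub>L\<^esub> z))"
      proof (intro E.finsum_cong' refl)
        fix i assume "i \<in> {..<m}"
        then have i: "i < m" by simp
        show "F.avg (x i \<otimes>\<^bsub>L\<^esub> E.tr (y i \<otimes>\<^bsub>L\<^esub> z)) = F.avg (x i) \<otimes>\<^bsub>L\<^esub> E.tr (y i \<otimes>\<^bsub>L\<^esub> z)"
          using F.avg_smult[OF c(2)[OF i] c(1)[OF i]] c[OF i] F.E_car[OF F.avg_closed[OF c(1)[OF i]]]
          by (simp add: E.m_comm)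
      qed (use c F.avg_closed F.E_car in auto)
      finally show ?thesis ..
    qed
  qed (use E.subring_E F.subring_E E_F E.k_sub E.x_car E.y_car F.avg_closed E.tr_closed F.E_car ext in auto)
  then show ?thesis by blast
qed

section \<open>Direct images\<close>

context cring
begin

lemma mult_op_apply: "z \<in> E \<Longrightarrow> mult_op (R\<lparr>carrier := E\<rparr>) a z = a \<otimes> z"
  by (simp add: mult_op_def)

lemma mult_op_ring:
  assumes E: "subring E R" and k: "k \<subseteq> E"
  shows "a \<in> E \<Longrightarrow> b \<in> E \<Longrightarrow> mult_op (R\<lparr>carrier := E\<rparr>) (a \<oplus> b) =
      mult_op (R\<lparr>carrier := E\<rparr>) a \<oplus>\<^bsub>diff_ring k (R\<lparr>carrier := E\<rparr>)\<^esub> mult_op (R\<lparr>carrier := E\<rparr>) b"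
    "a \<in> E \<Longrightarrow> b \<in> E \<Longrightarrow> mult_op (R\<lparr>carrier := E\<rparr>) (a \<otimes> b) =
      mult_op (R\<lparr>carrier := E\<rparr>) a \<otimes>\<^bsub>diff_ring k (R\<lparr>carrier := E\<rparr>)\<^esub> mult_op (R\<lparr>carrier := E\<rparr>) b"
    "mult_op (R\<lparr>carrier := E\<rparr>) \<one> = \<one>\<^bsub>diff_ring k (R\<lparr>carrier := E\<rparr>)\<^esub>"
proof -
  let ?D = "diff_ring k (R\<lparr>carrier := E\<rparr>)"
  interpret D: ring ?D by (rule ring_diff_ring[OF E k])
  note E' = subringE[OF E]
  have car: "z \<in> carrier R" if "z \<in> E" for z using E'(1) that by auto
  note simps = mult_op_diff_ring[OF E k] E' mult_op_apply diff_ring_ops[where E = E and k = k] l_distr m_assoc car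
  note eqI = diff_ring_eqI[OF E, of _ k]
  show "a \<in> E \<Longrightarrow> b \<in> E \<Longrightarrow> mult_op (R\<lparr>carrier := E\<rparr>) (a \<oplus> b) =
      mult_op (R\<lparr>carrier := E\<rparr>) a \<oplus>\<^bsub>?D\<^esub> mult_op (R\<lparr>carrier := E\<rparr>) b"
    by (intro eqI) (simp_all add: simps)
  show "a \<in> E \<Longrightarrow> b \<in> E \<Longrightarrow> mult_op (R\<lparr>carrier := E\<rparr>) (a \<otimes> b) =
      mult_op (R\<lparr>carrier := E\<rparr>) a \<otimes>\<^bsub>?D\<^esub> mult_op (R\<lparr>carrier := E\<rparr>) b"
    by (intro eqI) (simp_all add: simps)
  show "mult_op (R\<lparr>carrier := E\<rparr>) \<one> = \<one>\<^bsub>?D\<^esub>"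
    by (intro eqI) (simp_all add: simps)
qed

end

context etale_pair
begin

abbreviation "LE \<equiv> L\<lparr>carrier := E\<rparr>"
abbreviation "LF \<equiv> L\<lparr>carrier := F\<rparr>"
abbreviation "DE \<equiv> diff_ring k LE"
abbreviation "DF \<equiv> diff_ring k LF"
abbreviation "\<mu>E \<equiv> mult_op LE"
abbreviation "\<mu>F \<equiv> mult_op LF"
abbreviation "lift_op \<equiv> ext_op k LE LF"

lemma k_F: "k \<subseteq> F" using k_E E_F by auto
lemma E_car: "e \<in> E \<Longrightarrow> e \<in> carrier L" using subringE(1)[OF subring_E] by auto
lemma F_car: "e \<in> F \<Longrightarrow> e \<in> carrier L" using subringE(1)[OF subring_F] by auto
lemma EF: "e \<in> E \<Longrightarrow> e \<in> F" using E_F by auto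

lemma ring_DE: "ring DE" by (rule ring_diff_ring[OF subring_E k_E])
lemma ring_DF: "ring DF" by (rule ring_diff_ring[OF subring_F k_F])

lemmas E_ops = subringE(2,3,5-7)[OF subring_E]
lemmas F_ops = subringE(2,3,5-7)[OF subring_F]
lemmas DE_D = diff_ringD[OF subring_E, of _ k]
lemmas DF_D = diff_ringD[OF subring_F, of _ k]
lemmas DE_ops = diff_ring_ops[where E = E and k = k]
lemmas DF_ops = diff_ring_ops[where E = F and k = k]
lemmas \<mu>E_closed = mult_op_diff_ring[OF subring_E k_E]
lemmas \<mu>F_closed = mult_op_diff_ring[OF subring_F k_F]
lemmas DE_eqI = diff_ring_eqI[OF subring_E, of _ k]

lemma \<mu>E_apply: "e \<in> E \<Longrightarrow> \<mu>E a e = a \<otimes> e" and \<mu>F_apply: "z \<in> F \<Longrightarrow> \<mu>F a z = a \<otimes> z"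
  by (simp_all add: mult_op_def)

lemma lift_op_closed: "P \<in> carrier DE \<Longrightarrow> lift_op P \<in> carrier DF"
  and lift_op_apply: "P \<in> carrier DE \<Longrightarrow> e \<in> E \<Longrightarrow> lift_op P e = P e"
  using theI'[OF ext_ex1, of P] by (simp_all add: ext_op_def)

lemma lift_opI: "P \<in> carrier DE \<Longrightarrow> Q \<in> carrier DF \<Longrightarrow> (\<And>e. e \<in> E \<Longrightarrow> Q e = P e) \<Longrightarrow> lift_op P = Q"
  using ext_ex1[of P] lift_op_closed[of P] lift_op_apply[of P] by blast

text \<open>The difference vanishes on \<open>E\<close>, so it is the unique extension of the zero
  operator.\<close>

lemma DF_eq_on_E:
  assumes P: "P \<in> carrier DF" and Q: "Q \<in> carrier DF" and eq: "\<And>e. e \<in> E \<Longrightarrow> P e = Q e"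
  shows "P = Q"
proof -
  interpret DE: ring DE by (rule ring_DE)
  interpret DF: ring DF by (rule ring_DF)
  let ?T = "P \<ominus>\<^bsub>DF\<^esub> Q"
  have T: "?T \<in> carrier DF" using P Q by simp
  have "?T e = \<zero>" if e: "e \<in> E" for e
  proof -
    have "P e = (?T \<oplus>\<^bsub>DF\<^esub> Q) e" using P Q by (simp add: DF.add_diff_cancel)
    also have "\<dots> = ?T e \<oplus> Q e" using DF_ops(2)[OF EF[OF e]] .
    finally have "?T e \<oplus> Q e = Q e" using eq[OF e] by simp
    then show ?thesis using F_car[OF DF_D(2)[OF T EF[OF e]]] F_car[OF DF_D(2)[OF Q EF[OF e]]] by simp
  qed
  then have "lift_op \<zero>\<^bsub>DE\<^esub> = ?T"
    using DE_ops(4) by (intro lift_opI[OF DE.zero_closed T]) simp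
  moreover have "lift_op \<zero>\<^bsub>DE\<^esub> = \<zero>\<^bsub>DF\<^esub>"
    using DE_ops(4) DF_ops(4) EF by (intro lift_opI) simp_all
  ultimately have "P \<ominus>\<^bsub>DF\<^esub> Q = \<zero>\<^bsub>DF\<^esub>" by simp
  then show ?thesis using DF.minus_eq_zero_iff[OF P Q] by simp
qed

lemma lift_op_add: "P \<in> carrier DE \<Longrightarrow> Q \<in> carrier DE \<Longrightarrow> lift_op (P \<oplus>\<^bsub>DE\<^esub> Q) = lift_op P \<oplus>\<^bsub>DF\<^esub> lift_op Q"
proof -
  interpret DE: ring DE by (rule ring_DE)
  interpret DF: ring DF by (rule ring_DF)
  assume "P \<in> carrier DE" "Q \<in> carrier DE"
  then show ?thesis
    by (intro lift_opI) (simp_all add: lift_op_closed lift_op_apply DE_ops(2) DF_ops(2)[OF EF])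
qed

lemma lift_op_mult: "P \<in> carrier DE \<Longrightarrow> Q \<in> carrier DE \<Longrightarrow> lift_op (P \<otimes>\<^bsub>DE\<^esub> Q) = lift_op P \<otimes>\<^bsub>DF\<^esub> lift_op Q"
proof -
  interpret DE: ring DE by (rule ring_DE)
  interpret DF: ring DF by (rule ring_DF)
  assume "P \<in> carrier DE" "Q \<in> carrier DE"
  then show ?thesis
    by (intro lift_opI) (simp_all add: lift_op_closed lift_op_apply DE_ops(1) DF_ops(1)[OF EF] DE_D(2))
qed

lemma lift_op_one: "lift_op \<one>\<^bsub>DE\<^esub> = \<one>\<^bsub>DF\<^esub>"
proof -
  interpret DE: ring DE by (rule ring_DE)
  interpret DF: ring DF by (rule ring_DF)
  show ?thesis by (intro lift_opI) (simp_all add: DE_ops(3) DF_ops(3)[OF EF])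
qed

lemma lift_op_\<mu>: "e \<in> E \<Longrightarrow> lift_op (\<mu>E e) = \<mu>F e"
  using EF by (intro lift_opI) (simp_all add: \<mu>E_closed \<mu>F_closed \<mu>E_apply \<mu>F_apply)

lemmas \<mu>E_add = mult_op_ring(1)[OF subring_E k_E]
  and \<mu>E_mult = mult_op_ring(2)[OF subring_E k_E]
  and \<mu>E_one = mult_op_ring(3)[OF subring_E k_E]
lemmas \<mu>F_add = mult_op_ring(1)[OF subring_F k_F]
  and \<mu>F_mult = mult_op_ring(2)[OF subring_F k_F]
  and \<mu>F_one = mult_op_ring(3)[OF subring_F k_F]

lemma DF_finsum_apply:
  assumes "finite I" "\<And>i. i \<in> I \<Longrightarrow> f i \<in> carrier DF" "z \<in> F"
  shows "(\<Oplus>\<^bsub>DF\<^esub>i\<in>I. f i) z = (\<Oplus>i\<in>I. f i z)"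
  using assms(1,2)
proof (induction I rule: finite_induct)
  case empty
  interpret DF: ring DF by (rule ring_DF)
  show ?case using assms(3) by (simp add: DF_ops(4))
next
  case (insert i I)
  interpret DF: ring DF by (rule ring_DF)
  have "f j z \<in> carrier L" if "j \<in> insert i I" for j
    using insert.prems[OF that] assms(3) DF_D(2) F_car by auto
  then show ?case using insert assms(3) by (simp add: DF_ops(2) Pi_iff)
qed

definition functional :: "('a \<Rightarrow> 'a) \<Rightarrow> bool" where
  "functional \<psi> \<longleftrightarrow> (\<forall>z\<in>F. \<psi> z \<in> E) \<and> (\<forall>z\<in>F. \<forall>w\<in>F. \<psi> (z \<oplus> w) = \<psi> z \<oplus> \<psi> w) \<and>
    (\<forall>e\<in>E. \<forall>z\<in>F. \<psi> (e \<otimes> z) = e \<otimes> \<psi> z)"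

lemma functional_\<phi>: "i < m \<Longrightarrow> functional (\<phi> i)"
  using \<phi>_E \<phi>_add \<phi>_smult by (auto simp: functional_def)

lemma functionalD:
  assumes "functional \<psi>"
  shows "z \<in> F \<Longrightarrow> \<psi> z \<in> E" "z \<in> F \<Longrightarrow> w \<in> F \<Longrightarrow> \<psi> (z \<oplus> w) = \<psi> z \<oplus> \<psi> w"
    "e \<in> E \<Longrightarrow> z \<in> F \<Longrightarrow> \<psi> (e \<otimes> z) = e \<otimes> \<psi> z" "e \<in> E \<Longrightarrow> z \<in> F \<Longrightarrow> \<psi> (z \<otimes> e) = \<psi> z \<otimes> e"
proof -
  show *: "z \<in> F \<Longrightarrow> \<psi> z \<in> E" "z \<in> F \<Longrightarrow> w \<in> F \<Longrightarrow> \<psi> (z \<oplus> w) = \<psi> z \<oplus> \<psi> w"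
    "e \<in> E \<Longrightarrow> z \<in> F \<Longrightarrow> \<psi> (e \<otimes> z) = e \<otimes> \<psi> z" for z w e
    using assms by (simp_all add: functional_def)
  show "e \<in> E \<Longrightarrow> z \<in> F \<Longrightarrow> \<psi> (z \<otimes> e) = \<psi> z \<otimes> e"
    using *(1,3) by (simp add: m_comm E_car F_car)
qed

lemma F_finsum: "finite I \<Longrightarrow> (\<And>i. i \<in> I \<Longrightarrow> f i \<in> F) \<Longrightarrow> (\<Oplus>i\<in>I. f i) \<in> F"
proof (induction I rule: finite_induct)
  case (insert i I)
  then show ?case by (subst finsum_insert) (auto simp: F_ops F_car)
qed (simp add: F_ops)

lemma functional_zero: "functional \<psi> \<Longrightarrow> \<psi> \<zero> = \<zero>"
  using functionalD(2)[of \<psi> \<zero> \<zero>] E_car[OF functionalD(1)[of \<psi> \<zero>]] F_ops by simp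

text \<open>For \<psi> = \<phi>_i this is the coefficient of x_i when \<open>P\<close> is written in
  F \<otimes>_E D_E. Arguments are restricted to \<open>E\<close> so that the result is an operator
  of \<open>E\<close>.\<close>

definition coef :: "('a \<Rightarrow> 'a) \<Rightarrow> ('a \<Rightarrow> 'a) \<Rightarrow> 'a \<Rightarrow> 'a" where
  "coef \<psi> P = restrict (\<lambda>e. \<psi> (P e)) E"

lemma coef_apply: "e \<in> E \<Longrightarrow> coef \<psi> P e = \<psi> (P e)"
  by (simp add: coef_def)

text \<open>A functional is \<open>E\<close>-linear, so it commutes with forming commutators by
  elements of \<open>E\<close>, and the order does not grow.\<close>

lemma coef_closed:
  assumes \<psi>: "functional \<psi>" and P: "P \<in> carrier DF"
  shows "coef \<psi> P \<in> carrier DE"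
proof -
  obtain n where n: "ord_less L F F n P" using DF_D(5)[OF P] by blast
  have sc: "scalars E E" using E_ops E_car by (auto simp: scalars_def)
  have minus: "a \<ominus> b \<in> F" if "a \<in> F" "b \<in> F" for a b using that F_ops by (simp add: minus_eq)
  have "ord_less L E E n T \<Longrightarrow> (\<And>e. e \<in> E \<Longrightarrow> T e \<in> F) \<Longrightarrow> ord_less L E E n (\<lambda>e. \<psi> (T e))" for n T
  proof (induction n arbitrary: T)
    case 0
    then show ?case using functional_zero[OF \<psi>] by simp
  next
    case (Suc n)
    have "ord_less L E E n (\<lambda>e. \<psi> (T (a \<otimes> e)) \<ominus> a \<otimes> \<psi> (T e))" if a: "a \<in> E" for a
    proof -
      have "ord_less L E E n (\<lambda>e. \<psi> (com T a e))"
        using Suc.prems a minus F_ops E_ops EF by (intro Suc.IH) simp_all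
      then show ?thesis
      proof (rule ord_less_congD[OF _ sc])
        fix e assume e: "e \<in> E"
        have c: "T (a \<otimes> e) \<in> F" "a \<otimes> T e \<in> F" "com T a e \<in> F" using Suc.prems(2) a e E_ops F_ops EF minus by auto
        have "\<psi> (T (a \<otimes> e)) = \<psi> (com T a e \<oplus> a \<otimes> T e)" using c F_car by (simp add: add_diff_cancel)
        also have "\<dots> = \<psi> (com T a e) \<oplus> a \<otimes> \<psi> (T e)" using functionalD(2)[OF \<psi> c(3,2)] functionalD(3)[OF \<psi> a] Suc.prems(2)[OF e] by simp
        finally show "\<psi> (T (a \<otimes> e)) \<ominus> a \<otimes> \<psi> (T e) = \<psi> (com T a e)"
          using c a e Suc.prems(2)[OF e] functionalD(1)[OF \<psi>] E_car by (simp add: add_diff_cancel)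
      qed
    qed
    then show ?case by simp
  qed
  from this[OF ord_less_mono[OF E_F E_F n]]
  have "ord_less L E E n (\<lambda>e. \<psi> (P e))" using DF_D(2)[OF P EF] by blast
  then show ?thesis
    unfolding coef_def
    using functionalD[OF \<psi>] DF_D[OF P] EF k_E by (intro diff_ringI[OF subring_E k_E]) (auto simp: subset_iff)
qed

lemma coef_add_hom:
  assumes \<psi>: "functional \<psi>"
  shows "coef \<psi> \<in> add_hom DF DE"
proof (rule add_homI)
  interpret DE: ring DE by (rule ring_DE)
  interpret DF: ring DF by (rule ring_DF)
  fix P Q assume P: "P \<in> carrier DF" and Q: "Q \<in> carrier DF"
  show "coef \<psi> (P \<oplus>\<^bsub>DF\<^esub> Q) = coef \<psi> P \<oplus>\<^bsub>DE\<^esub> coef \<psi> Q"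
  proof (rule DE_eqI)
    fix e assume e: "e \<in> E"
    show "coef \<psi> (P \<oplus>\<^bsub>DF\<^esub> Q) e = (coef \<psi> P \<oplus>\<^bsub>DE\<^esub> coef \<psi> Q) e"
      using e functionalD(2)[OF \<psi> DF_D(2)[OF P EF[OF e]] DF_D(2)[OF Q EF[OF e]]]
      by (simp only: coef_apply DE_ops(2) DF_ops(2)[OF EF])
  qed (use coef_closed[OF \<psi>] P Q in simp_all)
qed (rule coef_closed[OF \<psi>])

lemma coef_mult_lift:
  assumes \<psi>: "functional \<psi>" and P: "P \<in> carrier DF" and Q: "Q \<in> carrier DE"
  shows "coef \<psi> (P \<otimes>\<^bsub>DF\<^esub> lift_op Q) = coef \<psi> P \<otimes>\<^bsub>DE\<^esub> Q"
proof (rule DE_eqI)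
  interpret DE: ring DE by (rule ring_DE)
  interpret DF: ring DF by (rule ring_DF)
  show "coef \<psi> (P \<otimes>\<^bsub>DF\<^esub> lift_op Q) \<in> carrier DE" "coef \<psi> P \<otimes>\<^bsub>DE\<^esub> Q \<in> carrier DE"
    using P Q coef_closed[OF \<psi>] lift_op_closed by simp_all
  show "coef \<psi> (P \<otimes>\<^bsub>DF\<^esub> lift_op Q) e = (coef \<psi> P \<otimes>\<^bsub>DE\<^esub> Q) e" if e: "e \<in> E" for e
    using e by (simp only: coef_apply DE_ops(1) DF_ops(1)[OF EF] lift_op_apply[OF Q] DE_D(2)[OF Q])
qed

lemma coef_\<mu>F:
  assumes \<psi>: "functional \<psi>" and b: "b \<in> F"
  shows "coef \<psi> (\<mu>F b) = \<mu>E (\<psi> b)"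
proof (rule DE_eqI)
  show "coef \<psi> (\<mu>F b) \<in> carrier DE" "\<mu>E (\<psi> b) \<in> carrier DE"
    using coef_closed[OF \<psi> \<mu>F_closed[OF b]] \<mu>E_closed[OF functionalD(1)[OF \<psi> b]] .
  show "coef \<psi> (\<mu>F b) e = \<mu>E (\<psi> b) e" if e: "e \<in> E" for e
    using functionalD(4)[OF \<psi> e b] by (simp add: coef_apply[OF e] \<mu>F_apply[OF EF[OF e]] \<mu>E_apply[OF e])
qed

lemma coef_expansion:
  assumes \<psi>: "functional \<psi>" and I: "finite I" and b: "\<And>i. i \<in> I \<Longrightarrow> b i \<in> F" and Q: "\<And>i. i \<in> I \<Longrightarrow> Q i \<in> carrier DE"
  shows "coef \<psi> (\<Oplus>\<^bsub>DF\<^esub>i\<in>I. \<mu>F (b i) \<otimes>\<^bsub>DF\<^esub> lift_op (Q i)) = (\<Oplus>\<^bsub>DE\<^esub>i\<in>I. \<mu>E (\<psi> (b i)) \<otimes>\<^bsub>DE\<^esub> Q i)"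
proof -
  interpret DE: ring DE by (rule ring_DE)
  interpret DF: ring DF by (rule ring_DF)
  have "coef \<psi> (\<Oplus>\<^bsub>DF\<^esub>i\<in>I. \<mu>F (b i) \<otimes>\<^bsub>DF\<^esub> lift_op (Q i)) = (\<Oplus>\<^bsub>DE\<^esub>i\<in>I. coef \<psi> (\<mu>F (b i) \<otimes>\<^bsub>DF\<^esub> lift_op (Q i)))"
    using b Q \<mu>F_closed lift_op_closed
    by (intro add_hom_finsum[OF DF.abelian_group_axioms DE.abelian_group_axioms coef_add_hom[OF \<psi>] I]) auto
  also have "\<dots> = (\<Oplus>\<^bsub>DE\<^esub>i\<in>I. \<mu>E (\<psi> (b i)) \<otimes>\<^bsub>DE\<^esub> Q i)"
    using coef_mult_lift[OF \<psi> \<mu>F_closed[OF b] Q] coef_\<mu>F[OF \<psi> b] \<mu>E_closed[OF functionalD(1)[OF \<psi> b]] Q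
    by (intro DE.finsum_cong') auto
  finally show ?thesis .
qed

text \<open>Both sides agree on \<open>E\<close>, where the equation is the expansion of
  \<open>P e\<close> in \<open>F\<close>. This is the surjectivity of F \<otimes>_E D_E
  \<rightarrow> D_F, with explicit coefficients.\<close>

lemma expand_operator:
  assumes P: "P \<in> carrier DF"
  shows "P = (\<Oplus>\<^bsub>DF\<^esub>i\<in>{..<m}. \<mu>F (x i) \<otimes>\<^bsub>DF\<^esub> lift_op (coef (\<phi> i) P))"
proof -
  interpret DF: ring DF by (rule ring_DF)
  have c: "coef (\<phi> i) P \<in> carrier DE" if "i < m" for i using coef_closed[OF functional_\<phi>[OF that] P] .
  then have d: "\<mu>F (x i) \<otimes>\<^bsub>DF\<^esub> lift_op (coef (\<phi> i) P) \<in> carrier DF" if "i < m" for i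
    using that x_F by (simp add: \<mu>F_closed lift_op_closed)
  show ?thesis
  proof (rule DF_eq_on_E[OF P])
    show "(\<Oplus>\<^bsub>DF\<^esub>i\<in>{..<m}. \<mu>F (x i) \<otimes>\<^bsub>DF\<^esub> lift_op (coef (\<phi> i) P)) \<in> carrier DF"
      using d by (intro DF.finsum_closed) auto
    fix e assume e: "e \<in> E"
    have "(\<Oplus>\<^bsub>DF\<^esub>i\<in>{..<m}. \<mu>F (x i) \<otimes>\<^bsub>DF\<^esub> lift_op (coef (\<phi> i) P)) e =
        (\<Oplus>i\<in>{..<m}. (\<mu>F (x i) \<otimes>\<^bsub>DF\<^esub> lift_op (coef (\<phi> i) P)) e)"
      using d EF[OF e] by (intro DF_finsum_apply) auto
    also have "\<dots> = (\<Oplus>i\<in>{..<m}. x i \<otimes> \<phi> i (P e))"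
    proof (intro finsum_cong' refl)
      fix i assume i: "i \<in> {..<m}"
      have "lift_op (coef (\<phi> i) P) e = \<phi> i (P e)" using lift_op_apply[OF c e] i coef_apply[OF e] by simp
      moreover have "\<phi> i (P e) \<in> F" using i \<phi>_E DF_D(2)[OF P EF[OF e]] EF by auto
      ultimately show "(\<mu>F (x i) \<otimes>\<^bsub>DF\<^esub> lift_op (coef (\<phi> i) P)) e = x i \<otimes> \<phi> i (P e)"
        using DF_ops(1)[OF EF[OF e]] \<mu>F_apply by simp
    qed (use x_F \<phi>_E DF_D(2)[OF P EF[OF e]] F_car E_car in auto)
    also have "\<dots> = P e" using expand DF_D(2)[OF P EF[OF e]] by simp
    finally show "P e = (\<Oplus>\<^bsub>DF\<^esub>i\<in>{..<m}. \<mu>F (x i) \<otimes>\<^bsub>DF\<^esub> lift_op (coef (\<phi> i) P)) e" ..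
  qed
qed

lemma direct_image_simps:
  "carrier (direct_image k LE LF V) = carrier V"
  "\<zero>\<^bsub>direct_image k LE LF V\<^esub> = \<zero>\<^bsub>V\<^esub>"
  "v \<oplus>\<^bsub>direct_image k LE LF V\<^esub> w = v \<oplus>\<^bsub>V\<^esub> w"
  "P \<odot>\<^bsub>direct_image k LE LF V\<^esub> v = lift_op P \<odot>\<^bsub>V\<^esub> v"
  "finsum (direct_image k LE LF V) = finsum V"
  by (simp_all add: direct_image_def finsum_def)

lemma left_module_direct_image:
  assumes V: "left_module DF V"
  shows "left_module DE (direct_image k LE LF V)"
proof -
  interpret V: left_module DF V by fact
  have "abelian_group (direct_image k LE LF V)"
  proof (rule abelian_groupI)
    show "\<exists>y\<in>carrier (direct_image k LE LF V). y \<oplus>\<^bsub>direct_image k LE LF V\<^esub> v = \<zero>\<^bsub>direct_image k LE LF V\<^esub>"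
      if "v \<in> carrier (direct_image k LE LF V)" for v
      using that V.M.l_neg unfolding direct_image_simps by (intro bexI[of _ "\<ominus>\<^bsub>V\<^esub> v"]) simp_all
  qed (simp_all add: direct_image_simps V.M.a_ac)
  then show ?thesis
    by (intro left_module.intro ring_DE left_module_axioms.intro)
      (simp_all add: direct_image_simps V.smult_closed V.smult_l_distr V.smult_r_distr V.smult_assoc
        V.smult_one lift_op_closed lift_op_add lift_op_mult lift_op_one)
qed

lemma mod_hom_direct_image:
  "f \<in> mod_hom DF V W \<Longrightarrow> f \<in> mod_hom DE (direct_image k LE LF V) (direct_image k LE LF W)"
  by (intro mod_homI) (simp_all add: direct_image_simps mod_homD lift_op_closed)

lemma submodule_direct_image:
  assumes V: "left_module DF V" and H: "submodule H DF V"
  shows "submodule H DE (direct_image k LE LF V)"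
proof -
  interpret V: left_module DF V by fact
  interpret V': left_module DE "direct_image k LE LF V" by (rule left_module_direct_image[OF V])
  show ?thesis using V.submoduleD[OF H] lift_op_closed
    by (intro V'.submoduleI) (auto simp: direct_image_simps)
qed

text \<open>\<open>DF\<close> is generated by \<open>DE\<close> and the multiplications with elements of \<open>F\<close>.\<close>

lemma submodule_of_direct_image:
  assumes V: "left_module DF V" and H: "submodule H DE (direct_image k LE LF V)"
    and F: "\<And>a v. a \<in> F \<Longrightarrow> v \<in> H \<Longrightarrow> \<mu>F a \<odot>\<^bsub>V\<^esub> v \<in> H"
  shows "submodule H DF V"
proof -
  interpret V: left_module DF V by fact
  interpret V': left_module DE "direct_image k LE LF V" by (rule left_module_direct_image[OF V])
  note HD = V'.submoduleD[OF H, unfolded direct_image_simps]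
  show ?thesis
  proof (rule V.submoduleI)
    fix P v assume P: "P \<in> carrier DF" and v: "v \<in> H"
    have c: "coef (\<phi> i) P \<in> carrier DE" if "i < m" for i using coef_closed[OF functional_\<phi>[OF that] P] .
    have vV: "v \<in> carrier V" using HD(1) v by auto
    have "P \<odot>\<^bsub>V\<^esub> v = (\<Oplus>\<^bsub>DF\<^esub>i\<in>{..<m}. \<mu>F (x i) \<otimes>\<^bsub>DF\<^esub> lift_op (coef (\<phi> i) P)) \<odot>\<^bsub>V\<^esub> v"
      using expand_operator[OF P] by simp
    also have "\<dots> = (\<Oplus>\<^bsub>V\<^esub>i\<in>{..<m}. (\<mu>F (x i) \<otimes>\<^bsub>DF\<^esub> lift_op (coef (\<phi> i) P)) \<odot>\<^bsub>V\<^esub> v)"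
      using c vV x_F \<mu>F_closed lift_op_closed by (intro V.smult_l_finsum) auto
    also have "\<dots> = (\<Oplus>\<^bsub>V\<^esub>i\<in>{..<m}. \<mu>F (x i) \<odot>\<^bsub>V\<^esub> (lift_op (coef (\<phi> i) P) \<odot>\<^bsub>V\<^esub> v))"
      using c vV x_F \<mu>F_closed lift_op_closed
      by (intro V.M.finsum_cong') (auto simp: V.smult_assoc V.smult_closed)
    also have "\<dots> \<in> H"
      using V'.submodule_finsum[OF H, of "{..<m}"] F[OF x_F HD(6)[OF c v]]
      unfolding direct_image_simps by simp
    finally show "P \<odot>\<^bsub>V\<^esub> v \<in> H" .
  qed (use HD in auto)
qed

text \<open>An operator of \<open>F\<close> is a combination of multiplications by elements of
  \<open>F\<close> and lifted operators of \<open>E\<close>, and \<open>f\<close> commutes with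
  both.\<close>

lemma mod_hom_of_direct_image:
  assumes V: "left_module DF V" and W: "left_module DF W"
    and f: "f \<in> mod_hom DE (direct_image k LE LF V) (direct_image k LE LF W)"
    and F: "\<And>a v. a \<in> F \<Longrightarrow> v \<in> carrier V \<Longrightarrow> f (\<mu>F a \<odot>\<^bsub>V\<^esub> v) = \<mu>F a \<odot>\<^bsub>W\<^esub> f v"
  shows "f \<in> mod_hom DF V W"
proof (rule mod_homI)
  interpret V: left_module DF V by fact
  interpret W: left_module DF W by fact
  note fD = mod_homD[OF f, unfolded direct_image_simps]
  show "f v \<in> carrier W" if "v \<in> carrier V" for v using fD(2) that .
  show "f (v \<oplus>\<^bsub>V\<^esub> w) = f v \<oplus>\<^bsub>W\<^esub> f w" if "v \<in> carrier V" "w \<in> carrier V" for v w using fD(3) that .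
  have fV: "f \<in> add_hom V W" using fD(2,3) by (intro add_homI) auto
  fix P v assume P: "P \<in> carrier DF" and v: "v \<in> carrier V"
  have c: "coef (\<phi> i) P \<in> carrier DE" if "i < m" for i using coef_closed[OF functional_\<phi>[OF that] P] .
  have e: "lift_op (coef (\<phi> i) P) \<odot>\<^bsub>V\<^esub> v \<in> carrier V" "\<mu>F (x i) \<in> carrier DF"
    "lift_op (coef (\<phi> i) P) \<in> carrier DF" if "i < m" for i
    using that c v lift_op_closed x_F \<mu>F_closed by (auto intro: V.smult_closed)
  have "f (P \<odot>\<^bsub>V\<^esub> v) = f ((\<Oplus>\<^bsub>DF\<^esub>i\<in>{..<m}. \<mu>F (x i) \<otimes>\<^bsub>DF\<^esub> lift_op (coef (\<phi> i) P)) \<odot>\<^bsub>V\<^esub> v)"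
    using expand_operator[OF P] by simp
  also have "\<dots> = f (\<Oplus>\<^bsub>V\<^esub>i\<in>{..<m}. \<mu>F (x i) \<odot>\<^bsub>V\<^esub> (lift_op (coef (\<phi> i) P) \<odot>\<^bsub>V\<^esub> v))"
  proof -
    have "(\<Oplus>\<^bsub>DF\<^esub>i\<in>{..<m}. \<mu>F (x i) \<otimes>\<^bsub>DF\<^esub> lift_op (coef (\<phi> i) P)) \<odot>\<^bsub>V\<^esub> v =
        (\<Oplus>\<^bsub>V\<^esub>i\<in>{..<m}. (\<mu>F (x i) \<otimes>\<^bsub>DF\<^esub> lift_op (coef (\<phi> i) P)) \<odot>\<^bsub>V\<^esub> v)"
      using e v by (intro V.smult_l_finsum) auto
    also have "\<dots> = (\<Oplus>\<^bsub>V\<^esub>i\<in>{..<m}. \<mu>F (x i) \<odot>\<^bsub>V\<^esub> (lift_op (coef (\<phi> i) P) \<odot>\<^bsub>V\<^esub> v))"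
      using e v by (intro V.M.finsum_cong') (auto simp: V.smult_assoc V.smult_closed)
    finally show ?thesis by simp
  qed
  also have "\<dots> = (\<Oplus>\<^bsub>W\<^esub>i\<in>{..<m}. f (\<mu>F (x i) \<odot>\<^bsub>V\<^esub> (lift_op (coef (\<phi> i) P) \<odot>\<^bsub>V\<^esub> v)))"
    using e by (intro add_hom_finsum[OF V.M.abelian_group_axioms W.M.abelian_group_axioms fV]) (auto intro: V.smult_closed)
  also have "\<dots> = (\<Oplus>\<^bsub>W\<^esub>i\<in>{..<m}. (\<mu>F (x i) \<otimes>\<^bsub>DF\<^esub> lift_op (coef (\<phi> i) P)) \<odot>\<^bsub>W\<^esub> f v)"
    using e v F fD(2,4) c x_F by (intro W.M.finsum_cong') (auto simp: W.smult_assoc W.smult_closed)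
  also have "\<dots> = (\<Oplus>\<^bsub>DF\<^esub>i\<in>{..<m}. \<mu>F (x i) \<otimes>\<^bsub>DF\<^esub> lift_op (coef (\<phi> i) P)) \<odot>\<^bsub>W\<^esub> f v"
    using e v fD(2) by (intro W.smult_l_finsum[symmetric]) auto
  also have "\<dots> = P \<odot>\<^bsub>W\<^esub> f v" using expand_operator[OF P] by simp
  finally show "f (P \<odot>\<^bsub>V\<^esub> v) = P \<odot>\<^bsub>W\<^esub> f v" .
qed

end

section \<open>Inverse images\<close>

locale inverse_image_pair = etale_pair +
  fixes N :: "('a \<Rightarrow> 'a, 'n) module"
  assumes N: "left_module (diff_ring k (L\<lparr>carrier := E\<rparr>)) N"

sublocale inverse_image_pair \<subseteq> N: left_module DE N
  by (rule N)

sublocale inverse_image_pair \<subseteq> DF: ring DF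
  by (rule ring_DF)

context inverse_image_pair
begin

abbreviation "FA \<equiv> free_Abelian_group (F \<times> carrier N)"
abbreviation "TK \<equiv> tensor_kernel LE LF N"
abbreviation "TG \<equiv> tensor_group LE LF N"
abbreviation "tensor \<equiv> pure_tensor LE LF N"
abbreviation "V \<equiv> inverse_image k LE LF N"

section \<open>The tensor product as an abelian group and its universal property\<close>

lemma FA_comm_group: "comm_group FA"
  by (rule abelian_free_Abelian_group)

lemma relations_closed: "tensor_relations LE LF N \<subseteq> carrier FA"
proof -
  have *: "frag_of p - frag_of q - frag_of r \<in> carrier FA" "frag_of p - frag_of q \<in> carrier FA"
    if "p \<in> F \<times> carrier N" "q \<in> F \<times> carrier N" "r \<in> F \<times> carrier N" for p q r
  proof -
    have 1: "Poly_Mapping.keys (frag_of p - frag_of q) \<subseteq> F \<times> carrier N"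
      using keys_diff[of "frag_of p" "frag_of q"] that by auto
    then show "frag_of p - frag_of q \<in> carrier FA" by simp
    show "frag_of p - frag_of q - frag_of r \<in> carrier FA"
      using keys_diff[of "frag_of p - frag_of q" "frag_of r"] 1 that by auto
  qed
  show ?thesis
  proof
    fix c assume "c \<in> tensor_relations LE LF N"
    then consider
      (1) a b n where "c = frag_of (a \<oplus> b, n) - frag_of (a, n) - frag_of (b, n)" "a \<in> F" "b \<in> F" "n \<in> carrier N"
    | (2) a n n' where "c = frag_of (a, n \<oplus>\<^bsub>N\<^esub> n') - frag_of (a, n) - frag_of (a, n')"
        "a \<in> F" "n \<in> carrier N" "n' \<in> carrier N"
    | (3) a e n where "c = frag_of (a \<otimes> e, n) - frag_of (a, \<mu>E e \<odot>\<^bsub>N\<^esub> n)" "a \<in> F" "e \<in> E" "n \<in> carrier N"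
      unfolding tensor_relations_def by auto
    then show "c \<in> carrier FA"
    proof cases
      case 1
      then show ?thesis unfolding 1(1) by (intro *(1)) (auto simp: F_ops)
    next
      case 2
      then show ?thesis unfolding 2(1) by (intro *(1)) auto
    next
      case 3
      then have "(a, \<mu>E e \<odot>\<^bsub>N\<^esub> n) \<in> F \<times> carrier N" by (auto intro: N.smult_closed \<mu>E_closed)
      then show ?thesis unfolding 3(1) using 3 by (intro *(2)) (auto simp: F_ops EF)
    qed
  qed
qed

lemma TK_eq: "TK = generate FA (tensor_relations LE LF N)"
  by (simp add: tensor_kernel_def)

lemma TG_eq: "TG = FA Mod TK"
  by (simp add: tensor_group_def)

lemma tensor_eq: "tensor a n = TK #>\<^bsub>FA\<^esub> frag_of (a, n)"
  by (simp add: pure_tensor_def)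

lemma TK_subgroup: "subgroup TK FA"
  unfolding TK_eq by (rule group.generate_is_subgroup[OF group_free_Abelian_group relations_closed])

lemma TK_normal: "TK \<lhd> FA"
  using comm_group.normal_iff_subgroup[OF FA_comm_group] TK_subgroup by blast

lemma TG_comm_group: "comm_group TG"
  unfolding TG_eq by (rule comm_group.abelian_FactGroup[OF FA_comm_group TK_subgroup])

lemma V_simps:
  "carrier V = carrier TG" "v \<oplus>\<^bsub>V\<^esub> w = v \<otimes>\<^bsub>TG\<^esub> w" "\<zero>\<^bsub>V\<^esub> = \<one>\<^bsub>TG\<^esub>"
  "P \<odot>\<^bsub>V\<^esub> v = tensor_action k LE LF N P v"
  by (simp_all add: inverse_image_def)

text \<open>The tensor group is written multiplicatively and the inverse image additively on the
  same carrier; additive maps are the same for both.\<close>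

lemma hom_V: "hom H (add_monoid V) = hom H TG" "hom (add_monoid V) H' = hom TG H'"
  by (simp_all add: hom_def V_simps)

lemma V_abelian_group: "abelian_group V"
proof -
  interpret TG: comm_group TG by (rule TG_comm_group)
  show ?thesis
  proof (rule abelian_groupI)
    show "\<exists>w\<in>carrier V. w \<oplus>\<^bsub>V\<^esub> v = \<zero>\<^bsub>V\<^esub>" if "v \<in> carrier V" for v
      using that TG.l_inv unfolding V_simps by (intro bexI[of _ "inv\<^bsub>TG\<^esub> v"]) simp_all
  qed (simp_all add: V_simps TG.m_ac)
qed

lemma FA_hom_diff:
  assumes C: "abelian_group C" and h: "h \<in> hom FA (add_monoid C)" and "c \<in> carrier FA" "d \<in> carrier FA"
  shows "h (c - d) = h c \<ominus>\<^bsub>C\<^esub> h d" "c - d \<in> carrier FA"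
proof -
  interpret C: abelian_group C by fact
  interpret h: group_hom FA "add_monoid C" h
    using h C.a_group by (intro group_hom.intro group_hom_axioms.intro) auto
  show *: "c - d \<in> carrier FA"
    using keys_diff[of c d] assms(3,4) by auto
  have "h c = h (c - d) \<oplus>\<^bsub>C\<^esub> h d"
    using h.hom_mult[OF * assms(4)] by simp
  then show "h (c - d) = h c \<ominus>\<^bsub>C\<^esub> h d"
    using h.hom_closed[OF *] h.hom_closed[OF assms(4)] by (simp add: C.add_diff_cancel)
qed

lemma quotient_hom: "(\<lambda>c. TK #>\<^bsub>FA\<^esub> c) \<in> hom FA (add_monoid V)"
  unfolding hom_V TG_eq by (rule normal.r_coset_hom_Mod[OF TK_normal])

lemma carrier_V: "carrier V = (\<lambda>c. TK #>\<^bsub>FA\<^esub> c) ` carrier FA"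
  by (simp add: V_simps TG_eq carrier_FactGroup)

lemma tensor_closed: "a \<in> F \<Longrightarrow> n \<in> carrier N \<Longrightarrow> tensor a n \<in> carrier V"
  unfolding tensor_eq carrier_V by (intro imageI) simp

lemma quotient_relation:
  assumes "r \<in> tensor_relations LE LF N" shows "TK #>\<^bsub>FA\<^esub> r = \<zero>\<^bsub>V\<^esub>"
proof -
  have "r \<in> TK" unfolding TK_eq by (rule generate.incl[OF assms])
  then have "TK #>\<^bsub>FA\<^esub> r = TK"
    using subgroup.rcos_const[OF TK_subgroup group_free_Abelian_group] by blast
  then show ?thesis by (simp add: V_simps TG_eq)
qed

lemma tensor_relation3:
  assumes "frag_of p - frag_of q - frag_of r \<in> tensor_relations LE LF N"
    "p \<in> F \<times> carrier N" "q \<in> F \<times> carrier N" "r \<in> F \<times> carrier N"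
  shows "tensor (fst p) (snd p) = tensor (fst q) (snd q) \<oplus>\<^bsub>V\<^esub> tensor (fst r) (snd r)"
proof -
  interpret V: abelian_group V by (rule V_abelian_group)
  let ?\<pi> = "\<lambda>c. TK #>\<^bsub>FA\<^esub> c"
  note d = FA_hom_diff[OF V_abelian_group quotient_hom]
  have c: "frag_of p \<in> carrier FA" "frag_of q \<in> carrier FA" "frag_of r \<in> carrier FA" using assms by auto
  have pc: "?\<pi> (frag_of p) \<in> carrier V" "?\<pi> (frag_of q) \<in> carrier V" "?\<pi> (frag_of r) \<in> carrier V"
    unfolding carrier_V using c by blast+
  have "\<zero>\<^bsub>V\<^esub> = ?\<pi> (frag_of p - frag_of q - frag_of r)" using quotient_relation[OF assms(1)] by simp
  also have "\<dots> = (?\<pi> (frag_of p) \<ominus>\<^bsub>V\<^esub> ?\<pi> (frag_of q)) \<ominus>\<^bsub>V\<^esub> ?\<pi> (frag_of r)"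
    using d(1)[OF d(2)[OF c(1,2)] c(3)] d(1)[OF c(1,2)] by simp
  finally have "?\<pi> (frag_of p) \<ominus>\<^bsub>V\<^esub> ?\<pi> (frag_of q) = ?\<pi> (frag_of r)"
    using pc V.minus_eq_zero_iff[of "?\<pi> (frag_of p) \<ominus>\<^bsub>V\<^esub> ?\<pi> (frag_of q)" "?\<pi> (frag_of r)"] by simp
  then have "?\<pi> (frag_of p) = ?\<pi> (frag_of r) \<oplus>\<^bsub>V\<^esub> ?\<pi> (frag_of q)"
    using V.add_diff_cancel(3)[OF pc(1,2)] by simp
  then show ?thesis using pc by (simp add: tensor_eq V.a_comm)
qed

lemma tensor_add_l:
  "a \<in> F \<Longrightarrow> b \<in> F \<Longrightarrow> n \<in> carrier N \<Longrightarrow> tensor (a \<oplus> b) n = tensor a n \<oplus>\<^bsub>V\<^esub> tensor b n"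
  using tensor_relation3[of "(a \<oplus> b, n)" "(a, n)" "(b, n)"]
  by (auto simp: tensor_relations_def F_ops)

lemma tensor_add_r:
  "a \<in> F \<Longrightarrow> n \<in> carrier N \<Longrightarrow> n' \<in> carrier N \<Longrightarrow> tensor a (n \<oplus>\<^bsub>N\<^esub> n') = tensor a n \<oplus>\<^bsub>V\<^esub> tensor a n'"
  using tensor_relation3[of "(a, n \<oplus>\<^bsub>N\<^esub> n')" "(a, n)" "(a, n')"]
  by (auto simp: tensor_relations_def)

lemma tensor_balanced:
  assumes "a \<in> F" "e \<in> E" "n \<in> carrier N"
  shows "tensor (a \<otimes> e) n = tensor a (\<mu>E e \<odot>\<^bsub>N\<^esub> n)"
proof -
  interpret V: abelian_group V by (rule V_abelian_group)
  let ?\<pi> = "\<lambda>c. TK #>\<^bsub>FA\<^esub> c"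
  have en: "\<mu>E e \<odot>\<^bsub>N\<^esub> n \<in> carrier N" using assms by (intro N.smult_closed \<mu>E_closed)
  have c: "frag_of (a \<otimes> e, n) \<in> carrier FA" "frag_of (a, \<mu>E e \<odot>\<^bsub>N\<^esub> n) \<in> carrier FA"
    using assms en by (auto simp: F_ops EF)
  have "frag_of (a \<otimes> e, n) - frag_of (a, \<mu>E e \<odot>\<^bsub>N\<^esub> n) \<in> tensor_relations LE LF N"
    using assms by (auto simp: tensor_relations_def)
  from quotient_relation[OF this] FA_hom_diff(1)[OF V_abelian_group quotient_hom c]
  have "?\<pi> (frag_of (a \<otimes> e, n)) \<ominus>\<^bsub>V\<^esub> ?\<pi> (frag_of (a, \<mu>E e \<odot>\<^bsub>N\<^esub> n)) = \<zero>\<^bsub>V\<^esub>" by simp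
  moreover have "?\<pi> (frag_of (a \<otimes> e, n)) \<in> carrier V" "?\<pi> (frag_of (a, \<mu>E e \<odot>\<^bsub>N\<^esub> n)) \<in> carrier V"
    unfolding carrier_V using c by blast+
  ultimately show ?thesis using V.minus_eq_zero_iff by (simp add: tensor_eq)
qed

text \<open>Pure tensors generate, since the free abelian group is generated by its basis under
  differences. Identities in the tensor product are reduced to pure tensors in this way
  throughout.\<close>

lemma add_hom_eqI:
  assumes C: "abelian_group C" and f: "f \<in> add_hom V C" and g: "g \<in> add_hom V C"
    and eq: "\<And>a n. a \<in> F \<Longrightarrow> n \<in> carrier N \<Longrightarrow> f (tensor a n) = g (tensor a n)" and v: "v \<in> carrier V"
  shows "f v = g v"
proof -
  let ?\<pi> = "\<lambda>c. TK #>\<^bsub>FA\<^esub> c"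
  have fp: "(\<lambda>c. f (?\<pi> c)) \<in> hom FA (add_monoid C)" "(\<lambda>c. g (?\<pi> c)) \<in> hom FA (add_monoid C)"
    using hom_compose[OF quotient_hom f] hom_compose[OF quotient_hom g] by (simp_all add: comp_def)
  obtain c where c: "Poly_Mapping.keys c \<subseteq> F \<times> carrier N" "v = ?\<pi> c" using v unfolding carrier_V by auto
  have "f (?\<pi> c) = g (?\<pi> c)" using c(1)
  proof (rule free_Abelian_group_induct)
    have "?\<pi> 0 = \<zero>\<^bsub>V\<^esub>"
      using hom_one[OF quotient_hom group_free_Abelian_group] abelian_group.a_group[OF V_abelian_group] by simp
    then show "f (?\<pi> 0) = g (?\<pi> 0)"
      using add_hom_zero[OF V_abelian_group C f] add_hom_zero[OF V_abelian_group C g] by simp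
  next
    fix p assume "p \<in> F \<times> carrier N"
    then show "f (?\<pi> (frag_of p)) = g (?\<pi> (frag_of p))" using eq by (auto simp: tensor_eq)
  next
    fix c d assume "Poly_Mapping.keys c \<subseteq> F \<times> carrier N" "Poly_Mapping.keys d \<subseteq> F \<times> carrier N"
      "f (?\<pi> c) = g (?\<pi> c)" "f (?\<pi> d) = g (?\<pi> d)"
    then show "f (?\<pi> (c - d)) = g (?\<pi> (c - d))"
      using FA_hom_diff(1)[OF C fp(1), of c d] FA_hom_diff(1)[OF C fp(2), of c d] by simp
  qed
  then show ?thesis by (simp add: c(2))
qed

text \<open>The map on generators extends to the free abelian group, kills the three kinds of
  relations, hence the subgroup that they generate, and so factors through the quotient.\<close>

lemma tensor_universal:
  assumes C: "abelian_group C"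
    and \<beta>: "\<And>a n. a \<in> F \<Longrightarrow> n \<in> carrier N \<Longrightarrow> \<beta> a n \<in> carrier C"
      "\<And>a b n. a \<in> F \<Longrightarrow> b \<in> F \<Longrightarrow> n \<in> carrier N \<Longrightarrow> \<beta> (a \<oplus> b) n = \<beta> a n \<oplus>\<^bsub>C\<^esub> \<beta> b n"
      "\<And>a n n'. a \<in> F \<Longrightarrow> n \<in> carrier N \<Longrightarrow> n' \<in> carrier N \<Longrightarrow> \<beta> a (n \<oplus>\<^bsub>N\<^esub> n') = \<beta> a n \<oplus>\<^bsub>C\<^esub> \<beta> a n'"
      "\<And>a e n. a \<in> F \<Longrightarrow> e \<in> E \<Longrightarrow> n \<in> carrier N \<Longrightarrow> \<beta> (a \<otimes> e) n = \<beta> a (\<mu>E e \<odot>\<^bsub>N\<^esub> n)"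
  shows "\<exists>h\<in>add_hom V C. \<forall>a\<in>F. \<forall>n\<in>carrier N. h (tensor a n) = \<beta> a n"
proof -
  interpret C: abelian_group C by fact
  have "(\<lambda>p. \<beta> (fst p) (snd p)) ` (F \<times> carrier N) \<subseteq> carrier (add_monoid C)" using \<beta>(1) by auto
  from comm_group.free_Abelian_group_universal[OF C.a_comm_group this]
  obtain h where h: "h \<in> hom FA (add_monoid C)"
    and hf: "\<And>p. p \<in> F \<times> carrier N \<Longrightarrow> h (frag_of p) = \<beta> (fst p) (snd p)" by blast
  interpret h: group_hom FA "add_monoid C" h
    using h C.a_group by (intro group_hom.intro group_hom_axioms.intro) auto
  have h3: "h (frag_of p - frag_of q - frag_of r) = h (frag_of p) \<ominus>\<^bsub>C\<^esub> h (frag_of q) \<ominus>\<^bsub>C\<^esub> h (frag_of r)"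
    if "p \<in> F \<times> carrier N" "q \<in> F \<times> carrier N" "r \<in> F \<times> carrier N" for p q r
    using that FA_hom_diff[OF C h, of "frag_of p" "frag_of q"]
      FA_hom_diff(1)[OF C h, of "frag_of p - frag_of q" "frag_of r"] by simp
  have rel: "h c = \<zero>\<^bsub>C\<^esub>" if c: "c \<in> tensor_relations LE LF N" for c
  proof -
    consider
      (1) a b n where "c = frag_of (a \<oplus> b, n) - frag_of (a, n) - frag_of (b, n)" "a \<in> F" "b \<in> F" "n \<in> carrier N"
    | (2) a n n' where "c = frag_of (a, n \<oplus>\<^bsub>N\<^esub> n') - frag_of (a, n) - frag_of (a, n')"
        "a \<in> F" "n \<in> carrier N" "n' \<in> carrier N"
    | (3) a e n where "c = frag_of (a \<otimes> e, n) - frag_of (a, \<mu>E e \<odot>\<^bsub>N\<^esub> n)" "a \<in> F" "e \<in> E" "n \<in> carrier N"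
      using c unfolding tensor_relations_def by auto
    then show ?thesis
    proof cases
      case 1
      then show ?thesis unfolding 1(1)
        using h3[of "(a \<oplus> b, n)" "(a, n)" "(b, n)"] hf \<beta>(1) \<beta>(2)[OF 1(2-4)]
        by (simp add: F_ops C.add_diff_cancel C.minus_eq_zero_iff)
    next
      case 2
      then show ?thesis unfolding 2(1)
        using h3[of "(a, n \<oplus>\<^bsub>N\<^esub> n')" "(a, n)" "(a, n')"] hf \<beta>(1) \<beta>(3)[OF 2(2-4)]
        by (simp add: C.add_diff_cancel C.minus_eq_zero_iff)
    next
      case 3
      have en: "\<mu>E e \<odot>\<^bsub>N\<^esub> n \<in> carrier N" using 3 by (intro N.smult_closed \<mu>E_closed)
      show ?thesis unfolding 3(1)
        using FA_hom_diff(1)[OF C h, of "frag_of (a \<otimes> e, n)" "frag_of (a, \<mu>E e \<odot>\<^bsub>N\<^esub> n)"] hf \<beta>(1) \<beta>(4)[OF 3(2-4)] 3 en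
        by (simp add: F_ops EF C.minus_eq_zero_iff)
    qed
  qed
  have "TK \<subseteq> kernel FA (add_monoid C) h"
    unfolding TK_eq
  proof (rule group.generate_subgroup_incl[OF group_free_Abelian_group _ h.subgroup_kernel])
    show "tensor_relations LE LF N \<subseteq> kernel FA (add_monoid C) h"
      using relations_closed rel by (auto simp: kernel_def simp del: carrier_free_Abelian_group_iff)
  qed
  then have ker: "h c = \<zero>\<^bsub>C\<^esub>" if "c \<in> TK" for c using that by (auto simp: kernel_def)
  have "h c = h d" if cd: "c \<in> carrier FA" "d \<in> carrier FA" "TK #>\<^bsub>FA\<^esub> c = TK #>\<^bsub>FA\<^esub> d" for c d
  proof -
    have "c \<in> TK #>\<^bsub>FA\<^esub> d"
      using group.rcos_self[OF group_free_Abelian_group cd(1) TK_subgroup] cd(3) by simp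
    then obtain t where t: "t \<in> TK" "c = t \<otimes>\<^bsub>FA\<^esub> d" by (auto simp: r_coset_def)
    have "t \<in> carrier FA" using t(1) subgroup.subset[OF TK_subgroup] by blast
    then show ?thesis using h.hom_mult[of t d] ker[OF t(1)] t(2) cd(2) h.hom_closed[OF cd(2)] by simp
  qed
  from FactGroup_universal[OF h TK_normal this]
  obtain g where g: "g \<in> hom (FA Mod TK) (add_monoid C)"
    "\<And>c. c \<in> carrier FA \<Longrightarrow> g (TK #>\<^bsub>FA\<^esub> c) = h c" by blast
  show ?thesis
  proof (intro bexI ballI)
    show "g \<in> add_hom V C" using g(1) unfolding hom_V TG_eq .
    show "g (tensor a n) = \<beta> a n" if "a \<in> F" "n \<in> carrier N" for a n
      using that g(2)[of "frag_of (a, n)"] hf[of "(a, n)"] by (simp add: tensor_eq)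
  qed
qed

text \<open>The map \<psi> \<otimes> id from F \<otimes>_E N to E \<otimes>_E N = N. With the trace
  or the normalised trace as \<psi> it leads from f_+ f^! N back to \<open>N\<close>.\<close>

definition push :: "('a \<Rightarrow> 'a) \<Rightarrow> _ \<Rightarrow> 'n" where
  "push \<psi> = (SOME h. h \<in> add_hom V N \<and> (\<forall>a\<in>F. \<forall>n\<in>carrier N. h (tensor a n) = \<mu>E (\<psi> a) \<odot>\<^bsub>N\<^esub> n))"

lemma push:
  assumes \<psi>: "functional \<psi>"
  shows "push \<psi> \<in> add_hom V N" "a \<in> F \<Longrightarrow> n \<in> carrier N \<Longrightarrow> push \<psi> (tensor a n) = \<mu>E (\<psi> a) \<odot>\<^bsub>N\<^esub> n"
proof -
  note \<psi>D = functionalD[OF \<psi>]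
  have "\<exists>h\<in>add_hom V N. \<forall>a\<in>F. \<forall>n\<in>carrier N. h (tensor a n) = \<mu>E (\<psi> a) \<odot>\<^bsub>N\<^esub> n"
  proof (rule tensor_universal[OF N.M.abelian_group_axioms])
    show "\<mu>E (\<psi> a) \<odot>\<^bsub>N\<^esub> n \<in> carrier N" if "a \<in> F" "n \<in> carrier N" for a n
      using that \<mu>E_closed[OF \<psi>D(1)] by (intro N.smult_closed)
    show "\<mu>E (\<psi> (a \<oplus> b)) \<odot>\<^bsub>N\<^esub> n = \<mu>E (\<psi> a) \<odot>\<^bsub>N\<^esub> n \<oplus>\<^bsub>N\<^esub> \<mu>E (\<psi> b) \<odot>\<^bsub>N\<^esub> n"
      if "a \<in> F" "b \<in> F" "n \<in> carrier N" for a b n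
      using N.smult_l_distr[OF \<mu>E_closed[OF \<psi>D(1)] \<mu>E_closed[OF \<psi>D(1)], of a b n] \<psi>D(1) that
      by (simp add: \<psi>D(2) \<mu>E_add)
    show "\<mu>E (\<psi> a) \<odot>\<^bsub>N\<^esub> (n \<oplus>\<^bsub>N\<^esub> n') = \<mu>E (\<psi> a) \<odot>\<^bsub>N\<^esub> n \<oplus>\<^bsub>N\<^esub> \<mu>E (\<psi> a) \<odot>\<^bsub>N\<^esub> n'"
      if "a \<in> F" "n \<in> carrier N" "n' \<in> carrier N" for a n n'
      using that \<mu>E_closed[OF \<psi>D(1)] by (intro N.smult_r_distr)
    show "\<mu>E (\<psi> (a \<otimes> e)) \<odot>\<^bsub>N\<^esub> n = \<mu>E (\<psi> a) \<odot>\<^bsub>N\<^esub> (\<mu>E e \<odot>\<^bsub>N\<^esub> n)"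
      if "a \<in> F" "e \<in> E" "n \<in> carrier N" for a e n
      using N.smult_assoc[OF \<mu>E_closed[OF \<psi>D(1)] \<mu>E_closed, of a e n] \<psi>D(1) that
      by (simp add: \<psi>D(4) \<mu>E_mult)
  qed
  then have "\<exists>h. h \<in> add_hom V N \<and> (\<forall>a\<in>F. \<forall>n\<in>carrier N. h (tensor a n) = \<mu>E (\<psi> a) \<odot>\<^bsub>N\<^esub> n)" by blast
  from someI_ex[OF this] have *: "push \<psi> \<in> add_hom V N \<and>
      (\<forall>a\<in>F. \<forall>n\<in>carrier N. push \<psi> (tensor a n) = \<mu>E (\<psi> a) \<odot>\<^bsub>N\<^esub> n)"
    unfolding push_def .
  then show "push \<psi> \<in> add_hom V N" by blast
  show "a \<in> F \<Longrightarrow> n \<in> carrier N \<Longrightarrow> push \<psi> (tensor a n) = \<mu>E (\<psi> a) \<odot>\<^bsub>N\<^esub> n"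
    using * by blast
qed

lemma push_closed: "functional \<psi> \<Longrightarrow> v \<in> carrier V \<Longrightarrow> push \<psi> v \<in> carrier N"
  by (rule add_hom_closed[OF push(1)])

section \<open>The action of operators on the tensor product\<close>

lemma tensor_add_hom: "a \<in> F \<Longrightarrow> (\<lambda>n. tensor a n) \<in> add_hom N V"
  by (intro add_homI tensor_closed tensor_add_r)

lemma tensor_sum:
  assumes Q: "Q \<in> carrier DE" and n: "n \<in> carrier N" and I: "finite I" and a: "a \<in> F"
    and P: "\<And>i. i \<in> I \<Longrightarrow> P i \<in> carrier DE" and eq: "Q = (\<Oplus>\<^bsub>DE\<^esub>i\<in>I. P i)"
  shows "tensor a (Q \<odot>\<^bsub>N\<^esub> n) = (\<Oplus>\<^bsub>V\<^esub>i\<in>I. tensor a (P i \<odot>\<^bsub>N\<^esub> n))"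
proof -
  have "Q \<odot>\<^bsub>N\<^esub> n = (\<Oplus>\<^bsub>N\<^esub>i\<in>I. P i \<odot>\<^bsub>N\<^esub> n)" unfolding eq using N.smult_l_finsum[OF n I] P by blast
  then show ?thesis
    using P n by (simp, intro add_hom_finsum[OF N.M.abelian_group_axioms V_abelian_group tensor_add_hom[OF a] I])
      (auto intro: N.smult_closed)
qed

text \<open>The value prescribed by the canonical expansion of \<open>P\<close> composed with
  multiplication by \<open>a\<close>. It is the candidate for the definite description in
  \<open>tensor_action\<close>, which quantifies over all expansions.\<close>

definition act :: "('a \<Rightarrow> 'a) \<Rightarrow> _ \<Rightarrow> _" where
  "act P = (SOME h. h \<in> add_hom V V \<and> (\<forall>a\<in>F. \<forall>n\<in>carrier N.
      h (tensor a n) = (\<Oplus>\<^bsub>V\<^esub>j\<in>{..<m}. tensor (x j) (coef (\<phi> j) (P \<otimes>\<^bsub>DF\<^esub> \<mu>F a) \<odot>\<^bsub>N\<^esub> n))))"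

lemma coef_\<phi>_closed: "j < m \<Longrightarrow> P \<in> carrier DF \<Longrightarrow> a \<in> F \<Longrightarrow> coef (\<phi> j) (P \<otimes>\<^bsub>DF\<^esub> \<mu>F a) \<in> carrier DE"
  by (intro coef_closed functional_\<phi> DF.m_closed \<mu>F_closed)

lemma act:
  assumes P: "P \<in> carrier DF"
  shows act_add_hom: "act P \<in> add_hom V V"
    and act_tensor: "a \<in> F \<Longrightarrow> n \<in> carrier N \<Longrightarrow>
      act P (tensor a n) = (\<Oplus>\<^bsub>V\<^esub>j\<in>{..<m}. tensor (x j) (coef (\<phi> j) (P \<otimes>\<^bsub>DF\<^esub> \<mu>F a) \<odot>\<^bsub>N\<^esub> n))"
proof -
  interpret V: abelian_group V by (rule V_abelian_group)
  let ?c = "\<lambda>j a. coef (\<phi> j) (P \<otimes>\<^bsub>DF\<^esub> \<mu>F a)"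
  let ?\<beta> = "\<lambda>a n. \<Oplus>\<^bsub>V\<^esub>j\<in>{..<m}. tensor (x j) (?c j a \<odot>\<^bsub>N\<^esub> n)"
  note c = coef_\<phi>_closed[OF _ P]
  have cn: "?c j a \<odot>\<^bsub>N\<^esub> n \<in> carrier N" if "j < m" "a \<in> F" "n \<in> carrier N" for j a n
    using N.smult_closed[OF c[OF that(1,2)] that(3)] .
  have t: "tensor (x j) (?c j a \<odot>\<^bsub>N\<^esub> n) \<in> carrier V" if "j < m" "a \<in> F" "n \<in> carrier N" for j a n
    using tensor_closed[OF x_F cn] that by simp
  have "\<exists>h\<in>add_hom V V. \<forall>a\<in>F. \<forall>n\<in>carrier N. h (tensor a n) = ?\<beta> a n"
  proof (rule tensor_universal[OF V_abelian_group])
    show "?\<beta> a n \<in> carrier V" if "a \<in> F" "n \<in> carrier N" for a n using t that by (intro V.finsum_closed) auto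
    show "?\<beta> (a \<oplus> b) n = ?\<beta> a n \<oplus>\<^bsub>V\<^esub> ?\<beta> b n" if ab: "a \<in> F" "b \<in> F" and n: "n \<in> carrier N" for a b n
    proof -
      have "?c j (a \<oplus> b) = ?c j a \<oplus>\<^bsub>DE\<^esub> ?c j b" if j: "j < m" for j
        using P ab \<mu>F_closed add_hom_add[OF coef_add_hom[OF functional_\<phi>[OF j]]] by (simp add: \<mu>F_add DF.r_distr)
      then have "?\<beta> (a \<oplus> b) n = (\<Oplus>\<^bsub>V\<^esub>j\<in>{..<m}. tensor (x j) (?c j a \<odot>\<^bsub>N\<^esub> n) \<oplus>\<^bsub>V\<^esub> tensor (x j) (?c j b \<odot>\<^bsub>N\<^esub> n))"
        using c ab n t cn x_F by (intro V.finsum_cong') (auto simp: N.smult_l_distr tensor_add_r)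
      also have "\<dots> = ?\<beta> a n \<oplus>\<^bsub>V\<^esub> ?\<beta> b n" using t ab n by (intro V.finsum_addf) auto
      finally show ?thesis .
    qed
    show "?\<beta> a (n \<oplus>\<^bsub>N\<^esub> n') = ?\<beta> a n \<oplus>\<^bsub>V\<^esub> ?\<beta> a n'"
      if a: "a \<in> F" and n: "n \<in> carrier N" "n' \<in> carrier N" for a n n'
    proof -
      have "?\<beta> a (n \<oplus>\<^bsub>N\<^esub> n') = (\<Oplus>\<^bsub>V\<^esub>j\<in>{..<m}. tensor (x j) (?c j a \<odot>\<^bsub>N\<^esub> n) \<oplus>\<^bsub>V\<^esub> tensor (x j) (?c j a \<odot>\<^bsub>N\<^esub> n'))"
        using c a n t cn x_F by (intro V.finsum_cong') (auto simp: N.smult_r_distr tensor_add_r)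
      also have "\<dots> = ?\<beta> a n \<oplus>\<^bsub>V\<^esub> ?\<beta> a n'" using t a n by (intro V.finsum_addf) auto
      finally show ?thesis .
    qed
    show "?\<beta> (a \<otimes> e) n = ?\<beta> a (\<mu>E e \<odot>\<^bsub>N\<^esub> n)" if a: "a \<in> F" and e: "e \<in> E" and n: "n \<in> carrier N" for a e n
    proof (intro V.finsum_cong' refl)
      note ue = \<mu>E_closed[OF e]
      fix j assume "j \<in> {..<m}"
      then have j: "j < m" by simp
      \<comment> \<open>For balancedness: multiplication by \<open>e\<close> is the lift of an
        operator of \<open>E\<close>, which the coefficient maps let through on the right.\<close>
      have "P \<otimes>\<^bsub>DF\<^esub> \<mu>F (a \<otimes> e) = (P \<otimes>\<^bsub>DF\<^esub> \<mu>F a) \<otimes>\<^bsub>DF\<^esub> lift_op (\<mu>E e)"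
        using P a e EF \<mu>F_closed by (simp add: \<mu>F_mult lift_op_\<mu> DF.m_assoc)
      then have "?c j (a \<otimes> e) = ?c j a \<otimes>\<^bsub>DE\<^esub> \<mu>E e"
        using coef_mult_lift[OF functional_\<phi>[OF j] _ ue] P \<mu>F_closed[OF a] by simp
      then show "tensor (x j) (?c j (a \<otimes> e) \<odot>\<^bsub>N\<^esub> n) = tensor (x j) (?c j a \<odot>\<^bsub>N\<^esub> (\<mu>E e \<odot>\<^bsub>N\<^esub> n))"
        using N.smult_assoc[OF c[OF j a] ue n] by simp
    qed (use t a n e N.smult_closed[OF \<mu>E_closed[OF e] n] in auto)
  qed
  then have "\<exists>h. h \<in> add_hom V V \<and> (\<forall>a\<in>F. \<forall>n\<in>carrier N. h (tensor a n) = ?\<beta> a n)" by blast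
  from someI_ex[OF this] have *: "act P \<in> add_hom V V \<and> (\<forall>a\<in>F. \<forall>n\<in>carrier N. act P (tensor a n) = ?\<beta> a n)"
    unfolding act_def .
  show "act P \<in> add_hom V V" by (rule conjunct1[OF *])
  show "a \<in> F \<Longrightarrow> n \<in> carrier N \<Longrightarrow> act P (tensor a n) = ?\<beta> a n" using conjunct2[OF *] by simp
qed

lemma tensor_finsum_l:
  assumes n: "n \<in> carrier N" and "finite I" "\<And>i. i \<in> I \<Longrightarrow> f i \<in> F"
  shows "tensor (\<Oplus>i\<in>I. f i) n = (\<Oplus>\<^bsub>V\<^esub>i\<in>I. tensor (f i) n)"
  using assms(2,3)
proof (induction I rule: finite_induct)
  interpret V: abelian_group V by (rule V_abelian_group)
  {
    case empty
    have "tensor \<zero> n \<oplus>\<^bsub>V\<^esub> tensor \<zero> n = tensor \<zero> n" using tensor_add_l[of \<zero> \<zero> n] n F_ops by simp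
    then show ?case using tensor_closed[of \<zero> n] n F_ops by simp
  next
    case (insert i I)
    have s: "(\<Oplus>i\<in>I. f i) \<in> F" using insert by (intro F_finsum) auto
    show ?case using insert s tensor_closed n F_car tensor_add_l[OF _ s n, of "f i"]
      by (subst finsum_insert, simp, simp, force, force, subst V.finsum_insert) auto
  }
qed

text \<open>Independence of the expansion: the coefficient of x_j is \<Sum>_i \<phi>_j(b_i) Q_i, the
  scalar \<phi>_j(b_i) moves across the tensor sign, and \<Sum>_j x_j \<phi>_j(b_i) = b_i.\<close>

lemma act_unique:
  assumes P: "P \<in> carrier DF" and a: "a \<in> F" and n: "n \<in> carrier N"
    and b: "b \<in> {..<r} \<rightarrow> F" and Q: "Q \<in> {..<r} \<rightarrow> carrier DE"
    and eq: "P \<otimes>\<^bsub>DF\<^esub> \<mu>F a = (\<Oplus>\<^bsub>DF\<^esub>i\<in>{..<r::nat}. \<mu>F (b i) \<otimes>\<^bsub>DF\<^esub> lift_op (Q i))"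
  shows "act P (tensor a n) = (\<Oplus>\<^bsub>V\<^esub>i\<in>{..<r}. tensor (b i) (Q i \<odot>\<^bsub>N\<^esub> n))"
proof -
  interpret V: abelian_group V by (rule V_abelian_group)
  have bF: "b i \<in> F" and QD: "Q i \<in> carrier DE" if "i < r" for i using that b Q by auto
  have Qn: "Q i \<odot>\<^bsub>N\<^esub> n \<in> carrier N" if "i < r" for i using QD[OF that] n by (rule N.smult_closed)
  have \<phi>b: "\<phi> j (b i) \<in> E" if "j < m" "i < r" for i j using \<phi>_E bF that by simp
  have tc: "tensor (x j \<otimes> \<phi> j (b i)) (Q i \<odot>\<^bsub>N\<^esub> n) \<in> carrier V" if "j < m" "i < r" for i j
    using that x_F \<phi>b EF F_ops Qn by (intro tensor_closed) auto
  have "act P (tensor a n) = (\<Oplus>\<^bsub>V\<^esub>j\<in>{..<m}. \<Oplus>\<^bsub>V\<^esub>i\<in>{..<r}. tensor (x j \<otimes> \<phi> j (b i)) (Q i \<odot>\<^bsub>N\<^esub> n))"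
    unfolding act_tensor[OF P a n]
  proof (intro V.finsum_cong' refl)
    fix j assume "j \<in> {..<m}"
    then have j: "j < m" by simp
    have u: "\<mu>E (\<phi> j (b i)) \<in> carrier DE" if "i < r" for i using \<mu>E_closed[OF \<phi>b[OF j that]] .
    have "tensor (x j) (coef (\<phi> j) (P \<otimes>\<^bsub>DF\<^esub> \<mu>F a) \<odot>\<^bsub>N\<^esub> n) =
        (\<Oplus>\<^bsub>V\<^esub>i\<in>{..<r}. tensor (x j) ((\<mu>E (\<phi> j (b i)) \<otimes>\<^bsub>DE\<^esub> Q i) \<odot>\<^bsub>N\<^esub> n))"
    proof (rule tensor_sum[OF coef_\<phi>_closed[OF j P a] n _ x_F[OF j]])
      show "coef (\<phi> j) (P \<otimes>\<^bsub>DF\<^esub> \<mu>F a) = (\<Oplus>\<^bsub>DE\<^esub>i\<in>{..<r}. \<mu>E (\<phi> j (b i)) \<otimes>\<^bsub>DE\<^esub> Q i)"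
        unfolding eq using bF QD by (intro coef_expansion functional_\<phi> j) auto
    qed (use u QD in auto)
    also have "\<dots> = (\<Oplus>\<^bsub>V\<^esub>i\<in>{..<r}. tensor (x j \<otimes> \<phi> j (b i)) (Q i \<odot>\<^bsub>N\<^esub> n))"
      using tc[OF j] tensor_balanced[OF x_F[OF j] \<phi>b[OF j] Qn] N.smult_assoc[OF u QD n] by (intro V.finsum_cong') auto
    finally show "tensor (x j) (coef (\<phi> j) (P \<otimes>\<^bsub>DF\<^esub> \<mu>F a) \<odot>\<^bsub>N\<^esub> n) = \<dots>" .
  qed (use tc in \<open>auto intro!: V.finsum_closed\<close>)
  also have "\<dots> = (\<Oplus>\<^bsub>V\<^esub>i\<in>{..<r}. \<Oplus>\<^bsub>V\<^esub>j\<in>{..<m}. tensor (x j \<otimes> \<phi> j (b i)) (Q i \<odot>\<^bsub>N\<^esub> n))"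
    using tc by (intro V.finsum_swap) auto
  also have "\<dots> = (\<Oplus>\<^bsub>V\<^esub>i\<in>{..<r}. tensor (b i) (Q i \<odot>\<^bsub>N\<^esub> n))"
  proof (intro V.finsum_cong' refl)
    fix i assume "i \<in> {..<r}"
    then have i: "i < r" by simp
    have "(\<Oplus>\<^bsub>V\<^esub>j\<in>{..<m}. tensor (x j \<otimes> \<phi> j (b i)) (Q i \<odot>\<^bsub>N\<^esub> n)) = tensor (\<Oplus>j\<in>{..<m}. x j \<otimes> \<phi> j (b i)) (Q i \<odot>\<^bsub>N\<^esub> n)"
      using x_F \<phi>b[OF _ i] EF F_ops by (intro tensor_finsum_l[OF Qn[OF i], symmetric]) auto
    then show "(\<Oplus>\<^bsub>V\<^esub>j\<in>{..<m}. tensor (x j \<otimes> \<phi> j (b i)) (Q i \<odot>\<^bsub>N\<^esub> n)) = tensor (b i) (Q i \<odot>\<^bsub>N\<^esub> n)"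
      using expand[OF bF[OF i]] by simp
  qed (use bF Qn tensor_closed in auto)
  finally show ?thesis .
qed

lemma tensor_action_eq:
  assumes P: "P \<in> carrier DF"
  shows "tensor_action k LE LF N P = restrict (act P) (carrier V)"
proof -
  interpret V: abelian_group V by (rule V_abelian_group)
  \<comment> \<open>The definition of the action uses products in the multiplicative tensor group;
    they are the sums of the additive record.\<close>
  have fin: "finprod TG f I = finsum V f I" for f :: "nat \<Rightarrow> _" and I
  proof -
    have "(\<oplus>\<^bsub>V\<^esub>) = (\<otimes>\<^bsub>TG\<^esub>)" by (simp add: fun_eq_iff V_simps)
    then show ?thesis by (simp add: finsum_def finprod_def V_simps)
  qed
  have hom_TG: "hom TG TG = add_hom V V" by (simp add: hom_V)
  show ?thesis
    unfolding tensor_action_def fin hom_TG V_simps(1)[symmetric]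
  proof (rule the_equality)
    have "restrict (act P) (carrier V) \<in> add_hom V V"
      using add_hom_closed[OF act_add_hom[OF P]] add_hom_add[OF act_add_hom[OF P]] by (intro add_homI) auto
    moreover have "restrict (act P) (carrier V) (tensor a n) = (\<Oplus>\<^bsub>V\<^esub>i\<in>{..<r}. tensor (b i) (Q i \<odot>\<^bsub>N\<^esub> n))"
      if "a \<in> F" "n \<in> carrier N" "b \<in> {..<r} \<rightarrow> F" "Q \<in> {..<r} \<rightarrow> carrier DE"
        "P \<otimes>\<^bsub>DF\<^esub> \<mu>F a = (\<Oplus>\<^bsub>DF\<^esub>i\<in>{..<r::nat}. \<mu>F (b i) \<otimes>\<^bsub>DF\<^esub> lift_op (Q i))" for a n r b Q
      using act_unique[OF P that] tensor_closed[OF that(1,2)] by simp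
    ultimately show "restrict (act P) (carrier V) \<in> add_hom V V \<and> restrict (act P) (carrier V) \<in> extensional (carrier V) \<and>
      (\<forall>a\<in>carrier LF. \<forall>n\<in>carrier N. \<forall>(r::nat) b Q.
           b \<in> {..<r} \<rightarrow> carrier LF \<longrightarrow> Q \<in> {..<r} \<rightarrow> carrier DE \<longrightarrow>
           P \<otimes>\<^bsub>DF\<^esub> \<mu>F a = (\<Oplus>\<^bsub>DF\<^esub>i\<in>{..<r}. \<mu>F (b i) \<otimes>\<^bsub>DF\<^esub> lift_op (Q i)) \<longrightarrow>
           restrict (act P) (carrier V) (tensor a n) = (\<Oplus>\<^bsub>V\<^esub>i\<in>{..<r}. tensor (b i) (Q i \<odot>\<^bsub>N\<^esub> n)))"
      by simp
  next
    fix f assume f: "f \<in> add_hom V V \<and> f \<in> extensional (carrier V) \<and>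
      (\<forall>a\<in>carrier LF. \<forall>n\<in>carrier N. \<forall>(r::nat) b Q.
           b \<in> {..<r} \<rightarrow> carrier LF \<longrightarrow> Q \<in> {..<r} \<rightarrow> carrier DE \<longrightarrow>
           P \<otimes>\<^bsub>DF\<^esub> \<mu>F a = (\<Oplus>\<^bsub>DF\<^esub>i\<in>{..<r}. \<mu>F (b i) \<otimes>\<^bsub>DF\<^esub> lift_op (Q i)) \<longrightarrow>
           f (tensor a n) = (\<Oplus>\<^bsub>V\<^esub>i\<in>{..<r}. tensor (b i) (Q i \<odot>\<^bsub>N\<^esub> n)))"
    have "f (tensor a n) = act P (tensor a n)" if a: "a \<in> F" and n: "n \<in> carrier N" for a n
    proof -
      have Pm: "P \<otimes>\<^bsub>DF\<^esub> \<mu>F a \<in> carrier DF" using P \<mu>F_closed[OF a] by simp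
      have xm: "x \<in> {..<m} \<rightarrow> F" using x_F by auto
      have cm: "(\<lambda>i. coef (\<phi> i) (P \<otimes>\<^bsub>DF\<^esub> \<mu>F a)) \<in> {..<m} \<rightarrow> carrier DE"
        using coef_closed[OF functional_\<phi> Pm] by auto
      \<comment> \<open>Uniqueness: evaluate the defining condition at the canonical
        expansion.\<close>
      have "f (tensor a n) = (\<Oplus>\<^bsub>V\<^esub>i\<in>{..<m}. tensor (x i) (coef (\<phi> i) (P \<otimes>\<^bsub>DF\<^esub> \<mu>F a) \<odot>\<^bsub>N\<^esub> n))"
        using f a n xm cm expand_operator[OF Pm] by simp
      then show ?thesis using act_tensor[OF P a n] by simp
    qed
    then have "f v = act P v" if "v \<in> carrier V" for v
      using add_hom_eqI[OF V_abelian_group _ act_add_hom[OF P] _ that] f by blast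
    then show "f = restrict (act P) (carrier V)" using f by (intro extensionalityI[of _ "carrier V"]) auto
  qed
qed

lemma smult_V: "P \<in> carrier DF \<Longrightarrow> v \<in> carrier V \<Longrightarrow> P \<odot>\<^bsub>V\<^esub> v = act P v"
  using tensor_action_eq[of P] by (simp add: V_simps(4))

end

section \<open>Finite-dimensional modules\<close>

locale dmodule = field L for L (structure) +
  fixes k F :: "'a set" and V :: "('a \<Rightarrow> 'a, 'v) module"
  assumes subfield_F: "subfield F L" and k_F: "k \<subseteq> F"
    and V: "left_module (diff_ring k (L\<lparr>carrier := F\<rparr>)) V"

sublocale dmodule \<subseteq> V: left_module "diff_ring k (L\<lparr>carrier := F\<rparr>)" V
  by (rule V)

context dmodule
begin

abbreviation sc :: "'a \<Rightarrow> 'v \<Rightarrow> 'v" where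
  "sc a v \<equiv> mult_op (L\<lparr>carrier := F\<rparr>) a \<odot>\<^bsub>V\<^esub> v"

lemma subring_F: "subring F L" by (rule subfieldE(1)[OF subfield_F])

lemmas F_ops = subringE(2,3,5-7)[OF subring_F]
lemmas mult_op_closed = mult_op_diff_ring[OF subring_F k_F]

lemma F_car: "a \<in> F \<Longrightarrow> a \<in> carrier L" using subringE(1)[OF subring_F] by auto

lemma sc_closed: "a \<in> F \<Longrightarrow> v \<in> carrier V \<Longrightarrow> sc a v \<in> carrier V"
  by (intro V.smult_closed mult_op_closed)

lemma sc_add_r: "a \<in> F \<Longrightarrow> v \<in> carrier V \<Longrightarrow> w \<in> carrier V \<Longrightarrow> sc a (v \<oplus>\<^bsub>V\<^esub> w) = sc a v \<oplus>\<^bsub>V\<^esub> sc a w"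
  by (intro V.smult_r_distr mult_op_closed)

lemma sc_add_l: "a \<in> F \<Longrightarrow> b \<in> F \<Longrightarrow> v \<in> carrier V \<Longrightarrow> sc (a \<oplus> b) v = sc a v \<oplus>\<^bsub>V\<^esub> sc b v"
  by (simp add: mult_op_ring(1)[OF subring_F k_F] V.smult_l_distr mult_op_closed)

lemma sc_mult: "a \<in> F \<Longrightarrow> b \<in> F \<Longrightarrow> v \<in> carrier V \<Longrightarrow> sc (a \<otimes> b) v = sc a (sc b v)"
  by (simp add: mult_op_ring(2)[OF subring_F k_F] V.smult_assoc mult_op_closed)

lemma sc_one: "v \<in> carrier V \<Longrightarrow> sc \<one> v = v"
  by (simp add: mult_op_ring(3)[OF subring_F k_F] V.smult_one)

lemma sc_zero: "v \<in> carrier V \<Longrightarrow> sc \<zero> v = \<zero>\<^bsub>V\<^esub>"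
  using sc_add_l[of \<zero> \<zero> v] sc_closed[of \<zero> v] F_ops by simp

definition subspace :: "'v set \<Rightarrow> bool" where
  "subspace U \<longleftrightarrow> U \<subseteq> carrier V \<and> \<zero>\<^bsub>V\<^esub> \<in> U \<and> (\<forall>u\<in>U. \<forall>w\<in>U. u \<oplus>\<^bsub>V\<^esub> w \<in> U) \<and> (\<forall>a\<in>F. \<forall>u\<in>U. sc a u \<in> U)"

lemma subspaceD:
  assumes "subspace U"
  shows "u \<in> U \<Longrightarrow> u \<in> carrier V" "\<zero>\<^bsub>V\<^esub> \<in> U" "u \<in> U \<Longrightarrow> w \<in> U \<Longrightarrow> u \<oplus>\<^bsub>V\<^esub> w \<in> U"
    "a \<in> F \<Longrightarrow> u \<in> U \<Longrightarrow> sc a u \<in> U"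
  using assms by (auto simp: subspace_def)

lemma sc_minus: "w \<in> carrier V \<Longrightarrow> sc (\<ominus> \<one>) w = \<ominus>\<^bsub>V\<^esub> w"
proof -
  assume w: "w \<in> carrier V"
  have "\<zero>\<^bsub>V\<^esub> = sc (\<ominus> \<one> \<oplus> \<one>) w" using sc_zero[OF w] by (simp add: l_neg)
  also have "\<dots> = sc (\<ominus> \<one>) w \<oplus>\<^bsub>V\<^esub> w" using sc_add_l[of "\<ominus> \<one>" \<one> w] F_ops w sc_one by simp
  finally show ?thesis using V.M.minus_equality[of "sc (\<ominus> \<one>) w" w] sc_closed F_ops w by simp
qed

lemma subspace_minus: "subspace U \<Longrightarrow> u \<in> U \<Longrightarrow> w \<in> U \<Longrightarrow> u \<ominus>\<^bsub>V\<^esub> w \<in> U"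
  using subspaceD(3)[of U u "sc (\<ominus> \<one>) w"] subspaceD(4)[of U "\<ominus> \<one>" w] subspaceD(1)[of U w] sc_minus[of w] F_ops
  by (simp add: a_minus_def)

lemma subspace_finsum:
  assumes U: "subspace U" and "finite I" "\<And>i. i \<in> I \<Longrightarrow> f i \<in> U"
  shows "finsum V f I \<in> U"
  using assms(2,3)
proof (induction I rule: finite_induct)
  case (insert i I)
  then show ?case using subspaceD[OF U] by (subst V.M.finsum_insert) auto
qed (simp add: subspaceD[OF U])

lemma submodule_subspace: "submodule W (diff_ring k (L\<lparr>carrier := F\<rparr>)) V \<Longrightarrow> subspace W"
  using V.submoduleD mult_op_closed unfolding subspace_def by metis

text \<open>Spanning is rephrased by subspaces, so that later arguments handle no coefficient
  functions.\<close>

lemma finite_dim_overD: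
  assumes "finite_dim_over (L\<lparr>carrier := F\<rparr>) V"
  obtains B where "finite B" "B \<subseteq> carrier V" "\<And>U. subspace U \<Longrightarrow> B \<subseteq> U \<Longrightarrow> carrier V \<subseteq> U"
proof -
  obtain B where B: "finite B" "B \<subseteq> carrier V"
    "\<forall>v\<in>carrier V. \<exists>c\<in>B \<rightarrow> F. v = (\<Oplus>\<^bsub>V\<^esub>b\<in>B. sc (c b) b)"
    using assms by (auto simp: finite_dim_over_def)
  show thesis
  proof (rule that[OF B(1,2)])
    fix U assume U: "subspace U" "B \<subseteq> U"
    show "carrier V \<subseteq> U"
    proof
      fix v assume "v \<in> carrier V"
      then obtain c where c: "c \<in> B \<rightarrow> F" "v = (\<Oplus>\<^bsub>V\<^esub>b\<in>B. sc (c b) b)" using B(3) by blast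
      show "v \<in> U" unfolding c(2)
        using c(1) U(2) by (intro subspace_finsum[OF U(1) B(1)] subspaceD(4)[OF U(1)]) auto
    qed
  qed
qed

text \<open>The linear combinations of \<open>B\<close> form a subspace that contains
  \<open>B\<close>; the hypothesis is applied to this subspace.\<close>

lemma finite_dim_overI:
  assumes B: "finite B" "B \<subseteq> carrier V" and span: "\<And>U. subspace U \<Longrightarrow> B \<subseteq> U \<Longrightarrow> carrier V \<subseteq> U"
  shows "finite_dim_over (L\<lparr>carrier := F\<rparr>) V"
proof -
  let ?s = "\<lambda>c. \<Oplus>\<^bsub>V\<^esub>b\<in>B. sc (c b) b"
  define U where "U = ?s ` (B \<rightarrow> F)"
  have cl: "sc (c b) b \<in> carrier V" if "c \<in> B \<rightarrow> F" "b \<in> B" for c b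
    using that B(2) by (intro sc_closed) auto
  have sm: "?s c \<in> carrier V" if "c \<in> B \<rightarrow> F" for c using cl[OF that] by (intro V.M.finsum_closed) auto
  have "subspace U" unfolding subspace_def
  proof (intro conjI ballI)
    show "U \<subseteq> carrier V" using sm unfolding U_def by blast
    have "\<zero>\<^bsub>V\<^esub> = ?s (\<lambda>_. \<zero>)"
    proof -
      have "?s (\<lambda>_. \<zero>) = (\<Oplus>\<^bsub>V\<^esub>b\<in>B. \<zero>\<^bsub>V\<^esub>)" using sc_zero B(2) by (intro V.M.finsum_cong') auto
      then show ?thesis by simp
    qed
    moreover have "(\<lambda>_. \<zero>) \<in> B \<rightarrow> F" using F_ops by auto
    ultimately show "\<zero>\<^bsub>V\<^esub> \<in> U" unfolding U_def by (rule image_eqI)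
    show "u \<oplus>\<^bsub>V\<^esub> w \<in> U" if uw: "u \<in> U" "w \<in> U" for u w
    proof -
      obtain c d where cd: "c \<in> B \<rightarrow> F" "u = ?s c" "d \<in> B \<rightarrow> F" "w = ?s d" using uw unfolding U_def by blast
      have "u \<oplus>\<^bsub>V\<^esub> w = (\<Oplus>\<^bsub>V\<^esub>b\<in>B. sc (c b) b \<oplus>\<^bsub>V\<^esub> sc (d b) b)"
        unfolding cd(2,4) using cl[OF cd(1)] cl[OF cd(3)] by (intro V.M.finsum_addf[symmetric]) auto
      also have "\<dots> = ?s (\<lambda>b. c b \<oplus> d b)"
      proof (intro V.M.finsum_cong' refl)
        show "sc (c b) b \<oplus>\<^bsub>V\<^esub> sc (d b) b = sc (c b \<oplus> d b) b" if "b \<in> B" for b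
          using that cd(1,3) B(2) by (intro sc_add_l[symmetric]) auto
        show "(\<lambda>b. sc (c b \<oplus> d b) b) \<in> B \<rightarrow> carrier V"
          using cl[of "\<lambda>b. c b \<oplus> d b"] cd(1,3) F_ops by (simp add: Pi_iff)
      qed
      finally have "u \<oplus>\<^bsub>V\<^esub> w = ?s (\<lambda>b. c b \<oplus> d b)" .
      moreover have "(\<lambda>b. c b \<oplus> d b) \<in> B \<rightarrow> F" using cd(1,3) F_ops by (simp add: Pi_iff)
      ultimately show ?thesis unfolding U_def by (rule image_eqI)
    qed
    show "sc a u \<in> U" if au: "a \<in> F" "u \<in> U" for a u
    proof -
      obtain c where c: "c \<in> B \<rightarrow> F" "u = ?s c" using au unfolding U_def by blast
      have "sc a u = (\<Oplus>\<^bsub>V\<^esub>b\<in>B. sc a (sc (c b) b))"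
        unfolding c(2) using cl[OF c(1)] by (intro V.smult_finsum mult_op_closed au B(1)) auto
      also have "\<dots> = ?s (\<lambda>b. a \<otimes> c b)"
      proof (intro V.M.finsum_cong' refl)
        show "sc a (sc (c b) b) = sc (a \<otimes> c b) b" if "b \<in> B" for b
          using that c(1) B(2) au by (intro sc_mult[symmetric]) auto
        show "(\<lambda>b. sc (a \<otimes> c b) b) \<in> B \<rightarrow> carrier V"
          using cl[of "\<lambda>b. a \<otimes> c b"] c(1) F_ops au by (simp add: Pi_iff)
      qed
      finally have "sc a u = ?s (\<lambda>b. a \<otimes> c b)" .
      moreover have "(\<lambda>b. a \<otimes> c b) \<in> B \<rightarrow> F" using c(1) F_ops au by (simp add: Pi_iff)
      ultimately show ?thesis unfolding U_def by (rule image_eqI)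
    qed
  qed
  moreover have "B \<subseteq> U"
  proof
    fix b assume b: "b \<in> B"
    \<comment> \<open>The Kronecker delta exhibits a member of \<open>B\<close> as a
      combination.\<close>
    let ?d = "\<lambda>b'. if b = b' then \<one> else \<zero>"
    have "?s ?d = (\<Oplus>\<^bsub>V\<^esub>b'\<in>B. if b = b' then b' else \<zero>\<^bsub>V\<^esub>)"
      using B(2) sc_zero sc_one by (intro V.M.finsum_cong') auto
    also have "\<dots> = b" using B b by (intro V.M.add.finprod_singleton) auto
    finally have "b = ?s ?d" ..
    moreover have "?d \<in> B \<rightarrow> F" using F_ops by simp
    ultimately show "b \<in> U" unfolding U_def by (rule image_eqI)
  qed
  ultimately have "carrier V \<subseteq> U" using span by blast
  then show ?thesis using B unfolding finite_dim_over_def U_def by (intro exI[of _ B]) auto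
qed

text \<open>The set of leading indices with respect to a spanning sequence detects strict inclusions.\<close>

lemma finite_dim_lead:
  assumes "finite_dim_over (L\<lparr>carrier := F\<rparr>) V"
  obtains lead :: "'v set \<Rightarrow> nat set" where "\<And>W. finite (lead W)"
    "\<And>W W'. W' \<subseteq> W \<Longrightarrow> lead W' \<subseteq> lead W"
    "\<And>W W'. subspace W \<Longrightarrow> subspace W' \<Longrightarrow> W' \<subseteq> W \<Longrightarrow> lead W \<subseteq> lead W' \<Longrightarrow> W \<subseteq> W'"
    "\<And>W. \<exists>B. finite B \<and> B \<subseteq> W \<and> lead W \<subseteq> lead B"
proof -
  obtain B where B: "finite B" "B \<subseteq> carrier V" "\<And>U. subspace U \<Longrightarrow> B \<subseteq> U \<Longrightarrow> carrier V \<subseteq> U"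
    using finite_dim_overD[OF assms] by metis
  obtain b where b: "bij_betw b {..<card B} B"
    using ex_bij_betw_nat_finite[OF B(1)] unfolding atLeast0LessThan by blast
  let ?n = "card B"
  have bV: "b i \<in> carrier V" if "i < ?n" for i using b that B(2) unfolding bij_betw_def by blast
  \<comment> \<open>The flag of the spanning sequence: \<open>sp i\<close> is the span of the first
    \<open>i\<close> vectors, from \<open>b 0\<close> to \<open>b (i - 1)\<close>.\<close>
  define sp where "sp = rec_nat {\<zero>\<^bsub>V\<^esub>} (\<lambda>i S. {sc a (b i) \<oplus>\<^bsub>V\<^esub> u | a u. a \<in> F \<and> u \<in> S})"
  have sp0: "sp 0 = {\<zero>\<^bsub>V\<^esub>}" and spS: "sp (Suc i) = {sc a (b i) \<oplus>\<^bsub>V\<^esub> u | a u. a \<in> F \<and> u \<in> sp i}" for i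
    by (simp_all add: sp_def)
  have sub: "i \<le> ?n \<Longrightarrow> subspace (sp i) \<and> b ` {..<i} \<subseteq> sp i" for i
  proof (induction i)
    case 0
    show ?case unfolding sp0 subspace_def using mult_op_closed by (auto simp: V.smult_r_null)
  next
    case (Suc i)
    then have S: "subspace (sp i)" "b ` {..<i} \<subseteq> sp i" and i: "i < ?n" by auto
    note SD = subspaceD[OF S(1)]
    have in_sp: "u \<in> sp (Suc i)" if "u \<in> sp i" for u
      using that sc_zero[OF bV[OF i]] SD(1)[OF that] F_ops(1) unfolding spS
      by (intro CollectI exI[of _ \<zero>] exI[of _ u]) simp
    have "b i \<in> sp (Suc i)"
      using sc_one[OF bV[OF i]] bV[OF i] SD(2) F_ops(2) unfolding spS
      by (intro CollectI exI[of _ \<one>] exI[of _ "\<zero>\<^bsub>V\<^esub>"]) simp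
    then have "b ` {..<Suc i} \<subseteq> sp (Suc i)" using S(2) in_sp by (simp add: lessThan_Suc subset_iff)
    moreover have "subspace (sp (Suc i))" unfolding subspace_def
    proof (intro conjI ballI)
      show "sp (Suc i) \<subseteq> carrier V" unfolding spS using SD(1) sc_closed bV[OF i] by auto
      show "\<zero>\<^bsub>V\<^esub> \<in> sp (Suc i)" using in_sp SD(2) .
      show "u \<oplus>\<^bsub>V\<^esub> w \<in> sp (Suc i)" if uw: "u \<in> sp (Suc i)" "w \<in> sp (Suc i)" for u w
      proof -
        obtain a v where 1: "a \<in> F" "v \<in> sp i" "u = sc a (b i) \<oplus>\<^bsub>V\<^esub> v" using uw(1) unfolding spS by blast
        obtain a' v' where 2: "a' \<in> F" "v' \<in> sp i" "w = sc a' (b i) \<oplus>\<^bsub>V\<^esub> v'" using uw(2) unfolding spS by blast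
        have "u \<oplus>\<^bsub>V\<^esub> w = sc (a \<oplus> a') (b i) \<oplus>\<^bsub>V\<^esub> (v \<oplus>\<^bsub>V\<^esub> v')"
          unfolding 1(3) 2(3) using 1(1,2) 2(1,2) SD(1) sc_closed bV[OF i] by (simp add: sc_add_l V.M.a_ac)
        moreover have "a \<oplus> a' \<in> F" "v \<oplus>\<^bsub>V\<^esub> v' \<in> sp i" using 1 2 F_ops SD(3) by simp_all
        ultimately show ?thesis unfolding spS by blast
      qed
      show "sc c u \<in> sp (Suc i)" if cu: "c \<in> F" "u \<in> sp (Suc i)" for c u
      proof -
        obtain a v where 1: "a \<in> F" "v \<in> sp i" "u = sc a (b i) \<oplus>\<^bsub>V\<^esub> v" using cu(2) unfolding spS by blast
        have "sc c u = sc (c \<otimes> a) (b i) \<oplus>\<^bsub>V\<^esub> sc c v"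
          unfolding 1(3) using 1(1,2) cu(1) SD(1) sc_closed bV[OF i] by (simp add: sc_mult sc_add_r)
        moreover have "c \<otimes> a \<in> F" "sc c v \<in> sp i" using 1 F_ops SD(4) cu(1) by simp_all
        ultimately show ?thesis unfolding spS by blast
      qed
    qed
    ultimately show ?case by blast
  qed
  have spn: "carrier V \<subseteq> sp ?n"
    using B(3)[of "sp ?n"] sub[of ?n] b by (simp add: bij_betw_def)
  \<comment> \<open>The pivots of \<open>W\<close> along the flag: indices at which \<open>W\<close>
    has an element with leading term \<open>b i\<close>. The sequence may be dependent, and then the
    zero vector accounts for some pivots of every subspace; this does no harm, as only inclusions of
    pivot sets are compared.\<close>
  define lead where "lead W = {i. i < ?n \<and> (\<exists>u\<in>sp i. b i \<oplus>\<^bsub>V\<^esub> u \<in> W)}" for W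
  \<comment> \<open>Elimination along the flag: an element of \<open>W\<close> in
    \<open>sp (Suc i)\<close> is corrected by an element of \<open>W'\<close> with the same leading
    term and falls into \<open>sp i\<close>.\<close>
  have key: "W \<subseteq> W'" if W: "subspace W" and W': "subspace W'" and "W' \<subseteq> W" and eq: "lead W \<subseteq> lead W'" for W W'
  proof -
    have "i \<le> ?n \<Longrightarrow> W \<inter> sp i \<subseteq> W'" for i
    proof (induction i)
      case 0
      then show ?case using subspaceD(2)[OF W'] by (auto simp: sp0)
    next
      case (Suc i)
      then have i: "i < ?n" by simp
      note S = subspaceD[OF conjunct1[OF sub], of i] and sm = subspace_minus[OF conjunct1[OF sub], of i]
      show ?case
      proof
        fix w assume w: "w \<in> W \<inter> sp (Suc i)"
        then obtain a u where au: "a \<in> F" "u \<in> sp i" "w = sc a (b i) \<oplus>\<^bsub>V\<^esub> u" unfolding spS by blast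
        have uV: "u \<in> carrier V" "w \<in> carrier V" using au(2) S(1) i w subspaceD(1)[OF W] by auto
        show "w \<in> W'"
        proof (cases "a = \<zero>")
          case True
          then have "w = u" using au(3) sc_zero[OF bV[OF i]] uV by simp
          then show ?thesis using Suc au(2) w by auto
        next
          case False
          then have aF: "a \<in> F - {\<zero>}" using au(1) by blast
          note ia = subfield_m_inv[OF subfield_F aF]
          have "inv a \<in> F" using ia(1) by blast
          have "sc (inv a) w = b i \<oplus>\<^bsub>V\<^esub> sc (inv a) u"
            unfolding au(3) using sc_add_r[OF \<open>inv a \<in> F\<close> sc_closed[OF au(1) bV[OF i]] uV(1)]
              sc_mult[OF \<open>inv a \<in> F\<close> au(1) bV[OF i], symmetric] ia(3) sc_one[OF bV[OF i]] by simp
          then have "i \<in> lead W"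
            unfolding lead_def using i subspaceD(4)[OF W \<open>inv a \<in> F\<close>, of w] w S(4)[OF _ \<open>inv a \<in> F\<close> au(2)] by auto
          then obtain u' where u': "u' \<in> sp i" "b i \<oplus>\<^bsub>V\<^esub> u' \<in> W'" using eq unfolding lead_def by blast
          let ?w' = "sc a (b i \<oplus>\<^bsub>V\<^esub> u')"
          have w': "?w' \<in> W'" using subspaceD(4)[OF W' au(1) u'(2)] .
          have u'V: "u' \<in> carrier V" "sc a u' \<in> sp i" "sc a u' \<in> carrier V"
            using u' S(1,4) i au(1) sc_closed by auto
          have "?w' = sc a (b i) \<oplus>\<^bsub>V\<^esub> sc a u'" using sc_add_r au(1) bV[OF i] u'V by simp
          moreover have "w = (u \<ominus>\<^bsub>V\<^esub> sc a u') \<oplus>\<^bsub>V\<^esub> (sc a (b i) \<oplus>\<^bsub>V\<^esub> sc a u')"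
          proof -
            have "(u \<ominus>\<^bsub>V\<^esub> sc a u') \<oplus>\<^bsub>V\<^esub> (sc a (b i) \<oplus>\<^bsub>V\<^esub> sc a u') =
                sc a (b i) \<oplus>\<^bsub>V\<^esub> ((u \<ominus>\<^bsub>V\<^esub> sc a u') \<oplus>\<^bsub>V\<^esub> sc a u')"
              using sc_closed[OF au(1) bV[OF i]] uV u'V by (simp add: V.M.a_lcomm)
            then show ?thesis using au(3) V.M.add_diff_cancel(3)[OF uV(1) u'V(3)] by simp
          qed
          ultimately have "w \<ominus>\<^bsub>V\<^esub> ?w' = u \<ominus>\<^bsub>V\<^esub> sc a u'"
            using V.M.add_diff_cancel(1)[of "u \<ominus>\<^bsub>V\<^esub> sc a u'" ?w'] uV u'V subspaceD(1)[OF W' w'] by simp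
          then have "w \<ominus>\<^bsub>V\<^esub> ?w' \<in> sp i" using sm[OF _ au(2) u'V(2)] i by simp
          moreover have "w \<ominus>\<^bsub>V\<^esub> ?w' \<in> W" using subspace_minus[OF W] w w' \<open>W' \<subseteq> W\<close> by blast
          ultimately have "w \<ominus>\<^bsub>V\<^esub> ?w' \<in> W'" using Suc i by auto
          then have "(w \<ominus>\<^bsub>V\<^esub> ?w') \<oplus>\<^bsub>V\<^esub> ?w' \<in> W'" using subspaceD(3)[OF W'] w' by blast
          then show ?thesis using V.M.add_diff_cancel(3)[OF uV(2) subspaceD(1)[OF W' w']] by simp
        qed
      qed
    qed
    from this[of ?n] show ?thesis using spn subspaceD(1)[OF W] by blast
  qed
  show thesis
  proof (rule that[of lead])
    show "\<exists>C. finite C \<and> C \<subseteq> W \<and> lead W \<subseteq> lead C" for W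
    proof -
      \<comment> \<open>One witness for each pivot gives a finite subset that already has all pivots
        of \<open>W\<close>.\<close>
      have "\<forall>i. \<exists>w. i \<in> lead W \<longrightarrow> w \<in> W \<and> (\<exists>u\<in>sp i. w = b i \<oplus>\<^bsub>V\<^esub> u)" unfolding lead_def by blast
      then obtain w where w: "\<And>i. i \<in> lead W \<Longrightarrow> w i \<in> W \<and> (\<exists>u\<in>sp i. w i = b i \<oplus>\<^bsub>V\<^esub> u)" by metis
      have "lead W \<subseteq> lead (w ` lead W)"
      proof
        fix i assume i: "i \<in> lead W"
        then obtain u where "u \<in> sp i" "w i = b i \<oplus>\<^bsub>V\<^esub> u" using w by blast
        moreover have "i < ?n" "w i \<in> w ` lead W" using i by (auto simp: lead_def)
        ultimately show "i \<in> lead (w ` lead W)" unfolding lead_def by auto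
      qed
      moreover have "finite (lead W)" by (simp add: lead_def)
      ultimately show ?thesis using w by (intro exI[of _ "w ` lead W"]) blast
    qed
    show "lead W' \<subseteq> lead W" if "W' \<subseteq> W" for W W' using that unfolding lead_def by blast
    show "W \<subseteq> W'" if "subspace W" "subspace W'" "W' \<subseteq> W" "lead W \<subseteq> lead W'" for W W' using key[OF that] .
  qed (simp add: lead_def)
qed

text \<open>The number of pivots drops along strict inclusions and so serves as a measure.\<close>

lemma finite_dim_dcc:
  assumes "finite_dim_over (L\<lparr>carrier := F\<rparr>) V"
  shows V.dcc
proof -
  obtain lead :: "'v set \<Rightarrow> nat set" where lead: "\<And>W. finite (lead W)"
    "\<And>W W'. W' \<subseteq> W \<Longrightarrow> lead W' \<subseteq> lead W"
    "\<And>W W'. subspace W \<Longrightarrow> subspace W' \<Longrightarrow> W' \<subseteq> W \<Longrightarrow> lead W \<subseteq> lead W' \<Longrightarrow> W \<subseteq> W'"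
    using finite_dim_lead[OF assms] by metis
  have "{(H', H). submodule H' (diff_ring k (L\<lparr>carrier := F\<rparr>)) V \<and>
      submodule H (diff_ring k (L\<lparr>carrier := F\<rparr>)) V \<and> H' \<subset> H} \<subseteq> measure (\<lambda>W. card (lead W))" (is "?r \<subseteq> _")
  proof (rule subrelI)
    fix H' H assume "(H', H) \<in> ?r"
    then have H: "submodule H' (diff_ring k (L\<lparr>carrier := F\<rparr>)) V"
      "submodule H (diff_ring k (L\<lparr>carrier := F\<rparr>)) V" "H' \<subset> H" by simp_all
    have "lead H' \<subseteq> lead H" using H(3) by (intro lead(2)) blast
    moreover have "\<not> lead H \<subseteq> lead H'"
      using lead(3)[OF submodule_subspace[OF H(2)] submodule_subspace[OF H(1)]] H(3) by blast
    ultimately have "lead H' \<subset> lead H" by blast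
    then show "(H', H) \<in> measure (\<lambda>W. card (lead W))" using lead(1) by (simp add: psubset_card_mono)
  qed
  then show ?thesis unfolding V.dcc_def by (rule wf_subset[OF wf_measure])
qed

text \<open>Finitely many elements of \<open>W\<close> realise all its pivots, and a subspace of
  \<open>W\<close> with the same pivots is \<open>W\<close>.\<close>

lemma finite_dim_submodule:
  assumes fd: "finite_dim_over (L\<lparr>carrier := F\<rparr>) V"
    and W: "submodule W (diff_ring k (L\<lparr>carrier := F\<rparr>)) V"
  shows "finite_dim_over (L\<lparr>carrier := F\<rparr>) (V\<lparr>carrier := W\<rparr>)"
proof -
  interpret W: dmodule L k F "V\<lparr>carrier := W\<rparr>"
    by (intro dmodule.intro field_axioms dmodule_axioms.intro subfield_F k_F V.submodule_left_module[OF W])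
  note sW = submodule_subspace[OF W]
  obtain lead :: "'v set \<Rightarrow> nat set" where lead:
    "\<And>W W'. W' \<subseteq> W \<Longrightarrow> lead W' \<subseteq> lead W"
    "\<And>W W'. subspace W \<Longrightarrow> subspace W' \<Longrightarrow> W' \<subseteq> W \<Longrightarrow> lead W \<subseteq> lead W' \<Longrightarrow> W \<subseteq> W'"
    "\<And>W. \<exists>B. finite B \<and> B \<subseteq> W \<and> lead W \<subseteq> lead B"
    using finite_dim_lead[OF fd] by metis
  obtain B where B: "finite B" "B \<subseteq> W" "lead W \<subseteq> lead B" using lead(3) by blast
  show ?thesis
  proof (rule W.finite_dim_overI[OF B(1)])
    show "B \<subseteq> carrier (V\<lparr>carrier := W\<rparr>)" using B(2) by simp
    fix U assume U: "W.subspace U" "B \<subseteq> U"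
    have sub: "U \<subseteq> W" using U(1) by (simp add: W.subspace_def)
    have "subspace U"
      using U(1) subspaceD(1)[OF sW] unfolding W.subspace_def subspace_def by auto
    moreover have "lead W \<subseteq> lead U" using lead(1)[OF U(2)] B(3) by blast
    ultimately show "carrier (V\<lparr>carrier := W\<rparr>) \<subseteq> U" using lead(2)[OF sW _ sub] by simp
  qed
qed

end

section \<open>Properties of inverse images\<close>

context inverse_image_pair
begin

lemma smult_tensor:
  "P \<in> carrier DF \<Longrightarrow> a \<in> F \<Longrightarrow> n \<in> carrier N \<Longrightarrow>
    P \<odot>\<^bsub>V\<^esub> tensor a n = (\<Oplus>\<^bsub>V\<^esub>j\<in>{..<m}. tensor (x j) (coef (\<phi> j) (P \<otimes>\<^bsub>DF\<^esub> \<mu>F a) \<odot>\<^bsub>N\<^esub> n))"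
  by (simp add: smult_V tensor_closed act_tensor)

lemma smult_tensor_single:
  assumes P: "P \<in> carrier DF" and a: "a \<in> F" and n: "n \<in> carrier N" and b: "b \<in> F" and Q: "Q \<in> carrier DE"
    and eq: "P \<otimes>\<^bsub>DF\<^esub> \<mu>F a = \<mu>F b \<otimes>\<^bsub>DF\<^esub> lift_op Q"
  shows "P \<odot>\<^bsub>V\<^esub> tensor a n = tensor b (Q \<odot>\<^bsub>N\<^esub> n)"
proof -
  interpret V: abelian_group V by (rule V_abelian_group)
  have c: "\<mu>F b \<otimes>\<^bsub>DF\<^esub> lift_op Q \<in> carrier DF" using \<mu>F_closed[OF b] lift_op_closed[OF Q] by simp
  have t: "tensor b (Q \<odot>\<^bsub>N\<^esub> n) \<in> carrier V" using b Q n by (intro tensor_closed N.smult_closed)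
  have "act P (tensor a n) = (\<Oplus>\<^bsub>V\<^esub>i\<in>{..<1::nat}. tensor b (Q \<odot>\<^bsub>N\<^esub> n))"
    using c b Q by (intro act_unique[OF P a n]) (auto simp: eq lessThan_Suc)
  then show ?thesis using t P a n by (simp add: smult_V tensor_closed lessThan_Suc)
qed

lemma \<mu>F_tensor: "b \<in> F \<Longrightarrow> a \<in> F \<Longrightarrow> n \<in> carrier N \<Longrightarrow> \<mu>F b \<odot>\<^bsub>V\<^esub> tensor a n = tensor (b \<otimes> a) n"
  using smult_tensor_single[of "\<mu>F b" a n "b \<otimes> a" "\<one>\<^bsub>DE\<^esub>"]
  by (simp add: \<mu>F_closed \<mu>F_mult[symmetric] F_ops lift_op_one N.smult_one)

lemma lift_op_tensor: "Q \<in> carrier DE \<Longrightarrow> n \<in> carrier N \<Longrightarrow> lift_op Q \<odot>\<^bsub>V\<^esub> tensor \<one> n = tensor \<one> (Q \<odot>\<^bsub>N\<^esub> n)"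
  by (rule smult_tensor_single) (simp_all add: lift_op_closed F_ops \<mu>F_one)

text \<open>The content is associativity. Expand \<open>Q\<close> after \<open>a\<close> with
  coefficients A_j, and \<open>P\<close> after each \<open>x j\<close> with coefficients C_ij; then
  \<open>P\<close> after \<open>Q\<close> after \<open>a\<close> has the coefficients \<Sum>_j C_ij
  A_j, because coefficients are right linear over D_E.\<close>

lemma left_module_V: "left_module DF V"
proof (intro left_module.intro ring_DF V_abelian_group left_module_axioms.intro)
  interpret V: abelian_group V by (rule V_abelian_group)
  fix P v assume P: "P \<in> carrier DF" and v: "v \<in> carrier V"
  note aP = act_add_hom[OF P]
  have tc: "tensor (x j) (coef (\<phi> j) (T \<otimes>\<^bsub>DF\<^esub> \<mu>F a) \<odot>\<^bsub>N\<^esub> n) \<in> carrier V"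
    if "j < m" "T \<in> carrier DF" "a \<in> F" "n \<in> carrier N" for T j a n
    using tensor_closed[OF x_F[OF that(1)] N.smult_closed[OF coef_\<phi>_closed[OF that(1-3)] that(4)]] .
  show "P \<odot>\<^bsub>V\<^esub> v \<in> carrier V" using add_hom_closed[OF aP v] by (simp add: smult_V P v)
  show "P \<odot>\<^bsub>V\<^esub> (v \<oplus>\<^bsub>V\<^esub> w) = P \<odot>\<^bsub>V\<^esub> v \<oplus>\<^bsub>V\<^esub> P \<odot>\<^bsub>V\<^esub> w" if "w \<in> carrier V" for w
    using add_hom_add[OF aP v that] by (simp add: smult_V P v that)
  fix Q assume Q: "Q \<in> carrier DF"
  note aQ = act_add_hom[OF Q]
  show "(P \<oplus>\<^bsub>DF\<^esub> Q) \<odot>\<^bsub>V\<^esub> v = P \<odot>\<^bsub>V\<^esub> v \<oplus>\<^bsub>V\<^esub> Q \<odot>\<^bsub>V\<^esub> v"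
  proof -
    have h: "(\<lambda>v. act P v \<oplus>\<^bsub>V\<^esub> act Q v) \<in> add_hom V V"
      using add_hom_closed[OF aP] add_hom_closed[OF aQ] add_hom_add[OF aP] add_hom_add[OF aQ]
      by (intro add_homI) (simp_all add: V.a_ac)
    have "act (P \<oplus>\<^bsub>DF\<^esub> Q) v = (\<lambda>v. act P v \<oplus>\<^bsub>V\<^esub> act Q v) v"
    proof (rule add_hom_eqI[OF V_abelian_group act_add_hom h _ v])
      fix a n assume a: "a \<in> F" and n: "n \<in> carrier N"
      have "coef (\<phi> j) ((P \<oplus>\<^bsub>DF\<^esub> Q) \<otimes>\<^bsub>DF\<^esub> \<mu>F a) = coef (\<phi> j) (P \<otimes>\<^bsub>DF\<^esub> \<mu>F a) \<oplus>\<^bsub>DE\<^esub> coef (\<phi> j) (Q \<otimes>\<^bsub>DF\<^esub> \<mu>F a)"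
        if j: "j < m" for j
        using P Q \<mu>F_closed[OF a] add_hom_add[OF coef_add_hom[OF functional_\<phi>[OF j]]] by (simp add: DF.l_distr)
      then have "act (P \<oplus>\<^bsub>DF\<^esub> Q) (tensor a n) = (\<Oplus>\<^bsub>V\<^esub>j\<in>{..<m}. tensor (x j) (coef (\<phi> j) (P \<otimes>\<^bsub>DF\<^esub> \<mu>F a) \<odot>\<^bsub>N\<^esub> n)
          \<oplus>\<^bsub>V\<^esub> tensor (x j) (coef (\<phi> j) (Q \<otimes>\<^bsub>DF\<^esub> \<mu>F a) \<odot>\<^bsub>N\<^esub> n))"
        unfolding act_tensor[OF DF.a_closed[OF P Q] a n]
        using tc coef_\<phi>_closed N.smult_closed P Q a n x_F
        by (intro V.finsum_cong') (auto simp: N.smult_l_distr tensor_add_r)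
      also have "\<dots> = act P (tensor a n) \<oplus>\<^bsub>V\<^esub> act Q (tensor a n)"
        unfolding act_tensor[OF P a n] act_tensor[OF Q a n] using tc P Q a n by (intro V.finsum_addf) auto
      finally show "act (P \<oplus>\<^bsub>DF\<^esub> Q) (tensor a n) = act P (tensor a n) \<oplus>\<^bsub>V\<^esub> act Q (tensor a n)" .
    qed (use P Q in simp)
    then show ?thesis using P Q v by (simp add: smult_V)
  qed
  show "(P \<otimes>\<^bsub>DF\<^esub> Q) \<odot>\<^bsub>V\<^esub> v = P \<odot>\<^bsub>V\<^esub> (Q \<odot>\<^bsub>V\<^esub> v)"
  proof -
    have "act (P \<otimes>\<^bsub>DF\<^esub> Q) v = (\<lambda>v. act P (act Q v)) v"
    proof (rule add_hom_eqI[OF V_abelian_group act_add_hom add_hom_comp[OF aQ aP] _ v])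
      fix a n assume a: "a \<in> F" and n: "n \<in> carrier N"
      define A where "A j = coef (\<phi> j) (Q \<otimes>\<^bsub>DF\<^esub> \<mu>F a)" for j
      define C where "C i j = coef (\<phi> i) (P \<otimes>\<^bsub>DF\<^esub> \<mu>F (x j))" for i j
      have A: "A j \<in> carrier DE" if "j < m" for j unfolding A_def by (rule coef_\<phi>_closed[OF that Q a])
      have C: "C i j \<in> carrier DE" if "i < m" "j < m" for i j
        unfolding C_def by (rule coef_\<phi>_closed[OF that(1) P x_F[OF that(2)]])
      have An: "A j \<odot>\<^bsub>N\<^esub> n \<in> carrier N" if "j < m" for j using N.smult_closed[OF A[OF that] n] .
      have t: "tensor (x i) (C i j \<odot>\<^bsub>N\<^esub> (A j \<odot>\<^bsub>N\<^esub> n)) \<in> carrier V" if "i < m" "j < m" for i j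
        using tensor_closed[OF x_F[OF that(1)] N.smult_closed[OF C[OF that] An[OF that(2)]]] .
      have tA: "tensor (x j) (A j \<odot>\<^bsub>N\<^esub> n) \<in> carrier V" if "j < m" for j
        using tensor_closed[OF x_F[OF that] An[OF that]] .
      have xl: "\<mu>F (x j) \<in> carrier DF" "lift_op (A j) \<in> carrier DF" if "j < m" for j
        using \<mu>F_closed[OF x_F[OF that]] lift_op_closed[OF A[OF that]] .
      have Qa: "Q \<otimes>\<^bsub>DF\<^esub> \<mu>F a \<in> carrier DF" using Q \<mu>F_closed[OF a] by simp
      have "(P \<otimes>\<^bsub>DF\<^esub> Q) \<otimes>\<^bsub>DF\<^esub> \<mu>F a = P \<otimes>\<^bsub>DF\<^esub> (\<Oplus>\<^bsub>DF\<^esub>j\<in>{..<m}. \<mu>F (x j) \<otimes>\<^bsub>DF\<^esub> lift_op (A j))"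
        using DF.m_assoc[OF P Q \<mu>F_closed[OF a]] expand_operator[OF Qa] by (simp add: A_def)
      also have "\<dots> = (\<Oplus>\<^bsub>DF\<^esub>j\<in>{..<m}. P \<otimes>\<^bsub>DF\<^esub> (\<mu>F (x j) \<otimes>\<^bsub>DF\<^esub> lift_op (A j)))"
        using P xl by (intro DF.finsum_rdistr) auto
      also have "\<dots> = (\<Oplus>\<^bsub>DF\<^esub>j\<in>{..<m}. (P \<otimes>\<^bsub>DF\<^esub> \<mu>F (x j)) \<otimes>\<^bsub>DF\<^esub> lift_op (A j))"
        using P xl by (intro DF.finsum_cong') (auto simp: DF.m_assoc)
      finally have PQ: "(P \<otimes>\<^bsub>DF\<^esub> Q) \<otimes>\<^bsub>DF\<^esub> \<mu>F a = \<dots>" .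
      have comp: "tensor (x i) (coef (\<phi> i) ((P \<otimes>\<^bsub>DF\<^esub> Q) \<otimes>\<^bsub>DF\<^esub> \<mu>F a) \<odot>\<^bsub>N\<^esub> n) = (\<Oplus>\<^bsub>V\<^esub>j\<in>{..<m}. tensor (x i) (C i j \<odot>\<^bsub>N\<^esub> (A j \<odot>\<^bsub>N\<^esub> n)))"
        if i: "i < m" for i
      proof -
        have "coef (\<phi> i) ((P \<otimes>\<^bsub>DF\<^esub> Q) \<otimes>\<^bsub>DF\<^esub> \<mu>F a) = (\<Oplus>\<^bsub>DE\<^esub>j\<in>{..<m}. coef (\<phi> i) ((P \<otimes>\<^bsub>DF\<^esub> \<mu>F (x j)) \<otimes>\<^bsub>DF\<^esub> lift_op (A j)))"
          unfolding PQ using P xl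
          by (intro add_hom_finsum[OF DF.abelian_group_axioms N.R.abelian_group_axioms coef_add_hom[OF functional_\<phi>[OF i]]]) auto
        also have "\<dots> = (\<Oplus>\<^bsub>DE\<^esub>j\<in>{..<m}. C i j \<otimes>\<^bsub>DE\<^esub> A j)"
          using coef_mult_lift[OF functional_\<phi>[OF i] _ A] P xl C[OF i] A by (intro N.R.finsum_cong') (auto simp: C_def)
        finally have "tensor (x i) (coef (\<phi> i) ((P \<otimes>\<^bsub>DF\<^esub> Q) \<otimes>\<^bsub>DF\<^esub> \<mu>F a) \<odot>\<^bsub>N\<^esub> n) =
            (\<Oplus>\<^bsub>V\<^esub>j\<in>{..<m}. tensor (x i) ((C i j \<otimes>\<^bsub>DE\<^esub> A j) \<odot>\<^bsub>N\<^esub> n))"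
          using C[OF i] A n P Q a i x_F by (intro tensor_sum coef_\<phi>_closed) auto
        also have "\<dots> = (\<Oplus>\<^bsub>V\<^esub>j\<in>{..<m}. tensor (x i) (C i j \<odot>\<^bsub>N\<^esub> (A j \<odot>\<^bsub>N\<^esub> n)))"
          using C[OF i] A n t[OF i] by (intro V.finsum_cong') (auto simp: N.smult_assoc)
        finally show ?thesis .
      qed
      have "act P (act Q (tensor a n)) = act P (\<Oplus>\<^bsub>V\<^esub>j\<in>{..<m}. tensor (x j) (A j \<odot>\<^bsub>N\<^esub> n))"
        unfolding act_tensor[OF Q a n] A_def ..
      also have "\<dots> = (\<Oplus>\<^bsub>V\<^esub>j\<in>{..<m}. act P (tensor (x j) (A j \<odot>\<^bsub>N\<^esub> n)))"
        using tA by (intro add_hom_finsum[OF V_abelian_group V_abelian_group aP]) auto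
      also have "\<dots> = (\<Oplus>\<^bsub>V\<^esub>j\<in>{..<m}. \<Oplus>\<^bsub>V\<^esub>i\<in>{..<m}. tensor (x i) (C i j \<odot>\<^bsub>N\<^esub> (A j \<odot>\<^bsub>N\<^esub> n)))"
        using act_tensor[OF P x_F An] t unfolding C_def
        by (intro V.finsum_cong' refl) (auto intro!: V.finsum_closed)
      also have "\<dots> = (\<Oplus>\<^bsub>V\<^esub>i\<in>{..<m}. \<Oplus>\<^bsub>V\<^esub>j\<in>{..<m}. tensor (x i) (C i j \<odot>\<^bsub>N\<^esub> (A j \<odot>\<^bsub>N\<^esub> n)))"
        using t by (intro V.finsum_swap) auto
      also have "\<dots> = act (P \<otimes>\<^bsub>DF\<^esub> Q) (tensor a n)"
        unfolding act_tensor[OF DF.m_closed[OF P Q] a n]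
        using comp tc[OF _ DF.m_closed[OF P Q] a n] by (intro V.finsum_cong') auto
      finally show "act (P \<otimes>\<^bsub>DF\<^esub> Q) (tensor a n) = act P (act Q (tensor a n))" ..
    qed (use P Q in simp)
    then show ?thesis using P Q v add_hom_closed[OF aQ v] by (simp add: smult_V)
  qed
next
  interpret V: abelian_group V by (rule V_abelian_group)
  fix v assume v: "v \<in> carrier V"
  show "\<one>\<^bsub>DF\<^esub> \<odot>\<^bsub>V\<^esub> v = v"
  proof -
    have "act \<one>\<^bsub>DF\<^esub> v = (\<lambda>v. v) v"
    proof (rule add_hom_eqI[OF V_abelian_group act_add_hom _ _ v])
      fix a n assume a: "a \<in> F" and n: "n \<in> carrier N"
      have "\<one>\<^bsub>DF\<^esub> \<odot>\<^bsub>V\<^esub> tensor a n = tensor a (\<one>\<^bsub>DE\<^esub> \<odot>\<^bsub>N\<^esub> n)"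
        using a n \<mu>F_closed[OF a] by (intro smult_tensor_single) (simp_all add: lift_op_one)
      then show "act \<one>\<^bsub>DF\<^esub> (tensor a n) = tensor a n"
        using a n by (simp add: smult_V tensor_closed N.smult_one)
    qed (auto intro: add_homI)
    then show ?thesis using v by (simp add: smult_V)
  qed
qed

end

sublocale inverse_image_pair \<subseteq> V: left_module DF V
  by (rule left_module_V)

context inverse_image_pair
begin

abbreviation "f_plus W \<equiv> direct_image k LE LF W"

text \<open>The unit N \<rightarrow> f_+ f^! N of the adjunction between inverse and direct
  image.\<close>

lemma unit_mod_hom: "tensor \<one> \<in> mod_hom DE N (f_plus V)"
  by (rule mod_homI) (simp_all add: direct_image_simps tensor_closed tensor_add_r lift_op_tensor F_ops)

lemma tensor_smult: "a \<in> F \<Longrightarrow> n \<in> carrier N \<Longrightarrow> tensor a n = \<mu>F a \<odot>\<^bsub>V\<^esub> tensor \<one> n"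
  using \<mu>F_tensor[of a \<one> n] by (simp add: F_ops F_car)

text \<open>On a pure tensor a \<otimes> n the coefficients are \<phi>_i(a) n; balancedness and the
  expansion of \<open>a\<close> put them together again.\<close>

lemma expand_V:
  assumes v: "v \<in> carrier V"
  shows "v = (\<Oplus>\<^bsub>V\<^esub>i\<in>{..<m}. \<mu>F (x i) \<odot>\<^bsub>V\<^esub> tensor \<one> (push (\<phi> i) v))"
proof -
  have h: "(\<lambda>v. \<Oplus>\<^bsub>V\<^esub>i\<in>{..<m}. \<mu>F (x i) \<odot>\<^bsub>V\<^esub> tensor \<one> (push (\<phi> i) v)) \<in> add_hom V V"
    using F_ops x_F functional_\<phi> by (intro add_hom_sum[OF V_abelian_group V_abelian_group]
        add_hom_comp[OF add_hom_comp[OF push(1) tensor_add_hom] V.smult_add_hom] \<mu>F_closed) auto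
  have "(\<lambda>v. v) v = (\<lambda>v. \<Oplus>\<^bsub>V\<^esub>i\<in>{..<m}. \<mu>F (x i) \<odot>\<^bsub>V\<^esub> tensor \<one> (push (\<phi> i) v)) v"
  proof (rule add_hom_eqI[OF V_abelian_group _ h _ v])
    fix a n assume a: "a \<in> F" and n: "n \<in> carrier N"
    have pa: "\<phi> i a \<in> E" if "i < m" for i using \<phi>_E[OF that a] .
    have pn: "\<mu>E (\<phi> i a) \<odot>\<^bsub>N\<^esub> n \<in> carrier N" if "i < m" for i using N.smult_closed[OF \<mu>E_closed[OF pa[OF that]] n] .
    have xF: "x i \<otimes> \<phi> i a \<in> F" if "i < m" for i using x_F[OF that] EF[OF pa[OF that]] F_ops by simp
    have "(\<Oplus>\<^bsub>V\<^esub>i\<in>{..<m}. \<mu>F (x i) \<odot>\<^bsub>V\<^esub> tensor \<one> (push (\<phi> i) (tensor a n))) = (\<Oplus>\<^bsub>V\<^esub>i\<in>{..<m}. tensor (x i \<otimes> \<phi> i a) n)"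
    proof (intro V.M.finsum_cong' refl)
      fix i assume "i \<in> {..<m}"
      then have i: "i < m" by simp
      show "\<mu>F (x i) \<odot>\<^bsub>V\<^esub> tensor \<one> (push (\<phi> i) (tensor a n)) = tensor (x i \<otimes> \<phi> i a) n"
        using push(2)[OF functional_\<phi>[OF i] a n] tensor_smult[OF x_F[OF i] pn[OF i]] tensor_balanced[OF x_F[OF i] pa[OF i] n]
        by simp
    qed (use xF n tensor_closed in auto)
    also have "\<dots> = tensor (\<Oplus>i\<in>{..<m}. x i \<otimes> \<phi> i a) n"
      using xF by (intro tensor_finsum_l[OF n, symmetric]) auto
    finally show "tensor a n = (\<Oplus>\<^bsub>V\<^esub>i\<in>{..<m}. \<mu>F (x i) \<odot>\<^bsub>V\<^esub> tensor \<one> (push (\<phi> i) (tensor a n)))"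
      using expand[OF a] by simp
  qed (auto intro: add_homI)
  then show ?thesis .
qed

text \<open>By \<open>expand_V\<close> the image of the unit generates f^! N over
  \<open>F\<close>.\<close>

lemma submodule_contains_unit:
  assumes H: "submodule H DF V" and "\<And>n. n \<in> carrier N \<Longrightarrow> tensor \<one> n \<in> H"
  shows "H = carrier V"
proof
  show "H \<subseteq> carrier V" using V.submoduleD(1)[OF H] .
  show "carrier V \<subseteq> H"
  proof
    fix v assume v: "v \<in> carrier V"
    have "(\<Oplus>\<^bsub>V\<^esub>i\<in>{..<m}. \<mu>F (x i) \<odot>\<^bsub>V\<^esub> tensor \<one> (push (\<phi> i) v)) \<in> H"
      using assms(2) push_closed[OF functional_\<phi> v] x_F \<mu>F_closed
      by (intro V.submodule_finsum[OF H] V.submoduleD(6)[OF H]) auto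
    then show "v \<in> H" using expand_V[OF v] by simp
  qed
qed

lemma push_unit: "functional \<psi> \<Longrightarrow> \<psi> \<one> = \<one> \<Longrightarrow> n \<in> carrier N \<Longrightarrow> push \<psi> (tensor \<one> n) = n"
  using push(2)[of \<psi> \<one> n] by (simp add: F_ops \<mu>E_one N.smult_one)

text \<open>The condition \<open>comm\<close> is linearity of \<psi> over the operators of
  \<open>E\<close>. It identifies \<open>Q\<close> after multiplication by \<psi>(a) with the
  \<psi>-coefficient of the lift of \<open>Q\<close> after \<open>a\<close>, whose expansion
  describes the action on a \<otimes> n.\<close>

lemma push_mod_hom:
  assumes \<psi>: "functional \<psi>" and comm: "\<And>Q z. Q \<in> carrier DE \<Longrightarrow> z \<in> F \<Longrightarrow> \<psi> (lift_op Q z) = Q (\<psi> z)"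
  shows "push \<psi> \<in> mod_hom DE (f_plus V) N"
proof (rule mod_homI)
  show "push \<psi> v \<in> carrier N" if "v \<in> carrier (f_plus V)" for v
    using push_closed[OF \<psi>] that by (simp add: direct_image_simps)
  show "push \<psi> (v \<oplus>\<^bsub>f_plus V\<^esub> w) = push \<psi> v \<oplus>\<^bsub>N\<^esub> push \<psi> w" if "v \<in> carrier (f_plus V)" "w \<in> carrier (f_plus V)" for v w
    using add_hom_add[OF push(1)[OF \<psi>]] that by (simp add: direct_image_simps)
  fix Q v assume Q: "Q \<in> carrier DE" and "v \<in> carrier (f_plus V)"
  then have v: "v \<in> carrier V" by (simp add: direct_image_simps)
  let ?Q = "lift_op Q"
  note lQ = lift_op_closed[OF Q]
  have "(\<lambda>v. push \<psi> (?Q \<odot>\<^bsub>V\<^esub> v)) v = (\<lambda>v. Q \<odot>\<^bsub>N\<^esub> push \<psi> v) v"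
  proof (rule add_hom_eqI[OF N.M.abelian_group_axioms add_hom_comp[OF V.smult_add_hom[OF lQ] push(1)[OF \<psi>]]
        add_hom_comp[OF push(1)[OF \<psi>] N.smult_add_hom[OF Q]] _ v])
    fix a n assume a: "a \<in> F" and n: "n \<in> carrier N"
    have Qm: "?Q \<otimes>\<^bsub>DF\<^esub> \<mu>F a \<in> carrier DF" using lQ \<mu>F_closed[OF a] by simp
    define A where "A j = coef (\<phi> j) (?Q \<otimes>\<^bsub>DF\<^esub> \<mu>F a)" for j
    have A: "A j \<in> carrier DE" if "j < m" for j unfolding A_def by (rule coef_\<phi>_closed[OF that lQ a])
    have An: "A j \<odot>\<^bsub>N\<^esub> n \<in> carrier N" if "j < m" for j using N.smult_closed[OF A[OF that] n] .
    have u: "\<mu>E (\<psi> (x j)) \<in> carrier DE" if "j < m" for j using \<mu>E_closed[OF functionalD(1)[OF \<psi> x_F[OF that]]] .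
    have ua: "\<mu>E (\<psi> a) \<in> carrier DE" using \<mu>E_closed[OF functionalD(1)[OF \<psi> a]] .
    have "Q \<otimes>\<^bsub>DE\<^esub> \<mu>E (\<psi> a) = coef \<psi> (?Q \<otimes>\<^bsub>DF\<^esub> \<mu>F a)"
    proof (rule DE_eqI[OF N.R.m_closed[OF Q ua] coef_closed[OF \<psi> Qm]])
      fix e assume e: "e \<in> E"
      show "(Q \<otimes>\<^bsub>DE\<^esub> \<mu>E (\<psi> a)) e = coef \<psi> (?Q \<otimes>\<^bsub>DF\<^esub> \<mu>F a) e"
        using functionalD(4)[OF \<psi> e a] comm[OF Q, of "a \<otimes> e"] a EF[OF e] F_ops
        by (simp add: coef_apply[OF e] DE_ops(1)[OF e] DF_ops(1)[OF EF[OF e]] \<mu>E_apply[OF e] \<mu>F_apply[OF EF[OF e]])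
    qed
    also have "\<dots> = (\<Oplus>\<^bsub>DE\<^esub>j\<in>{..<m}. \<mu>E (\<psi> (x j)) \<otimes>\<^bsub>DE\<^esub> A j)"
      by (subst expand_operator[OF Qm], unfold A_def[symmetric]) (use x_F A in \<open>auto intro: coef_expansion[OF \<psi>]\<close>)
    finally have eq: "Q \<otimes>\<^bsub>DE\<^esub> \<mu>E (\<psi> a) = \<dots>" .
    have "push \<psi> (?Q \<odot>\<^bsub>V\<^esub> tensor a n) = (\<Oplus>\<^bsub>N\<^esub>j\<in>{..<m}. push \<psi> (tensor (x j) (A j \<odot>\<^bsub>N\<^esub> n)))"
      unfolding smult_tensor[OF lQ a n] A_def[symmetric]
      using An x_F by (intro add_hom_finsum[OF V_abelian_group N.M.abelian_group_axioms push(1)[OF \<psi>]]) (auto intro: tensor_closed)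
    also have "\<dots> = (\<Oplus>\<^bsub>N\<^esub>j\<in>{..<m}. (\<mu>E (\<psi> (x j)) \<otimes>\<^bsub>DE\<^esub> A j) \<odot>\<^bsub>N\<^esub> n)"
      using push(2)[OF \<psi> x_F An] u A n An by (intro N.M.finsum_cong') (auto simp: N.smult_assoc N.smult_closed)
    also have "\<dots> = (Q \<otimes>\<^bsub>DE\<^esub> \<mu>E (\<psi> a)) \<odot>\<^bsub>N\<^esub> n"
      unfolding eq using u A by (intro N.smult_l_finsum[OF n, symmetric]) auto
    also have "\<dots> = Q \<odot>\<^bsub>N\<^esub> push \<psi> (tensor a n)" using N.smult_assoc[OF Q ua n] push(2)[OF \<psi> a n] by simp
    finally show "push \<psi> (?Q \<odot>\<^bsub>V\<^esub> tensor a n) = Q \<odot>\<^bsub>N\<^esub> push \<psi> (tensor a n)" .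
  qed
  then show "push \<psi> (Q \<odot>\<^bsub>f_plus V\<^esub> v) = Q \<odot>\<^bsub>N\<^esub> push \<psi> v" by (simp add: direct_image_simps)
qed

text \<open>One half of the adjunction in which f^! is left adjoint to f_+. Linearity is reduced to
  pure tensors and the canonical expansion of \<open>P\<close> after \<open>a\<close>.\<close>

lemma inverse_image_universal:
  assumes W: "left_module DF W" and f: "f \<in> mod_hom DE N (f_plus W)"
  obtains h where "h \<in> mod_hom DF V W" "\<And>a n. a \<in> F \<Longrightarrow> n \<in> carrier N \<Longrightarrow> h (tensor a n) = \<mu>F a \<odot>\<^bsub>W\<^esub> f n"
proof -
  interpret W: left_module DF W by fact
  note fD = mod_homD[OF f, unfolded direct_image_simps]
  have "\<exists>h\<in>add_hom V W. \<forall>a\<in>F. \<forall>n\<in>carrier N. h (tensor a n) = \<mu>F a \<odot>\<^bsub>W\<^esub> f n"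
  proof (rule tensor_universal[OF W.M.abelian_group_axioms])
    show "\<mu>F a \<odot>\<^bsub>W\<^esub> f n \<in> carrier W" if "a \<in> F" "n \<in> carrier N" for a n
      using that fD(2) \<mu>F_closed by (intro W.smult_closed)
    show "\<mu>F (a \<oplus> b) \<odot>\<^bsub>W\<^esub> f n = \<mu>F a \<odot>\<^bsub>W\<^esub> f n \<oplus>\<^bsub>W\<^esub> \<mu>F b \<odot>\<^bsub>W\<^esub> f n" if "a \<in> F" "b \<in> F" "n \<in> carrier N" for a b n
      using that fD(2) \<mu>F_closed by (simp add: \<mu>F_add W.smult_l_distr)
    show "\<mu>F a \<odot>\<^bsub>W\<^esub> f (n \<oplus>\<^bsub>N\<^esub> n') = \<mu>F a \<odot>\<^bsub>W\<^esub> f n \<oplus>\<^bsub>W\<^esub> \<mu>F a \<odot>\<^bsub>W\<^esub> f n'"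
      if "a \<in> F" "n \<in> carrier N" "n' \<in> carrier N" for a n n'
      using that fD(2,3) \<mu>F_closed by (simp add: W.smult_r_distr)
    show "\<mu>F (a \<otimes> e) \<odot>\<^bsub>W\<^esub> f n = \<mu>F a \<odot>\<^bsub>W\<^esub> f (\<mu>E e \<odot>\<^bsub>N\<^esub> n)" if "a \<in> F" "e \<in> E" "n \<in> carrier N" for a e n
      using that fD(2) fD(4)[OF \<mu>E_closed] \<mu>F_closed EF by (simp add: \<mu>F_mult W.smult_assoc lift_op_\<mu>)
  qed
  then obtain h where h: "h \<in> add_hom V W" "\<And>a n. a \<in> F \<Longrightarrow> n \<in> carrier N \<Longrightarrow> h (tensor a n) = \<mu>F a \<odot>\<^bsub>W\<^esub> f n" by blast
  have "h \<in> mod_hom DF V W"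
  proof (rule mod_homI)
    fix P v assume P: "P \<in> carrier DF" and v: "v \<in> carrier V"
    have "(\<lambda>v. h (P \<odot>\<^bsub>V\<^esub> v)) v = (\<lambda>v. P \<odot>\<^bsub>W\<^esub> h v) v"
    proof (rule add_hom_eqI[OF W.M.abelian_group_axioms add_hom_comp[OF V.smult_add_hom[OF P] h(1)]
          add_hom_comp[OF h(1) W.smult_add_hom[OF P]] _ v])
      fix a n assume a: "a \<in> F" and n: "n \<in> carrier N"
      have Pm: "P \<otimes>\<^bsub>DF\<^esub> \<mu>F a \<in> carrier DF" using P \<mu>F_closed[OF a] by simp
      define A where "A j = coef (\<phi> j) (P \<otimes>\<^bsub>DF\<^esub> \<mu>F a)" for j
      have A: "A j \<in> carrier DE" if "j < m" for j
        unfolding A_def by (rule coef_closed[OF functional_\<phi>[OF that] Pm])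
      have An: "A j \<odot>\<^bsub>N\<^esub> n \<in> carrier N" if "j < m" for j using N.smult_closed[OF A[OF that] n] .
      have d: "\<mu>F (x j) \<in> carrier DF" "lift_op (A j) \<in> carrier DF" if "j < m" for j
        using that x_F A by (simp_all add: \<mu>F_closed lift_op_closed)
      have "h (P \<odot>\<^bsub>V\<^esub> tensor a n) = (\<Oplus>\<^bsub>W\<^esub>j\<in>{..<m}. h (tensor (x j) (A j \<odot>\<^bsub>N\<^esub> n)))"
        unfolding smult_tensor[OF P a n] A_def[symmetric]
        using An x_F by (intro add_hom_finsum[OF V_abelian_group W.M.abelian_group_axioms h(1)]) (auto intro: tensor_closed)
      also have "\<dots> = (\<Oplus>\<^bsub>W\<^esub>j\<in>{..<m}. (\<mu>F (x j) \<otimes>\<^bsub>DF\<^esub> lift_op (A j)) \<odot>\<^bsub>W\<^esub> f n)"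
        using h(2)[OF x_F An] fD(2)[OF n] fD(4)[OF A n] d
        by (intro W.M.finsum_cong') (auto simp: W.smult_assoc W.smult_closed)
      also have "\<dots> = (\<Oplus>\<^bsub>DF\<^esub>j\<in>{..<m}. \<mu>F (x j) \<otimes>\<^bsub>DF\<^esub> lift_op (A j)) \<odot>\<^bsub>W\<^esub> f n"
        using d fD(2)[OF n] by (intro W.smult_l_finsum[symmetric]) auto
      also have "\<dots> = (P \<otimes>\<^bsub>DF\<^esub> \<mu>F a) \<odot>\<^bsub>W\<^esub> f n" using expand_operator[OF Pm] by (simp add: A_def)
      also have "\<dots> = P \<odot>\<^bsub>W\<^esub> h (tensor a n)" using h(2)[OF a n] W.smult_assoc[OF P \<mu>F_closed[OF a] fD(2)[OF n]] by simp
      finally show "h (P \<odot>\<^bsub>V\<^esub> tensor a n) = P \<odot>\<^bsub>W\<^esub> h (tensor a n)" .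
    qed
    then show "h (P \<odot>\<^bsub>V\<^esub> v) = P \<odot>\<^bsub>W\<^esub> h v" .
  qed (use add_hom_closed[OF h(1)] add_hom_add[OF h(1)] in auto)
  then show thesis using that h(2) by blast
qed

end

text \<open>The other half, with nonvanishing made explicit: a kernel that contains the image of the
  unit is everything.\<close>

lemma (in inverse_image_pair) hom_to_direct_image:
  assumes W: "left_module DF W" and f: "f \<in> mod_hom DF V W" and v: "v \<in> carrier V" "f v \<noteq> \<zero>\<^bsub>W\<^esub>"
  shows "(\<lambda>n. f (tensor \<one> n)) \<in> mod_hom DE N (f_plus W) \<and> (\<exists>n\<in>carrier N. f (tensor \<one> n) \<noteq> \<zero>\<^bsub>W\<^esub>)"
proof
  show "(\<lambda>n. f (tensor \<one> n)) \<in> mod_hom DE N (f_plus W)"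
    by (rule mod_hom_comp[OF unit_mod_hom mod_hom_direct_image[OF f]])
  show "\<exists>n\<in>carrier N. f (tensor \<one> n) \<noteq> \<zero>\<^bsub>W\<^esub>"
  proof (rule ccontr)
    assume "\<not> ?thesis"
    then have "tensor \<one> n \<in> {v \<in> carrier V. f v \<in> {\<zero>\<^bsub>W\<^esub>}}" if "n \<in> carrier N" for n
      using that F_ops by (simp add: tensor_closed)
    then have "{v \<in> carrier V. f v \<in> {\<zero>\<^bsub>W\<^esub>}} = carrier V"
      by (rule submodule_contains_unit[OF submodule_preimage[OF left_module_V W f left_module.submodule_zero[OF W]]])
    then have "v \<in> {v \<in> carrier V. f v \<in> {\<zero>\<^bsub>W\<^esub>}}" using v(1) by simp
    then show False using v(2) by simp
  qed
qed

section \<open>Finite dimension under quotients, direct images and inverse images\<close>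

lemma finite_dim_image:
  assumes V: "dmodule L k F V" and W: "dmodule L k F W"
    and f: "f \<in> mod_hom (diff_ring k (L\<lparr>carrier := F\<rparr>)) V W" and surj: "f ` carrier V = carrier W"
    and fd: "finite_dim_over (L\<lparr>carrier := F\<rparr>) V"
  shows "finite_dim_over (L\<lparr>carrier := F\<rparr>) W"
proof -
  interpret V: dmodule L k F V by fact
  interpret W: dmodule L k F W by fact
  note f0 = mod_hom_zero[OF V.V W.V f] and fD = mod_homD[OF f]
  obtain B where B: "finite B" "B \<subseteq> carrier V" "\<And>U. V.subspace U \<Longrightarrow> B \<subseteq> U \<Longrightarrow> carrier V \<subseteq> U"
    by (rule V.finite_dim_overD[OF fd], rule that, assumption, assumption) simp
  show ?thesis
  proof (rule W.finite_dim_overI)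
    show "finite (f ` B)" "f ` B \<subseteq> carrier W" using B surj by auto
    fix U assume U: "W.subspace U" "f ` B \<subseteq> U"
    note UD = W.subspaceD[OF U(1)]
    have "V.subspace {v \<in> carrier V. f v \<in> U}"
      unfolding V.subspace_def
    proof (intro conjI ballI)
      show "\<zero>\<^bsub>V\<^esub> \<in> {v \<in> carrier V. f v \<in> U}" using UD(2) f0 by simp
      show "u \<oplus>\<^bsub>V\<^esub> w \<in> {v \<in> carrier V. f v \<in> U}"
        if "u \<in> {v \<in> carrier V. f v \<in> U}" "w \<in> {v \<in> carrier V. f v \<in> U}" for u w
        using that UD(3) fD(3)[of u w] by simp
      show "V.sc a u \<in> {v \<in> carrier V. f v \<in> U}" if "a \<in> F" "u \<in> {v \<in> carrier V. f v \<in> U}" for a u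
      proof (intro CollectI conjI)
        have u: "u \<in> carrier V" "f u \<in> U" using that(2) by simp_all
        show "V.sc a u \<in> carrier V" using V.sc_closed[OF that(1) u(1)] .
        show "f (V.sc a u) \<in> U" unfolding fD(4)[OF V.mult_op_closed[OF that(1)] u(1)] by (rule UD(4)[OF that(1) u(2)])
      qed
    qed simp
    then have "carrier V \<subseteq> {v \<in> carrier V. f v \<in> U}"
    proof (rule B(3))
      show "B \<subseteq> {v \<in> carrier V. f v \<in> U}" using B(2) U(2) by auto
    qed
    then show "carrier W \<subseteq> U" unfolding surj[symmetric] image_subset_iff by (simp add: subset_iff)
  qed
qed

locale field_pair = field L + etale_pair L k E F m x \<phi>
  for L (structure) and k E F m x \<phi> +
  assumes subfield_E: "subfield E L" and subfield_F: "subfield F L"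
begin

text \<open>If \<open>B\<close> spans over \<open>F\<close>, the products of the \<open>x i\<close>
  with \<open>B\<close> span over \<open>E\<close>. For an \<open>E\<close>-subspace
  \<open>U\<close>, the vectors whose \<open>F\<close>-multiples all lie in \<open>U\<close> form an
  \<open>F\<close>-subspace, to which the spanning property of \<open>B\<close> applies.\<close>

lemma finite_dim_direct_image:
  assumes V: "left_module DF V" and fd: "finite_dim_over LF V"
  shows "finite_dim_over LE (direct_image k LE LF V)"
proof -
  interpret V: dmodule L k F V
    by (intro dmodule.intro field_axioms dmodule_axioms.intro subfield_F k_F V)
  interpret W: dmodule L k E "direct_image k LE LF V"
    by (intro dmodule.intro field_axioms dmodule_axioms.intro subfield_E k_E left_module_direct_image V)
  obtain B where B: "finite B" "B \<subseteq> carrier V" "\<And>U. V.subspace U \<Longrightarrow> B \<subseteq> U \<Longrightarrow> carrier V \<subseteq> U"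
    by (rule V.finite_dim_overD[OF fd], rule that, assumption, assumption) simp
  have Wsc: "W.sc e v = V.sc e v" if "e \<in> E" for e v using that by (simp add: direct_image_simps lift_op_\<mu>)
  let ?B = "(\<lambda>(i, b). V.sc (x i) b) ` ({..<m} \<times> B)"
  show ?thesis
  proof (rule W.finite_dim_overI)
    show "finite ?B" using B(1) by simp
    show "?B \<subseteq> carrier (direct_image k LE LF V)" using B(2) x_F V.sc_closed by (auto simp: direct_image_simps)
    fix U assume U: "W.subspace U" "?B \<subseteq> U"
    note UD = W.subspaceD[OF U(1), unfolded direct_image_simps(1-3)]
    let ?U = "{v \<in> carrier V. \<forall>a\<in>F. V.sc a v \<in> U}"
    have "V.subspace ?U"
      unfolding V.subspace_def
    proof (intro conjI ballI)
      show "\<zero>\<^bsub>V\<^esub> \<in> ?U" using UD(2) \<mu>F_closed by (simp add: V.V.smult_r_null)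
      show "u \<oplus>\<^bsub>V\<^esub> w \<in> ?U" if "u \<in> ?U" "w \<in> ?U" for u w
        using that UD(3) by (simp add: V.sc_add_r)
      show "V.sc a u \<in> ?U" if "a \<in> F" "u \<in> ?U" for a u
        using that V.sc_closed V.F_ops by (simp add: V.sc_mult[symmetric])
    qed auto
    moreover have "B \<subseteq> ?U"
    proof
      fix b assume b: "b \<in> B"
      have bV: "b \<in> carrier V" using b B(2) by auto
      have "V.sc a b \<in> U" if a: "a \<in> F" for a
      proof -
        have c: "\<phi> i a \<in> E" "\<phi> i a \<in> F" "x i \<in> F" if "i < m" for i using that a \<phi>_E EF x_F by auto
        have d: "\<mu>F (x i) \<in> carrier DF" "\<mu>F (\<phi> i a) \<in> carrier DF" if "i < m" for i
          using c[OF that] \<mu>F_closed by simp_all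
        \<comment> \<open>The expansion of the multiplication operator by \<open>a\<close> takes the
          place of an expansion of the element \<open>a\<close>; its coefficients are the
          multiplications by \<phi>_i(a).\<close>
        have "\<mu>F a = (\<Oplus>\<^bsub>DF\<^esub>i\<in>{..<m}. \<mu>F (x i) \<otimes>\<^bsub>DF\<^esub> lift_op (coef (\<phi> i) (\<mu>F a)))"
          by (rule expand_operator[OF \<mu>F_closed[OF a]])
        also have "\<dots> = (\<Oplus>\<^bsub>DF\<^esub>i\<in>{..<m}. \<mu>F (x i) \<otimes>\<^bsub>DF\<^esub> \<mu>F (\<phi> i a))"
          using d c by (intro V.V.R.finsum_cong') (auto simp: coef_\<mu>F[OF functional_\<phi> a] lift_op_\<mu>)
        finally have "V.sc a b = (\<Oplus>\<^bsub>V\<^esub>i\<in>{..<m}. (\<mu>F (x i) \<otimes>\<^bsub>DF\<^esub> \<mu>F (\<phi> i a)) \<odot>\<^bsub>V\<^esub> b)"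
          using V.V.smult_l_finsum[OF bV, of "{..<m}" "\<lambda>i. \<mu>F (x i) \<otimes>\<^bsub>DF\<^esub> \<mu>F (\<phi> i a)"] d by (simp add: Pi_iff)
        also have "\<dots> = (\<Oplus>\<^bsub>V\<^esub>i\<in>{..<m}. V.sc (\<phi> i a) (V.sc (x i) b))"
        proof (intro V.V.M.finsum_cong' refl)
          fix i assume "i \<in> {..<m}"
          then have i: "i < m" by simp
          have "\<mu>F (x i) \<otimes>\<^bsub>DF\<^esub> \<mu>F (\<phi> i a) = \<mu>F (\<phi> i a \<otimes> x i)"
            using c[OF i] F_car by (simp add: \<mu>F_mult[symmetric] m_comm)
          then show "(\<mu>F (x i) \<otimes>\<^bsub>DF\<^esub> \<mu>F (\<phi> i a)) \<odot>\<^bsub>V\<^esub> b = V.sc (\<phi> i a) (V.sc (x i) b)"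
            using V.sc_mult[OF c(2,3)[OF i] bV] by simp
        qed (use c V.sc_closed bV in auto)
        also have "\<dots> \<in> U"
        proof (rule W.subspace_finsum[OF U(1), of "{..<m}" "\<lambda>i. V.sc (\<phi> i a) (V.sc (x i) b)", unfolded direct_image_simps(5)])
          fix i assume "i \<in> {..<m}"
          then have i: "i < m" by simp
          have "V.sc (x i) b \<in> U" using U(2) b i by auto
          then have "W.sc (\<phi> i a) (V.sc (x i) b) \<in> U" by (rule W.subspaceD(4)[OF U(1) c(1)[OF i]])
          then show "V.sc (\<phi> i a) (V.sc (x i) b) \<in> U" unfolding Wsc[OF c(1)[OF i]] .
        qed simp
        finally show ?thesis .
      qed
      then show "b \<in> ?U" using bV by simp
    qed
    ultimately have "carrier V \<subseteq> ?U" by (rule B(3))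
    then have "v \<in> U" if "v \<in> carrier V" for v
      using subsetD[OF \<open>carrier V \<subseteq> ?U\<close> that] V.sc_one[OF that] F_ops(2) by auto
    then show "carrier (direct_image k LE LF V) \<subseteq> U" by (auto simp: direct_image_simps)
  qed
qed

text \<open>A subspace of f^! N pulls back to a subspace of \<open>N\<close> along the unit, and f^!
  N is generated over \<open>F\<close> by the image of the unit.\<close>

lemma finite_dim_inverse_image:
  assumes N: "left_module DE N" and fd: "finite_dim_over LE N"
  shows "finite_dim_over LF (inverse_image k LE LF N)"
proof -
  interpret ip: inverse_image_pair L k E F m x \<phi> N
    by (intro inverse_image_pair.intro etale_pair_axioms inverse_image_pair_axioms.intro N)
  interpret N: dmodule L k E N
    by (intro dmodule.intro field_axioms dmodule_axioms.intro subfield_E k_E N)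
  interpret V: dmodule L k F ip.V
    by (intro dmodule.intro field_axioms dmodule_axioms.intro subfield_F k_F ip.left_module_V)
  obtain B where B: "finite B" "B \<subseteq> carrier N" "\<And>U. N.subspace U \<Longrightarrow> B \<subseteq> U \<Longrightarrow> carrier N \<subseteq> U"
    by (rule N.finite_dim_overD[OF fd], rule that, assumption, assumption) simp
  note t = mod_homD[OF ip.unit_mod_hom, unfolded direct_image_simps]
  show ?thesis
  proof (rule V.finite_dim_overI)
    show "finite (ip.tensor \<one> ` B)" using B(1) by simp
    show "ip.tensor \<one> ` B \<subseteq> carrier ip.V" using B(2) t(2) by auto
    fix U assume U: "V.subspace U" "ip.tensor \<one> ` B \<subseteq> U"
    note UD = V.subspaceD[OF U(1)]
    have t0: "ip.tensor \<one> \<zero>\<^bsub>N\<^esub> = \<zero>\<^bsub>ip.V\<^esub>"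
      using mod_hom_zero[OF N left_module_direct_image[OF ip.left_module_V] ip.unit_mod_hom]
      by (simp only: direct_image_simps)
    have tsc: "ip.tensor \<one> (N.sc e n) = V.sc e (ip.tensor \<one> n)" if "e \<in> E" "n \<in> carrier N" for e n
      using t(4)[OF \<mu>E_closed[OF that(1)] that(2)] that(1) by (simp add: lift_op_\<mu>)
    have "N.subspace {n \<in> carrier N. ip.tensor \<one> n \<in> U}"
      unfolding N.subspace_def
    proof (intro conjI ballI)
      show "\<zero>\<^bsub>N\<^esub> \<in> {n \<in> carrier N. ip.tensor \<one> n \<in> U}" using UD(2) t0 by simp
      show "u \<oplus>\<^bsub>N\<^esub> w \<in> {n \<in> carrier N. ip.tensor \<one> n \<in> U}"
        if "u \<in> {n \<in> carrier N. ip.tensor \<one> n \<in> U}" "w \<in> {n \<in> carrier N. ip.tensor \<one> n \<in> U}" for u w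
        using that UD(3) t(3)[of u w] by simp
      show "N.sc a u \<in> {n \<in> carrier N. ip.tensor \<one> n \<in> U}"
        if "a \<in> E" "u \<in> {n \<in> carrier N. ip.tensor \<one> n \<in> U}" for a u
      proof (intro CollectI conjI)
        have u: "u \<in> carrier N" "ip.tensor \<one> u \<in> U" using that(2) by simp_all
        show "N.sc a u \<in> carrier N" using N.sc_closed[OF that(1) u(1)] .
        show "ip.tensor \<one> (N.sc a u) \<in> U" unfolding tsc[OF that(1) u(1)] by (rule UD(4)[OF EF[OF that(1)] u(2)])
      qed
    qed simp
    then have "carrier N \<subseteq> {n \<in> carrier N. ip.tensor \<one> n \<in> U}"
    proof (rule B(3))
      show "B \<subseteq> {n \<in> carrier N. ip.tensor \<one> n \<in> U}" using B(2) U(2) by auto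
    qed
    then have tU: "ip.tensor \<one> n \<in> U" if "n \<in> carrier N" for n using that by blast
    show "carrier ip.V \<subseteq> U"
    proof
      fix v assume v: "v \<in> carrier ip.V"
      have "(\<Oplus>\<^bsub>ip.V\<^esub>i\<in>{..<m}. \<mu>F (x i) \<odot>\<^bsub>ip.V\<^esub> ip.tensor \<one> (ip.push (\<phi> i) v)) \<in> U"
        using tU ip.push_closed[OF functional_\<phi> v] x_F
        by (intro V.subspace_finsum[OF U(1)] UD(4)) auto
      then show "v \<in> U" using ip.expand_V[OF v] by simp
    qed
  qed
qed

end

section \<open>Semisimplicity of inverse images\<close>

context galois_sub
begin

lemma inv_bij: "bij_betw (\<lambda>g. ginv g) G G"
proof (rule bij_betwI[of _ _ _ "\<lambda>g. ginv g"])
  interpret B: group "BijGroup (carrier L)" by (rule group_BijGroup)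
  have "g \<in> carrier (BijGroup (carrier L))" if "g \<in> G" for g
    using that by (simp add: galois_group_def BijGroup_def)
  then show "ginv (ginv g) = g" if "g \<in> G" for g
    using that by simp
  then show "ginv (ginv g) = g" if "g \<in> G" for g
    using that by simp
qed (use galois_inv(1)[OF E_sub] in auto)

lemma tr_inv:
  assumes "z \<in> carrier L"
  shows "tr z = (\<Oplus>g\<in>G. ginv g z)"
  unfolding tr_def
  using finsum_reindex[of "\<lambda>g. g z" "\<lambda>g. ginv g" G] inv_bij galois_groupD(1) assms
  by (auto simp: bij_betw_def)

text \<open>Every operator is a conjugate by \<open>g\<close>, namely of its own conjugate by the
  inverse; so module and twist are acted upon by the same set of maps.\<close>

lemma submodule_twist_iff:
  assumes g: "g \<in> G" and M: "left_module (diff_ring k L) M"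
  shows "submodule H (diff_ring k L) (twist L g M) \<longleftrightarrow> submodule H (diff_ring k L) M"
proof -
  interpret M: left_module "diff_ring k L" M by fact
  interpret T: left_module "diff_ring k L" "twist L g M" by (rule left_module_twist[OF g M])
  let ?h = "ginv g"
  have tw: "carrier (twist L g M) = carrier M" "\<zero>\<^bsub>twist L g M\<^esub> = \<zero>\<^bsub>M\<^esub>"
    "x \<oplus>\<^bsub>twist L g M\<^esub> y = x \<oplus>\<^bsub>M\<^esub> y" "P \<odot>\<^bsub>twist L g M\<^esub> x = conj_op g P \<odot>\<^bsub>M\<^esub> x" for x y P
    by (simp_all add: twist_def)
  note h = galois_inv[OF E_sub g]
  have surj: "conj_op g (conj_op ?h P) = P" if P: "P \<in> carrier (diff_ring k L)" for P
  proof (rule DL_eqI[OF conj_closed[OF g conj_closed[OF h(1) P]] P])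
    fix z assume z: "z \<in> carrier L"
    have "conj_op g (conj_op ?h P) z = ?h (conj_op ?h P (g z))"
      using conj_apply(1)[OF g conj_closed[OF h(1) P] z] .
    also have "\<dots> = P (?h (g z))" using conj_apply(2)[OF h(1) P galois_groupD(1)[OF g z]] .
    finally show "conj_op g (conj_op ?h P) z = P z" using h(2)[OF z] by simp
  qed
  show ?thesis
  proof
    assume H: "submodule H (diff_ring k L) (twist L g M)"
    note HD = T.submoduleD[OF H, unfolded tw]
    show "submodule H (diff_ring k L) M"
    proof (rule M.submoduleI)
      fix P v assume P: "P \<in> carrier (diff_ring k L)" and v: "v \<in> H"
      show "P \<odot>\<^bsub>M\<^esub> v \<in> H" using HD(6)[OF conj_closed[OF h(1) P] v] unfolding surj[OF P] .
    qed (use HD in auto)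
  next
    assume H: "submodule H (diff_ring k L) M"
    note HD = M.submoduleD[OF H]
    show "submodule H (diff_ring k L) (twist L g M)"
      using HD conj_closed[OF g] by (intro T.submoduleI) (auto simp only: tw)
  qed
qed

lemma simple_sub_twist_iff:
  assumes g: "g \<in> G" and M: "left_module (diff_ring k L) M"
  shows "simple_sub (diff_ring k L) (twist L g M) H \<longleftrightarrow> simple_sub (diff_ring k L) M H"
  unfolding simple_sub_def submodule_twist_iff[OF assms] by (simp add: twist_def)

lemma simple_twist:
  assumes g: "g \<in> G" and M: "simple_left_module (diff_ring k L) M"
  shows "simple_left_module (diff_ring k L) (twist L g M)"
proof -
  have M': "left_module (diff_ring k L) M" using M by (rule simple_left_moduleD)
  interpret M: left_module "diff_ring k L" M by fact
  interpret T: left_module "diff_ring k L" "twist L g M" by (rule left_module_twist[OF g M'])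
  have "carrier (twist L g M) = carrier M" by (simp add: twist_def)
  then show ?thesis
    using M M.simple_sub_carrier T.simple_sub_carrier simple_sub_twist_iff[OF g M'] by simp
qed

end

text \<open>The rewrite rule removes the update of \<open>L\<close> by its own carrier, so that the
  case \<open>F = L\<close> is available for \<open>L\<close> itself.\<close>

sublocale galois_dual \<subseteq> top: etale_pair L k E "carrier L" m x "\<lambda>i z. tr (y i \<otimes> z)"
  rewrites "L\<lparr>carrier := carrier L\<rparr> = L"
  by (rule etale_pair_top) simp

lemma twist_simps:
  "carrier (twist L g M) = carrier M" "\<zero>\<^bsub>twist L g M\<^esub> = \<zero>\<^bsub>M\<^esub>"
  "v \<oplus>\<^bsub>twist L g M\<^esub> w = v \<oplus>\<^bsub>M\<^esub> w"
  "P \<odot>\<^bsub>twist L g M\<^esub> v = compose (carrier L) (inv\<^bsub>BijGroup (carrier L)\<^esub> g) (compose (carrier L) P g) \<odot>\<^bsub>M\<^esub> v"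
  "finsum (twist L g M) = finsum M" "set_add (twist L g M) = set_add M"
  by (simp_all add: twist_def finsum_def set_add_def)

lemma (in galois_sub) fss_twist:
  assumes g: "g \<in> G" and M: "left_module (diff_ring k L) M" and H: "fss (diff_ring k L) (twist L g M) H"
  shows "fss (diff_ring k L) M H"
  using H
proof induction
  case zero
  show ?case unfolding twist_simps by (rule fss.zero)
next
  case (add W S)
  then show ?case unfolding twist_simps simple_sub_twist_iff[OF g M] by (intro fss.add)
qed

lemma (in galois_sub) conj_mult_op:
  assumes g: "g \<in> G" and a: "a \<in> carrier L"
  shows "conj_op g (mult_op L a) = mult_op L (ginv g a)"
proof -
  note h = galois_inv[OF E_sub g]
  note hD = galois_groupD[OF h(1)]
  show ?thesis
  proof (rule DL_eqI[OF conj_closed[OF g DL_mult_op[OF k_carrier a]] DL_mult_op[OF k_carrier hD(1)[OF a]]])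
    fix z assume z: "z \<in> carrier L"
    have gz: "g z \<in> carrier L" using galois_groupD(1)[OF g z] .
    have "conj_op g (mult_op L a) z = ginv g (a \<otimes> g z)"
      using conj_apply(1)[OF g DL_mult_op[OF k_carrier a] z] gz by (simp add: mult_op_def)
    also have "\<dots> = ginv g a \<otimes> z" using hD(3)[OF a gz] h(2)[OF z] by simp
    finally show "conj_op g (mult_op L a) z = mult_op L (ginv g a) z"
      using z by (simp add: mult_op_def)
  qed
qed

locale galois_inverse = galois_avg +
  fixes N :: "('a \<Rightarrow> 'a, 'n) module"
  assumes N: "left_module (diff_ring k (L\<lparr>carrier := E\<rparr>)) N"

sublocale galois_inverse \<subseteq> ip: inverse_image_pair L k E "carrier L" m x "\<lambda>i z. tr (y i \<otimes> z)" N
  rewrites "L\<lparr>carrier := carrier L\<rparr> = L"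
  by (intro inverse_image_pair.intro etale_pair_top inverse_image_pair_axioms.intro N) simp

context galois_inverse
begin

abbreviation "LE \<equiv> L\<lparr>carrier := E\<rparr>"
abbreviation "DE \<equiv> diff_ring k LE"
abbreviation "DL \<equiv> diff_ring k L"
abbreviation "\<mu> \<equiv> mult_op L"
abbreviation "\<mu>E \<equiv> mult_op LE"
abbreviation "lift_op \<equiv> ext_op k LE L"
abbreviation "V \<equiv> inverse_image k LE L N"
abbreviation "tensor \<equiv> pure_tensor LE L N"
abbreviation "f_plus W \<equiv> direct_image k LE L W"

lemma functional_tr: "top.functional tr" and functional_avg: "top.functional avg"
  unfolding top.functional_def
  using tr_closed add_hom_add[OF tr_add_hom] tr_smult avg_closed avg_add avg_smult by auto

lemma lift_conj: "Q \<in> carrier DE \<Longrightarrow> g \<in> G \<Longrightarrow> conj_op g (lift_op Q) = lift_op Q"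
  by (rule ext_galois_commute(1)[OF _ top.lift_op_closed top.lift_op_apply])

text \<open>The trace is linear over the operators of \<open>E\<close>. The resulting map f_+ f^! N
  \<rightarrow> N is the counit of the second adjunction, in which f_+ is the left adjoint.\<close>

lemma push_tr_hom: "ip.push tr \<in> mod_hom DE (f_plus V) N"
  by (rule ip.push_mod_hom[OF functional_tr])
    (rule ext_tr_commute[OF _ top.lift_op_closed top.lift_op_apply, symmetric])

lemma push_avg_hom: "ip.push avg \<in> mod_hom DE (f_plus V) N"
  by (rule ip.push_mod_hom[OF functional_avg])
    (rule avg_commute[OF _ top.lift_op_closed top.lift_op_apply, symmetric])

text \<open>The normalised trace splits the unit, so \<open>N\<close> is a direct factor of f_+ f^!
  N.\<close>

lemma push_avg_unit: "n \<in> carrier N \<Longrightarrow> ip.push avg (tensor \<one> n) = n"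
  by (rule ip.push_unit[OF functional_avg avg_one])

lemma unit_zero: "tensor \<one> \<zero>\<^bsub>N\<^esub> = \<zero>\<^bsub>V\<^esub>"
  using mod_hom_zero[OF N top.left_module_direct_image[OF ip.left_module_V] ip.unit_mod_hom]
  by (simp only: top.direct_image_simps)

lemma push_zero: "top.functional \<psi> \<Longrightarrow> ip.push \<psi> \<zero>\<^bsub>V\<^esub> = \<zero>\<^bsub>N\<^esub>"
  by (rule add_hom_zero[OF ip.V_abelian_group ip.N.M.abelian_group_axioms ip.push(1)])

lemma unit_eq_zero: "n \<in> carrier N \<Longrightarrow> tensor \<one> n = \<zero>\<^bsub>V\<^esub> \<Longrightarrow> n = \<zero>\<^bsub>N\<^esub>"
  using push_avg_unit[of n] push_zero[OF functional_avg] by simp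

lemma push_dual:
  assumes i: "i < m" and v: "v \<in> carrier V"
  shows "ip.push (\<lambda>z. tr (y i \<otimes> z)) v = ip.push tr (\<mu> (y i) \<odot>\<^bsub>V\<^esub> v)"
proof -
  note yc = top.\<mu>F_closed[OF y_car[OF i]]
  have "ip.push (\<lambda>z. tr (y i \<otimes> z)) v = (\<lambda>v. ip.push tr (\<mu> (y i) \<odot>\<^bsub>V\<^esub> v)) v"
  proof (rule ip.add_hom_eqI[OF ip.N.M.abelian_group_axioms ip.push(1)[OF top.functional_\<phi>[OF i]]
        add_hom_comp[OF ip.V.smult_add_hom[OF yc] ip.push(1)[OF functional_tr]] _ v])
    fix a n assume a: "a \<in> carrier L" and n: "n \<in> carrier N"
    show "ip.push (\<lambda>z. tr (y i \<otimes> z)) (tensor a n) = ip.push tr (\<mu> (y i) \<odot>\<^bsub>V\<^esub> tensor a n)"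
      using ip.push(2)[OF top.functional_\<phi>[OF i] a n] ip.push(2)[OF functional_tr m_closed[OF y_car[OF i] a] n]
        ip.\<mu>F_tensor[OF y_car[OF i] a n] by simp
  qed
  then show ?thesis .
qed

text \<open>Nondegeneracy of the trace form: the coefficients of \<open>v\<close> in its expansion
  are the traces of the multiples y_i v.\<close>

lemma push_tr_nondegenerate:
  assumes v: "v \<in> carrier V" and "\<And>a. a \<in> carrier L \<Longrightarrow> ip.push tr (\<mu> a \<odot>\<^bsub>V\<^esub> v) = \<zero>\<^bsub>N\<^esub>"
  shows "v = \<zero>\<^bsub>V\<^esub>"
proof -
  have "v = (\<Oplus>\<^bsub>V\<^esub>i\<in>{..<m}. \<mu> (x i) \<odot>\<^bsub>V\<^esub> tensor \<one> (ip.push (\<lambda>z. tr (y i \<otimes> z)) v))"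
    using ip.expand_V[OF v] .
  also have "\<dots> = (\<Oplus>\<^bsub>V\<^esub>i\<in>{..<m}. \<zero>\<^bsub>V\<^esub>)"
  proof (intro ip.V.M.finsum_cong' refl)
    fix i assume "i \<in> {..<m}"
    then have i: "i < m" by simp
    show "\<mu> (x i) \<odot>\<^bsub>V\<^esub> tensor \<one> (ip.push (\<lambda>z. tr (y i \<otimes> z)) v) = \<zero>\<^bsub>V\<^esub>"
      unfolding push_dual[OF i v] assms(2)[OF y_car[OF i]] unit_zero
      using top.\<mu>F_closed[OF x_car[OF i]] by (rule ip.V.smult_r_null)
  qed simp
  also have "\<dots> = \<zero>\<^bsub>V\<^esub>" by simp
  finally show ?thesis .
qed

text \<open>\<open>h g\<close> sends a \<otimes> n to g^-1(a) \<otimes> n. It is linear into the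
  twist because lifted operators commute with the Galois group, and the sum over the group is the
  trace in the first factor.\<close>

lemma conjugation_maps:
  obtains h where "\<And>g. g \<in> G \<Longrightarrow> h g \<in> mod_hom DL V (twist L g V)"
    "\<And>v. v \<in> carrier V \<Longrightarrow> (\<Oplus>\<^bsub>V\<^esub>g\<in>G. h g v) = tensor \<one> (ip.push tr v)"
proof -
  have "\<exists>h. h \<in> mod_hom DL V (twist L g V) \<and> (\<forall>a\<in>carrier L. \<forall>n\<in>carrier N.
      h (tensor a n) = tensor (ginv g a) n)" if g: "g \<in> G" for g
  proof -
    note T = left_module_twist[OF g ip.left_module_V]
    have f: "tensor \<one> \<in> mod_hom DE N (f_plus (twist L g V))"
    proof (rule mod_homI)
      fix Q n assume Q: "Q \<in> carrier DE" and n: "n \<in> carrier N"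
      show "tensor \<one> (Q \<odot>\<^bsub>N\<^esub> n) = Q \<odot>\<^bsub>f_plus (twist L g V)\<^esub> tensor \<one> n"
        unfolding top.direct_image_simps twist_simps lift_conj[OF Q g] ip.lift_op_tensor[OF Q n] ..
    qed (simp_all add: top.direct_image_simps twist_simps ip.tensor_closed ip.tensor_add_r)
    show ?thesis
    proof (rule ip.inverse_image_universal[OF T f])
      fix h assume h: "h \<in> mod_hom DL V (twist L g V)"
        and eq: "\<And>a n. a \<in> carrier L \<Longrightarrow> n \<in> carrier N \<Longrightarrow> h (tensor a n) = \<mu> a \<odot>\<^bsub>twist L g V\<^esub> tensor \<one> n"
      have "h (tensor a n) = tensor (ginv g a) n" if "a \<in> carrier L" "n \<in> carrier N" for a n
        unfolding eq[OF that] twist_simps conj_mult_op[OF g that(1)]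
        using ip.tensor_smult[OF galois_groupD(1)[OF galois_inv(1)[OF E_sub g] that(1)] that(2)] by simp
      then show ?thesis using h by blast
    qed
  qed
  then obtain h where h: "\<And>g. g \<in> G \<Longrightarrow> h g \<in> mod_hom DL V (twist L g V)"
    and ht: "\<And>g a n. g \<in> G \<Longrightarrow> a \<in> carrier L \<Longrightarrow> n \<in> carrier N \<Longrightarrow>
      h g (tensor a n) = tensor (ginv g a) n" by metis
  have hV: "h g \<in> add_hom V V" if g: "g \<in> G" for g
    using mod_homD(2,3)[OF h[OF g]] unfolding twist_simps by (intro add_homI) auto
  have sum: "(\<Oplus>\<^bsub>V\<^esub>g\<in>G. h g v) = tensor \<one> (ip.push tr v)" if v: "v \<in> carrier V" for v
  proof -
    have "(\<lambda>v. \<Oplus>\<^bsub>V\<^esub>g\<in>G. h g v) v = (\<lambda>v. tensor \<one> (ip.push tr v)) v"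
    proof (rule ip.add_hom_eqI[OF ip.V_abelian_group _ _ _ v])
      show "(\<lambda>v. \<Oplus>\<^bsub>V\<^esub>g\<in>G. h g v) \<in> add_hom V V"
        by (rule add_hom_sum[OF ip.V_abelian_group ip.V_abelian_group finite_G hV])
      show "(\<lambda>v. tensor \<one> (ip.push tr v)) \<in> add_hom V V"
        by (rule add_hom_comp[OF ip.push(1)[OF functional_tr] ip.tensor_add_hom]) simp
      fix a n assume a: "a \<in> carrier L" and n: "n \<in> carrier N"
      have ca: "ginv g a \<in> carrier L" if "g \<in> G" for g
        using galois_groupD(1)[OF galois_inv(1)[OF E_sub that] a] .
      have "(\<Oplus>\<^bsub>V\<^esub>g\<in>G. h g (tensor a n)) = (\<Oplus>\<^bsub>V\<^esub>g\<in>G. tensor (ginv g a) n)"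
        using ht[OF _ a n] ca n by (intro ip.V.M.finsum_cong') (auto intro: ip.tensor_closed)
      also have "\<dots> = tensor (tr a) n"
        unfolding tr_inv[OF a] using ca by (intro ip.tensor_finsum_l[OF n finite_G, symmetric]) auto
      also have "\<dots> = tensor \<one> (ip.push tr (tensor a n))"
        unfolding ip.push(2)[OF functional_tr a n]
        using ip.tensor_balanced[OF one_closed tr_closed[OF a] n] tr_car[OF a] by simp
      finally show "(\<Oplus>\<^bsub>V\<^esub>g\<in>G. h g (tensor a n)) = tensor \<one> (ip.push tr (tensor a n))" .
    qed
    then show ?thesis .
  qed
  show thesis by (rule that[of h, OF h sum])
qed

text \<open>The sum of the conjugates of a simple submodule meets \<open>N\<close> in a nonzero submodule.\<close>

lemma fss_inverse_image:
  assumes simple: "simple_left_module DE N" and fd: "finite_dim_over LE N"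
  shows "fss DL V (carrier V)"
proof -
  interpret fp: field_pair L k E "carrier L" m x "\<lambda>i z. tr (y i \<otimes> z)"
    by (intro field_pair.intro field_pair_axioms.intro field_axioms etale_pair_top subfield carrier_is_subfield)
  interpret VD: dmodule L k "carrier L" V
    using ip.left_module_V
    by (intro dmodule.intro dmodule_axioms.intro field_axioms carrier_is_subfield k_carrier) simp
  have dcc: ip.V.dcc
    using VD.finite_dim_dcc fp.finite_dim_inverse_image[OF N fd] by simp
  obtain n0 where n0: "n0 \<in> carrier N" "n0 \<noteq> \<zero>\<^bsub>N\<^esub>" using simple_module_nonzero[OF simple] .
  have "tensor \<one> n0 \<noteq> \<zero>\<^bsub>V\<^esub>" using unit_eq_zero[OF n0(1)] n0(2) by blast
  moreover have "tensor \<one> n0 \<in> carrier V" using n0(1) by (simp add: ip.tensor_closed)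
  ultimately have "carrier V \<noteq> {\<zero>\<^bsub>V\<^esub>}" by blast
  \<comment> \<open>Finite dimension over \<open>L\<close> yields the descending chain condition and
    thereby a simple submodule to start from.\<close>
  with dcc ip.V.submodule_carrier obtain S where S: "simple_sub DL V S" by (rule ip.V.dcc_simple_sub)
  have Ssub: "submodule S DL V" using S by (simp add: simple_sub_def)
  note SD = ip.V.submoduleD[OF Ssub]
  obtain s where s: "s \<in> S" "s \<noteq> \<zero>\<^bsub>V\<^esub>" using S SD(2) unfolding simple_sub_def by blast
  have sV: "s \<in> carrier V" using s(1) SD(1) by blast
  obtain h where h: "\<And>g. g \<in> G \<Longrightarrow> h g \<in> mod_hom DL V (twist L g V)"
    and sum: "\<And>v. v \<in> carrier V \<Longrightarrow> (\<Oplus>\<^bsub>V\<^esub>g\<in>G. h g v) = tensor \<one> (ip.push tr v)"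
    using conjugation_maps by metis
  have hS: "fss DL V (h g ` S)" if g: "g \<in> G" for g
    using fss_image[OF ip.left_module_V left_module_twist[OF g ip.left_module_V] h[OF g] ip.V.fss_simple_sub[OF S]]
      fss_twist[OF g ip.left_module_V] by blast
  \<comment> \<open>The conjugates of \<open>S\<close> are collected one by one in a semisimple
    submodule.\<close>
  have "finite A \<Longrightarrow> A \<subseteq> G \<Longrightarrow> \<exists>W. fss DL V W \<and> (\<forall>g\<in>A. h g ` S \<subseteq> W)" for A
  proof (induction A rule: finite_induct)
    case empty
    then show ?case using fss.zero by blast
  next
    case (insert g A)
    then obtain W where W: "fss DL V W" "\<forall>g\<in>A. h g ` S \<subseteq> W" by blast
    have g: "g \<in> G" using insert by blast
    note WD = ip.V.submoduleD[OF ip.V.fss_submodule[OF W(1)]]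
      and HD = ip.V.submoduleD[OF ip.V.fss_submodule[OF hS[OF g]]]
    let ?W = "W <+>\<^bsub>V\<^esub> (h g ` S)"
    have "W \<subseteq> ?W"
    proof
      fix w assume w: "w \<in> W"
      have "w \<oplus>\<^bsub>V\<^esub> \<zero>\<^bsub>V\<^esub> \<in> ?W" using w HD(2) by (rule set_addI)
      then show "w \<in> ?W" using w WD(1) by auto
    qed
    moreover have "h g ` S \<subseteq> ?W"
    proof
      fix w assume w: "w \<in> h g ` S"
      have "\<zero>\<^bsub>V\<^esub> \<oplus>\<^bsub>V\<^esub> w \<in> ?W" using WD(2) w by (rule set_addI)
      then show "w \<in> ?W" using w HD(1) by auto
    qed
    moreover have "fss DL V ?W" by (rule ip.V.fss_add[OF hS[OF g] W(1)])
    ultimately show ?case using W(2) by (intro exI[of _ ?W]) blast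
  qed
  from this[OF finite_G] obtain W where W: "fss DL V W" "\<And>g. g \<in> G \<Longrightarrow> h g ` S \<subseteq> W" by blast
  have WS: "submodule W DL V" by (rule ip.V.fss_submodule[OF W(1)])
  \<comment> \<open>\<open>W\<close> contains all conjugates of \<open>v\<close>, hence their sum,
    which is the image under the unit of the trace of \<open>v\<close>.\<close>
  have inW: "tensor \<one> (ip.push tr v) \<in> W" if v: "v \<in> S" for v
  proof -
    have "v \<in> carrier V" using v SD(1) by blast
    note sum[OF this]
    moreover have "(\<Oplus>\<^bsub>V\<^esub>g\<in>G. h g v) \<in> W"
      using W(2) v by (intro ip.V.submodule_finsum[OF WS finite_G]) blast
    ultimately show ?thesis by simp
  qed
  let ?N = "{n \<in> carrier N. tensor \<one> n \<in> W}"
  have Nsub: "submodule ?N DE N"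
    by (rule submodule_preimage[OF N top.left_module_direct_image[OF ip.left_module_V] ip.unit_mod_hom
          top.submodule_direct_image[OF ip.left_module_V WS]])
  \<comment> \<open>Nondegeneracy provides a multiple of \<open>s\<close>, still in
    \<open>S\<close>, with nonzero trace; so the submodule \<open>?N\<close> of the simple module
    \<open>N\<close> is not zero.\<close>
  obtain a where a: "a \<in> carrier L" "ip.push tr (\<mu> a \<odot>\<^bsub>V\<^esub> s) \<noteq> \<zero>\<^bsub>N\<^esub>"
    using push_tr_nondegenerate[OF sV] s(2) by metis
  have as: "\<mu> a \<odot>\<^bsub>V\<^esub> s \<in> S" using SD(6)[OF top.\<mu>F_closed[OF a(1)] s(1)] .
  then have "ip.push tr (\<mu> a \<odot>\<^bsub>V\<^esub> s) \<in> ?N"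
    using inW[OF as] SD(1) ip.push_closed[OF functional_tr, of "\<mu> a \<odot>\<^bsub>V\<^esub> s"] by blast
  then have "?N \<noteq> {\<zero>\<^bsub>N\<^esub>}" using a(2) by blast
  then have "?N = carrier N" using simple Nsub unfolding simple_left_module_def by blast
  then have "W = carrier V" by (intro ip.submodule_contains_unit[OF WS]) blast
  then show ?thesis using W(1) by simp
qed

text \<open>By semisimplicity the surjection \<open>f\<close> has a section, an embedding of
  \<open>M\<close> into f^! N. Following it by the trace map gives the required homomorphism,
  nonzero because the trace form is nondegenerate.\<close>

lemma hom_from_direct_image:
  assumes M: "simple_left_module DL M" and fss: "fss DL V (carrier V)"
    and f: "f \<in> mod_hom DL V M" and v: "v \<in> carrier V" "f v \<noteq> \<zero>\<^bsub>M\<^esub>"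
  shows "\<exists>g\<in>mod_hom DE (f_plus M) N. \<exists>u\<in>carrier M. g u \<noteq> \<zero>\<^bsub>N\<^esub>"
proof -
  note M' = simple_left_moduleD[OF M]
  have surj: "f ` carrier V = carrier M" by (rule surj_simple[OF ip.left_module_V M f ip.V.submodule_carrier v])
  let ?K = "{w \<in> carrier V. f w \<in> {\<zero>\<^bsub>M\<^esub>}}"
  have K: "submodule ?K DL V"
    by (rule submodule_preimage[OF ip.left_module_V M' f left_module.submodule_zero[OF M']])
  obtain C where C: "submodule C DL V" "?K \<inter> C = {\<zero>\<^bsub>V\<^esub>}" "carrier V \<subseteq> ?K <+>\<^bsub>V\<^esub> C"
    using ip.V.fss_complement[OF fss K] by blast
  note CD = ip.V.submoduleD[OF C(1)]
  let ?C = "V\<lparr>carrier := C\<rparr>"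
  have CM: "left_module DL ?C" by (rule ip.V.submodule_left_module[OF C(1)])
  have fC: "f \<in> mod_hom DL ?C M"
    using mod_homD(2-4)[OF f] subsetD[OF CD(1)] by (intro mod_homI) simp_all
  have "inj_on f C"
  proof (rule inj_on_mod_hom[OF ip.left_module_V M' f C(1)])
    fix w assume w: "w \<in> C" "f w = \<zero>\<^bsub>M\<^esub>"
    then have "w \<in> ?K \<inter> C" using CD(1) by auto
    then show "w = \<zero>\<^bsub>V\<^esub>" unfolding C(2) by simp
  qed
  moreover have "f ` C = carrier M"
  proof
    show "f ` C \<subseteq> carrier M" using mod_homD(2)[OF f] CD(1) by auto
    show "carrier M \<subseteq> f ` C"
    proof
      fix u assume "u \<in> carrier M"
      then obtain w where w: "w \<in> carrier V" "u = f w" using surj by blast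
      then have "w \<in> ?K <+>\<^bsub>V\<^esub> C" using C(3) by blast
      then obtain a c where ac: "a \<in> ?K" "c \<in> C" "w = a \<oplus>\<^bsub>V\<^esub> c" by (elim set_addD)
      interpret M: left_module DL M by (rule M')
      have c: "c \<in> carrier V" using ac(2) CD(1) by blast
      then have "u = f c" using w(2) ac mod_homD(2,3)[OF f] by simp
      then show "u \<in> f ` C" using ac(2) by blast
    qed
  qed
  ultimately have bij: "bij_betw f (carrier ?C) (carrier M)" by (simp add: bij_betw_def)
  let ?s = "inv_into C f"
  have s: "?s \<in> mod_hom DL M ?C" using mod_hom_inv_into[OF CM fC bij] by simp
  have "?s \<in> mod_hom DL M V" using mod_homD(2-4)[OF s] subsetD[OF CD(1)] by (intro mod_homI) simp_all
  note sV = this and sD = mod_homD[OF this]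
  let ?g = "\<lambda>u. ip.push tr (?s u)"
  have g: "?g \<in> mod_hom DE (f_plus M) N"
    by (rule mod_hom_comp[OF top.mod_hom_direct_image[OF sV] push_tr_hom])
  obtain u where u: "u \<in> carrier M" "u \<noteq> \<zero>\<^bsub>M\<^esub>" using simple_module_nonzero[OF M] .
  have fs: "f (?s u) = u" using bij u(1) by (simp add: bij_betw_def f_inv_into_f)
  have "?s u \<noteq> \<zero>\<^bsub>V\<^esub>" using fs u(2) mod_hom_zero[OF ip.left_module_V M' f] by metis
  then obtain a where a: "a \<in> carrier L" "ip.push tr (\<mu> a \<odot>\<^bsub>V\<^esub> ?s u) \<noteq> \<zero>\<^bsub>N\<^esub>"
    using push_tr_nondegenerate[OF sD(2)[OF u(1)]] by metis
  have ac: "\<mu> a \<in> carrier DL" using top.\<mu>F_closed[OF a(1)] .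
  have "?g (\<mu> a \<odot>\<^bsub>M\<^esub> u) \<noteq> \<zero>\<^bsub>N\<^esub>" unfolding sD(4)[OF ac u(1)] by (rule a(2))
  then have "\<exists>u\<in>carrier M. ?g u \<noteq> \<zero>\<^bsub>N\<^esub>" using left_module.smult_closed[OF M' ac u(1)] by (rule bexI)
  then show ?thesis using g by (rule bexI[of _ ?g])
qed

end

section \<open>Homomorphisms between direct images\<close>

context galois_avg
begin

text \<open>This reflects the decomposition of \<open>L \<otimes>\<^sub>E V\<close> as the direct sum of the twists of \<open>V\<close>, with
  inclusions \<open>\<sigma> g\<close> and projections \<open>p h\<close>.\<close>

lemma direct_image_hom_decomposition:
  fixes V :: "('a \<Rightarrow> 'a, 'v) module" and W :: "('a \<Rightarrow> 'a, 'w) module"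
  assumes V: "left_module (diff_ring k L) V" and W: "left_module (diff_ring k L) W"
    and \<phi>: "\<phi> \<in> mod_hom (diff_ring k (L\<lparr>carrier := E\<rparr>)) (direct_image k (L\<lparr>carrier := E\<rparr>) L V)
      (direct_image k (L\<lparr>carrier := E\<rparr>) L W)"
  shows "\<exists>\<psi>. (\<forall>g\<in>G. \<psi> g \<in> mod_hom (diff_ring k L) (twist L g V) W) \<and>
    (\<forall>v\<in>carrier V. \<phi> v = (\<Oplus>\<^bsub>W\<^esub>g\<in>G. \<psi> g v))"
proof -
  interpret V: left_module "diff_ring k L" V by fact
  interpret W: left_module "diff_ring k L" W by fact
  let ?N = "direct_image k (L\<lparr>carrier := E\<rparr>) L V"
  interpret U: galois_inverse L k E m x y ?N
    by (intro galois_inverse.intro galois_avg_axioms galois_inverse_axioms.intro top.left_module_direct_image[OF V])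
  note di = top.direct_image_simps
  have Nc: "carrier ?N = carrier V" by (simp add: di)
  note mc = DL_mult_op[OF k_carrier]
  have mv: "U.\<mu> a \<odot>\<^bsub>V\<^esub> v \<in> carrier V" if "a \<in> carrier L" "v \<in> carrier V" for a v
    using V.smult_closed[OF mc[OF that(1)] that(2)] .
  have mult: "U.\<mu> (a \<otimes> b) \<odot>\<^bsub>V\<^esub> v = U.\<mu> a \<odot>\<^bsub>V\<^esub> (U.\<mu> b \<odot>\<^bsub>V\<^esub> v)"
    if "a \<in> carrier L" "b \<in> carrier L" "v \<in> carrier V" for a b v
    using V.smult_assoc[OF mc[OF that(1)] mc[OF that(2)] that(3)] top.\<mu>F_mult[OF that(1,2)] by simp
  have zero: "U.\<mu> \<zero> \<odot>\<^bsub>V\<^esub> v = \<zero>\<^bsub>V\<^esub>" if v: "v \<in> carrier V" for v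
    using V.smult_l_distr[OF mc[OF zero_closed] mc[OF zero_closed] v] top.\<mu>F_add[of \<zero> \<zero>] mv[OF zero_closed v] by simp
  have one: "U.\<mu> \<one> \<odot>\<^bsub>V\<^esub> v = v" if v: "v \<in> carrier V" for v
    using V.smult_one[OF v] top.\<mu>F_one by simp
  have sum_mult: "U.\<mu> (\<Oplus>i\<in>I. a i) \<odot>\<^bsub>V\<^esub> v = (\<Oplus>\<^bsub>V\<^esub>i\<in>I. U.\<mu> (a i) \<odot>\<^bsub>V\<^esub> v)"
    if v: "v \<in> carrier V" and I: "finite I" and a: "\<And>i. i \<in> I \<Longrightarrow> a i \<in> carrier L" for I :: "'z set" and a v
  proof -
    have "(\<lambda>a. U.\<mu> a \<odot>\<^bsub>V\<^esub> v) \<in> add_hom L V"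
      using mv v V.smult_l_distr[OF mc mc v] top.\<mu>F_add by (intro add_homI) simp_all
    from add_hom_finsum[OF abelian_group_axioms V.M.abelian_group_axioms this I] show ?thesis using a by blast
  qed
  \<comment> \<open>The projection to the twist by \<open>h\<close> is a \<otimes> v \<mapsto>
    h^-1(a) v. It is adjoint to the identity of \<open>V\<close>, which is D_E-linear into the twist
    since lifted operators commute with \<open>h\<close>.\<close>
  have "\<exists>p. p \<in> mod_hom (diff_ring k L) U.V (twist L h V) \<and> (\<forall>a\<in>carrier L. \<forall>v\<in>carrier V.
      p (U.tensor a v) = U.\<mu> (ginv h a) \<odot>\<^bsub>V\<^esub> v)" if h: "h \<in> G" for h
  proof -
    have f: "(\<lambda>v. v) \<in> mod_hom U.DE ?N (U.f_plus (twist L h V))"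
    proof (rule mod_homI)
      fix Q v assume Q: "Q \<in> carrier U.DE" and v: "v \<in> carrier ?N"
      show "Q \<odot>\<^bsub>?N\<^esub> v = Q \<odot>\<^bsub>U.f_plus (twist L h V)\<^esub> v"
        unfolding di twist_simps U.lift_conj[OF Q h] ..
    qed (simp_all add: di twist_simps)
    show ?thesis
    proof (rule U.ip.inverse_image_universal[OF left_module_twist[OF h V] f])
      fix p assume p: "p \<in> mod_hom (diff_ring k L) U.V (twist L h V)"
        and eq: "\<And>a n. a \<in> carrier L \<Longrightarrow> n \<in> carrier ?N \<Longrightarrow> p (U.tensor a n) = U.\<mu> a \<odot>\<^bsub>twist L h V\<^esub> n"
      have "p (U.tensor a n) = U.\<mu> (ginv h a) \<odot>\<^bsub>V\<^esub> n" if "a \<in> carrier L" "n \<in> carrier V" for a n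
        using eq[OF that(1)] that(2) unfolding di twist_simps conj_mult_op[OF h that(1)] by simp
      then show ?thesis using p by blast
    qed
  qed
  then obtain p where p: "\<And>h. h \<in> G \<Longrightarrow> p h \<in> mod_hom (diff_ring k L) U.V (twist L h V)"
    and pt: "\<And>h a v. h \<in> G \<Longrightarrow> a \<in> carrier L \<Longrightarrow> v \<in> carrier V \<Longrightarrow>
      p h (U.tensor a v) = U.\<mu> (ginv h a) \<odot>\<^bsub>V\<^esub> v" by metis
  have pV: "p h \<in> add_hom U.V V" if h: "h \<in> G" for h
    using mod_homD(2,3)[OF p[OF h]] unfolding twist_simps by (intro add_homI) auto
  have hc: "ginv h a \<in> carrier L" if "h \<in> G" "a \<in> carrier L" for h a
    using galois_groupD(1)[OF galois_inv(1)[OF E_sub that(1)] that(2)] .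
  have push: "U.ip.push tr u = (\<Oplus>\<^bsub>V\<^esub>h\<in>G. p h u)" if u: "u \<in> carrier U.V" for u
  proof -
    have "U.ip.push tr \<in> add_hom U.V V"
      using add_hom_closed[OF U.ip.push(1)[OF U.functional_tr]] add_hom_add[OF U.ip.push(1)[OF U.functional_tr]]
      unfolding di by (intro add_homI) auto
    then have "U.ip.push tr u = (\<lambda>u. \<Oplus>\<^bsub>V\<^esub>h\<in>G. p h u) u"
    proof (rule U.ip.add_hom_eqI[OF V.M.abelian_group_axioms _ _ _ u])
      show "(\<lambda>u. \<Oplus>\<^bsub>V\<^esub>h\<in>G. p h u) \<in> add_hom U.V V"
        by (rule add_hom_sum[OF U.ip.V_abelian_group V.M.abelian_group_axioms finite_G pV])
      fix a n assume a: "a \<in> carrier L" and n': "n \<in> carrier ?N"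
      then have n: "n \<in> carrier V" by (simp add: di)
      have "U.ip.push tr (U.tensor a n) = U.\<mu> (tr a) \<odot>\<^bsub>V\<^esub> n"
        unfolding U.ip.push(2)[OF U.functional_tr a n'] di top.lift_op_\<mu>[OF tr_closed[OF a]] ..
      also have "\<dots> = (\<Oplus>\<^bsub>V\<^esub>h\<in>G. U.\<mu> (ginv h a) \<odot>\<^bsub>V\<^esub> n)"
        unfolding tr_inv[OF a] by (rule sum_mult[OF n finite_G hc[OF _ a]])
      also have "\<dots> = (\<Oplus>\<^bsub>V\<^esub>h\<in>G. p h (U.tensor a n))"
        using pt[OF _ a n] mv[OF hc[OF _ a] n] by (intro V.M.finsum_cong') auto
      finally show "U.ip.push tr (U.tensor a n) = (\<Oplus>\<^bsub>V\<^esub>h\<in>G. p h (U.tensor a n))" .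
    qed
    then show ?thesis .
  qed
  \<comment> \<open>The trace map is the sum of the projections, so all multiples of an element
    killed by every projection have trace zero, and the element vanishes by nondegeneracy.
    Identities in the tensor product are verified by projecting from here on.\<close>
  have inj: "u = u'" if u: "u \<in> carrier U.V" "u' \<in> carrier U.V" and eq: "\<And>h. h \<in> G \<Longrightarrow> p h u = p h u'" for u u'
  proof -
    have "u \<ominus>\<^bsub>U.V\<^esub> u' = \<zero>\<^bsub>U.V\<^esub>"
    proof (rule U.push_tr_nondegenerate)
      show w: "u \<ominus>\<^bsub>U.V\<^esub> u' \<in> carrier U.V" using u by simp
      fix a assume a: "a \<in> carrier L"
      have "p h (U.\<mu> a \<odot>\<^bsub>U.V\<^esub> (u \<ominus>\<^bsub>U.V\<^esub> u')) = \<zero>\<^bsub>V\<^esub>" if h: "h \<in> G" for h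
      proof -
        have "p h (u \<ominus>\<^bsub>U.V\<^esub> u') = \<zero>\<^bsub>V\<^esub>"
          using add_hom_diff[OF U.ip.V_abelian_group V.M.abelian_group_axioms pV[OF h] u] eq[OF h]
            add_hom_closed[OF pV[OF h] u(2)] by (simp add: V.M.minus_eq_zero_iff)
        then show ?thesis
          using mod_homD(4)[OF p[OF h] mc[OF a] w] V.smult_r_null[OF conj_closed[OF h mc[OF a]]]
          unfolding twist_simps by simp
      qed
      then show "U.ip.push tr (U.\<mu> a \<odot>\<^bsub>U.V\<^esub> (u \<ominus>\<^bsub>U.V\<^esub> u')) = \<zero>\<^bsub>?N\<^esub>"
        unfolding push[OF U.ip.V.smult_closed[OF mc[OF a] w]] di
        using V.M.finsum_cong'[of G G "\<lambda>_. \<zero>\<^bsub>V\<^esub>"] by simp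
    qed
    then show ?thesis using u by (simp add: U.ip.V.M.minus_eq_zero_iff)
  qed
  \<comment> \<open>The dual family with g^-1 applied to its second entries is the idempotent that
    cuts out the twist by \<open>g\<close>; here it is applied to \<open>v\<close>.\<close>
  define \<sigma> where "\<sigma> g v = (\<Oplus>\<^bsub>U.V\<^esub>i\<in>{..<m}. U.tensor (x i) (U.\<mu> (ginv g (y i)) \<odot>\<^bsub>V\<^esub> v))" for g v
  have \<sigma>t: "U.tensor (x i) (U.\<mu> (ginv g (y i)) \<odot>\<^bsub>V\<^esub> v) \<in> carrier U.V"
    if "i < m" "g \<in> G" "v \<in> carrier V" for i g v
    using that hc[OF that(2) y_car] mv by (intro U.ip.tensor_closed x_car) (simp_all add: di)
  have \<sigma>c: "\<sigma> g v \<in> carrier U.V" if "g \<in> G" "v \<in> carrier V" for g v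
    unfolding \<sigma>_def using \<sigma>t that by (intro U.ip.V.M.finsum_closed) auto
  have p\<sigma>: "p h (\<sigma> g v) = (if h = g then v else \<zero>\<^bsub>V\<^esub>)" if h: "h \<in> G" and g: "g \<in> G" and v: "v \<in> carrier V" for h g v
  proof -
    let ?a = "\<lambda>i. ginv h (x i)" and ?b = "\<lambda>i. ginv g (y i)"
    have ab: "?a i \<in> carrier L" "?b i \<in> carrier L" if "i < m" for i
      using that hc h g x_car y_car by auto
    have "p h (\<sigma> g v) = (\<Oplus>\<^bsub>V\<^esub>i\<in>{..<m}. p h (U.tensor (x i) (U.\<mu> (?b i) \<odot>\<^bsub>V\<^esub> v)))"
      unfolding \<sigma>_def using \<sigma>t[OF _ g v]
      by (intro add_hom_finsum[OF U.ip.V_abelian_group V.M.abelian_group_axioms pV[OF h]]) auto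
    also have "\<dots> = (\<Oplus>\<^bsub>V\<^esub>i\<in>{..<m}. U.\<mu> (?a i \<otimes> ?b i) \<odot>\<^bsub>V\<^esub> v)"
      using pt[OF h x_car mv[OF ab(2) v]] ab mv v mult[OF ab(1) ab(2) v] by (intro V.M.finsum_cong') auto
    also have "\<dots> = U.\<mu> (\<Oplus>i\<in>{..<m}. ?a i \<otimes> ?b i) \<odot>\<^bsub>V\<^esub> v"
      using ab by (intro sum_mult[OF v, symmetric]) auto
    also have "(\<Oplus>i\<in>{..<m}. ?a i \<otimes> ?b i) = (if h = g then \<one> else \<zero>)"
    proof -
      have "ginv h = ginv g \<longleftrightarrow> h = g"
        using inv_bij h g by (auto simp: bij_betw_def inj_on_def)
      then show ?thesis using dual_pair[OF galois_inv(1)[OF E_sub h] galois_inv(1)[OF E_sub g]] by simp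
    qed
    finally show ?thesis using one[OF v] zero[OF v] by simp
  qed
  \<comment> \<open>The projections of \<open>\<sigma> g v\<close> are \<open>v\<close> at
    \<open>g\<close> and zero elsewhere, so both sides of each linearity equation have the same
    projections.\<close>
  have \<sigma>hom: "\<sigma> g \<in> mod_hom (diff_ring k L) (twist L g V) U.V" if g: "g \<in> G" for g
  proof (rule mod_homI)
    show "\<sigma> g v \<in> carrier U.V" if "v \<in> carrier (twist L g V)" for v using \<sigma>c[OF g] that by (simp add: twist_simps)
    show "\<sigma> g (v \<oplus>\<^bsub>twist L g V\<^esub> w) = \<sigma> g v \<oplus>\<^bsub>U.V\<^esub> \<sigma> g w"
      if "v \<in> carrier (twist L g V)" "w \<in> carrier (twist L g V)" for v w
    proof (rule inj)
      have v: "v \<in> carrier V" "w \<in> carrier V" using that by (simp_all add: twist_simps)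
      show "\<sigma> g (v \<oplus>\<^bsub>twist L g V\<^esub> w) \<in> carrier U.V" "\<sigma> g v \<oplus>\<^bsub>U.V\<^esub> \<sigma> g w \<in> carrier U.V"
        using v \<sigma>c[OF g] by (simp_all add: twist_simps)
      show "p h (\<sigma> g (v \<oplus>\<^bsub>twist L g V\<^esub> w)) = p h (\<sigma> g v \<oplus>\<^bsub>U.V\<^esub> \<sigma> g w)" if h: "h \<in> G" for h
        using v p\<sigma>[OF h g] add_hom_add[OF pV[OF h] \<sigma>c[OF g v(1)] \<sigma>c[OF g v(2)]] by (simp add: twist_simps)
    qed
    fix P v assume P: "P \<in> carrier (diff_ring k L)" and "v \<in> carrier (twist L g V)"
    then have v: "v \<in> carrier V" by (simp add: twist_simps)
    have Pv: "conj_op g P \<odot>\<^bsub>V\<^esub> v \<in> carrier V" using V.smult_closed[OF conj_closed[OF g P] v] .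
    show "\<sigma> g (P \<odot>\<^bsub>twist L g V\<^esub> v) = P \<odot>\<^bsub>U.V\<^esub> \<sigma> g v"
      unfolding twist_simps
    proof (rule inj[OF \<sigma>c[OF g Pv] U.ip.V.smult_closed[OF P \<sigma>c[OF g v]]])
      fix h assume h: "h \<in> G"
      show "p h (\<sigma> g (conj_op g P \<odot>\<^bsub>V\<^esub> v)) = p h (P \<odot>\<^bsub>U.V\<^esub> \<sigma> g v)"
        unfolding mod_homD(4)[OF p[OF h] P \<sigma>c[OF g v]] twist_simps p\<sigma>[OF h g Pv] p\<sigma>[OF h g v]
        using V.smult_r_null[OF conj_closed[OF h P]] by simp
    qed
  qed
  have sum\<sigma>: "(\<Oplus>\<^bsub>U.V\<^esub>g\<in>G. \<sigma> g v) = U.tensor \<one> v" if v: "v \<in> carrier V" for v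
  proof (rule inj)
    show "(\<Oplus>\<^bsub>U.V\<^esub>g\<in>G. \<sigma> g v) \<in> carrier U.V" using \<sigma>c v by (intro U.ip.V.M.finsum_closed) auto
    show "U.tensor \<one> v \<in> carrier U.V" using v by (intro U.ip.tensor_closed) (simp_all add: di)
    fix h assume h: "h \<in> G"
    have "p h (\<Oplus>\<^bsub>U.V\<^esub>g\<in>G. \<sigma> g v) = (\<Oplus>\<^bsub>V\<^esub>g\<in>G. p h (\<sigma> g v))"
      using \<sigma>c v by (intro add_hom_finsum[OF U.ip.V_abelian_group V.M.abelian_group_axioms pV[OF h] finite_G]) auto
    also have "\<dots> = (\<Oplus>\<^bsub>V\<^esub>g\<in>G. if h = g then v else \<zero>\<^bsub>V\<^esub>)"
      using p\<sigma>[OF h _ v] v by (intro V.M.finsum_cong') auto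
    also have "\<dots> = v" using V.M.add.finprod_singleton[OF h finite_G, of "\<lambda>_. v"] v by simp
    also have "v = p h (U.tensor \<one> v)"
      using pt[OF h one_closed v] one[OF v] galois_groupD(4)[OF galois_inv(1)[OF E_sub h]] by simp
    finally show "p h (\<Oplus>\<^bsub>U.V\<^esub>g\<in>G. \<sigma> g v) = p h (U.tensor \<one> v)" .
  qed
  show ?thesis
  proof (rule U.ip.inverse_image_universal[OF W \<phi>])
    \<comment> \<open>\<Phi> extends \<phi> by adjunction. As 1 \<otimes> v is the sum of the
      inclusions of \<open>v\<close>, the components of \<phi> are the restrictions of \<Phi> to the
      twists.\<close>
    fix \<Phi> assume \<Phi>: "\<Phi> \<in> mod_hom (diff_ring k L) U.V W"
      and eq: "\<And>a n. a \<in> carrier L \<Longrightarrow> n \<in> carrier ?N \<Longrightarrow> \<Phi> (U.tensor a n) = U.\<mu> a \<odot>\<^bsub>W\<^esub> \<phi> n"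
    have "\<phi> v = (\<Oplus>\<^bsub>W\<^esub>g\<in>G. \<Phi> (\<sigma> g v))" if v: "v \<in> carrier V" for v
    proof -
      have "\<phi> v \<in> carrier W" using mod_homD(2)[OF \<phi>] v by (simp add: di)
      then have "\<phi> v = \<Phi> (U.tensor \<one> v)"
        using eq[OF one_closed] v top.\<mu>F_one W.smult_one by (simp add: di)
      also have "\<dots> = (\<Oplus>\<^bsub>W\<^esub>g\<in>G. \<Phi> (\<sigma> g v))"
        unfolding sum\<sigma>[OF v, symmetric] using \<sigma>c v
        by (intro add_hom_finsum[OF U.ip.V_abelian_group W.M.abelian_group_axioms mod_homD(1)[OF \<Phi>] finite_G]) auto
      finally show ?thesis .
    qed
    moreover have "(\<lambda>v. \<Phi> (\<sigma> g v)) \<in> mod_hom (diff_ring k L) (twist L g V) W" if "g \<in> G" for g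
      by (rule mod_hom_comp[OF \<sigma>hom[OF that] \<Phi>])
    ultimately show ?thesis by (intro exI[of _ "\<lambda>g v. \<Phi> (\<sigma> g v)"]) blast
  qed
qed

lemma endomorphism_fixed_field_linear:
  assumes M: "simple_left_module (diff_ring k L) M"
    and \<phi>: "\<phi> \<in> mod_hom (diff_ring k (L\<lparr>carrier := E\<rparr>)) (direct_image k (L\<lparr>carrier := E\<rparr>) L M)
      (direct_image k (L\<lparr>carrier := E\<rparr>) L M)"
    and c: "c \<in> fixed_field L (inertia_group k L E M)" and v: "v \<in> carrier M"
  shows "\<phi> (mult_op L c \<odot>\<^bsub>M\<^esub> v) = mult_op L c \<odot>\<^bsub>M\<^esub> \<phi> v"
proof -
  note M' = simple_left_moduleD[OF M]
  interpret M: left_module "diff_ring k L" M by (rule M')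
  obtain \<psi> where \<psi>: "\<And>g. g \<in> G \<Longrightarrow> \<psi> g \<in> mod_hom (diff_ring k L) (twist L g M) M"
    and sum: "\<And>v. v \<in> carrier M \<Longrightarrow> \<phi> v = (\<Oplus>\<^bsub>M\<^esub>g\<in>G. \<psi> g v)"
    using direct_image_hom_decomposition[OF M' M' \<phi>] by metis
  have cL: "c \<in> carrier L" using c by (simp add: fixed_field_def)
  note mc = DL_mult_op[OF k_carrier cL]
  have \<psi>c: "\<psi> g w \<in> carrier M" if "g \<in> G" "w \<in> carrier M" for g w
    using mod_homD(2)[OF \<psi>[OF that(1)]] that(2) by (simp add: twist_simps)
  have cv: "mult_op L c \<odot>\<^bsub>M\<^esub> v \<in> carrier M" using M.smult_closed[OF mc v] .
  have "\<psi> g (mult_op L c \<odot>\<^bsub>M\<^esub> v) = mult_op L c \<odot>\<^bsub>M\<^esub> \<psi> g v" if g: "g \<in> G" for g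
  proof (cases "\<exists>w\<in>carrier M. \<psi> g w \<noteq> \<zero>\<^bsub>M\<^esub>")
    case True
    then obtain w where w: "w \<in> carrier M" "\<psi> g w \<noteq> \<zero>\<^bsub>M\<^esub>" by blast
    \<comment> \<open>A nonzero map between simple modules is an isomorphism, so \<open>g\<close>
      lies in the inertia group and fixes \<open>c\<close>; conjugation by \<open>g\<close> then
      leaves the multiplication by \<open>c\<close> unchanged.\<close>
    have "module_isomorphic (diff_ring k L) (twist L g M) M"
      by (rule simple_hom_iso[OF simple_twist[OF g M] M \<psi>[OF g] _ w(2)]) (simp add: twist_simps w(1))
    then have gc: "g c = c" using g c by (simp add: inertia_group_def fixed_field_def)
    have "conj_op g (mult_op L c) = mult_op L c"
      unfolding conj_mult_op[OF g cL] using galois_inv(2)[OF E_sub g cL] gc by simp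
    then show ?thesis using mod_homD(4)[OF \<psi>[OF g] mc] v unfolding twist_simps by simp
  next
    case False
    then show ?thesis using cv v M.smult_r_null[OF mc] by simp
  qed
  then have "\<phi> (mult_op L c \<odot>\<^bsub>M\<^esub> v) = (\<Oplus>\<^bsub>M\<^esub>g\<in>G. mult_op L c \<odot>\<^bsub>M\<^esub> \<psi> g v)"
    unfolding sum[OF cv] using \<psi>c v M.smult_closed[OF mc] by (intro M.M.finsum_cong') auto
  also have "\<dots> = mult_op L c \<odot>\<^bsub>M\<^esub> \<phi> v"
    unfolding sum[OF v] using \<psi>c v by (intro M.smult_finsum[OF mc finite_G, symmetric]) auto
  finally show ?thesis .
qed

end

context galois_inverse
begin

text \<open>Semisimplicity turns a nonzero multiplicity into a nonzero map to \<open>M\<close>;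
  adjunction moves this map to the direct image.\<close>

lemma multiplicity_inverse_image_iff:
  assumes simple: "simple_left_module DE N" and fd: "finite_dim_over LE N" and M: "simple_left_module DL M"
  shows "multiplicity_in DL V M \<noteq> 0 \<longleftrightarrow> (\<exists>f\<in>mod_hom DE N (f_plus M). \<exists>n\<in>carrier N. f n \<noteq> \<zero>\<^bsub>M\<^esub>)"
proof -
  note M' = simple_left_moduleD[OF M]
  interpret M: left_module DL M by (rule M')
  have "multiplicity_in DL V M \<noteq> 0 \<longleftrightarrow> (\<exists>f\<in>mod_hom DL V M. \<exists>v\<in>carrier V. f v \<noteq> \<zero>\<^bsub>M\<^esub>)"
    by (rule multiplicity_nonzero_iff[OF ip.left_module_V M fss_inverse_image[OF simple fd]])
  also have "\<dots> \<longleftrightarrow> (\<exists>f\<in>mod_hom DE N (f_plus M). \<exists>n\<in>carrier N. f n \<noteq> \<zero>\<^bsub>M\<^esub>)" (is "?l \<longleftrightarrow> ?r")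
  proof
    assume ?l
    then obtain f v where f: "f \<in> mod_hom DL V M" "v \<in> carrier V" "f v \<noteq> \<zero>\<^bsub>M\<^esub>" by (elim bexE)
    note h = ip.hom_to_direct_image[OF M' f]
    show ?r using conjunct2[OF h] conjunct1[OF h] by (rule bexI[of _ "\<lambda>n. f (tensor \<one> n)"])
  next
    assume ?r
    then obtain f n where f: "f \<in> mod_hom DE N (f_plus M)" "n \<in> carrier N" "f n \<noteq> \<zero>\<^bsub>M\<^esub>" by (elim bexE)
    show ?l
    proof (rule ip.inverse_image_universal[OF M' f(1)])
      fix h assume h: "h \<in> mod_hom DL V M"
        and eq: "\<And>a n. a \<in> carrier L \<Longrightarrow> n \<in> carrier N \<Longrightarrow> h (tensor a n) = \<mu> a \<odot>\<^bsub>M\<^esub> f n"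
      have "f n \<in> carrier M" using mod_homD(2)[OF f(1,2)] by (simp add: top.direct_image_simps)
      then have "h (tensor \<one> n) \<noteq> \<zero>\<^bsub>M\<^esub>" using eq[OF one_closed f(2)] top.\<mu>F_one M.smult_one f(3) by simp
      then have "\<exists>v\<in>carrier V. h v \<noteq> \<zero>\<^bsub>M\<^esub>" using ip.tensor_closed[OF one_closed f(2)] by (rule bexI)
      then show ?l using h by (rule bexI)
    qed
  qed
  finally show ?thesis .
qed

lemma multiplicity_inverse_image_quotient:
  assumes simple: "simple_left_module DE N" and fd: "finite_dim_over LE N" and M: "simple_left_module DL M"
    and mult: "multiplicity_in DL V M \<noteq> 0"
  shows "\<exists>g\<in>mod_hom DE (f_plus M) N. \<exists>u\<in>carrier M. g u \<noteq> \<zero>\<^bsub>N\<^esub>"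
proof -
  note fss = fss_inverse_image[OF simple fd]
  obtain f v where f: "f \<in> mod_hom DL V M" "v \<in> carrier V" "f v \<noteq> \<zero>\<^bsub>M\<^esub>"
    using mult unfolding multiplicity_nonzero_iff[OF ip.left_module_V M fss] by (elim bexE)
  show ?thesis by (rule hom_from_direct_image[OF M fss f])
qed

text \<open>Averaging over the Galois group turns a retraction onto the submodule generated by a submodule
  \<open>W\<close> of \<open>N\<close> into a retraction onto \<open>W\<close>.\<close>

lemma fss_of_inverse_image:
  assumes fd: "finite_dim_over LE N" and fss: "fss DL V (carrier V)"
  shows "fss DE N (carrier N)"
proof (rule ip.N.dcc_fss)
  interpret ND: dmodule L k E N
    by (intro dmodule.intro dmodule_axioms.intro field_axioms subfield k_sub N)
  show ip.N.dcc by (rule ND.finite_dim_dcc[OF fd])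
  fix W assume W: "submodule W DE N"
  note WD = ip.N.submoduleD[OF W]
  let ?N = "N\<lparr>carrier := W\<rparr>"
  interpret W: galois_inverse L k E m x y ?N
    by (intro galois_inverse.intro galois_avg_axioms galois_inverse_axioms.intro ip.N.submodule_left_module[OF W])
  have incl: "tensor \<one> \<in> mod_hom DE ?N (f_plus V)"
    using mod_homD(2-4)[OF ip.unit_mod_hom] subsetD[OF WD(1)] by (intro mod_homI) simp_all
  show "\<exists>p\<in>mod_hom DE N N. (\<forall>n\<in>carrier N. p n \<in> W) \<and> (\<forall>n\<in>W. p n = n)"
  \<comment> \<open>The submodule generated by \<open>W\<close> is realised as the image of f^! W in
    f^! N, under the map \<open>h\<close> that extends the inclusion.\<close>
  proof (rule W.ip.inverse_image_universal[OF ip.left_module_V incl])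
    fix h assume h: "h \<in> mod_hom DL W.V V"
      and ht: "\<And>a w. a \<in> carrier L \<Longrightarrow> w \<in> carrier ?N \<Longrightarrow> h (W.tensor a w) = \<mu> a \<odot>\<^bsub>V\<^esub> tensor \<one> w"
    have ht': "h (W.tensor a w) = tensor a w" if "a \<in> carrier L" "w \<in> W" for a w
      using ht[OF that(1)] that ip.tensor_smult[OF that(1) subsetD[OF WD(1) that(2)]] by simp
    have LW: "submodule (h ` carrier W.V) DL V"
      by (rule submodule_image[OF W.ip.left_module_V ip.left_module_V h W.ip.V.submodule_carrier])
    obtain r where r: "r \<in> mod_hom DL V V" "\<And>v. v \<in> carrier V \<Longrightarrow> r v \<in> h ` carrier W.V"
      "\<And>v. v \<in> h ` carrier W.V \<Longrightarrow> r v = v"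
      using ip.V.fss_retraction[OF fss LW] by metis
    \<comment> \<open>Elements of that image are sums of tensors a \<otimes> w with \<open>w\<close>
      in \<open>W\<close>, and the normalised trace sends these to multiples of \<open>w\<close> by
      elements of \<open>E\<close>.\<close>
    have push_W: "ip.push avg (h t) \<in> W" if t: "t \<in> carrier W.V" for t
    proof -
      let ?w = "\<lambda>i. W.ip.push (\<lambda>z. tr (y i \<otimes> z)) t"
      have w: "?w i \<in> W" "?w i \<in> carrier N" if "i < m" for i
        using W.ip.push_closed[OF top.functional_\<phi>[OF that] t] WD(1) by auto
      have tc: "tensor (x i) (?w i) \<in> carrier V" "W.tensor (x i) (?w i) \<in> carrier W.V" if "i < m" for i
        using x_car[OF that] w[OF that] by (auto intro: ip.tensor_closed W.ip.tensor_closed)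
      have "t = (\<Oplus>\<^bsub>W.V\<^esub>i\<in>{..<m}. \<mu> (x i) \<odot>\<^bsub>W.V\<^esub> W.tensor \<one> (?w i))" by (rule W.ip.expand_V[OF t])
      also have "\<dots> = (\<Oplus>\<^bsub>W.V\<^esub>i\<in>{..<m}. W.tensor (x i) (?w i))"
        using W.ip.tensor_smult[OF x_car] w tc by (intro W.ip.V.M.finsum_cong') auto
      finally have "h t = h (\<Oplus>\<^bsub>W.V\<^esub>i\<in>{..<m}. W.tensor (x i) (?w i))" by simp
      also have "\<dots> = (\<Oplus>\<^bsub>V\<^esub>i\<in>{..<m}. h (W.tensor (x i) (?w i)))"
        using tc by (intro add_hom_finsum[OF W.ip.V_abelian_group ip.V_abelian_group mod_homD(1)[OF h]]) auto
      also have "\<dots> = (\<Oplus>\<^bsub>V\<^esub>i\<in>{..<m}. tensor (x i) (?w i))"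
        using ht'[OF x_car] w tc by (intro ip.V.M.finsum_cong') auto
      finally have "ip.push avg (h t) = ip.push avg (\<Oplus>\<^bsub>V\<^esub>i\<in>{..<m}. tensor (x i) (?w i))" by simp
      also have "\<dots> = (\<Oplus>\<^bsub>N\<^esub>i\<in>{..<m}. ip.push avg (tensor (x i) (?w i)))"
        using tc by (intro add_hom_finsum[OF ip.V_abelian_group ip.N.M.abelian_group_axioms ip.push(1)[OF functional_avg]]) auto
      also have "\<dots> \<in> W"
      proof (rule ip.N.submodule_finsum[OF W])
        fix i assume "i \<in> {..<m}"
        then have i: "i < m" by simp
        show "ip.push avg (tensor (x i) (?w i)) \<in> W"
          unfolding ip.push(2)[OF functional_avg x_car[OF i] w(2)[OF i]]
          by (rule WD(6)[OF top.\<mu>E_closed[OF avg_closed[OF x_car[OF i]]] w(1)[OF i]])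
      qed simp
      finally show ?thesis .
    qed
    \<comment> \<open>Unit, retraction \<open>r\<close> onto the generated submodule, normalised
      trace: all three are D_E-linear, and on \<open>W\<close> they compose to the identity because
      the normalised trace splits the unit.\<close>
    let ?p = "\<lambda>n. ip.push avg (r (tensor \<one> n))"
    have p: "?p \<in> mod_hom DE N N"
      by (rule mod_hom_comp[OF mod_hom_comp[OF ip.unit_mod_hom top.mod_hom_direct_image[OF r(1)]] push_avg_hom])
    have "?p n \<in> W" if n: "n \<in> carrier N" for n
    proof -
      obtain t where "t \<in> carrier W.V" "r (tensor \<one> n) = h t"
        using r(2)[OF ip.tensor_closed[OF one_closed n]] by (elim imageE)
      then show ?thesis using push_W by simp
    qed
    moreover have "?p n = n" if n: "n \<in> W" for n
    proof -
      have "W.tensor \<one> n \<in> carrier W.V" using n by (intro W.ip.tensor_closed) simp_all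
      then have "tensor \<one> n \<in> h ` carrier W.V" using ht'[OF one_closed n] by (metis imageI)
      then have "r (tensor \<one> n) = tensor \<one> n" by (rule r(3))
      then show ?thesis using push_avg_unit subsetD[OF WD(1) n] by simp
    qed
    ultimately show ?thesis using p by (intro bexI[of _ ?p]) simp_all
  qed
qed

end

context field_pair
begin

text \<open>Every \<open>F\<close>-subspace is an \<open>E\<close>-subspace, so a set that spans
  over \<open>E\<close> also spans over \<open>F\<close>.\<close>

lemma finite_dim_of_direct_image:
  assumes V: "left_module DF V" and fd: "finite_dim_over LE (direct_image k LE LF V)"
  shows "finite_dim_over LF V"
proof -
  interpret V: dmodule L k F V
    by (intro dmodule.intro field_axioms dmodule_axioms.intro subfield_F k_F V)
  interpret W: dmodule L k E "direct_image k LE LF V"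
    by (intro dmodule.intro field_axioms dmodule_axioms.intro subfield_E k_E left_module_direct_image V)
  obtain B where B: "finite B" "B \<subseteq> carrier (direct_image k LE LF V)"
    "\<And>U. W.subspace U \<Longrightarrow> B \<subseteq> U \<Longrightarrow> carrier (direct_image k LE LF V) \<subseteq> U"
    by (rule W.finite_dim_overD[OF fd], rule that, assumption, assumption) simp
  show ?thesis
  proof (rule V.finite_dim_overI[OF B(1)])
    show "B \<subseteq> carrier V" using B(2) by (simp add: direct_image_simps)
    fix U assume U: "V.subspace U" "B \<subseteq> U"
    have "W.subspace U"
      unfolding W.subspace_def direct_image_simps
    proof (intro conjI ballI)
      show "U \<subseteq> carrier V" using V.subspaceD(1)[OF U(1)] by (rule subsetI)
      show "lift_op (\<mu>E a) \<odot>\<^bsub>V\<^esub> u \<in> U" if "a \<in> E" "u \<in> U" for a u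
        unfolding lift_op_\<mu>[OF that(1)] by (rule V.subspaceD(4)[OF U(1) EF[OF that(1)] that(2)])
    qed (use V.subspaceD(2,3)[OF U(1)] in auto)
    from B(3)[OF this U(2)] show "carrier V \<subseteq> U" by (simp add: direct_image_simps)
  qed
qed

lemma module_isomorphic_direct_image:
  assumes "module_isomorphic DF V W"
  shows "module_isomorphic DE (direct_image k LE LF V) (direct_image k LE LF W)"
proof -
  obtain f where f: "left_module DF V" "left_module DF W" "f \<in> mod_hom DF V W" "bij_betw f (carrier V) (carrier W)"
    using assms unfolding module_isomorphic_iff by (elim conjE bexE)
  show ?thesis
    unfolding module_isomorphic_iff direct_image_simps(1)
    by (intro conjI bexI[of _ f] left_module_direct_image mod_hom_direct_image f)
qed

end

text \<open>Module records built in different ways may agree only on their carriers and for scalars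
  of \<open>R\<close>; homomorphisms do not see the difference.\<close>

lemma mod_hom_congL:
  assumes "f \<in> mod_hom R V W" and "carrier V' = carrier V"
    and "\<And>x y. x \<in> carrier V \<Longrightarrow> y \<in> carrier V \<Longrightarrow> x \<oplus>\<^bsub>V'\<^esub> y = x \<oplus>\<^bsub>V\<^esub> y"
    and "\<And>a x. a \<in> carrier R \<Longrightarrow> x \<in> carrier V \<Longrightarrow> a \<odot>\<^bsub>V'\<^esub> x = a \<odot>\<^bsub>V\<^esub> x"
  shows "f \<in> mod_hom R V' W"
  using assms(2-4) mod_homD(2-4)[OF assms(1)] by (intro mod_homI) simp_all

lemma mod_hom_congR:
  assumes "f \<in> mod_hom R V W" and "carrier W' = carrier W"
    and "\<And>x y. x \<in> carrier W \<Longrightarrow> y \<in> carrier W \<Longrightarrow> x \<oplus>\<^bsub>W'\<^esub> y = x \<oplus>\<^bsub>W\<^esub> y"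
    and "\<And>a x. a \<in> carrier R \<Longrightarrow> x \<in> carrier W \<Longrightarrow> a \<odot>\<^bsub>W'\<^esub> x = a \<odot>\<^bsub>W\<^esub> x"
  shows "f \<in> mod_hom R V W'"
  using assms(2-4) mod_homD(2-4)[OF assms(1)] by (intro mod_homI) simp_all

text \<open>Transport of structure back to the carrier of \<open>N\<close>, which keeps the element
  type of \<open>N\<close> although \<open>W\<close> may have another one. In this way a module
  found inside \<open>M\<close> gets the element type of the given simple module.\<close>

lemma transport_left_module:
  fixes N :: "('r, 'm) module"
  assumes N: "abelian_group N" and W: "left_module R W"
    and f: "f \<in> add_hom N W" and bij: "bij_betw f (carrier N) (carrier W)"
  defines "N' \<equiv> N\<lparr>smult := \<lambda>a n. inv_into (carrier N) f (a \<odot>\<^bsub>W\<^esub> f n)\<rparr>"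
  shows "left_module R N'" "f \<in> mod_hom R N' W"
proof -
  interpret N: abelian_group N by fact
  interpret W: left_module R W by fact
  have s: "carrier N' = carrier N" "\<zero>\<^bsub>N'\<^esub> = \<zero>\<^bsub>N\<^esub>" "v \<oplus>\<^bsub>N'\<^esub> w = v \<oplus>\<^bsub>N\<^esub> w"
    "a \<odot>\<^bsub>N'\<^esub> v = inv_into (carrier N) f (a \<odot>\<^bsub>W\<^esub> f v)" for a v w
    by (simp_all add: N'_def)
  note fc = add_hom_closed[OF f] and fa = add_hom_add[OF f]
  have g: "a \<odot>\<^bsub>N'\<^esub> v \<in> carrier N" "f (a \<odot>\<^bsub>N'\<^esub> v) = a \<odot>\<^bsub>W\<^esub> f v" if "a \<in> carrier R" "v \<in> carrier N" for a v
  proof -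
    have "a \<odot>\<^bsub>W\<^esub> f v \<in> f ` carrier N"
      using W.smult_closed[OF that(1) fc[OF that(2)]] bij by (simp add: bij_betw_def)
    then show "a \<odot>\<^bsub>N'\<^esub> v \<in> carrier N" "f (a \<odot>\<^bsub>N'\<^esub> v) = a \<odot>\<^bsub>W\<^esub> f v"
      unfolding s by (rule inv_into_into, rule f_inv_into_f)
  qed
  have inj: "v = w" if "v \<in> carrier N" "w \<in> carrier N" "f v = f w" for v w
    using bij that by (auto simp: bij_betw_def inj_on_def)
  have ab: "abelian_group N'"
  proof (rule abelian_groupI)
    show "\<exists>y\<in>carrier N'. y \<oplus>\<^bsub>N'\<^esub> v = \<zero>\<^bsub>N'\<^esub>" if "v \<in> carrier N'" for v
      using that N.l_neg unfolding s by (intro bexI[of _ "\<ominus>\<^bsub>N\<^esub> v"]) simp_all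
  qed (simp_all add: s(1-3) N.a_ac)
  show "left_module R N'"
  proof (intro left_module.intro W.R.ring_axioms ab left_module_axioms.intro; unfold s(1,3))
    show "a \<odot>\<^bsub>N'\<^esub> v \<in> carrier N" if "a \<in> carrier R" "v \<in> carrier N" for a v using g that by simp
    show "(a \<oplus>\<^bsub>R\<^esub> b) \<odot>\<^bsub>N'\<^esub> v = a \<odot>\<^bsub>N'\<^esub> v \<oplus>\<^bsub>N\<^esub> b \<odot>\<^bsub>N'\<^esub> v"
      if "a \<in> carrier R" "b \<in> carrier R" "v \<in> carrier N" for a b v
      using g that fa fc by (intro inj) (simp_all add: W.smult_l_distr)
    show "(a \<otimes>\<^bsub>R\<^esub> b) \<odot>\<^bsub>N'\<^esub> v = a \<odot>\<^bsub>N'\<^esub> (b \<odot>\<^bsub>N'\<^esub> v)"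
      if "a \<in> carrier R" "b \<in> carrier R" "v \<in> carrier N" for a b v
      using g that fc by (intro inj) (simp_all add: W.smult_assoc)
    show "a \<odot>\<^bsub>N'\<^esub> (v \<oplus>\<^bsub>N\<^esub> w) = a \<odot>\<^bsub>N'\<^esub> v \<oplus>\<^bsub>N\<^esub> a \<odot>\<^bsub>N'\<^esub> w"
      if "a \<in> carrier R" "v \<in> carrier N" "w \<in> carrier N" for a v w
      using g that fa fc by (intro inj) (simp_all add: W.smult_r_distr)
    show "\<one>\<^bsub>R\<^esub> \<odot>\<^bsub>N'\<^esub> v = v" if "v \<in> carrier N" for v
      using g(1)[OF _ that] g(2)[OF _ that] that fc by (intro inj) (simp_all add: W.smult_one)
  qed
  show "f \<in> mod_hom R N' W"
    using g(2) fc fa by (intro mod_homI) (simp_all add: s(1,3))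
qed

context galois_avg
begin

text \<open>The map \<open>f\<close> is adjoint to a nonzero map from the inverse image to
  \<open>M\<close>; this is the practical test for being below \<open>M\<close>.\<close>

lemma simple_belowI:
  assumes N: "simple_dmodule k (L\<lparr>carrier := E\<rparr>) N" and M: "simple_left_module (diff_ring k L) M"
    and f: "f \<in> mod_hom (diff_ring k (L\<lparr>carrier := E\<rparr>)) N (direct_image k (L\<lparr>carrier := E\<rparr>) L M)"
    and n: "n \<in> carrier N" "f n \<noteq> \<zero>\<^bsub>M\<^esub>"
  shows "N \<in> simple_below k (L\<lparr>carrier := E\<rparr>) L M"
proof -
  note N' = N[unfolded simple_dmodule_def]
  interpret N: galois_inverse L k E m x y N
    by (intro galois_inverse.intro galois_avg_axioms galois_inverse_axioms.intro simple_left_moduleD[OF conjunct1[OF N']])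
  have "\<exists>n\<in>carrier N. f n \<noteq> \<zero>\<^bsub>M\<^esub>" using n(2,1) by (rule bexI)
  then have "\<exists>f\<in>mod_hom N.DE N (N.f_plus M). \<exists>n\<in>carrier N. f n \<noteq> \<zero>\<^bsub>M\<^esub>" using f by (rule bexI[of _ f])
  then show ?thesis
    using N N.multiplicity_inverse_image_iff[OF conjunct1[OF N'] conjunct2[OF N'] M] by (simp add: simple_below_def)
qed

lemma simple_below_maps:
  assumes N: "N \<in> simple_below k (L\<lparr>carrier := E\<rparr>) L M" and M: "simple_left_module (diff_ring k L) M"
  obtains f g where "f \<in> mod_hom (diff_ring k (L\<lparr>carrier := E\<rparr>)) N (direct_image k (L\<lparr>carrier := E\<rparr>) L M)"
    "inj_on f (carrier N)" "g \<in> mod_hom (diff_ring k (L\<lparr>carrier := E\<rparr>)) (direct_image k (L\<lparr>carrier := E\<rparr>) L M) N"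
    "g ` carrier M = carrier N"
proof -
  have N': "simple_left_module (diff_ring k (L\<lparr>carrier := E\<rparr>)) N" "finite_dim_over (L\<lparr>carrier := E\<rparr>) N"
    "multiplicity_in (diff_ring k L) (inverse_image k (L\<lparr>carrier := E\<rparr>) L N) M \<noteq> 0"
    using N by (simp_all add: simple_below_def simple_dmodule_def)
  note M' = simple_left_moduleD[OF M]
  interpret N: galois_inverse L k E m x y N
    by (intro galois_inverse.intro galois_avg_axioms galois_inverse_axioms.intro simple_left_moduleD[OF N'(1)])
  note P = top.left_module_direct_image[OF M']
  obtain f n where f: "f \<in> mod_hom N.DE N (N.f_plus M)" "n \<in> carrier N" "f n \<noteq> \<zero>\<^bsub>M\<^esub>"
    using N'(3) unfolding N.multiplicity_inverse_image_iff[OF N'(1,2) M] by (elim bexE)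
  obtain g u where g: "g \<in> mod_hom N.DE (N.f_plus M) N" "u \<in> carrier M" "g u \<noteq> \<zero>\<^bsub>N\<^esub>"
    using N.multiplicity_inverse_image_quotient[OF N'(1,2) M N'(3)] by (elim bexE)
  show thesis
  proof (rule that[OF f(1) _ g(1)])
    show "inj_on f (carrier N)"
      by (rule inj_on_simple[OF N'(1) P f(1,2)]) (simp add: top.direct_image_simps f(3))
    show "g ` carrier M = carrier N"
      using surj_simple[OF P N'(1) g(1) left_module.submodule_carrier[OF P], of u] g(2,3)
      by (simp add: top.direct_image_simps)
  qed
qed

end

section \<open>The tower of the inertia field\<close>

locale inertia_tower = field L for L (structure) +
  fixes k K L1 :: "'a set" and mY mZ m :: nat and xY yY xZ yZ x :: "nat \<Rightarrow> 'a"
    and \<phi> :: "nat \<Rightarrow> 'a \<Rightarrow> 'a" and M :: "('a \<Rightarrow> 'a, 'n) module"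
  assumes Y: "galois_avg L k K mY xY yY" and Z: "galois_avg L k L1 mZ xZ yZ"
    and YZ: "field_pair L k K L1 m x \<phi>" and M: "simple_left_module (diff_ring k L) M"
    and L1: "L1 = fixed_field L (inertia_group k L K M)"

sublocale inertia_tower \<subseteq> Y: galois_avg L k K mY xY yY by (rule Y)
sublocale inertia_tower \<subseteq> Z: galois_avg L k L1 mZ xZ yZ by (rule Z)
sublocale inertia_tower \<subseteq> YZ: field_pair L k K L1 m x \<phi> by (rule YZ)

context inertia_tower
begin

abbreviation "LY \<equiv> L\<lparr>carrier := K\<rparr>"
abbreviation "LZ \<equiv> L\<lparr>carrier := L1\<rparr>"
abbreviation "DY \<equiv> diff_ring k LY"
abbreviation "DZ \<equiv> diff_ring k LZ"
abbreviation "DL \<equiv> diff_ring k L"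
abbreviation "\<mu> \<equiv> mult_op L"
abbreviation "\<mu>Z \<equiv> mult_op LZ"
abbreviation "pi_plus W \<equiv> direct_image k LY L W"
abbreviation "p_plus W \<equiv> direct_image k LZ L W"
abbreviation "q_plus W \<equiv> direct_image k LY LZ W"

lemma M': "left_module DL M"
  by (rule simple_left_moduleD[OF M])

lemma direct_image_carrier: "carrier (direct_image k E F W) = carrier W"
  by (simp add: direct_image_def)

text \<open>Extending in two steps gives an extension to \<open>L\<close>, and that is
  unique.\<close>

lemma ext_op_comp:
  assumes P: "P \<in> carrier DY"
  shows "ext_op k LZ L (ext_op k LY LZ P) = ext_op k LY L P"
proof (rule Y.top.lift_opI[OF P, symmetric])
  note q = YZ.lift_op_closed[OF P]
  show "ext_op k LZ L (ext_op k LY LZ P) \<in> carrier DL" by (rule Z.top.lift_op_closed[OF q])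
  show "ext_op k LZ L (ext_op k LY LZ P) e = P e" if e: "e \<in> K" for e
    using Z.top.lift_op_apply[OF q YZ.EF[OF e]] YZ.lift_op_apply[OF P e] by simp
qed

text \<open>The actions on \<open>pi_plus W\<close> and on \<open>q_plus (p_plus W)\<close> are only
  known to agree for operators in D_Y, so homomorphisms are compared rather than records.\<close>

lemma to_pi_plus_iff: "f \<in> mod_hom DY N (pi_plus W) \<longleftrightarrow> f \<in> mod_hom DY N (q_plus (p_plus W))"
proof
  show "f \<in> mod_hom DY N (q_plus (p_plus W))" if "f \<in> mod_hom DY N (pi_plus W)"
    by (rule mod_hom_congR[OF that]) (simp_all add: direct_image_def ext_op_comp)
  show "f \<in> mod_hom DY N (pi_plus W)" if "f \<in> mod_hom DY N (q_plus (p_plus W))"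
    by (rule mod_hom_congR[OF that]) (simp_all add: direct_image_def ext_op_comp)
qed

lemma from_pi_plus_iff: "f \<in> mod_hom DY (pi_plus W) N \<longleftrightarrow> f \<in> mod_hom DY (q_plus (p_plus W)) N"
proof
  show "f \<in> mod_hom DY (q_plus (p_plus W)) N" if "f \<in> mod_hom DY (pi_plus W) N"
    by (rule mod_hom_congL[OF that]) (simp_all add: direct_image_def ext_op_comp)
  show "f \<in> mod_hom DY (pi_plus W) N" if "f \<in> mod_hom DY (q_plus (p_plus W)) N"
    by (rule mod_hom_congL[OF that]) (simp_all add: direct_image_def ext_op_comp)
qed

lemma p_plus_smult: "c \<in> L1 \<Longrightarrow> \<mu>Z c \<odot>\<^bsub>p_plus W\<^esub> v = \<mu> c \<odot>\<^bsub>W\<^esub> v"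
  by (simp add: Z.top.direct_image_simps Z.top.lift_op_\<mu>)

lemma endomorphism_linear:
  "\<psi> \<in> mod_hom DY (pi_plus M) (pi_plus M) \<Longrightarrow> c \<in> L1 \<Longrightarrow> v \<in> carrier M \<Longrightarrow> \<psi> (\<mu> c \<odot>\<^bsub>M\<^esub> v) = \<mu> c \<odot>\<^bsub>M\<^esub> \<psi> v"
  using Y.endomorphism_fixed_field_linear[OF M] unfolding L1[symmetric] .

text \<open>The source is a quotient of \<open>M\<close> and the target embeds in \<open>M\<close>.
  Simplicity is left out of the formulation because the comparison of multiplicities uses all of p_+
  M as target.\<close>

lemma mod_hom_linear:
  assumes N: "left_module DZ N" and N': "left_module DZ N'"
    and g: "g \<in> mod_hom DZ (p_plus M) N" "g ` carrier M = carrier N"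
    and f: "f \<in> mod_hom DZ N' (p_plus M)" "inj_on f (carrier N')"
    and h: "h \<in> mod_hom DY (q_plus N) (q_plus N')"
  shows "h \<in> mod_hom DZ N N'"
proof (rule YZ.mod_hom_of_direct_image[OF N N' h])
  fix c n assume c: "c \<in> L1" and n: "n \<in> carrier N"
  obtain v where v: "v \<in> carrier M" "n = g v" using n g(2) by auto
  have hc: "h u \<in> carrier N'" if "u \<in> carrier N" for u
    using mod_homD(2)[OF h] that by (simp add: direct_image_carrier)
  note mc = YZ.\<mu>F_closed[OF c]
  let ?\<psi> = "\<lambda>v. f (h (g v))"
  have "?\<psi> \<in> mod_hom DY (q_plus (p_plus M)) (q_plus (p_plus M))"
    by (rule mod_hom_comp[OF mod_hom_comp[OF YZ.mod_hom_direct_image[OF g(1)] h] YZ.mod_hom_direct_image[OF f(1)]])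
  then have \<psi>: "?\<psi> \<in> mod_hom DY (pi_plus M) (pi_plus M)" unfolding to_pi_plus_iff from_pi_plus_iff .
  have "g (\<mu> c \<odot>\<^bsub>M\<^esub> v) = \<mu>Z c \<odot>\<^bsub>N\<^esub> n"
    using mod_homD(4)[OF g(1) mc, of v] v by (simp add: p_plus_smult[OF c] direct_image_carrier)
  then have "f (h (\<mu>Z c \<odot>\<^bsub>N\<^esub> n)) = \<mu> c \<odot>\<^bsub>M\<^esub> f (h n)"
    using endomorphism_linear[OF \<psi> c v(1)] v(2) by simp
  also have "\<dots> = f (\<mu>Z c \<odot>\<^bsub>N'\<^esub> h n)"
    using mod_homD(4)[OF f(1) mc hc[OF n]] by (simp add: p_plus_smult[OF c])
  finally show "h (\<mu>Z c \<odot>\<^bsub>N\<^esub> n) = \<mu>Z c \<odot>\<^bsub>N'\<^esub> h n"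
    using inj_onD[OF f(2)] hc[OF left_module.smult_closed[OF N mc n]] left_module.smult_closed[OF N' mc hc[OF n]] by blast
qed

text \<open>The endomorphism f \<circ> g of \<open>M\<close> is linear over \<open>L1\<close>, so c
  f(g(v)) = f(g(c v)).\<close>

lemma image_stable:
  assumes f: "f \<in> mod_hom DY W (pi_plus M)" and g: "g \<in> mod_hom DY (pi_plus M) W" "g ` carrier M = carrier W"
    and c: "c \<in> L1" and u: "u \<in> f ` carrier W"
  shows "\<mu> c \<odot>\<^bsub>M\<^esub> u \<in> f ` carrier W"
proof -
  obtain w where w: "w \<in> carrier W" "u = f w" using u by (elim imageE)
  obtain v where v: "v \<in> carrier M" "w = g v" using w(1) g(2) by auto
  have "(\<lambda>v. f (g v)) \<in> mod_hom DY (pi_plus M) (pi_plus M)" by (rule mod_hom_comp[OF g(1) f])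
  from endomorphism_linear[OF this c v(1)] have "\<mu> c \<odot>\<^bsub>M\<^esub> u = f (g (\<mu> c \<odot>\<^bsub>M\<^esub> v))" using w(2) v(2) by simp
  moreover have "g (\<mu> c \<odot>\<^bsub>M\<^esub> v) \<in> carrier W"
    using mod_homD(2)[OF g(1)] left_module.smult_closed[OF M' DL_mult_op[OF Y.k_carrier Z.E_car[OF c]] v(1)]
    by (simp add: direct_image_carrier)
  ultimately show ?thesis by (simp only: imageI)
qed

text \<open>A nonzero D_Y-submodule contains a simple one, \<open>S\<close>, which maps nontrivially
  to \<open>M\<close> through the embedding of \<open>N\<close>. So \<open>S\<close> is itself below
  \<open>M\<close> and hence a quotient of \<open>M\<close>; its image in \<open>M\<close> is then
  stable under \<open>L1\<close>, which makes \<open>S\<close> a D_Z-submodule of the simple module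
  \<open>N\<close>.\<close>

lemma simple_q_plus:
  assumes N: "N \<in> simple_below k LZ L M"
  shows "simple_dmodule k LY (q_plus N)"
proof -
  have N': "simple_left_module DZ N" "finite_dim_over LZ N" using N by (simp_all add: simple_below_def simple_dmodule_def)
  note NM = simple_left_moduleD[OF N'(1)]
  note qN = YZ.left_module_direct_image[OF NM] and fd = YZ.finite_dim_direct_image[OF NM N'(2)]
  obtain f g where f: "f \<in> mod_hom DZ N (p_plus M)" "inj_on f (carrier N)" by (rule Z.simple_below_maps[OF N M])
  have fY: "f \<in> mod_hom DY (q_plus N) (pi_plus M)"
    unfolding to_pi_plus_iff by (rule YZ.mod_hom_direct_image[OF f(1)])
  interpret qN: dmodule L k K "q_plus N"
    by (intro dmodule.intro dmodule_axioms.intro field_axioms Y.subfield Y.k_sub qN)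
  interpret N: left_module DZ N by (rule NM)
  have "H = {\<zero>\<^bsub>q_plus N\<^esub>} \<or> H = carrier (q_plus N)" if H: "submodule H DY (q_plus N)" for H
  proof (cases "H = {\<zero>\<^bsub>q_plus N\<^esub>}")
    case False
    obtain S where S: "simple_sub DY (q_plus N) S" "S \<subseteq> H"
      by (rule qN.V.dcc_simple_sub[OF qN.finite_dim_dcc[OF fd] H False])
    let ?S = "(q_plus N)\<lparr>carrier := S\<rparr>"
    have Sub: "submodule S DY (q_plus N)" and simple: "simple_left_module DY ?S"
      using S(1) unfolding qN.V.simple_sub_iff by (rule conjunct1, rule conjunct2)
    note SD = qN.V.submoduleD[OF Sub, unfolded YZ.direct_image_simps]
    have "simple_dmodule k LY ?S"
      unfolding simple_dmodule_def using simple qN.finite_dim_submodule[OF fd Sub] by (rule conjI)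
    moreover have fS: "f \<in> mod_hom DY ?S (pi_plus M)"
      using mod_homD(2-4)[OF fY] subsetD[OF SD(1)] by (intro mod_homI) (simp_all add: direct_image_carrier)
    moreover obtain s where s: "s \<in> carrier ?S" "s \<noteq> \<zero>\<^bsub>?S\<^esub>" using simple_module_nonzero[OF simple] .
    moreover have "f s \<noteq> \<zero>\<^bsub>M\<^esub>"
    proof
      assume "f s = \<zero>\<^bsub>M\<^esub>"
      moreover have "f \<zero>\<^bsub>N\<^esub> = \<zero>\<^bsub>M\<^esub>"
        using mod_hom_zero[OF NM Z.top.left_module_direct_image[OF M'] f(1)] by (simp add: Z.top.direct_image_simps)
      ultimately have "s = \<zero>\<^bsub>N\<^esub>" using inj_onD[OF f(2), of s "\<zero>\<^bsub>N\<^esub>"] s(1) SD(1) by auto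
      then show False using s(2) by (simp add: YZ.direct_image_simps)
    qed
    ultimately have "?S \<in> simple_below k LY L M" by (intro Y.simple_belowI[OF _ M])
    then obtain g where g: "g \<in> mod_hom DY (pi_plus M) ?S" "g ` carrier M = carrier ?S"
      by (rule Y.simple_below_maps[OF _ M])
    have "submodule S DZ N"
    \<comment> \<open>Stability is checked in \<open>M\<close>, where \<open>image_stable\<close>
      applies, and pulled back along the injective \<open>f\<close>.\<close>
    proof (rule YZ.submodule_of_direct_image[OF NM Sub])
      fix c s assume c: "c \<in> L1" and s: "s \<in> S"
      have sN: "s \<in> carrier N" using s SD(1) by blast
      have "f (\<mu>Z c \<odot>\<^bsub>N\<^esub> s) = \<mu> c \<odot>\<^bsub>M\<^esub> f s"
        using mod_homD(4)[OF f(1) YZ.\<mu>F_closed[OF c] sN] by (simp add: p_plus_smult[OF c])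
      also have "\<dots> \<in> f ` S" using image_stable[OF fS g c, of "f s"] s by simp
      finally obtain t where t: "t \<in> S" "f (\<mu>Z c \<odot>\<^bsub>N\<^esub> s) = f t" by (elim imageE)
      have "\<mu>Z c \<odot>\<^bsub>N\<^esub> s \<in> carrier N" "t \<in> carrier N"
        using N.smult_closed[OF YZ.\<mu>F_closed[OF c] sN] t(1) SD(1) by auto
      then have "\<mu>Z c \<odot>\<^bsub>N\<^esub> s = t" using inj_onD[OF f(2) t(2)] by simp
      then show "\<mu>Z c \<odot>\<^bsub>N\<^esub> s \<in> S" using t(1) by simp
    qed
    moreover have "S \<noteq> {\<zero>\<^bsub>N\<^esub>}" using s by (auto simp: YZ.direct_image_simps)
    ultimately have "S = carrier N" using N'(1) unfolding simple_left_module_def by blast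
    then show ?thesis using S(2) qN.V.submoduleD(1)[OF H] by (auto simp: direct_image_carrier)
  qed simp
  moreover have "carrier (q_plus N) \<noteq> {\<zero>\<^bsub>q_plus N\<^esub>}"
    using N'(1) unfolding simple_left_module_def YZ.direct_image_simps by blast
  ultimately show ?thesis unfolding simple_dmodule_def simple_left_module_def using qN fd by blast
qed

lemma q_plus_below:
  assumes N: "N \<in> simple_below k LZ L M"
  shows "q_plus N \<in> simple_below k LY L M"
proof -
  have N': "simple_left_module DZ N" using N by (simp_all add: simple_below_def simple_dmodule_def)
  interpret N: left_module DZ N by (rule simple_left_moduleD[OF N'])
  obtain f g where f: "f \<in> mod_hom DZ N (p_plus M)" "inj_on f (carrier N)" by (rule Z.simple_below_maps[OF N M])
  obtain n where n: "n \<in> carrier N" "n \<noteq> \<zero>\<^bsub>N\<^esub>" using simple_module_nonzero[OF N'] .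
  have "f \<zero>\<^bsub>N\<^esub> = \<zero>\<^bsub>M\<^esub>"
    using mod_hom_zero[OF N.left_module_axioms Z.top.left_module_direct_image[OF M'] f(1)] by (simp add: Z.top.direct_image_simps)
  then have "f n \<noteq> \<zero>\<^bsub>M\<^esub>" using inj_onD[OF f(2), of n "\<zero>\<^bsub>N\<^esub>"] n by auto
  moreover have "f \<in> mod_hom DY (q_plus N) (pi_plus M)"
    unfolding to_pi_plus_iff by (rule YZ.mod_hom_direct_image[OF f(1)])
  ultimately show ?thesis
    using n(1) by (intro Y.simple_belowI[OF simple_q_plus[OF N] M]) (simp_all add: direct_image_carrier)
qed

lemma q_plus_injective:
  assumes N: "N \<in> simple_below k LZ L M" and N': "N' \<in> simple_below k LZ L M"
    and h: "h \<in> mod_hom DY (q_plus N) (q_plus N')"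
  shows "h \<in> mod_hom DZ N N'"
proof -
  have NM: "left_module DZ N" "left_module DZ N'"
    using N N' by (simp_all add: simple_below_def simple_dmodule_def simple_left_moduleD)
  obtain f where f: "f \<in> mod_hom DZ N' (p_plus M)" "inj_on f (carrier N')" by (rule Z.simple_below_maps[OF N' M])
  obtain g where g: "g \<in> mod_hom DZ (p_plus M) N" "g ` carrier M = carrier N" by (rule Z.simple_below_maps[OF N M])
  show ?thesis by (rule mod_hom_linear[OF NM g f h])
qed

lemma q_plus_isomorphic:
  assumes N: "N \<in> simple_below k LZ L M" and N': "N' \<in> simple_below k LZ L M"
    and iso: "module_isomorphic DY (q_plus N) (q_plus N')"
  shows "module_isomorphic DZ N N'"
proof -
  have NM: "left_module DZ N" "left_module DZ N'"
    using N N' by (simp_all add: simple_below_def simple_dmodule_def simple_left_moduleD)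
  obtain h where h: "h \<in> mod_hom DY (q_plus N) (q_plus N')" "bij_betw h (carrier N) (carrier N')"
    using iso unfolding module_isomorphic_iff direct_image_carrier by (elim conjE bexE)
  show ?thesis unfolding module_isomorphic_iff
    by (intro conjI NM bexI[of _ h] h q_plus_injective[OF N N' h(1)])
qed

end

section \<open>Descent to the inertia field, unique components and equality of
  multiplicities\<close>

context inertia_tower
begin

text \<open>Surjectivity on isomorphism classes. The image of \<open>N\<close> in \<open>M\<close>
  is stable under \<open>L1\<close>, hence a D_Z-submodule of p_+ M, and its structure is carried
  back to the carrier of \<open>N\<close>.\<close>

lemma simple_descends:
  fixes N :: "('a \<Rightarrow> 'a, 'm) module"
  assumes N: "N \<in> simple_below k LY L M"
  shows "\<exists>N'\<in>simple_below k LZ L M :: ('a \<Rightarrow> 'a, 'm) module set. module_isomorphic DY N (q_plus N')"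
proof -
  have simple: "simple_left_module DY N" and fd: "finite_dim_over LY N"
    using N by (simp_all add: simple_below_def simple_dmodule_def)
  note NM = simple_left_moduleD[OF simple]
  interpret N: left_module DY N by (rule NM)
  obtain f g where f: "f \<in> mod_hom DY N (pi_plus M)" "inj_on f (carrier N)"
    and g: "g \<in> mod_hom DY (pi_plus M) N" "g ` carrier M = carrier N"
    by (rule Y.simple_below_maps[OF N M])
  note pM = Z.top.left_module_direct_image[OF M']
  note qpM = YZ.left_module_direct_image[OF pM]
  have fq: "f \<in> mod_hom DY N (q_plus (p_plus M))" using f(1) unfolding to_pi_plus_iff .
  note fqD = mod_homD[OF fq, unfolded YZ.direct_image_simps Z.top.direct_image_simps(1-3)]
  let ?H = "f ` carrier N"
  have "submodule ?H DY (q_plus (p_plus M))" by (rule submodule_image[OF NM qpM fq N.submodule_carrier])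
  then have H: "submodule ?H DZ (p_plus M)"
  proof (rule YZ.submodule_of_direct_image[OF pM])
    show "\<mu>Z c \<odot>\<^bsub>p_plus M\<^esub> u \<in> ?H" if "c \<in> L1" "u \<in> ?H" for c u
      unfolding p_plus_smult[OF that(1)] by (rule image_stable[OF f(1) g that])
  qed
  let ?W = "(p_plus M)\<lparr>carrier := ?H\<rparr>"
  have W: "left_module DZ ?W" by (rule left_module.submodule_left_module[OF pM H])
  have fW: "f \<in> add_hom N ?W" using fqD(3) by (intro add_homI) (simp_all add: direct_image_def)
  have bij: "bij_betw f (carrier N) (carrier ?W)" using f(2) by (simp add: bij_betw_def)
  define N' where "N' = N\<lparr>smult := \<lambda>P n. inv_into (carrier N) f (P \<odot>\<^bsub>?W\<^esub> f n)\<rparr>"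
  have N': "left_module DZ N'" and fN': "f \<in> mod_hom DZ N' ?W"
    unfolding N'_def by (rule transport_left_module[OF N.M.abelian_group_axioms W fW bij])+
  have s: "carrier N' = carrier N" "\<zero>\<^bsub>N'\<^esub> = \<zero>\<^bsub>N\<^esub>" "v \<oplus>\<^bsub>N'\<^esub> w = v \<oplus>\<^bsub>N\<^esub> w" for v w
    by (simp_all add: N'_def)
  interpret N': left_module DZ N' by (rule N')
  note qN' = YZ.left_module_direct_image[OF N']
  \<comment> \<open>The new structure restricts to the given one over D_Y, since \<open>f\<close> is
    injective and linear for both.\<close>
  have id: "(\<lambda>n. n) \<in> mod_hom DY N (q_plus N')"
  proof (rule mod_homI)
    fix Q n assume Q: "Q \<in> carrier DY" and n: "n \<in> carrier N"
    let ?Q = "ext_op k LY LZ Q"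
    note Q' = YZ.lift_op_closed[OF Q]
    have "f (?Q \<odot>\<^bsub>N'\<^esub> n) = ?Q \<odot>\<^bsub>p_plus M\<^esub> f n" using mod_homD(4)[OF fN' Q'] n by (simp add: s)
    also have "\<dots> = f (Q \<odot>\<^bsub>N\<^esub> n)" using mod_homD(4)[OF fq Q n] by (simp add: YZ.direct_image_simps)
    finally have "Q \<odot>\<^bsub>N\<^esub> n = ?Q \<odot>\<^bsub>N'\<^esub> n"
      using inj_onD[OF f(2)] N.smult_closed[OF Q n] N'.smult_closed[OF Q', of n] n by (simp add: s)
    then show "Q \<odot>\<^bsub>N\<^esub> n = Q \<odot>\<^bsub>q_plus N'\<^esub> n" by (simp add: YZ.direct_image_simps)
  qed (simp_all add: YZ.direct_image_simps s)
  have iso: "module_isomorphic DY N (q_plus N')"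
    unfolding module_isomorphic_iff
    by (intro conjI NM qN' bexI[OF _ id]) (simp add: YZ.direct_image_simps s bij_betw_def)
  have simple_q: "simple_left_module DY (q_plus N')" by (rule simple_left_module_iso[OF iso simple])
  have fd_q: "finite_dim_over LY (q_plus N')"
    using NM qN' by (intro finite_dim_image[OF _ _ id _ fd] dmodule.intro dmodule_axioms.intro field_axioms Y.subfield Y.k_sub)
      (simp_all add: YZ.direct_image_simps s)
  have "simple_left_module DZ N'"
    unfolding simple_left_module_def
  proof (intro conjI allI impI N')
    show "carrier N' \<noteq> {\<zero>\<^bsub>N'\<^esub>}" using simple unfolding simple_left_module_def s by blast
    fix H assume "submodule H DZ N'"
    then have "submodule H DY (q_plus N')" by (rule YZ.submodule_direct_image[OF N'])
    then show "H = {\<zero>\<^bsub>N'\<^esub>} \<or> H = carrier N'"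
      using simple_q unfolding simple_left_module_def YZ.direct_image_simps by blast
  qed
  then have "simple_dmodule k LZ N'"
    unfolding simple_dmodule_def using YZ.finite_dim_of_direct_image[OF N' fd_q] by (rule conjI)
  moreover have "f \<in> mod_hom DZ N' (p_plus M)"
    using mod_homD(2-4)[OF fN'] fqD(2) by (intro mod_homI) (simp_all add: direct_image_def s)
  moreover obtain n where n: "n \<in> carrier N" "n \<noteq> \<zero>\<^bsub>N\<^esub>" using simple_module_nonzero[OF simple] .
  moreover have "f n \<noteq> \<zero>\<^bsub>M\<^esub>"
    using inj_onD[OF f(2), of n "\<zero>\<^bsub>N\<^esub>"] n mod_hom_zero[OF NM qpM fq]
    by (auto simp: YZ.direct_image_simps Z.top.direct_image_simps)
  ultimately have "N' \<in> simple_below k LZ L M" by (intro Z.simple_belowI[OF _ M, of _ f n]) (simp_all add: s)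
  from iso this show ?thesis by (rule bexI)
qed

text \<open>The natural map \<pi>^! N \<rightarrow> p^! N', adjoint to \<open>j\<close> followed by
  the unit of p. It is onto because the image of \<open>j\<close> generates N'. The two applications
  are N' = q^! N and an N' whose direct image is isomorphic to \<open>N\<close>.\<close>

lemma inverse_image_tower:
  fixes N :: "('a \<Rightarrow> 'a, 'm) module" and N' :: "('a \<Rightarrow> 'a, 'w) module"
  assumes N: "left_module DY N" and N': "left_module DZ N'" and j: "j \<in> mod_hom DY N (q_plus N')"
    and gen: "\<And>H. submodule H DZ N' \<Longrightarrow> (\<And>n. n \<in> carrier N \<Longrightarrow> j n \<in> H) \<Longrightarrow> H = carrier N'"
  obtains t where "t \<in> mod_hom DL (inverse_image k LY L N) (inverse_image k LZ L N')"
    "t ` carrier (inverse_image k LY L N) = carrier (inverse_image k LZ L N')"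
    "\<And>a n. a \<in> carrier L \<Longrightarrow> n \<in> carrier N \<Longrightarrow> t (pure_tensor LY L N a n) = pure_tensor LZ L N' a (j n)"
proof -
  interpret P: galois_inverse L k K mY xY yY N
    by (intro galois_inverse.intro Y.galois_avg_axioms galois_inverse_axioms.intro N)
  interpret Q: galois_inverse L k L1 mZ xZ yZ N'
    by (intro galois_inverse.intro Z.galois_avg_axioms galois_inverse_axioms.intro N')
  have jc: "j n \<in> carrier N'" if "n \<in> carrier N" for n
    using mod_homD(2)[OF j that] by (simp add: direct_image_carrier)
  have f: "(\<lambda>n. Q.tensor \<one> (j n)) \<in> mod_hom DY N (pi_plus Q.V)"
    unfolding to_pi_plus_iff by (rule mod_hom_comp[OF j YZ.mod_hom_direct_image[OF Q.ip.unit_mod_hom]])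
  obtain t where t: "t \<in> mod_hom DL P.V Q.V"
    and tt: "\<And>a n. a \<in> carrier L \<Longrightarrow> n \<in> carrier N \<Longrightarrow> t (P.tensor a n) = \<mu> a \<odot>\<^bsub>Q.V\<^esub> Q.tensor \<one> (j n)"
    by (rule P.ip.inverse_image_universal[OF Q.ip.left_module_V f], rule that, assumption, simp)
  have tt': "t (P.tensor a n) = Q.tensor a (j n)" if "a \<in> carrier L" "n \<in> carrier N" for a n
    using tt[OF that] Q.ip.tensor_smult[OF that(1) jc[OF that(2)]] by simp
  let ?I = "t ` carrier P.V"
  have I: "submodule ?I DL Q.V"
    by (rule submodule_image[OF P.ip.left_module_V Q.ip.left_module_V t P.ip.V.submodule_carrier])
  have "{v \<in> carrier N'. Q.tensor \<one> v \<in> ?I} = carrier N'"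
  proof (rule gen[OF submodule_preimage[OF N' Z.top.left_module_direct_image[OF Q.ip.left_module_V]
          Q.ip.unit_mod_hom Z.top.submodule_direct_image[OF Q.ip.left_module_V I]]])
    fix n assume n: "n \<in> carrier N"
    have "t (P.tensor \<one> n) \<in> ?I" using P.ip.tensor_closed[OF one_closed n] by (rule imageI)
    then show "j n \<in> {v \<in> carrier N'. Q.tensor \<one> v \<in> ?I}" unfolding tt'[OF one_closed n] using jc[OF n] by simp
  qed
  then have "?I = carrier Q.V" by (intro Q.ip.submodule_contains_unit[OF I]) blast
  then show thesis using that t tt' by simp
qed

text \<open>\<open>fss_inverse_image\<close> is about Galois extensions, and L1/K need not be one.
  Instead, p^! q^! N is a quotient of the semisimple \<pi>^! N, and semisimplicity descends from p^!
  q^! N to q^! N.\<close>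

lemma fss_q_inverse_image:
  assumes simple: "simple_left_module DY N" and fd: "finite_dim_over LY N"
  shows "fss DZ (inverse_image k LY LZ N) (carrier (inverse_image k LY LZ N))"
proof -
  note N = simple_left_moduleD[OF simple]
  interpret P: galois_inverse L k K mY xY yY N
    by (intro galois_inverse.intro Y.galois_avg_axioms galois_inverse_axioms.intro N)
  interpret q: inverse_image_pair L k K L1 m x \<phi> N
    by (intro inverse_image_pair.intro YZ.etale_pair_axioms inverse_image_pair_axioms.intro N)
  interpret Q: galois_inverse L k L1 mZ xZ yZ q.V
    by (intro galois_inverse.intro Z.galois_avg_axioms galois_inverse_axioms.intro q.left_module_V)
  obtain t where t: "t \<in> mod_hom DL P.V Q.V" "t ` carrier P.V = carrier Q.V"
    by (rule inverse_image_tower[OF N q.left_module_V q.unit_mod_hom q.submodule_contains_unit])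
  have "fss DL Q.V (carrier Q.V)"
    using fss_image[OF P.ip.left_module_V Q.ip.left_module_V t(1) P.fss_inverse_image[OF simple fd]]
    unfolding t(2) by (rule conjunct2)
  then show ?thesis by (rule Q.fss_of_inverse_image[OF YZ.finite_dim_inverse_image[OF N fd]])
qed

lemma simple_dmodule_iso:
  fixes N :: "('a \<Rightarrow> 'a, 'm) module" and N' :: "('a \<Rightarrow> 'a, 'w) module"
  assumes "simple_dmodule k LY N" "module_isomorphic DY N N'"
  shows "simple_dmodule k LY N'"
proof -
  obtain f where f: "left_module DY N" "left_module DY N'" "f \<in> mod_hom DY N N'" "bij_betw f (carrier N) (carrier N')"
    using assms(2) unfolding module_isomorphic_iff by (elim conjE bexE)
  have "finite_dim_over LY N'"
    using f assms(1) unfolding simple_dmodule_def bij_betw_def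
    by (intro finite_dim_image[OF _ _ f(3)] dmodule.intro dmodule_axioms.intro field_axioms Y.subfield Y.k_sub) simp_all
  then show ?thesis using assms simple_left_module_iso unfolding simple_dmodule_def by blast
qed

text \<open>By adjunction a nonzero map from q^! N0 to a simple module N' below \<open>M\<close>
  amounts to a nonzero map from N0 to q_+ N'. Both are simple, so this is an isomorphism, and
  isomorphisms between direct images come from D_Z-isomorphisms.\<close>

lemma component_unique:
  assumes N: "N \<in> simple_below k LZ L M" and iso: "module_isomorphic DY (q_plus N) N0"
  shows "multiplicity_in DZ (inverse_image k LY LZ N0) N \<noteq> 0"
    and "N' \<in> simple_below k LZ L M \<Longrightarrow> multiplicity_in DZ (inverse_image k LY LZ N0) N' \<noteq> 0 \<Longrightarrow> module_isomorphic DZ N' N"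
proof -
  have simple0: "simple_left_module DY N0" and fd0: "finite_dim_over LY N0"
    using simple_dmodule_iso[OF simple_q_plus[OF N] iso] by (simp_all add: simple_dmodule_def)
  note N0 = simple_left_moduleD[OF simple0]
  have simple: "simple_left_module DZ N" using N by (simp add: simple_below_def simple_dmodule_def)
  interpret N: left_module DZ N by (rule simple_left_moduleD[OF simple])
  interpret q: inverse_image_pair L k K L1 m x \<phi> N0
    by (intro inverse_image_pair.intro YZ.etale_pair_axioms inverse_image_pair_axioms.intro N0)
  note fss = fss_q_inverse_image[OF simple0 fd0]
  obtain f where f: "f \<in> mod_hom DY N0 (q_plus N)" "bij_betw f (carrier N0) (carrier (q_plus N))"
    using module_isomorphic_sym[OF iso] unfolding module_isomorphic_iff by (elim conjE bexE)
  obtain u where u: "u \<in> carrier N" "u \<noteq> \<zero>\<^bsub>N\<^esub>" using simple_module_nonzero[OF simple] .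
  then have "u \<in> f ` carrier N0" using f(2) unfolding bij_betw_def direct_image_carrier by simp
  then obtain n where n: "u = f n" "n \<in> carrier N0" by (elim imageE)
  obtain h where h: "h \<in> mod_hom DZ q.V N"
    and ht: "\<And>a n. a \<in> L1 \<Longrightarrow> n \<in> carrier N0 \<Longrightarrow> h (q.tensor a n) = \<mu>Z a \<odot>\<^bsub>N\<^esub> f n"
    by (rule q.inverse_image_universal[OF N.left_module_axioms f(1)], rule that, assumption, simp)
  have "h (q.tensor \<one> n) \<noteq> \<zero>\<^bsub>N\<^esub>"
    using ht[OF YZ.F_ops(2) n(2)] n(1) u YZ.\<mu>F_one N.smult_one by simp
  then have "\<exists>v\<in>carrier q.V. h v \<noteq> \<zero>\<^bsub>N\<^esub>" using q.tensor_closed[OF YZ.F_ops(2) n(2)] by (rule bexI)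
  then show "multiplicity_in DZ q.V N \<noteq> 0"
    unfolding multiplicity_nonzero_iff[OF q.left_module_V simple fss] using h by (rule bexI)
  assume N': "N' \<in> simple_below k LZ L M" and mult: "multiplicity_in DZ q.V N' \<noteq> 0"
  have simple': "simple_left_module DZ N'" using N' by (simp add: simple_below_def simple_dmodule_def)
  obtain h' v where h': "h' \<in> mod_hom DZ q.V N'" "v \<in> carrier q.V" "h' v \<noteq> \<zero>\<^bsub>N'\<^esub>"
    using mult unfolding multiplicity_nonzero_iff[OF q.left_module_V simple' fss] by (elim bexE)
  note r = q.hom_to_direct_image[OF simple_left_moduleD[OF simple'] h']
  obtain n' where n': "n' \<in> carrier N0" "h' (q.tensor \<one> n') \<noteq> \<zero>\<^bsub>N'\<^esub>" using conjunct2[OF r] by (elim bexE)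
  have "simple_left_module DY (q_plus N')" using simple_q_plus[OF N'] by (simp add: simple_dmodule_def)
  then have "module_isomorphic DY N0 (q_plus N')"
    by (rule simple_hom_iso[OF simple0 _ conjunct1[OF r] n'(1)]) (simp add: YZ.direct_image_simps n'(2))
  from module_isomorphic_trans[OF iso this] have "module_isomorphic DY (q_plus N) (q_plus N')" .
  then show "module_isomorphic DZ N' N" using q_plus_isomorphic[OF N N'] module_isomorphic_sym by blast
qed

text \<open>The natural surjection from \<pi>^! N0 to p^! N need not be injective, but every map h
  from \<pi>^! N0 to \<open>M\<close> factors through it: the adjoint of h, read as a map from
  \<open>N\<close> to p_+ M, is D_Z-linear by \<open>mod_hom_linear\<close> and hence adjoint to a
  map from p^! N.\<close>

lemma multiplicity_eq:
  assumes N: "N \<in> simple_below k LZ L M" and iso: "module_isomorphic DY (q_plus N) N0"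
  shows "multiplicity_in DL (inverse_image k LZ L N) M = multiplicity_in DL (inverse_image k LY L N0) M"
proof -
  have simple0: "simple_left_module DY N0" and fd0: "finite_dim_over LY N0"
    using simple_dmodule_iso[OF simple_q_plus[OF N] iso] by (simp_all add: simple_dmodule_def)
  note N0 = simple_left_moduleD[OF simple0]
  have simple: "simple_left_module DZ N" and fd: "finite_dim_over LZ N"
    using N by (simp_all add: simple_below_def simple_dmodule_def)
  note NM = simple_left_moduleD[OF simple]
  note pM = Z.top.left_module_direct_image[OF M']
  interpret P: galois_inverse L k K mY xY yY N0
    by (intro galois_inverse.intro Y.galois_avg_axioms galois_inverse_axioms.intro N0)
  interpret Q: galois_inverse L k L1 mZ xZ yZ N
    by (intro galois_inverse.intro Z.galois_avg_axioms galois_inverse_axioms.intro NM)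
  interpret M: left_module DL M by (rule M')
  obtain f where f: "f \<in> mod_hom DY (q_plus N) N0" "bij_betw f (carrier (q_plus N)) (carrier N0)"
    using iso unfolding module_isomorphic_iff by (elim conjE bexE)
  define j where "j = inv_into (carrier (q_plus N)) f"
  have j: "j \<in> mod_hom DY N0 (q_plus N)"
    unfolding j_def by (rule mod_hom_inv_into[OF YZ.left_module_direct_image[OF NM] f])
  have jc: "j n \<in> carrier N" if "n \<in> carrier N0" for n using mod_homD(2)[OF j that] by (simp add: direct_image_carrier)
  have fj: "f (j n) = n" if "n \<in> carrier N0" for n
    using f(2) that unfolding j_def bij_betw_def by (simp add: f_inv_into_f)
  have jf: "j (f n) = n" if "n \<in> carrier N" for n
    using bij_betw_inv_into_left[OF f(2)] that unfolding j_def by (simp add: direct_image_carrier)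
  have fc: "f n \<in> carrier N0" if "n \<in> carrier N" for n
    using mod_homD(2)[OF f(1)] that by (simp add: direct_image_carrier)
  obtain t where t: "t \<in> mod_hom DL P.V Q.V" "t ` carrier P.V = carrier Q.V"
    and tt: "\<And>a n. a \<in> carrier L \<Longrightarrow> n \<in> carrier N0 \<Longrightarrow> t (P.tensor a n) = Q.tensor a (j n)"
  proof (rule inverse_image_tower[OF N0 NM j])
    fix H assume H: "submodule H DZ N" and jH: "\<And>n. n \<in> carrier N0 \<Longrightarrow> j n \<in> H"
    have "n \<in> H" if "n \<in> carrier N" for n using jH[OF fc[OF that]] jf[OF that] by simp
    then show "H = carrier N" using Q.ip.N.submoduleD(1)[OF H] by blast
  qed (rule that)
  obtain g where g: "g \<in> mod_hom DZ (p_plus M) N" "g ` carrier M = carrier N" by (rule Z.simple_below_maps[OF N M])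
  \<comment> \<open>Here \<open>mod_hom_linear\<close> is used with p_+ M as the target, embedded in
    itself.\<close>
  have id: "(\<lambda>v. v) \<in> mod_hom DZ (p_plus M) (p_plus M)" "inj_on (\<lambda>v. v) (carrier (p_plus M))"
    by (auto intro: mod_homI)
  have "multiplicity_in DL P.V M = multiplicity_in DL Q.V M"
  proof (rule multiplicity_eqI[OF P.ip.left_module_V P.fss_inverse_image[OF simple0 fd0] Q.ip.left_module_V
        Q.fss_inverse_image[OF simple fd] M t])
    fix h assume h: "h \<in> mod_hom DL P.V M"
    let ?h = "\<lambda>n. h (P.tensor \<one> (f n))"
    have "(\<lambda>n. h (P.tensor \<one> n)) \<in> mod_hom DY N0 (pi_plus M)"
      by (rule mod_hom_comp[OF P.ip.unit_mod_hom Y.top.mod_hom_direct_image[OF h]])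
    then have "?h \<in> mod_hom DY (q_plus N) (q_plus (p_plus M))"
      unfolding to_pi_plus_iff by (rule mod_hom_comp[OF f(1)])
    then have h': "?h \<in> mod_hom DZ N (p_plus M)" by (rule mod_hom_linear[OF NM pM g id])
    show "\<exists>g\<in>mod_hom DL Q.V M. \<forall>v\<in>carrier P.V. h v = g (t v)"
    proof (rule Q.ip.inverse_image_universal[OF M' h'])
      fix u assume u: "u \<in> mod_hom DL Q.V M"
        and ut: "\<And>a n. a \<in> carrier L \<Longrightarrow> n \<in> carrier N \<Longrightarrow> u (Q.tensor a n) = \<mu> a \<odot>\<^bsub>M\<^esub> ?h n"
      have "h v = (\<lambda>v. u (t v)) v" if v: "v \<in> carrier P.V" for v
      proof (rule P.ip.add_hom_eqI[OF M.M.abelian_group_axioms mod_homD(1)[OF h] mod_homD(1)[OF mod_hom_comp[OF t(1) u]] _ v])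
        fix a n assume a: "a \<in> carrier L" and n: "n \<in> carrier N0"
        have "h (P.tensor a n) = \<mu> a \<odot>\<^bsub>M\<^esub> h (P.tensor \<one> n)"
          unfolding P.ip.tensor_smult[OF a n]
          by (rule mod_homD(4)[OF h DL_mult_op[OF Y.k_carrier a] P.ip.tensor_closed[OF one_closed n]])
        also have "\<dots> = u (t (P.tensor a n))" unfolding tt[OF a n] ut[OF a jc[OF n]] fj[OF n] ..
        finally show "h (P.tensor a n) = u (t (P.tensor a n))" .
      qed
      then show ?thesis using u by (intro bexI[of _ u]) simp_all
    qed
  qed
  then show ?thesis ..
qed

text \<open>A class consists of all modules isomorphic to a given one, and its image collects
  whatever is isomorphic to the direct image of a member. Fact \<open>F\<close> identifies this with
  the class of the direct image of one representative; injectivity and surjectivity are then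
  \<open>q_plus_isomorphic\<close> and \<open>simple_descends\<close>.\<close>

lemma q_plus_bij_betw:
  fixes A B :: "('a \<Rightarrow> 'a, 'm) module set"
  defines "A \<equiv> simple_below k LZ L M" and "B \<equiv> simple_below k LY L M"
  shows "bij_betw (\<lambda>C. module_iso_rel DY `` (q_plus ` C)) (A // module_iso_rel DZ) (B // module_iso_rel DY)"
proof -
  have A: "left_module DZ N" if "N \<in> A" for N
    using that by (simp add: A_def simple_below_def simple_dmodule_def simple_left_moduleD)
  have B: "left_module DY N" if "N \<in> B" for N
    using that by (simp add: B_def simple_below_def simple_dmodule_def simple_left_moduleD)
  have iso_eq: "module_iso_rel R `` {N} = module_iso_rel R `` {N'} \<longleftrightarrow> module_isomorphic R N N'"
    if N': "left_module R N'" for R :: "('a \<Rightarrow> 'a) ring" and N N' :: "('a \<Rightarrow> 'a, 'm) module"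
  proof
    assume "module_iso_rel R `` {N} = module_iso_rel R `` {N'}"
    then have "N' \<in> module_iso_rel R `` {N}" using module_isomorphic_refl[OF N'] by (simp add: module_iso_rel_def)
    then show "module_isomorphic R N N'" by (simp add: module_iso_rel_def)
  next
    assume *: "module_isomorphic R N N'"
    have "module_isomorphic R N S \<longleftrightarrow> module_isomorphic R N' S" for S :: "('a \<Rightarrow> 'a, 'm) module"
      using module_isomorphic_trans[OF *, of S] module_isomorphic_trans[OF module_isomorphic_sym[OF *], of S] by blast
    then show "module_iso_rel R `` {N} = module_iso_rel R `` {N'}" by (auto simp: module_iso_rel_def)
  qed
  let ?F = "\<lambda>C. module_iso_rel DY `` (q_plus ` C)"
  have F: "?F (module_iso_rel DZ `` {N}) = module_iso_rel DY `` {q_plus N}" if N: "N \<in> A" for N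
  proof
    show "?F (module_iso_rel DZ `` {N}) \<subseteq> module_iso_rel DY `` {q_plus N}"
    proof
      fix S assume "S \<in> ?F (module_iso_rel DZ `` {N})"
      then obtain T where T: "(T, S) \<in> module_iso_rel DY" "T \<in> q_plus ` (module_iso_rel DZ `` {N})" by (elim ImageE)
      obtain N' where "T = q_plus N'" "N' \<in> module_iso_rel DZ `` {N}" using T(2) by (elim imageE)
      then have N': "module_isomorphic DZ N N'" "module_isomorphic DY (q_plus N') S"
        using T(1) by (simp_all add: module_iso_rel_def)
      from module_isomorphic_trans[OF YZ.module_isomorphic_direct_image[OF N'(1)] N'(2)]
      show "S \<in> module_iso_rel DY `` {q_plus N}" by (simp add: module_iso_rel_def)
    qed
    show "module_iso_rel DY `` {q_plus N} \<subseteq> ?F (module_iso_rel DZ `` {N})"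
      using module_isomorphic_refl[OF A[OF N]] by (auto simp: module_iso_rel_def)
  qed
  have "inj_on ?F (A // module_iso_rel DZ)"
  proof (rule inj_onI)
    fix C C' assume C: "C \<in> A // module_iso_rel DZ" "C' \<in> A // module_iso_rel DZ" and eq: "?F C = ?F C'"
    obtain N where N: "C = module_iso_rel DZ `` {N}" "N \<in> A" using C(1) by (rule quotientE)
    obtain N' where N': "C' = module_iso_rel DZ `` {N'}" "N' \<in> A" using C(2) by (rule quotientE)
    have "module_isomorphic DY (q_plus N) (q_plus N')"
      using eq unfolding N(1) N'(1) F[OF N(2)] F[OF N'(2)]
        iso_eq[OF YZ.left_module_direct_image[OF A[OF N'(2)]]] .
    then have "module_isomorphic DZ N N'"
      by (rule q_plus_isomorphic[OF N(2)[unfolded A_def] N'(2)[unfolded A_def]])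
    then show "C = C'" unfolding N(1) N'(1) iso_eq[OF A[OF N'(2)]] .
  qed
  moreover have "?F ` (A // module_iso_rel DZ) = B // module_iso_rel DY"
  proof (intro equalityI subsetI)
    fix D assume "D \<in> ?F ` (A // module_iso_rel DZ)"
    then obtain C where C: "D = ?F C" "C \<in> A // module_iso_rel DZ" by (elim imageE)
    obtain N where N: "C = module_iso_rel DZ `` {N}" "N \<in> A" using C(2) by (rule quotientE)
    have "q_plus N \<in> B" unfolding B_def by (rule q_plus_below[OF N(2)[unfolded A_def]])
    then show "D \<in> B // module_iso_rel DY" unfolding C(1) N(1) F[OF N(2)] by (rule quotientI)
  next
    fix D assume "D \<in> B // module_iso_rel DY"
    then obtain N where N: "D = module_iso_rel DY `` {N}" "N \<in> B" by (rule quotientE)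
    obtain N' where N': "N' \<in> A" "module_isomorphic DY N (q_plus N')"
      using simple_descends[OF N(2)[unfolded B_def]] unfolding A_def by (elim bexE)
    have "D = ?F (module_iso_rel DZ `` {N'})"
      unfolding N(1) F[OF N'(1)] iso_eq[OF YZ.left_module_direct_image[OF A[OF N'(1)]]] by (rule N'(2))
    then show "D \<in> ?F ` (A // module_iso_rel DZ)" using quotientI[OF N'(1)] by (rule image_eqI)
  qed
  ultimately show ?thesis unfolding bij_betw_def ..
qed

end

text \<open>An element of the Galois group is determined by its values on a basis, which are roots of
  polynomials over \<open>K\<close>.\<close>

lemma (in field) finite_galois_group:
  assumes K: "subfield K R" and fd: "finite_dimension K (carrier R)"
  shows "finite (galois_group R K)"
proof -
  have KR: "K \<subseteq> carrier R" using subfieldE(3)[OF K] .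
  obtain n where "dimension n K (carrier R)" using fd by (auto simp: finite_dimension_def)
  then obtain Vs where Vs: "set Vs \<subseteq> carrier R" "Span K Vs = carrier R" using exists_base[OF K] by blast
  define rts where "rts v = {g v | g. g \<in> galois_group R K}" for v
  have rts: "finite (rts v)" if v: "v \<in> set Vs" for v
  proof -
    have vR: "v \<in> carrier R" using v Vs by blast
    have "(algebraic over K) v" using finite_dimension_imp_algebraic[OF K carrier_is_subring fd vR] .
    then obtain p where p: "p \<in> carrier (K[X])" "p \<noteq> []" "eval p v = \<zero>"
      using algebraicE[OF subfieldE(1)[OF K] vR] by blast
    have pK: "polynomial K p" using p(1) unfolding univ_poly_carrier .
    have setp: "set p \<subseteq> K" using pK by (auto simp: polynomial_def)
    have pR: "p \<in> carrier (poly_ring R)"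
      using carrier_polynomial[OF subfieldE(1)[OF K] pK] unfolding univ_poly_carrier .
    have "rts v \<subseteq> {x. is_root p x}"
    proof
      fix w assume "w \<in> rts v"
      then obtain g where g: "g \<in> galois_group R K" "w = g v" by (auto simp: rts_def)
      have "ring_hom_ring R R g"
        using galois_groupD(1-4)[OF g(1)] ring_axioms by (intro ring_hom_ringI) auto
      then interpret g: ring_hom_ring R R g .
      have "map g p = p" using setp galois_groupD(5)[OF g(1)] by (intro map_idI) blast
      then have "eval p (g v) = g (eval p v)" using g.eval_hom'[OF vR, of p] setp KR by simp
      also have "\<dots> = \<zero>" using p(3) galois_groupD(9)[OF g(1)] by simp
      finally have "eval p w = \<zero>" unfolding g(2) .
      then show "w \<in> {x. is_root p x}" using p(2) galois_groupD(1)[OF g(1) vR] g(2) by (simp add: is_root_def)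
    qed
    then show ?thesis using finite_number_of_roots[OF pR] finite_subset by blast
  qed
  have "inj_on (\<lambda>g. restrict g (set Vs)) (galois_group R K)"
  proof (rule inj_onI)
    fix g h assume g: "g \<in> galois_group R K" and h: "h \<in> galois_group R K"
      and eq: "restrict g (set Vs) = restrict h (set Vs)"
    note gD = galois_groupD[OF g] and hD = galois_groupD[OF h]
    \<comment> \<open>The set on which \<open>g\<close> and \<open>h\<close> agree is an additive
      subgroup containing the \<open>K\<close>-multiples of the basis, hence contains its
      span.\<close>
    let ?E = "{x \<in> carrier R. g x = h x}"
    have minus: "g (\<ominus> x) = \<ominus> g x" "h (\<ominus> x) = \<ominus> h x" if "x \<in> carrier R" for x
      using add_hom_minus[OF abelian_group_axioms abelian_group_axioms gD(8) that]
        add_hom_minus[OF abelian_group_axioms abelian_group_axioms hD(8) that] by simp_all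
    have "subgroup ?E (add_monoid R)"
    proof (rule subgroup.intro)
      show "inv\<^bsub>add_monoid R\<^esub> x \<in> ?E" if "x \<in> ?E" for x
        using that minus[of x] by (simp add: a_inv_def[symmetric])
    qed (use gD(2,9) hD(2,9) in auto)
    moreover have "K <#> set Vs \<subseteq> ?E"
    proof
      fix x assume "x \<in> K <#> set Vs"
      then obtain c v where cv: "c \<in> K" "v \<in> set Vs" "x = c \<otimes> v" by (auto simp: set_mult_def)
      have c: "c \<in> carrier R" "v \<in> carrier R" using cv KR Vs by auto
      have "g v = h v" using fun_cong[OF eq, of v] cv(2) by simp
      then show "x \<in> ?E" using c cv gD(3)[OF c] hD(3)[OF c] gD(5)[OF cv(1)] hD(5)[OF cv(1)] by simp
    qed
    ultimately have "Span K Vs \<subseteq> ?E" using Span_min[OF K Vs(1)] by blast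
    then have "g x = h x" if "x \<in> carrier R" for x using that Vs(2) by blast
    then show "g = h" by (rule extensionalityI[OF gD(6) hD(6)])
  qed
  moreover have "(\<lambda>g. restrict g (set Vs)) ` galois_group R K \<subseteq> (\<Pi>\<^sub>E v\<in>set Vs. rts v)"
    by (auto simp: rts_def)
  then have "finite ((\<lambda>g. restrict g (set Vs)) ` galois_group R K)"
    using finite_PiE[of "set Vs" rts] rts finite_subset by blast
  ultimately show ?thesis using finite_imageD by blast
qed

lemma inertia_tower_exists:
  fixes L :: "('l, 'b) ring_scheme" and k K L1 :: "'l set" and M :: "('l \<Rightarrow> 'l, 'n) module"
  assumes field: "field L" and char_0: "\<And>n::nat. n > 0 \<Longrightarrow> add_pow L n \<one>\<^bsub>L\<^esub> \<noteq> \<zero>\<^bsub>L\<^esub>"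
    and k: "subfield k L" "k \<subseteq> K" and gal: "finite_galois L K" and M: "simple_left_module (diff_ring k L) M"
    and L1: "L1 = fixed_field L (inertia_group k L K M)"
  shows "\<exists>mY mZ m xY yY xZ yZ x \<phi>. inertia_tower L k K L1 mY mZ m xY yY xZ yZ x \<phi> M"
proof -
  interpret field L by fact
  have K: "subfield K L" "ring.finite_dimension L K (carrier L)" "fixed_field L (galois_group L K) = K"
    using gal by (simp_all add: finite_galois_def)
  have finK: "finite (galois_group L K)" by (rule finite_galois_group[OF K(1,2)])
  have Y: "galois_sub L k K" by (intro galois_sub.intro galois_sub_axioms.intro field K(1,3) k(2) finK)
  interpret Y: galois_sub L k K by (rule Y)
  have I: "inertia_group k L K M \<subseteq> galois_group L K" by (auto simp: inertia_group_def)
  have KL1: "K \<subseteq> L1" using I galois_groupD(5) Y.E_sub unfolding L1 fixed_field_def by blast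
  have L1c: "L1 \<subseteq> carrier L" unfolding L1 fixed_field_def by blast
  have sub: "galois_group L L1 \<subseteq> galois_group L K" using KL1 by (auto simp: galois_group_def)
  \<comment> \<open>The inertia group fixes \<open>L1\<close> by construction, so it lies in the
    group of L/L1. The fixed field of the latter is therefore contained in \<open>L1\<close>, and
    L/L1 is Galois.\<close>
  have "inertia_group k L K M \<subseteq> galois_group L L1"
  proof
    fix g assume g: "g \<in> inertia_group k L K M"
    then have "\<forall>c\<in>L1. g c = c" unfolding L1 fixed_field_def by blast
    then show "g \<in> galois_group L L1" using I g by (auto simp: galois_group_def)
  qed
  then have fixL1: "fixed_field L (galois_group L L1) = L1"
    using L1c galois_groupD(5)[of _ L1] unfolding fixed_field_def L1 by blast
  have "subfield L1 L"
  proof (rule subfieldI')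
    note D = galois_groupD[OF subsetD[OF I]]
    have mem: "c \<in> L1 \<longleftrightarrow> c \<in> carrier L \<and> (\<forall>g\<in>inertia_group k L K M. g c = c)" for c
      by (simp add: L1 fixed_field_def)
    have fix_c: "g c = c" if "g \<in> inertia_group k L K M" "c \<in> L1" for g c using that mem by blast
    note minus = add_hom_minus[OF abelian_group_axioms abelian_group_axioms D(8)]
    show "subring L1 L"
    proof (rule subringI)
      fix c d assume c: "c \<in> L1" and d: "d \<in> L1"
      have cd: "c \<in> carrier L" "d \<in> carrier L" using c d L1c by auto
      have "g (\<ominus>\<^bsub>L\<^esub> c) = \<ominus>\<^bsub>L\<^esub> c" "g (c \<otimes>\<^bsub>L\<^esub> d) = c \<otimes>\<^bsub>L\<^esub> d" "g (c \<oplus>\<^bsub>L\<^esub> d) = c \<oplus>\<^bsub>L\<^esub> d"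
        if g: "g \<in> inertia_group k L K M" for g
        using minus[OF g cd(1)] D(2,3)[OF g cd] fix_c[OF g c] fix_c[OF g d] by simp_all
      then show "\<ominus>\<^bsub>L\<^esub> c \<in> L1" "c \<otimes>\<^bsub>L\<^esub> d \<in> L1" "c \<oplus>\<^bsub>L\<^esub> d \<in> L1" unfolding mem using cd by simp_all
    qed (use mem D(4) in auto)
    fix c assume c: "c \<in> L1 - {\<zero>\<^bsub>L\<^esub>}"
    then have cL: "c \<in> carrier L" "c \<noteq> \<zero>\<^bsub>L\<^esub>" using mem by auto
    then have ic: "inv\<^bsub>L\<^esub> c \<in> carrier L" "c \<otimes>\<^bsub>L\<^esub> inv\<^bsub>L\<^esub> c = \<one>\<^bsub>L\<^esub>" using field_Units by auto
    have "g (inv\<^bsub>L\<^esub> c) = inv\<^bsub>L\<^esub> c" if g: "g \<in> inertia_group k L K M" for g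
    proof -
      have "c \<otimes>\<^bsub>L\<^esub> g (inv\<^bsub>L\<^esub> c) = \<one>\<^bsub>L\<^esub>"
        using D(3)[OF g cL(1) ic(1)] D(4)[OF g] ic(2) g c mem by auto
      then show ?thesis using m_lcancel[OF cL(2,1) D(1)[OF g ic(1)] ic(1)] ic(2) by simp
    qed
    then show "inv\<^bsub>L\<^esub> c \<in> L1" using ic(1) unfolding mem by blast
  qed
  then have Z: "galois_sub L k L1"
    using k(2) KL1 fixL1 finite_subset[OF sub finK] field
    by (intro galois_sub.intro galois_sub_axioms.intro) auto
  obtain mY xY yY where "galois_dual L k K mY xY yY" using Y.galois_dual_exists by blast
  then have Y': "galois_avg L k K mY xY yY"
    using k(1) char_0 by (intro galois_avg.intro galois_avg_axioms.intro)
  obtain mZ xZ yZ where "galois_dual L k L1 mZ xZ yZ" using galois_sub.galois_dual_exists[OF Z] by blast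
  then have Z': "galois_avg L k L1 mZ xZ yZ"
    using k(1) char_0 by (intro galois_avg.intro galois_avg_axioms.intro)
  obtain m x \<phi> where "etale_pair L k K L1 m x \<phi>" using etale_pair_galois[OF Y Z' KL1] by blast
  then have "field_pair L k K L1 m x \<phi>"
    using K(1) \<open>subfield L1 L\<close> field by (intro field_pair.intro field_pair_axioms.intro)
  then have "inertia_tower L k K L1 mY mZ m xY yY xZ yZ x \<phi> M"
    using Y' Z' M L1 field by (intro inertia_tower.intro inertia_tower_axioms.intro)
  then show ?thesis by blast
qed

text \<open>Modules count up to isomorphism. An equality with a direct image is therefore rendered
  by \<open>module_isomorphic\<close>, and the bijection is one between quotients by
  \<open>module_iso_rel\<close>.\<close>

theorem theorem3p19:
  fixes L Z Y :: "('l, 'b) ring_scheme" and k K L1 :: "'l set"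
    and M :: "('l \<Rightarrow> 'l, 'n) module"
    and A B :: "('l \<Rightarrow> 'l, 'm) module set"
  assumes "field L"
    and char_0: "\<And>n::nat. n > 0 \<Longrightarrow> add_pow L n \<one>\<^bsub>L\<^esub> \<noteq> \<zero>\<^bsub>L\<^esub>"
    and "subfield k L" and "algebraically_closed (L\<lparr>carrier := k\<rparr>)"
    and "subfield K L" and "k \<subseteq> K"
    and "fin_gen_field L k" and "fin_gen_field (L\<lparr>carrier := K\<rparr>) k"
    and "finite_galois L K"
    and "simple_dmodule k L M"
    and "L1 = fixed_field L (inertia_group k L K M)"
    and "Z = L\<lparr>carrier := L1\<rparr>" and "Y = L\<lparr>carrier := K\<rparr>"
    and "A = simple_below k Z L M" and "B = simple_below k Y L M"
  shows "(\<forall>NZ\<in>A. simple_dmodule k Y (direct_image k Y Z NZ)) \<and>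
    bij_betw (\<lambda>C. module_iso_rel (diff_ring k Y) `` (direct_image k Y Z ` C))
      (A // module_iso_rel (diff_ring k Z)) (B // module_iso_rel (diff_ring k Y)) \<and>
    (\<forall>NZ\<in>A. \<forall>NY :: ('l \<Rightarrow> 'l, 'm) module.
      module_isomorphic (diff_ring k Y) (direct_image k Y Z NZ) NY \<longrightarrow>
        multiplicity_in (diff_ring k Z) (inverse_image k Y Z NY) NZ \<noteq> 0 \<and>
        (\<forall>N\<in>A. multiplicity_in (diff_ring k Z) (inverse_image k Y Z NY) N \<noteq> 0 \<longrightarrow>
          module_isomorphic (diff_ring k Z) N NZ)) \<and>
    (\<forall>NZ\<in>A. \<forall>NY :: ('l \<Rightarrow> 'l, 'm) module.
      module_isomorphic (diff_ring k Y) (direct_image k Y Z NZ) NY \<longrightarrow>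
        multiplicity_in (diff_ring k L) (inverse_image k Z L NZ) M =
        multiplicity_in (diff_ring k L) (inverse_image k Y L NY) M)"
proof -
  have field_L: "field L" by fact
  interpret field L by fact
  have M: "simple_left_module (diff_ring k L) M"
    using \<open>simple_dmodule k L M\<close> by (simp add: simple_dmodule_def)
  have "\<exists>mY mZ m xY yY xZ yZ x \<phi>. inertia_tower L k K L1 mY mZ m xY yY xZ yZ x \<phi> M"
    by (rule inertia_tower_exists[OF field_L _ \<open>subfield k L\<close> \<open>k \<subseteq> K\<close> \<open>finite_galois L K\<close> M
          \<open>L1 = fixed_field L (inertia_group k L K M)\<close>]) (rule char_0)
  then obtain mY mZ m xY yY xZ yZ x \<phi> where "inertia_tower L k K L1 mY mZ m xY yY xZ yZ x \<phi> M" by (elim exE)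
  then interpret T: inertia_tower L k K L1 mY mZ m xY yY xZ yZ x \<phi> M .
  show ?thesis
    unfolding \<open>A = _\<close> \<open>B = _\<close> \<open>Z = _\<close> \<open>Y = _\<close>
  proof (intro conjI ballI allI impI)
    fix NZ :: "('l \<Rightarrow> 'l, 'm) module" assume "NZ \<in> simple_below k T.LZ L M"
    then show "simple_dmodule k T.LY (T.q_plus NZ)" by (rule T.simple_q_plus)
  next
    fix NZ NY :: "('l \<Rightarrow> 'l, 'm) module" assume "NZ \<in> simple_below k T.LZ L M" "module_isomorphic T.DY (T.q_plus NZ) NY"
    then show "multiplicity_in T.DZ (inverse_image k T.LY T.LZ NY) NZ \<noteq> 0" by (rule T.component_unique(1))
  next
    fix NZ NY N :: "('l \<Rightarrow> 'l, 'm) module" assume "NZ \<in> simple_below k T.LZ L M" "module_isomorphic T.DY (T.q_plus NZ) NY"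
      "N \<in> simple_below k T.LZ L M" "multiplicity_in T.DZ (inverse_image k T.LY T.LZ NY) N \<noteq> 0"
    then show "module_isomorphic T.DZ N NZ" by (rule T.component_unique(2))
  next
    fix NZ NY :: "('l \<Rightarrow> 'l, 'm) module" assume "NZ \<in> simple_below k T.LZ L M" "module_isomorphic T.DY (T.q_plus NZ) NY"
    then show "multiplicity_in T.DL (inverse_image k T.LZ L NZ) M = multiplicity_in T.DL (inverse_image k T.LY L NY) M"
      by (rule T.multiplicity_eq)
  qed (rule T.q_plus_bij_betw)
qed

end
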